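(* Let $\Sigma$ be a monoidal signature. The PROP $\mathbf{STMC}(\Sigma)+\mathbf{CComon}$ is isomorphic to $\mathsf{PLM}\,\mathrm{Csp}_D(\mathbf{Hyp}_\Sigma)$, the isomorphism being the corestriction of $[\![[\mathcal{I},\mathcal{C}](-)]\!]$.
   Context: A monoidal signature $\Sigma$ is a set of generators each with an arity and coarity in $\mathbb{N}$. A hypergraph $F$ has a set $F_\star$ of vertices and sets $F_{k,l}$ of hyperedges with ordered source maps $s_i$ ($i<k$) and target maps $t_j$ ($j<l$) into $F_\star$; $\mathbf{Hyp}_\Sigma$ is the category of hypergraphs whose hyperedges in $F_{k,l}$ are labelled by generators of arity $k$ and coarity $l$, with structure-preserving morphisms. The discrete hypergraph $n$ has $n$ vertices and no hyperedges. $\mathrm{Csp}_D(\mathbf{Hyp}_\Sigma)$ is the PROP whose morphisms $m\to n$ are isomorphism classes of cospans $m\to F\leftarrow n$ in $\mathbf{Hyp}_\Sigma$ (isomorphism of apexes commuting with legs), with composition by pushout and tensor by disjoint union. It has the Frobenius structure of discrete cospans merge $n+n\to n\leftarrow n$, unit $0\to n\leftarrow n$, copy $n\to n\leftarrow n+n$, counit $n\to n\leftarrow 0$, hence a canonical trace $\mathrm{Tr}^x(h)=(\mathrm{cup}_x\otimes\mathrm{id}_m);(\mathrm{id}_x\otimes h);(\mathrm{cap}_x\otimes\mathrm{id}_n)$ with $\mathrm{cup}=$ unit;copy, $\mathrm{cap}=$ merge;counit. The in-degree of a vertex $v$ is the number of pairs $(e,j)$ with $v=t_j(e)$. A cospan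 $m\xrightarrow{f}F\xleftarrow{g}n$ is partial left-monogamous if $f$ is injective, every vertex in the image of $f$ has in-degree $0$ and every other vertex has in-degree $0$ or $1$ (out-degrees arbitrary). $\mathsf{PLM}\,\mathrm{Csp}_D(\mathbf{Hyp}_\Sigma)$ is the sub-PROP of such cospans, traced by the canonical trace. $\mathbf{STMC}(\Sigma)$ is the free symmetric traced monoidal PROP on $\Sigma$; $\mathbf{CComon}$ is the PROP of commutative comonoids (generators copy $1\to2$, discard $1\to0$, with coassociativity, counitality, cocommutativity); $\mathbf{STMC}(\Sigma)+\mathbf{CComon}$ is their coproduct. $\mathbf{SMC}(\Sigma)+\mathbf{Frob}$ is the coproduct of the free symmetric monoidal PROP on $\Sigma$ and the PROP $\mathbf{Frob}$ of special commutative Frobenius algebras; it is compact closed with the analogous cup, cap and canonical trace. $\mathcal{I}:\mathbf{STMC}(\Sigma)\to\mathbf{SMC}(\Sigma)+\mathbf{Frob}$ sends generators to themselves and the trace to the canonical trace; $\mathcal{C}:\mathbf{CComon}\to\mathbf{Frob}$ is the evident embedding; $[\mathcal{I},\mathcal{C}]$ is their copairing. $[\![-]\!]:\mathbf{SMC}(\Sigma)+\mathbf{Frob}\to\mathrm{Csp}_D(\mathbf{Hyp}_\Sigma)$ sends $\phi:m\to n$ to $m\to E_\phi\leftarrow n$, where $E_\phi$ has $m+n$ vertices and one hyperedge labelled $\phi$ with sources the $m$ left-interface vertices and targets the $n$ right-interface vertices (in order), and the Frobenius generators to the discrete cospans above.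
   Formalization: Hypergraphs are taken to be finite (with infinite ones the claim fails: the cospan 0 → F ← 0 with F infinite and discrete is partial left-monogamous but denoted by no term), and the coproduct STMC(Σ)+CComon is formed as a traced PROP, so the trace also applies to copy and discard. *)

theory Defs
  imports Main
begin

section \<open>PROPs and traced PROPs\<close>

text \<open>
  A PROP is a strict symmetric monoidal category with object monoid \<open>(\<nat>, +, 0)\<close>, so it is given by
  its hom-sets and operations on arrows. Composition is written in diagrammatic order.
\<close>

record 'a prop_data =
  hom :: "nat \<Rightarrow> nat \<Rightarrow> 'a set"
  ident :: "nat \<Rightarrow> 'a"
  compose :: "'a \<Rightarrow> 'a \<Rightarrow> 'a" (infixl "\<Zcomp>\<index>" 65)
  tensor :: "'a \<Rightarrow> 'a \<Rightarrow> 'a" (infixl "\<otimes>\<index>" 70)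
  swap :: "nat \<Rightarrow> nat \<Rightarrow> 'a"

locale prop_cat =
  fixes P :: "('a, 'm) prop_data_scheme" (structure)
  assumes hom_disjoint:
      "f \<in> hom P m n \<Longrightarrow> f \<in> hom P m' n' \<Longrightarrow> m = m' \<and> n = n'"
    and ident_hom: "ident P n \<in> hom P n n"
    and compose_hom: "f \<in> hom P m n \<Longrightarrow> g \<in> hom P n p \<Longrightarrow> f \<Zcomp> g \<in> hom P m p"
    and tensor_hom:
      "f \<in> hom P m n \<Longrightarrow> g \<in> hom P p q \<Longrightarrow> f \<otimes> g \<in> hom P (m + p) (n + q)"
    and swap_hom: "swap P m n \<in> hom P (m + n) (n + m)"
    and ident_compose: "f \<in> hom P m n \<Longrightarrow> ident P m \<Zcomp> f = f"
    and compose_ident: "f \<in> hom P m n \<Longrightarrow> f \<Zcomp> ident P n = f"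
    and compose_assoc:
      "f \<in> hom P m n \<Longrightarrow> g \<in> hom P n p \<Longrightarrow> h \<in> hom P p q \<Longrightarrow> (f \<Zcomp> g) \<Zcomp> h = f \<Zcomp> (g \<Zcomp> h)"
    and tensor_ident: "ident P m \<otimes> ident P n = ident P (m + n)"
    and interchange:
      "f \<in> hom P m n \<Longrightarrow> g \<in> hom P n p \<Longrightarrow> f' \<in> hom P m' n' \<Longrightarrow> g' \<in> hom P n' p' \<Longrightarrow>
        (f \<Zcomp> g) \<otimes> (f' \<Zcomp> g') = (f \<otimes> f') \<Zcomp> (g \<otimes> g')"
    and tensor_assoc:
      "f \<in> hom P m n \<Longrightarrow> g \<in> hom P m' n' \<Longrightarrow> h \<in> hom P m'' n'' \<Longrightarrow>
        (f \<otimes> g) \<otimes> h = f \<otimes> (g \<otimes> h)"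
    and unit_tensor: "f \<in> hom P m n \<Longrightarrow> ident P 0 \<otimes> f = f"
    and tensor_unit: "f \<in> hom P m n \<Longrightarrow> f \<otimes> ident P 0 = f"
    and swap_natural:
      "f \<in> hom P m n \<Longrightarrow> g \<in> hom P p q \<Longrightarrow>
        (f \<otimes> g) \<Zcomp> swap P n q = swap P m p \<Zcomp> (g \<otimes> f)"
    and swap_swap: "swap P m n \<Zcomp> swap P n m = ident P (m + n)"
    and hexagon:
      "swap P m (n + p) = (swap P m n \<otimes> ident P p) \<Zcomp> (ident P n \<otimes> swap P m p)"

record 'a traced_prop_data = "'a prop_data" +
  \<comment> \<open>\<open>trace P x m n\<close> maps arrows \<open>x + m \<rightarrow> x + n\<close> to arrows \<open>m \<rightarrow> n\<close>\<close>
  trace :: "nat \<Rightarrow> nat \<Rightarrow> nat \<Rightarrow> 'a \<Rightarrow> 'a"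

locale traced_prop_cat = prop_cat P
  for P :: "('a, 'm) traced_prop_data_scheme" (structure) +
  assumes trace_hom: "h \<in> hom P (x + m) (x + n) \<Longrightarrow> trace P x m n h \<in> hom P m n"
    and tightening:
      "f \<in> hom P m m' \<Longrightarrow> h \<in> hom P (x + m') (x + n') \<Longrightarrow> g \<in> hom P n' n \<Longrightarrow>
        trace P x m n ((ident P x \<otimes> f) \<Zcomp> h \<Zcomp> (ident P x \<otimes> g)) = f \<Zcomp> trace P x m' n' h \<Zcomp> g"
    and sliding:
      "f \<in> hom P x y \<Longrightarrow> h \<in> hom P (y + m) (x + n) \<Longrightarrow>
        trace P x m n ((f \<otimes> ident P m) \<Zcomp> h) = trace P y m n (h \<Zcomp> (f \<otimes> ident P n))"
    and vanishing_zero: "h \<in> hom P m n \<Longrightarrow> trace P 0 m n h = h"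
    and vanishing_add:
      "h \<in> hom P (x + y + m) (x + y + n) \<Longrightarrow>
        trace P (x + y) m n h = trace P y m n (trace P x (y + m) (y + n) h)"
    and superposing:
      "h \<in> hom P (x + m) (x + n) \<Longrightarrow> g \<in> hom P p q \<Longrightarrow>
        trace P x (m + p) (n + q) (h \<otimes> g) = trace P x m n h \<otimes> g"
    and yanking: "trace P x x x (swap P x x) = ident P x"

text \<open>Morphisms of PROPs are strict symmetric monoidal and the identity on objects.\<close>

definition prop_morphism ::
    "('a, 'm) prop_data_scheme \<Rightarrow> ('b, 'n) prop_data_scheme \<Rightarrow> ('a \<Rightarrow> 'b) \<Rightarrow> bool" where
  "prop_morphism P Q F \<longleftrightarrow>
     (\<forall>m n. \<forall>f\<in>hom P m n. F f \<in> hom Q m n) \<and>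
     (\<forall>n. F (ident P n) = ident Q n) \<and>
     (\<forall>m n p. \<forall>f\<in>hom P m n. \<forall>g\<in>hom P n p. F (f \<Zcomp>\<^bsub>P\<^esub> g) = F f \<Zcomp>\<^bsub>Q\<^esub> F g) \<and>
     (\<forall>m n p q. \<forall>f\<in>hom P m n. \<forall>g\<in>hom P p q. F (f \<otimes>\<^bsub>P\<^esub> g) = F f \<otimes>\<^bsub>Q\<^esub> F g) \<and>
     (\<forall>m n. F (swap P m n) = swap Q m n)"

definition traced_prop_morphism ::
    "('a, 'm) traced_prop_data_scheme \<Rightarrow> ('b, 'n) traced_prop_data_scheme \<Rightarrow> ('a \<Rightarrow> 'b) \<Rightarrow> bool" where
  "traced_prop_morphism P Q F \<longleftrightarrow> prop_morphism P Q F \<and>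
     (\<forall>x m n. \<forall>h\<in>hom P (x + m) (x + n). F (trace P x m n h) = trace Q x m n (F h))"

definition traced_prop_iso ::
    "('a, 'm) traced_prop_data_scheme \<Rightarrow> ('b, 'n) traced_prop_data_scheme \<Rightarrow> ('a \<Rightarrow> 'b) \<Rightarrow> bool" where
  "traced_prop_iso P Q F \<longleftrightarrow>
     traced_prop_cat P \<and> traced_prop_cat Q \<and> traced_prop_morphism P Q F \<and>
     (\<forall>m n. bij_betw F (hom P m n) (hom Q m n))"

text \<open>
  A Frobenius structure consists of arrows \<open>merge n : n + n \<rightarrow> n\<close>, \<open>unit n : 0 \<rightarrow> n\<close>,
  \<open>copy n : n \<rightarrow> n + n\<close> and \<open>counit n : n \<rightarrow> 0\<close> on every object; it induces a trace.
\<close>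

record 'a frobenius_data =
  fmerge :: "nat \<Rightarrow> 'a"
  funit :: "nat \<Rightarrow> 'a"
  fcopy :: "nat \<Rightarrow> 'a"
  fcounit :: "nat \<Rightarrow> 'a"

definition cup :: "('a, 'm) prop_data_scheme \<Rightarrow> 'a frobenius_data \<Rightarrow> nat \<Rightarrow> 'a" where
  "cup P \<F> x = funit \<F> x \<Zcomp>\<^bsub>P\<^esub> fcopy \<F> x"

definition cap :: "('a, 'm) prop_data_scheme \<Rightarrow> 'a frobenius_data \<Rightarrow> nat \<Rightarrow> 'a" where
  "cap P \<F> x = fmerge \<F> x \<Zcomp>\<^bsub>P\<^esub> fcounit \<F> x"

definition canonical_trace ::
    "('a, 'm) prop_data_scheme \<Rightarrow> 'a frobenius_data \<Rightarrow> nat \<Rightarrow> nat \<Rightarrow> nat \<Rightarrow> 'a \<Rightarrow> 'a" where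
  "canonical_trace P \<F> x m n h =
     (cup P \<F> x \<otimes>\<^bsub>P\<^esub> ident P m) \<Zcomp>\<^bsub>P\<^esub> (ident P x \<otimes>\<^bsub>P\<^esub> h) \<Zcomp>\<^bsub>P\<^esub> (cap P \<F> x \<otimes>\<^bsub>P\<^esub> ident P n)"

definition with_canonical_trace :: "'a prop_data \<Rightarrow> 'a frobenius_data \<Rightarrow> 'a traced_prop_data" where
  "with_canonical_trace P \<F> = prop_data.extend P \<lparr>trace = canonical_trace P \<F>\<rparr>"

text \<open>A Frobenius algebra on the object 1 extends to all objects, interleaving the wires.\<close>

primrec merge_power :: "('a, 'm) prop_data_scheme \<Rightarrow> 'a \<Rightarrow> nat \<Rightarrow> 'a" where
  "merge_power P mu 0 = ident P 0"
| "merge_power P mu (Suc n) =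
     (ident P 1 \<otimes>\<^bsub>P\<^esub> swap P n 1 \<otimes>\<^bsub>P\<^esub> ident P n) \<Zcomp>\<^bsub>P\<^esub> (mu \<otimes>\<^bsub>P\<^esub> merge_power P mu n)"

primrec copy_power :: "('a, 'm) prop_data_scheme \<Rightarrow> 'a \<Rightarrow> nat \<Rightarrow> 'a" where
  "copy_power P de 0 = ident P 0"
| "copy_power P de (Suc n) =
     (de \<otimes>\<^bsub>P\<^esub> copy_power P de n) \<Zcomp>\<^bsub>P\<^esub> (ident P 1 \<otimes>\<^bsub>P\<^esub> swap P 1 n \<otimes>\<^bsub>P\<^esub> ident P n)"

primrec tensor_power :: "('a, 'm) prop_data_scheme \<Rightarrow> 'a \<Rightarrow> nat \<Rightarrow> 'a" where
  "tensor_power P f 0 = ident P 0"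
| "tensor_power P f (Suc n) = f \<otimes>\<^bsub>P\<^esub> tensor_power P f n"


section \<open>Signatures, terms and presented PROPs\<close>

record 'g signature =
  gens :: "'g set"
  arity :: "'g \<Rightarrow> nat"
  coarity :: "'g \<Rightarrow> nat"

datatype 'g trm =
    Gen 'g
  | Ident nat
  | Swap nat nat
  | Seq "'g trm" "'g trm" (infixl "\<triangleright>" 65)
  | Tens "'g trm" "'g trm" (infixl "\<oplus>" 70)
  | Tr nat "'g trm"

record 'g presentation = "'g signature" +
  equations :: "('g trm \<times> 'g trm) set"

text \<open>Whether a presentation generates a PROP or a traced PROP.\<close>

datatype doctrine = Sym_Mon | Traced

primrec tdom :: "('g, 'm) signature_scheme \<Rightarrow> 'g trm \<Rightarrow> nat" where
  "tdom S (Gen g) = arity S g"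
| "tdom S (Ident n) = n"
| "tdom S (Swap m n) = m + n"
| "tdom S (s \<triangleright> t) = tdom S s"
| "tdom S (s \<oplus> t) = tdom S s + tdom S t"
| "tdom S (Tr x t) = tdom S t - x"

primrec tcod :: "('g, 'm) signature_scheme \<Rightarrow> 'g trm \<Rightarrow> nat" where
  "tcod S (Gen g) = coarity S g"
| "tcod S (Ident n) = n"
| "tcod S (Swap m n) = n + m"
| "tcod S (s \<triangleright> t) = tcod S t"
| "tcod S (s \<oplus> t) = tcod S s + tcod S t"
| "tcod S (Tr x t) = tcod S t - x"

primrec well_formed :: "doctrine \<Rightarrow> ('g, 'm) signature_scheme \<Rightarrow> 'g trm \<Rightarrow> bool" where
  "well_formed D S (Gen g) \<longleftrightarrow> g \<in> gens S"
| "well_formed D S (Ident n) \<longleftrightarrow> True"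
| "well_formed D S (Swap m n) \<longleftrightarrow> True"
| "well_formed D S (s \<triangleright> t) \<longleftrightarrow> well_formed D S s \<and> well_formed D S t \<and> tcod S s = tdom S t"
| "well_formed D S (s \<oplus> t) \<longleftrightarrow> well_formed D S s \<and> well_formed D S t"
| "well_formed D S (Tr x t) \<longleftrightarrow> D = Traced \<and> well_formed D S t \<and> x \<le> tdom S t \<and> x \<le> tcod S t"

definition typed :: "doctrine \<Rightarrow> ('g, 'm) signature_scheme \<Rightarrow> 'g trm \<Rightarrow> nat \<Rightarrow> nat \<Rightarrow> bool" where
  "typed D S t m n \<longleftrightarrow> well_formed D S t \<and> tdom S t = m \<and> tcod S t = n"

text \<open>
  The least congruence on typed terms that contains the equations of the presentation and the
  axioms of symmetric (traced) strict monoidal categories.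
\<close>

inductive term_eq :: "doctrine \<Rightarrow> 'g presentation \<Rightarrow> 'g trm \<Rightarrow> 'g trm \<Rightarrow> bool"
  for D :: doctrine and P :: "'g presentation" where
  eq_refl: "typed D P t m n \<Longrightarrow> term_eq D P t t"
| eq_sym: "term_eq D P s t \<Longrightarrow> term_eq D P t s"
| eq_trans: "term_eq D P s t \<Longrightarrow> term_eq D P t u \<Longrightarrow> term_eq D P s u"
| eq_seq: "term_eq D P s s' \<Longrightarrow> term_eq D P t t' \<Longrightarrow> tcod P s = tdom P t \<Longrightarrow>
    term_eq D P (s \<triangleright> t) (s' \<triangleright> t')"
| eq_tens: "term_eq D P s s' \<Longrightarrow> term_eq D P t t' \<Longrightarrow> term_eq D P (s \<oplus> t) (s' \<oplus> t')"
| eq_tr: "D = Traced \<Longrightarrow> term_eq D P t t' \<Longrightarrow> x \<le> tdom P t \<Longrightarrow> x \<le> tcod P t \<Longrightarrow>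
    term_eq D P (Tr x t) (Tr x t')"
| eq_presentation: "(s, t) \<in> equations P \<Longrightarrow> typed D P s m n \<Longrightarrow> typed D P t m n \<Longrightarrow> term_eq D P s t"
| eq_ident_compose: "typed D P f m n \<Longrightarrow> term_eq D P (Ident m \<triangleright> f) f"
| eq_compose_ident: "typed D P f m n \<Longrightarrow> term_eq D P (f \<triangleright> Ident n) f"
| eq_compose_assoc: "typed D P f m n \<Longrightarrow> typed D P g n p \<Longrightarrow> typed D P h p q \<Longrightarrow>
    term_eq D P ((f \<triangleright> g) \<triangleright> h) (f \<triangleright> (g \<triangleright> h))"
| eq_tensor_ident: "term_eq D P (Ident m \<oplus> Ident n) (Ident (m + n))"
| eq_interchange: "typed D P f m n \<Longrightarrow> typed D P g n p \<Longrightarrow> typed D P f' m' n' \<Longrightarrow> typed D P g' n' p' \<Longrightarrow>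
    term_eq D P ((f \<triangleright> g) \<oplus> (f' \<triangleright> g')) ((f \<oplus> f') \<triangleright> (g \<oplus> g'))"
| eq_tensor_assoc: "typed D P f m n \<Longrightarrow> typed D P g m' n' \<Longrightarrow> typed D P h m'' n'' \<Longrightarrow>
    term_eq D P ((f \<oplus> g) \<oplus> h) (f \<oplus> (g \<oplus> h))"
| eq_unit_tensor: "typed D P f m n \<Longrightarrow> term_eq D P (Ident 0 \<oplus> f) f"
| eq_tensor_unit: "typed D P f m n \<Longrightarrow> term_eq D P (f \<oplus> Ident 0) f"
| eq_swap_natural: "typed D P f m n \<Longrightarrow> typed D P g p q \<Longrightarrow>
    term_eq D P ((f \<oplus> g) \<triangleright> Swap n q) (Swap m p \<triangleright> (g \<oplus> f))"
| eq_swap_swap: "term_eq D P (Swap m n \<triangleright> Swap n m) (Ident (m + n))"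
| eq_hexagon: "term_eq D P (Swap m (n + p)) ((Swap m n \<oplus> Ident p) \<triangleright> (Ident n \<oplus> Swap m p))"
| eq_tightening: "D = Traced \<Longrightarrow>
    typed D P f m m' \<Longrightarrow> typed D P h (x + m') (x + n') \<Longrightarrow> typed D P g n' n \<Longrightarrow>
    term_eq D P (Tr x ((Ident x \<oplus> f) \<triangleright> h \<triangleright> (Ident x \<oplus> g))) (f \<triangleright> Tr x h \<triangleright> g)"
| eq_sliding: "D = Traced \<Longrightarrow> typed D P f x y \<Longrightarrow> typed D P h (y + m) (x + n) \<Longrightarrow>
    term_eq D P (Tr x ((f \<oplus> Ident m) \<triangleright> h)) (Tr y (h \<triangleright> (f \<oplus> Ident n)))"
| eq_vanishing_zero: "D = Traced \<Longrightarrow> typed D P h m n \<Longrightarrow> term_eq D P (Tr 0 h) h"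
| eq_vanishing_add: "D = Traced \<Longrightarrow> typed D P h (x + y + m) (x + y + n) \<Longrightarrow>
    term_eq D P (Tr (x + y) h) (Tr y (Tr x h))"
| eq_superposing: "D = Traced \<Longrightarrow> typed D P h (x + m) (x + n) \<Longrightarrow> typed D P g p q \<Longrightarrow>
    term_eq D P (Tr x (h \<oplus> g)) (Tr x h \<oplus> g)"
| eq_yanking: "D = Traced \<Longrightarrow> term_eq D P (Tr x (Swap x x)) (Ident x)"

definition term_class :: "doctrine \<Rightarrow> 'g presentation \<Rightarrow> 'g trm \<Rightarrow> 'g trm set" where
  "term_class D P t = {s. term_eq D P t s}"

definition presented :: "doctrine \<Rightarrow> 'g presentation \<Rightarrow> 'g trm set prop_data" where
  "presented D P =
    \<lparr>hom = (\<lambda>m n. {term_class D P t | t. typed D P t m n}),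
     ident = (\<lambda>n. term_class D P (Ident n)),
     compose = (\<lambda>X Y. \<Union>s\<in>X. \<Union>t\<in>Y. term_class D P (s \<triangleright> t)),
     tensor = (\<lambda>X Y. \<Union>s\<in>X. \<Union>t\<in>Y. term_class D P (s \<oplus> t)),
     swap = (\<lambda>m n. term_class D P (Swap m n))\<rparr>"

abbreviation presented_prop :: "'g presentation \<Rightarrow> 'g trm set prop_data" where
  "presented_prop \<equiv> presented Sym_Mon"

definition presented_traced_prop :: "'g presentation \<Rightarrow> 'g trm set traced_prop_data" where
  "presented_traced_prop P =
    prop_data.extend (presented Traced P)
      \<lparr>trace = (\<lambda>x m n X. \<Union>t\<in>X. term_class Traced P (Tr x t))\<rparr>"

definition free_presentation :: "'g signature \<Rightarrow> 'g presentation" where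
  "free_presentation \<Sigma> = signature.extend \<Sigma> \<lparr>equations = {}\<rparr>"

text \<open>
  Disjoint union of generators and equations: it presents the coproduct of the presented PROPs
  (of the presented traced PROPs in the doctrine \<^const>\<open>Traced\<close>).
\<close>

definition presentation_sum ::
    "'g presentation \<Rightarrow> 'h presentation \<Rightarrow> ('g + 'h) presentation" where
  "presentation_sum P Q =
    \<lparr>gens = gens P <+> gens Q,
     arity = case_sum (arity P) (arity Q),
     coarity = case_sum (coarity P) (coarity Q),
     equations = map_prod (map_trm Inl) (map_trm Inl) ` equations P \<union>
                 map_prod (map_trm Inr) (map_trm Inr) ` equations Q\<rparr>"

primrec eval ::
    "('g, 'm) signature_scheme \<Rightarrow> ('a, 'n) traced_prop_data_scheme \<Rightarrow> ('g \<Rightarrow> 'a) \<Rightarrow> 'g trm \<Rightarrow> 'a" where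
  "eval S Q \<gamma> (Gen g) = \<gamma> g"
| "eval S Q \<gamma> (Ident n) = ident Q n"
| "eval S Q \<gamma> (Swap m n) = swap Q m n"
| "eval S Q \<gamma> (s \<triangleright> t) = eval S Q \<gamma> s \<Zcomp>\<^bsub>Q\<^esub> eval S Q \<gamma> t"
| "eval S Q \<gamma> (s \<oplus> t) = eval S Q \<gamma> s \<otimes>\<^bsub>Q\<^esub> eval S Q \<gamma> t"
| "eval S Q \<gamma> (Tr x t) = trace Q x (tdom S t - x) (tcod S t - x) (eval S Q \<gamma> t)"

text \<open>
  The morphism out of a presented PROP given by the images of the generators. If these satisfy the
  equations of the presentation, then \<open>eval\<close> is constant on every class and the image in the
  definition is a singleton.
\<close>

definition induced ::
    "('g, 'm) signature_scheme \<Rightarrow> ('a, 'n) traced_prop_data_scheme \<Rightarrow> ('g \<Rightarrow> 'a) \<Rightarrow> 'g trm set \<Rightarrow> 'a" where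
  "induced S Q \<gamma> X = the_elem (eval S Q \<gamma> ` X)"


section \<open>The syntactic PROPs\<close>

text \<open>\<open>STMC \<Sigma>\<close> is the free traced PROP on \<open>\<Sigma>\<close>.\<close>

definition STMC :: "'g signature \<Rightarrow> 'g trm set traced_prop_data" where
  "STMC \<Sigma> = presented_traced_prop (free_presentation \<Sigma>)"

datatype comon_gen = Copy | Discard

definition comon_presentation :: "comon_gen presentation" where
  "comon_presentation =
    \<lparr>gens = UNIV,
     arity = (\<lambda>_. 1),
     coarity = case_comon_gen 2 0,
     equations =
       {(Gen Copy \<triangleright> (Gen Copy \<oplus> Ident 1), Gen Copy \<triangleright> (Ident 1 \<oplus> Gen Copy)),
        (Gen Copy \<triangleright> (Gen Discard \<oplus> Ident 1), Ident 1),
        (Gen Copy \<triangleright> (Ident 1 \<oplus> Gen Discard), Ident 1),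
        (Gen Copy \<triangleright> Swap 1 1, Gen Copy)}\<rparr>"

definition CComon :: "comon_gen trm set prop_data" where
  "CComon = presented_prop comon_presentation"

datatype frob_gen = FMerge | FUnit | FCopy | FCounit

definition frob_presentation :: "frob_gen presentation" where
  "frob_presentation =
    \<lparr>gens = UNIV,
     arity = case_frob_gen 2 0 1 1,
     coarity = case_frob_gen 1 1 2 0,
     equations =
       {(Gen FCopy \<triangleright> (Gen FCopy \<oplus> Ident 1), Gen FCopy \<triangleright> (Ident 1 \<oplus> Gen FCopy)),
        (Gen FCopy \<triangleright> (Gen FCounit \<oplus> Ident 1), Ident 1),
        (Gen FCopy \<triangleright> (Ident 1 \<oplus> Gen FCounit), Ident 1),
        (Gen FCopy \<triangleright> Swap 1 1, Gen FCopy),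
        ((Gen FMerge \<oplus> Ident 1) \<triangleright> Gen FMerge, (Ident 1 \<oplus> Gen FMerge) \<triangleright> Gen FMerge),
        ((Gen FUnit \<oplus> Ident 1) \<triangleright> Gen FMerge, Ident 1),
        ((Ident 1 \<oplus> Gen FUnit) \<triangleright> Gen FMerge, Ident 1),
        (Swap 1 1 \<triangleright> Gen FMerge, Gen FMerge),
        ((Gen FCopy \<oplus> Ident 1) \<triangleright> (Ident 1 \<oplus> Gen FMerge), Gen FMerge \<triangleright> Gen FCopy),
        ((Ident 1 \<oplus> Gen FCopy) \<triangleright> (Gen FMerge \<oplus> Ident 1), Gen FMerge \<triangleright> Gen FCopy),
        (Gen FCopy \<triangleright> Gen FMerge, Ident 1)}\<rparr>"

definition frobenius_from ::
    "('a, 'm) prop_data_scheme \<Rightarrow> (frob_gen \<Rightarrow> 'a) \<Rightarrow> 'a frobenius_data" where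
  "frobenius_from P \<phi> =
    \<lparr>fmerge = merge_power P (\<phi> FMerge),
     funit = tensor_power P (\<phi> FUnit),
     fcopy = copy_power P (\<phi> FCopy),
     fcounit = tensor_power P (\<phi> FCounit)\<rparr>"

definition Frob :: "frob_gen trm set traced_prop_data" where
  "Frob = with_canonical_trace (presented_prop frob_presentation)
     (frobenius_from (presented_prop frob_presentation)
       (\<lambda>c. term_class Sym_Mon frob_presentation (Gen c)))"

text \<open>
  The coproduct of the free traced PROP on \<open>\<Sigma>\<close> and of \<^const>\<open>CComon\<close> is a traced PROP: the
  comonoid generators may occur under the trace.
\<close>

abbreviation STMC_CComon_presentation :: "'g signature \<Rightarrow> ('g + comon_gen) presentation" where
  "STMC_CComon_presentation \<Sigma> \<equiv> presentation_sum (free_presentation \<Sigma>) comon_presentation"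

definition STMC_CComon :: "'g signature \<Rightarrow> ('g + comon_gen) trm set traced_prop_data" where
  "STMC_CComon \<Sigma> = presented_traced_prop (STMC_CComon_presentation \<Sigma>)"

abbreviation SMC_Frob_presentation :: "'g signature \<Rightarrow> ('g + frob_gen) presentation" where
  "SMC_Frob_presentation \<Sigma> \<equiv> presentation_sum (free_presentation \<Sigma>) frob_presentation"

definition SMC_Frob :: "'g signature \<Rightarrow> ('g + frob_gen) trm set traced_prop_data" where
  "SMC_Frob \<Sigma> = with_canonical_trace (presented_prop (SMC_Frob_presentation \<Sigma>))
     (frobenius_from (presented_prop (SMC_Frob_presentation \<Sigma>))
       (\<lambda>c. term_class Sym_Mon (SMC_Frob_presentation \<Sigma>) (Gen (Inr c))))"

definition \<I> :: "'g signature \<Rightarrow> 'g trm set \<Rightarrow> ('g + frob_gen) trm set" where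
  "\<I> \<Sigma> = induced \<Sigma> (SMC_Frob \<Sigma>) (\<lambda>g. term_class Sym_Mon (SMC_Frob_presentation \<Sigma>) (Gen (Inl g)))"

definition \<C> :: "comon_gen trm set \<Rightarrow> frob_gen trm set" where
  "\<C> = induced comon_presentation Frob
     (case_comon_gen (term_class Sym_Mon frob_presentation (Gen FCopy))
                     (term_class Sym_Mon frob_presentation (Gen FCounit)))"

text \<open>The coprojections of the two coproducts.\<close>

definition STMC_inl :: "'g signature \<Rightarrow> 'g trm set \<Rightarrow> ('g + comon_gen) trm set" where
  "STMC_inl \<Sigma> = induced \<Sigma> (STMC_CComon \<Sigma>)
     (\<lambda>g. term_class Traced (STMC_CComon_presentation \<Sigma>) (Gen (Inl g)))"

definition CComon_inr :: "'g signature \<Rightarrow> comon_gen trm set \<Rightarrow> ('g + comon_gen) trm set" where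
  "CComon_inr \<Sigma> = induced comon_presentation (STMC_CComon \<Sigma>)
     (\<lambda>c. term_class Traced (STMC_CComon_presentation \<Sigma>) (Gen (Inr c)))"

definition Frob_inr :: "'g signature \<Rightarrow> frob_gen trm set \<Rightarrow> ('g + frob_gen) trm set" where
  "Frob_inr \<Sigma> = induced frob_presentation (SMC_Frob \<Sigma>)
     (\<lambda>c. term_class Sym_Mon (SMC_Frob_presentation \<Sigma>) (Gen (Inr c)))"

definition copairing ::
    "'g signature \<Rightarrow> ('a, 'm) traced_prop_data_scheme \<Rightarrow>
     ('g trm set \<Rightarrow> 'a) \<Rightarrow> (comon_gen trm set \<Rightarrow> 'a) \<Rightarrow> ('g + comon_gen) trm set \<Rightarrow> 'a" where
  "copairing \<Sigma> Q F G = induced (STMC_CComon_presentation \<Sigma>) Q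
     (case_sum (\<lambda>g. F (term_class Traced (free_presentation \<Sigma>) (Gen g)))
               (\<lambda>c. G (term_class Sym_Mon comon_presentation (Gen c))))"

text \<open>The codomain of \<^const>\<open>\<C>\<close> is included into \<open>SMC_Frob \<Sigma>\<close> by the coprojection.\<close>

definition copairing_\<I>_\<C> :: "'g signature \<Rightarrow> ('g + comon_gen) trm set \<Rightarrow> ('g + frob_gen) trm set" where
  "copairing_\<I>_\<C> \<Sigma> = copairing \<Sigma> (SMC_Frob \<Sigma>) (\<I> \<Sigma>) (Frob_inr \<Sigma> \<circ> \<C>)"


section \<open>Hypergraphs and cospans\<close>

text \<open>
  The hyperedges in \<open>F\<^bsub>k,l\<^esub>\<close> are those with \<open>k\<close> sources and \<open>l\<close> targets. Hypergraphs over a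
  signature are finite: only these are denoted by terms.
\<close>

record ('v, 'e, 'g) hypergraph =
  verts :: "'v set"
  edges :: "'e set"
  label :: "'e \<Rightarrow> 'g"
  sources :: "'e \<Rightarrow> 'v list"
  targets :: "'e \<Rightarrow> 'v list"

definition hyp :: "'g signature \<Rightarrow> ('v, 'e, 'g) hypergraph \<Rightarrow> bool" where
  "hyp \<Sigma> F \<longleftrightarrow> finite (verts F) \<and> finite (edges F) \<and>
     (\<forall>e\<in>edges F. label F e \<in> gens \<Sigma> \<and>
        length (sources F e) = arity \<Sigma> (label F e) \<and> set (sources F e) \<subseteq> verts F \<and>
        length (targets F e) = coarity \<Sigma> (label F e) \<and> set (targets F e) \<subseteq> verts F)"

definition hyp_morphism ::
    "('v, 'e, 'g) hypergraph \<Rightarrow> ('w, 'f, 'g) hypergraph \<Rightarrow> ('v \<Rightarrow> 'w) \<Rightarrow> ('e \<Rightarrow> 'f) \<Rightarrow> bool" where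
  "hyp_morphism F G hv he \<longleftrightarrow> hv ` verts F \<subseteq> verts G \<and> he ` edges F \<subseteq> edges G \<and>
     (\<forall>e\<in>edges F. label G (he e) = label F e \<and>
        sources G (he e) = map hv (sources F e) \<and> targets G (he e) = map hv (targets F e))"

definition discrete :: "nat \<Rightarrow> (nat, nat, 'g) hypergraph" where
  "discrete n = \<lparr>verts = {..<n}, edges = {}, label = (\<lambda>_. undefined),
     sources = (\<lambda>_. []), targets = (\<lambda>_. [])\<rparr>"

text \<open>
  A morphism from the discrete hypergraph \<open>n\<close> to \<open>F\<close> is a function from \<open>{..<n}\<close> to the vertices of
  \<open>F\<close>; it is represented by the list of its \<open>n\<close> values.
\<close>

record ('v, 'e, 'g) cospan =
  apex :: "('v, 'e, 'g) hypergraph"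
  left_leg :: "'v list"
  right_leg :: "'v list"

definition cospan :: "'g signature \<Rightarrow> nat \<Rightarrow> nat \<Rightarrow> ('v, 'e, 'g) cospan \<Rightarrow> bool" where
  "cospan \<Sigma> m n c \<longleftrightarrow> hyp \<Sigma> (apex c) \<and>
     length (left_leg c) = m \<and> set (left_leg c) \<subseteq> verts (apex c) \<and>
     length (right_leg c) = n \<and> set (right_leg c) \<subseteq> verts (apex c)"

definition cospan_iso :: "('v, 'e, 'g) cospan \<Rightarrow> ('w, 'f, 'g) cospan \<Rightarrow> bool" where
  "cospan_iso c d \<longleftrightarrow> (\<exists>hv he. hyp_morphism (apex c) (apex d) hv he \<and>
     bij_betw hv (verts (apex c)) (verts (apex d)) \<and> bij_betw he (edges (apex c)) (edges (apex d)) \<and>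
     map hv (left_leg c) = left_leg d \<and> map hv (right_leg c) = right_leg d)"

text \<open>
  Every finite hypergraph is isomorphic to one whose vertices and hyperedges are natural numbers,
  so isomorphism classes of cospans are taken among the latter.
\<close>

type_synonym 'g ncospan = "(nat, nat, 'g) cospan"

definition cospan_class :: "'g signature \<Rightarrow> ('v, 'e, 'g) cospan \<Rightarrow> 'g ncospan set" where
  "cospan_class \<Sigma> c = {d. hyp \<Sigma> (apex d) \<and> cospan_iso c d}"

text \<open>
  The square with legs \<open>xs : n \<rightarrow> F\<close>, \<open>ys : n \<rightarrow> G\<close> out of the discrete hypergraph \<open>n\<close> and
  coprojections \<open>(jv, je) : F \<rightarrow> H\<close>, \<open>(kv, ke) : G \<rightarrow> H\<close> is a pushout.
\<close>

definition is_pushout ::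
    "'g signature \<Rightarrow> nat list \<Rightarrow> nat list \<Rightarrow>
     (nat, nat, 'g) hypergraph \<Rightarrow> (nat, nat, 'g) hypergraph \<Rightarrow> (nat, nat, 'g) hypergraph \<Rightarrow>
     (nat \<Rightarrow> nat) \<Rightarrow> (nat \<Rightarrow> nat) \<Rightarrow> (nat \<Rightarrow> nat) \<Rightarrow> (nat \<Rightarrow> nat) \<Rightarrow> bool" where
  "is_pushout \<Sigma> xs ys F G H jv je kv ke \<longleftrightarrow>
     hyp \<Sigma> H \<and> hyp_morphism F H jv je \<and> hyp_morphism G H kv ke \<and> map jv xs = map kv ys \<and>
     (\<forall>(K :: (nat, nat, 'g) hypergraph) (pv :: nat \<Rightarrow> nat) (pe :: nat \<Rightarrow> nat) (qv :: nat \<Rightarrow> nat) (qe :: nat \<Rightarrow> nat).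
        hyp \<Sigma> K \<and> hyp_morphism F K pv pe \<and> hyp_morphism G K qv qe \<and> map pv xs = map qv ys \<longrightarrow>
        (let mediates = \<lambda>(uv :: nat \<Rightarrow> nat) (ue :: nat \<Rightarrow> nat). hyp_morphism H K uv ue \<and>
               (\<forall>v\<in>verts F. uv (jv v) = pv v) \<and> (\<forall>e\<in>edges F. ue (je e) = pe e) \<and>
               (\<forall>v\<in>verts G. uv (kv v) = qv v) \<and> (\<forall>e\<in>edges G. ue (ke e) = qe e)
         in (\<exists>uv ue. mediates uv ue) \<and>
            (\<forall>uv ue uv' ue'. mediates uv ue \<and> mediates uv' ue' \<longrightarrow>
               (\<forall>v\<in>verts H. uv v = uv' v) \<and> (\<forall>e\<in>edges H. ue e = ue' e))))"

definition cospan_composite :: "'g signature \<Rightarrow> 'g ncospan \<Rightarrow> 'g ncospan \<Rightarrow> 'g ncospan \<Rightarrow> bool" where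
  "cospan_composite \<Sigma> c d z \<longleftrightarrow> (\<exists>jv je kv ke.
     is_pushout \<Sigma> (right_leg c) (left_leg d) (apex c) (apex d) (apex z) jv je kv ke \<and>
     left_leg z = map jv (left_leg c) \<and> right_leg z = map kv (right_leg d))"

definition hyp_sum ::
    "('v, 'e, 'g) hypergraph \<Rightarrow> ('w, 'f, 'g) hypergraph \<Rightarrow> ('v + 'w, 'e + 'f, 'g) hypergraph" where
  "hyp_sum F G =
    \<lparr>verts = verts F <+> verts G,
     edges = edges F <+> edges G,
     label = case_sum (label F) (label G),
     sources = case_sum (\<lambda>e. map Inl (sources F e)) (\<lambda>e. map Inr (sources G e)),
     targets = case_sum (\<lambda>e. map Inl (targets F e)) (\<lambda>e. map Inr (targets G e))\<rparr>"

definition cospan_sum ::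
    "('v, 'e, 'g) cospan \<Rightarrow> ('w, 'f, 'g) cospan \<Rightarrow> ('v + 'w, 'e + 'f, 'g) cospan" where
  "cospan_sum c d =
    \<lparr>apex = hyp_sum (apex c) (apex d),
     left_leg = map Inl (left_leg c) @ map Inr (left_leg d),
     right_leg = map Inl (right_leg c) @ map Inr (right_leg d)\<rparr>"

definition discrete_cospan :: "nat \<Rightarrow> nat list \<Rightarrow> nat list \<Rightarrow> 'g ncospan" where
  "discrete_cospan n xs ys = \<lparr>apex = discrete n, left_leg = xs, right_leg = ys\<rparr>"

definition Csp_prop :: "'g signature \<Rightarrow> 'g ncospan set prop_data" where
  "Csp_prop \<Sigma> =
    \<lparr>hom = (\<lambda>m n. {cospan_class \<Sigma> c | c :: 'g ncospan. cospan \<Sigma> m n c}),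
     ident = (\<lambda>n. cospan_class \<Sigma> (discrete_cospan n [0..<n] [0..<n])),
     compose = (\<lambda>X Y. {z. \<exists>c\<in>X. \<exists>d\<in>Y. cospan_composite \<Sigma> c d z}),
     tensor = (\<lambda>X Y. \<Union>c\<in>X. \<Union>d\<in>Y. cospan_class \<Sigma> (cospan_sum c d)),
     swap = (\<lambda>m n. cospan_class \<Sigma>
       (discrete_cospan (m + n) [0..<m + n] ([m..<m + n] @ [0..<m])))\<rparr>"

definition Csp_frobenius :: "'g signature \<Rightarrow> 'g ncospan set frobenius_data" where
  "Csp_frobenius \<Sigma> =
    \<lparr>fmerge = (\<lambda>n. cospan_class \<Sigma> (discrete_cospan n ([0..<n] @ [0..<n]) [0..<n])),
     funit = (\<lambda>n. cospan_class \<Sigma> (discrete_cospan n [] [0..<n])),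
     fcopy = (\<lambda>n. cospan_class \<Sigma> (discrete_cospan n [0..<n] ([0..<n] @ [0..<n]))),
     fcounit = (\<lambda>n. cospan_class \<Sigma> (discrete_cospan n [0..<n] []))\<rparr>"

definition Csp :: "'g signature \<Rightarrow> 'g ncospan set traced_prop_data" where
  "Csp \<Sigma> = with_canonical_trace (Csp_prop \<Sigma>) (Csp_frobenius \<Sigma>)"

definition in_degree :: "('v, 'e, 'g) hypergraph \<Rightarrow> 'v \<Rightarrow> nat" where
  "in_degree F v = card {(e, j). e \<in> edges F \<and> j < length (targets F e) \<and> targets F e ! j = v}"

text \<open>\<open>distinct\<close> states that the left leg is injective.\<close>

definition partial_left_monogamous :: "('v, 'e, 'g) cospan \<Rightarrow> bool" where
  "partial_left_monogamous c \<longleftrightarrow> distinct (left_leg c) \<and>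
     (\<forall>v\<in>set (left_leg c). in_degree (apex c) v = 0) \<and>
     (\<forall>v\<in>verts (apex c) - set (left_leg c). in_degree (apex c) v \<in> {0, 1})"

definition PLM_Csp :: "'g signature \<Rightarrow> 'g ncospan set traced_prop_data" where
  "PLM_Csp \<Sigma> = Csp \<Sigma>
    \<lparr>hom := (\<lambda>m n. {cospan_class \<Sigma> c | c :: 'g ncospan.
                      cospan \<Sigma> m n c \<and> partial_left_monogamous c})\<rparr>"

definition gen_cospan :: "'g signature \<Rightarrow> 'g \<Rightarrow> 'g ncospan" where
  "gen_cospan \<Sigma> g = (let k = arity \<Sigma> g; l = coarity \<Sigma> g in
    \<lparr>apex = \<lparr>verts = {..<k + l}, edges = {0}, label = (\<lambda>_. g),
             sources = (\<lambda>_. [0..<k]), targets = (\<lambda>_. [k..<k + l])\<rparr>,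
     left_leg = [0..<k],
     right_leg = [k..<k + l]\<rparr>)"

definition sem_gen :: "'g signature \<Rightarrow> 'g + frob_gen \<Rightarrow> 'g ncospan set" where
  "sem_gen \<Sigma> = case_sum (\<lambda>g. cospan_class \<Sigma> (gen_cospan \<Sigma> g))
     (case_frob_gen (fmerge (Csp_frobenius \<Sigma>) 1) (funit (Csp_frobenius \<Sigma>) 1)
                    (fcopy (Csp_frobenius \<Sigma>) 1) (fcounit (Csp_frobenius \<Sigma>) 1))"

definition sem :: "'g signature \<Rightarrow> ('g + frob_gen) trm set \<Rightarrow> 'g ncospan set" where
  "sem \<Sigma> = induced (SMC_Frob_presentation \<Sigma>) (Csp \<Sigma>) (sem_gen \<Sigma>)"


section \<open>Universal properties of the presented PROPs\<close>

lemma term_eq_typed: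
  "term_eq D P s t \<Longrightarrow> well_formed D P s \<and> well_formed D P t \<and> tdom P s = tdom P t \<and> tcod P s = tcod P t"
  by (induction rule: term_eq.induct) (auto simp: typed_def)

lemma term_class_eq_iff:
  assumes "typed D P s m n"
  shows "term_class D P s = term_class D P t \<longleftrightarrow> term_eq D P s t"
proof
  assume "term_class D P s = term_class D P t"
  moreover have "s \<in> term_class D P s" by (simp add: term_class_def eq_refl[OF assms])
  ultimately show "term_eq D P s t" by (simp add: term_class_def eq_sym)
qed (auto simp: term_class_def dest: eq_sym eq_trans)

lemma term_class_eqI: "term_eq D P s t \<Longrightarrow> term_class D P s = term_class D P t"
  unfolding term_class_def by (auto dest: eq_sym eq_trans)

lemma term_class_Un:
  assumes "typed D P s m n" and "\<And>s'. term_eq D P s s' \<Longrightarrow> term_eq D P (f s) (f s')"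
  shows "(\<Union>s'\<in>term_class D P s. term_class D P (f s')) = term_class D P (f s)"
proof -
  have "s \<in> term_class D P s" using assms(1) by (auto simp: term_class_def intro: eq_refl)
  moreover have "term_class D P (f s') = term_class D P (f s)" if "s' \<in> term_class D P s" for s'
    using that assms(2) term_class_eqI unfolding term_class_def by (metis mem_Collect_eq)
  ultimately show ?thesis by blast
qed

lemma presented_hom: "typed D P t m n \<Longrightarrow> term_class D P t \<in> hom (presented D P) m n"
  by (auto simp: presented_def)

lemma presented_homE:
  assumes "X \<in> hom (presented D P) m n"
  obtains t where "typed D P t m n" "X = term_class D P t"
  using assms by (auto simp: presented_def)

lemma presented_compose:
  assumes "typed D P s m n" "typed D P t n p"
  shows "compose (presented D P) (term_class D P s) (term_class D P t) = term_class D P (s \<triangleright> t)"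
proof -
  have "(\<Union>t'\<in>term_class D P t. term_class D P (s' \<triangleright> t')) = term_class D P (s' \<triangleright> t)"
    if "term_eq D P s s'" for s'
    using term_eq_typed[OF that] assms
    by (intro term_class_Un[OF assms(2)]) (auto simp: typed_def intro!: eq_seq eq_refl[of D P s' m n])
  then have "(\<Union>s'\<in>term_class D P s. \<Union>t'\<in>term_class D P t. term_class D P (s' \<triangleright> t'))
     = (\<Union>s'\<in>term_class D P s. term_class D P (s' \<triangleright> t))"
    by (intro SUP_cong) (auto simp: term_class_def)
  also have "\<dots> = term_class D P (s \<triangleright> t)"
    using assms by (intro term_class_Un[OF assms(1)])
      (auto simp: typed_def intro!: eq_seq eq_refl[of D P t n p])
  finally show ?thesis by (simp add: presented_def)
qed

lemma presented_tensor:
  assumes "typed D P s m n" "typed D P t p q"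
  shows "tensor (presented D P) (term_class D P s) (term_class D P t) = term_class D P (s \<oplus> t)"
proof -
  have "(\<Union>t'\<in>term_class D P t. term_class D P (s' \<oplus> t')) = term_class D P (s' \<oplus> t)"
    if "term_eq D P s s'" for s'
    using term_eq_typed[OF that] assms
    by (intro term_class_Un[OF assms(2)]) (auto simp: typed_def intro!: eq_tens eq_refl[of D P s' m n])
  then have "(\<Union>s'\<in>term_class D P s. \<Union>t'\<in>term_class D P t. term_class D P (s' \<oplus> t'))
     = (\<Union>s'\<in>term_class D P s. term_class D P (s' \<oplus> t))"
    by (intro SUP_cong) (auto simp: term_class_def)
  also have "\<dots> = term_class D P (s \<oplus> t)"
    using assms by (intro term_class_Un[OF assms(1)])
      (auto simp: typed_def intro!: eq_tens eq_refl[of D P t p q])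
  finally show ?thesis by (simp add: presented_def)
qed

lemma presented_ident: "ident (presented D P) n = term_class D P (Ident n)"
  by (simp add: presented_def)

lemma presented_swap: "swap (presented D P) m n = term_class D P (Swap m n)"
  by (simp add: presented_def)

lemma typed_simps [simp]:
  "typed D P (Ident n) m m' \<longleftrightarrow> m = n \<and> m' = n"
  "typed D P (Swap p q) m m' \<longleftrightarrow> m = p + q \<and> m' = q + p"
  by (auto simp: typed_def)

lemma typed_Seq: "typed D P s m n \<Longrightarrow> typed D P t n p \<Longrightarrow> typed D P (s \<triangleright> t) m p"
  by (auto simp: typed_def)

lemma typed_Tens: "typed D P s m n \<Longrightarrow> typed D P t p q \<Longrightarrow> typed D P (s \<oplus> t) (m + p) (n + q)"
  by (auto simp: typed_def)

lemma typed_Tr: "typed Traced P t (x + m) (x + n) \<Longrightarrow> typed Traced P (Tr x t) m n"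
  by (auto simp: typed_def)

lemma prop_cat_presented: "prop_cat (presented D P)"
proof -
  let ?Q = "presented D P"
  note tI = typed_simps(1)[THEN iffD2, OF conjI, OF refl refl]
  note tS = typed_simps(2)[THEN iffD2, OF conjI, OF refl refl]
  note sq = presented_compose and tn = presented_tensor and q = presented_ident presented_swap
    and S = typed_Seq and T = typed_Tens
  show ?thesis
  proof
    fix f m n m' n' assume "f \<in> hom ?Q m n" "f \<in> hom ?Q m' n'"
    then show "m = m' \<and> n = n'"
      by (elim presented_homE) (metis term_class_eq_iff term_eq_typed typed_def)
  next
    fix n show "ident ?Q n \<in> hom ?Q n n" by (simp add: q presented_hom)
  next
    fix f m n g p assume "f \<in> hom ?Q m n" "g \<in> hom ?Q n p"
    then show "compose ?Q f g \<in> hom ?Q m p"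
      by (elim presented_homE) (simp add: sq presented_hom S)
  next
    fix f m n g p q assume "f \<in> hom ?Q m n" "g \<in> hom ?Q p q"
    then show "tensor ?Q f g \<in> hom ?Q (m + p) (n + q)"
      by (elim presented_homE) (simp add: tn presented_hom T)
  next
    fix m n show "swap ?Q m n \<in> hom ?Q (m + n) (n + m)" by (simp add: q presented_hom)
  next
    fix f m n assume "f \<in> hom ?Q m n"
    then obtain r where r: "typed D P r m n" and [simp]: "f = term_class D P r" by (rule presented_homE)
    show "compose ?Q (ident ?Q m) f = f"
      by (simp add: q sq[OF tI r] term_class_eqI[OF eq_ident_compose[OF r]])
    show "compose ?Q f (ident ?Q n) = f"
      by (simp add: q sq[OF r tI] term_class_eqI[OF eq_compose_ident[OF r]])
    show "tensor ?Q (ident ?Q 0) f = f"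
      by (simp add: q tn[OF tI r] term_class_eqI[OF eq_unit_tensor[OF r]])
    show "tensor ?Q f (ident ?Q 0) = f"
      by (simp add: q tn[OF r tI] term_class_eqI[OF eq_tensor_unit[OF r]])
  next
    fix f m n g p h k assume "f \<in> hom ?Q m n" "g \<in> hom ?Q n p" "h \<in> hom ?Q p k"
    then obtain r s t where r: "typed D P r m n" and s: "typed D P s n p" and t: "typed D P t p k"
      and [simp]: "f = term_class D P r" "g = term_class D P s" "h = term_class D P t"
      by (elim presented_homE)
    show "compose ?Q (compose ?Q f g) h = compose ?Q f (compose ?Q g h)"
      by (simp add: sq[OF r s] sq[OF s t] sq[OF S[OF r s] t] sq[OF r S[OF s t]]
        term_class_eqI[OF eq_compose_assoc[OF r s t]])
  next
    fix m n show "tensor ?Q (ident ?Q m) (ident ?Q n) = ident ?Q (m + n)"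
      by (simp add: q tn[OF tI tI] term_class_eqI[OF eq_tensor_ident])
  next
    fix f m n g p f' m' n' g' p'
    assume "f \<in> hom ?Q m n" "g \<in> hom ?Q n p" "f' \<in> hom ?Q m' n'" "g' \<in> hom ?Q n' p'"
    then obtain r s r' s' where r: "typed D P r m n" and s: "typed D P s n p"
      and r': "typed D P r' m' n'" and s': "typed D P s' n' p'"
      and [simp]: "f = term_class D P r" "g = term_class D P s" "f' = term_class D P r'" "g' = term_class D P s'"
      by (elim presented_homE)
    show "tensor ?Q (compose ?Q f g) (compose ?Q f' g') = compose ?Q (tensor ?Q f f') (tensor ?Q g g')"
      by (simp add: sq[OF r s] sq[OF r' s'] tn[OF r r'] tn[OF s s'] tn[OF S[OF r s] S[OF r' s']]
        sq[OF T[OF r r'] T[OF s s']] term_class_eqI[OF eq_interchange[OF r s r' s']])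
  next
    fix f m n g m' n' h m'' n''
    assume "f \<in> hom ?Q m n" "g \<in> hom ?Q m' n'" "h \<in> hom ?Q m'' n''"
    then obtain r s t where r: "typed D P r m n" and s: "typed D P s m' n'" and t: "typed D P t m'' n''"
      and [simp]: "f = term_class D P r" "g = term_class D P s" "h = term_class D P t"
      by (elim presented_homE)
    show "tensor ?Q (tensor ?Q f g) h = tensor ?Q f (tensor ?Q g h)"
      by (simp add: tn[OF r s] tn[OF s t] tn[OF T[OF r s] t] tn[OF r T[OF s t]]
        term_class_eqI[OF eq_tensor_assoc[OF r s t]])
  next
    fix f m n g p k assume "f \<in> hom ?Q m n" "g \<in> hom ?Q p k"
    then obtain r s where r: "typed D P r m n" and s: "typed D P s p k"
      and [simp]: "f = term_class D P r" "g = term_class D P s" by (elim presented_homE)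
    show "compose ?Q (tensor ?Q f g) (swap ?Q n k) = compose ?Q (swap ?Q m p) (tensor ?Q g f)"
      by (simp add: q tn[OF r s] tn[OF s r] sq[OF T[OF r s] tS] sq[OF tS T[OF s r]]
        term_class_eqI[OF eq_swap_natural[OF r s]])
  next
    fix m n show "compose ?Q (swap ?Q m n) (swap ?Q n m) = ident ?Q (m + n)"
      by (simp add: q sq[OF tS tS] term_class_eqI[OF eq_swap_swap])
  next
    fix m n p
    have l: "typed D P (Swap m n \<oplus> Ident p) (m + n + p) (n + m + p)"
      and r: "typed D P (Ident n \<oplus> Swap m p) (n + m + p) (n + p + m)"
      by (auto simp: typed_def)
    show "swap ?Q m (n + p) =
      compose ?Q (tensor ?Q (swap ?Q m n) (ident ?Q p)) (tensor ?Q (ident ?Q n) (swap ?Q m p))"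
      by (simp add: q tn[OF tS tI] tn[OF tI tS] sq[OF l r] term_class_eqI[OF eq_hexagon])
  qed
qed

lemma presented_traced_simps [simp]:
  "hom (presented_traced_prop P) = hom (presented Traced P)"
  "ident (presented_traced_prop P) = ident (presented Traced P)"
  "compose (presented_traced_prop P) = compose (presented Traced P)"
  "tensor (presented_traced_prop P) = tensor (presented Traced P)"
  "swap (presented_traced_prop P) = swap (presented Traced P)"
  by (simp_all add: presented_traced_prop_def prop_data.defs)

lemma presented_trace:
  assumes "typed Traced P t (x + m) (x + n)"
  shows "trace (presented_traced_prop P) x m n (term_class Traced P t) = term_class Traced P (Tr x t)"
  using assms unfolding presented_traced_prop_def
  by (simp add: prop_data.defs, intro term_class_Un[OF assms]) (auto simp: typed_def intro: eq_tr)

lemma prop_cat_cong: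
  assumes "prop_cat P" "hom Q = hom P" "ident Q = ident P" "compose Q = compose P"
    "tensor Q = tensor P" "swap Q = swap P"
  shows "prop_cat Q"
  using assms(1) unfolding prop_cat_def assms(2-) .


lemma eval_term_class_traced:
  "typed Traced P t m n \<Longrightarrow>
    eval P (presented_traced_prop P) (\<lambda>g. term_class Traced P (Gen g)) t = term_class Traced P t"
proof (induction t arbitrary: m n)
  case (Seq s t)
  then have "typed Traced P s m (tdom P t)" "typed Traced P t (tdom P t) n"
    by (auto simp: typed_def)
  with Seq.IH show ?case by (simp add: presented_compose)
next
  case (Tens s t)
  then have "typed Traced P s (tdom P s) (tcod P s)" "typed Traced P t (tdom P t) (tcod P t)"
    by (auto simp: typed_def)
  with Tens.IH show ?case by (simp add: presented_tensor)
next
  case (Tr x t)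
  then have "typed Traced P t (x + (tdom P t - x)) (x + (tcod P t - x))"
    by (auto simp: typed_def)
  with Tr.IH show ?case by (simp add: presented_trace)
qed (simp_all add: presented_ident presented_swap)

lemma traced_prop_cat_presented: "traced_prop_cat (presented_traced_prop P)"
proof -
  let ?Q = "presented_traced_prop P" and ?c = "term_class Traced P"
  let ?e = "eval P ?Q (\<lambda>g. ?c (Gen g))"
  have ev: "?e s = ?e t" if "term_eq Traced P s t" for s t
    using term_eq_typed[OF that] term_class_eqI[OF that] eval_term_class_traced[of P]
    by (metis typed_def)
  have rep: "\<exists>t. typed Traced P t m n \<and> f = ?e t" if "f \<in> hom ?Q m n" for f m n
    using that by (simp, metis presented_homE eval_term_class_traced)
  have td: "tdom P t = m" "tcod P t = n" if "typed Traced P t m n" for t m n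
    using that by (auto simp: typed_def)
  have in_hom: "?e t \<in> hom ?Q m n" if "typed Traced P t m n" for t m n
    using that by (simp add: eval_term_class_traced presented_hom)
  interpret prop_cat ?Q
    by (rule prop_cat_cong[OF prop_cat_presented[of Traced P]]) simp_all
  show ?thesis
  proof
    fix h x m n assume "h \<in> hom ?Q (x + m) (x + n)"
    then obtain t where t: "typed Traced P t (x + m) (x + n)" "h = ?e t" using rep by blast
    show "trace ?Q x m n h \<in> hom ?Q m n"
      using in_hom[OF typed_Tr[OF t(1)]] t td[OF t(1)] by simp
  next
    fix f m m' h x n' g n
    assume "f \<in> hom ?Q m m'" "h \<in> hom ?Q (x + m') (x + n')" "g \<in> hom ?Q n' n"
    then obtain r s t where t: "typed Traced P r m m'" "f = ?e r"
      "typed Traced P s (x + m') (x + n')" "h = ?e s" "typed Traced P t n' n" "g = ?e t"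
      using rep by metis
    show "trace ?Q x m n (compose ?Q (compose ?Q (tensor ?Q (ident ?Q x) f) h)
        (tensor ?Q (ident ?Q x) g)) = compose ?Q (compose ?Q f (trace ?Q x m' n' h)) g"
      using ev[OF eq_tightening[OF refl t(1,3,5)]] t td[OF t(1)] td[OF t(3)] td[OF t(5)] by simp
  next
    fix f x y h m n
    assume "f \<in> hom ?Q x y" "h \<in> hom ?Q (y + m) (x + n)"
    then obtain s t where t: "typed Traced P s x y" "f = ?e s"
      "typed Traced P t (y + m) (x + n)" "h = ?e t"
      using rep by metis
    show "trace ?Q x m n (compose ?Q (tensor ?Q f (ident ?Q m)) h) =
       trace ?Q y m n (compose ?Q h (tensor ?Q f (ident ?Q n)))"
      using ev[OF eq_sliding[OF refl t(1,3)]] t td[OF t(1)] td[OF t(3)] by simp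
  next
    fix h m n assume "h \<in> hom ?Q m n"
    then obtain t where t: "typed Traced P t m n" "h = ?e t" using rep by metis
    show "trace ?Q 0 m n h = h"
      using ev[OF eq_vanishing_zero[OF refl t(1)]] t td[OF t(1)] by simp
  next
    fix h x y m n assume "h \<in> hom ?Q (x + y + m) (x + y + n)"
    then obtain t where t: "typed Traced P t (x + y + m) (x + y + n)" "h = ?e t" using rep by metis
    show "trace ?Q (x + y) m n h = trace ?Q y m n (trace ?Q x (y + m) (y + n) h)"
      using ev[OF eq_vanishing_add[OF refl t(1)]] t td[OF t(1)] by (simp add: add.assoc)
  next
    fix h x m n g p q assume "h \<in> hom ?Q (x + m) (x + n)" "g \<in> hom ?Q p q"
    then obtain s t where t: "typed Traced P s (x + m) (x + n)" "h = ?e s"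
      "typed Traced P t p q" "g = ?e t" using rep by metis
    show "trace ?Q x (m + p) (n + q) (tensor ?Q h g) = tensor ?Q (trace ?Q x m n h) g"
      using ev[OF eq_superposing[OF refl t(1,3)]] t td[OF t(1)] td[OF t(3)] by (simp add: add.assoc)
  next
    fix x show "trace ?Q x x x (swap ?Q x x) = ident ?Q x"
      using ev[OF eq_yanking[of Traced P x]] by simp
  qed
qed

text \<open>
  Doctrine-generic notions: a PROP (traced PROP), a morphism from the one presented by \<open>P\<close> to \<open>Q\<close>,
  and an assignment of arrows of \<open>Q\<close> to the generators of \<open>P\<close> that satisfies the equations of \<open>P\<close>.
\<close>

definition is_morphism ::
    "doctrine \<Rightarrow> 'g presentation \<Rightarrow> ('a, 'm) traced_prop_data_scheme \<Rightarrow> ('g trm set \<Rightarrow> 'a) \<Rightarrow> bool" where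
  "is_morphism D P Q F \<longleftrightarrow> (case D of Sym_Mon \<Rightarrow> prop_morphism (presented_prop P) Q F
     | Traced \<Rightarrow> traced_prop_morphism (presented_traced_prop P) Q F)"

definition is_model ::
    "doctrine \<Rightarrow> 'g presentation \<Rightarrow> ('a, 'm) traced_prop_data_scheme \<Rightarrow> ('g \<Rightarrow> 'a) \<Rightarrow> bool" where
  "is_model D P Q \<gamma> \<longleftrightarrow> (\<forall>g\<in>gens P. \<gamma> g \<in> hom Q (arity P g) (coarity P g)) \<and>
     (\<forall>(s, t)\<in>equations P. \<forall>m n. typed D P s m n \<longrightarrow> typed D P t m n \<longrightarrow> eval P Q \<gamma> s = eval P Q \<gamma> t)"

definition is_cat :: "doctrine \<Rightarrow> ('a, 'm) traced_prop_data_scheme \<Rightarrow> bool" where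
  "is_cat D Q \<longleftrightarrow> prop_cat Q \<and> (D = Traced \<longrightarrow> traced_prop_cat Q)"

lemma eval_hom:
  assumes Q: "is_cat D Q" and g: "\<forall>g\<in>gens P. \<gamma> g \<in> hom Q (arity P g) (coarity P g)"
  shows "typed D P t m n \<Longrightarrow> eval P Q \<gamma> t \<in> hom Q m n"
proof (induction t arbitrary: m n)
  case (Gen g) then show ?case using g by (auto simp: typed_def)
next
  case (Seq s t)
  then show ?case using Q prop_cat.compose_hom[of Q] by (auto simp: typed_def is_cat_def)
next
  case (Tens s t)
  then show ?case using Q prop_cat.tensor_hom[of Q] by (auto simp: typed_def is_cat_def)
next
  case (Tr x t)
  then have "typed D P t (x + m) (x + n)" by (auto simp: typed_def)
  with Tr show ?case using Q traced_prop_cat.trace_hom[of Q] by (auto simp: typed_def is_cat_def)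
qed (use Q in \<open>auto simp: is_cat_def intro: prop_cat.ident_hom prop_cat.swap_hom\<close>)

lemma eval_sound:
  assumes Q: "is_cat D Q" and m: "is_model D P Q \<gamma>"
  shows "term_eq D P s t \<Longrightarrow> eval P Q \<gamma> s = eval P Q \<gamma> t"
proof (induction rule: term_eq.induct)
  have h: "typed D P t m n \<Longrightarrow> eval P Q \<gamma> t \<in> hom Q m n" for t m n
    using eval_hom[OF Q, of P \<gamma>] m by (auto simp: is_model_def)
  interpret prop_cat Q using Q by (simp add: is_cat_def)
  have T: "D = Traced \<Longrightarrow> traced_prop_cat Q" using Q by (simp add: is_cat_def)
  have td: "tdom P t = m" "tcod P t = n" if "typed D P t m n" for t m n
    using that by (auto simp: typed_def)
  {
    case (eq_tr t t' x) with term_eq_typed[OF eq_tr(2)] show ?case by simp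
  next
    case (eq_presentation s t m n) then show ?case using m by (auto simp: is_model_def)
  next
    case (eq_ident_compose f m n) then show ?case using ident_compose[OF h] by simp
  next
    case (eq_compose_ident f m n) then show ?case using compose_ident[OF h] by simp
  next
    case (eq_compose_assoc f m n g p h' q)
    then show ?case using compose_assoc[OF h h h] by simp
  next
    case (eq_tensor_ident m n) then show ?case using tensor_ident by simp
  next
    case (eq_interchange f m n g p f' m' n' g' p')
    then show ?case using interchange[OF h h h h] by simp
  next
    case (eq_tensor_assoc f m n g m' n' h' m'' n'')
    then show ?case using tensor_assoc[OF h h h] by simp
  next
    case (eq_unit_tensor f m n) then show ?case using unit_tensor[OF h] by simp
  next
    case (eq_tensor_unit f m n) then show ?case using tensor_unit[OF h] by simp
  next
    case (eq_swap_natural f m n g p q)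
    then show ?case using swap_natural[OF h h] by simp
  next
    case (eq_swap_swap m n) then show ?case using swap_swap by simp
  next
    case (eq_hexagon m n p) then show ?case using hexagon by simp
  next
    case (eq_tightening f m m' k x n' g n)
    with traced_prop_cat.tightening[OF T h[OF eq_tightening(2)] h[OF eq_tightening(3)] h[OF eq_tightening(4)]]
    show ?case using td[OF eq_tightening(2)] td[OF eq_tightening(3)] td[OF eq_tightening(4)] by simp
  next
    case (eq_sliding f x y k m n)
    with traced_prop_cat.sliding[OF T h[OF eq_sliding(2)] h[OF eq_sliding(3)]]
    show ?case using td[OF eq_sliding(2)] td[OF eq_sliding(3)] by simp
  next
    case (eq_vanishing_zero k m n)
    with traced_prop_cat.vanishing_zero[OF T h[OF eq_vanishing_zero(2)]]
    show ?case using td[OF eq_vanishing_zero(2)] by simp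
  next
    case (eq_vanishing_add k x y m n)
    with traced_prop_cat.vanishing_add[OF T h[OF eq_vanishing_add(2)]]
    show ?case using td[OF eq_vanishing_add(2)] by (simp add: add.assoc)
  next
    case (eq_superposing k x m n g p q)
    with traced_prop_cat.superposing[OF T h[OF eq_superposing(2)] h[OF eq_superposing(3)]]
    show ?case using td[OF eq_superposing(2)] td[OF eq_superposing(3)] by (simp add: add.assoc)
  next
    case (eq_yanking x)
    with traced_prop_cat.yanking[OF T] show ?case by simp
  }
qed simp_all

lemma induced_class:
  assumes "is_cat D Q" "is_model D P Q \<gamma>" "typed D P t m n"
  shows "induced P Q \<gamma> (term_class D P t) = eval P Q \<gamma> t"
proof -
  have t: "t \<in> term_class D P t" by (simp add: term_class_def eq_refl[OF assms(3)])
  have "y = eval P Q \<gamma> t" if "y \<in> eval P Q \<gamma> ` term_class D P t" for y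
    using that eval_sound[OF assms(1,2), of t] by (auto simp only: term_class_def mem_Collect_eq image_iff)
  then have "eval P Q \<gamma> ` term_class D P t = {eval P Q \<gamma> t}"
    using imageI[OF t, of "eval P Q \<gamma>"] by blast
  then show ?thesis by (simp add: induced_def)
qed

lemma is_morphism_eval:
  assumes F: "is_morphism D P Q F"
  shows "typed D P t m n \<Longrightarrow> F (term_class D P t) = eval P Q (\<lambda>g. F (term_class D P (Gen g))) t"
proof (induction t arbitrary: m n)
  have p: "prop_morphism (presented D P) Q F"
    using F by (cases D) (auto simp: is_morphism_def traced_prop_morphism_def prop_morphism_def)
  {
    case (Ident n)
    show ?case using p by (simp add: prop_morphism_def presented_ident)
  next
    case (Swap m n)
    show ?case using p by (simp add: prop_morphism_def presented_swap)
  next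
    case (Seq s t)
    then have t: "typed D P s m (tdom P t)" "typed D P t (tdom P t) n" by (auto simp: typed_def)
    show ?case using p Seq.IH(1)[OF t(1)] Seq.IH(2)[OF t(2)] presented_hom[OF t(1)] presented_hom[OF t(2)]
      by (simp add: prop_morphism_def flip: presented_compose[OF t])
  next
    case (Tens s t)
    then have t: "typed D P s (tdom P s) (tcod P s)" "typed D P t (tdom P t) (tcod P t)"
      by (auto simp: typed_def)
    show ?case using p Tens.IH(1)[OF t(1)] Tens.IH(2)[OF t(2)] presented_hom[OF t(1)] presented_hom[OF t(2)]
      by (simp add: prop_morphism_def flip: presented_tensor[OF t])
  next
    case (Tr x t)
    then have D: "D = Traced" by (auto simp: typed_def)
    from Tr have t: "typed Traced P t (x + (tdom P t - x)) (x + (tcod P t - x))"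
      by (auto simp: typed_def)
    show ?case using F Tr.IH[OF t[folded D]] presented_hom[OF t]
      by (simp add: D is_morphism_def traced_prop_morphism_def flip: presented_trace[OF t])
  }
qed simp

lemma is_morphism_induced:
  assumes "is_cat D Q" "is_model D P Q \<gamma>"
  shows "is_morphism D P Q (induced P Q \<gamma>)"
proof -
  note ic = induced_class[OF assms]
  have h: "typed D P t m n \<Longrightarrow> eval P Q \<gamma> t \<in> hom Q m n" for t m n
    using eval_hom[OF assms(1), of P \<gamma>] assms(2) by (auto simp: is_model_def)
  have p: "prop_morphism (presented D P) Q (induced P Q \<gamma>)"
    unfolding prop_morphism_def
    by (intro conjI allI ballI; (elim presented_homE)?)
       (simp_all add: presented_ident presented_swap presented_compose presented_tensor ic h
         ic[OF typed_Seq] ic[OF typed_Tens])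
  show ?thesis
  proof (cases D)
    case Traced
    have "induced P Q \<gamma> (trace (presented_traced_prop P) x m n f) = trace Q x m n (induced P Q \<gamma> f)"
      if f: "f \<in> hom (presented Traced P) (x + m) (x + n)" for x m n f
    proof -
      obtain t where t: "typed Traced P t (x + m) (x + n)" "f = term_class Traced P t"
        using f by (rule presented_homE)
      then show ?thesis
        using ic[of t] ic[of "Tr x t"] typed_Tr[OF t(1)]
        by (simp add: presented_trace Traced) (simp add: typed_def)
    qed
    then show ?thesis using p by (simp add: is_morphism_def Traced traced_prop_morphism_def prop_morphism_def)
  qed (use p in \<open>simp add: is_morphism_def\<close>)
qed

lemma is_model_of_morphism:
  assumes F: "is_morphism D P Q F"
  shows "is_model D P Q (\<lambda>g. F (term_class D P (Gen g)))"
proof -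
  have p: "prop_morphism (presented D P) Q F"
    using F by (cases D) (auto simp: is_morphism_def traced_prop_morphism_def prop_morphism_def)
  have "F (term_class D P (Gen g)) \<in> hom Q (arity P g) (coarity P g)" if "g \<in> gens P" for g
    using p that presented_hom[of D P "Gen g"] by (simp add: prop_morphism_def typed_def)
  moreover have "eval P Q (\<lambda>g. F (term_class D P (Gen g))) s = eval P Q (\<lambda>g. F (term_class D P (Gen g))) t"
    if "(s, t) \<in> equations P" "typed D P s m n" "typed D P t m n" for s t m n
    using is_morphism_eval[OF F that(2)] is_morphism_eval[OF F that(3)]
      term_class_eqI[OF eq_presentation[OF that]] by simp
  ultimately show ?thesis by (auto simp: is_model_def)
qed


lemma induced_unique:
  assumes F: "is_morphism D P Q F" and Q: "is_cat D Q"
    and g: "\<And>g. g \<in> gens P \<Longrightarrow> F (term_class D P (Gen g)) = \<gamma> g"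
    and X: "X \<in> hom (presented D P) m n"
  shows "F X = induced P Q \<gamma> X"
proof -
  let ?\<delta> = "\<lambda>g. F (term_class D P (Gen g))"
  have ev: "well_formed D P t \<Longrightarrow> eval P Q ?\<delta> t = eval P Q \<gamma> t" for t
    by (induction t) (auto simp: g)
  have "is_model D P Q \<gamma>"
    using is_model_of_morphism[OF F] g ev unfolding is_model_def typed_def by fastforce
  moreover obtain t where t: "typed D P t m n" "X = term_class D P t"
    using X by (rule presented_homE)
  ultimately show ?thesis
    using is_morphism_eval[OF F t(1)] induced_class[OF Q _ t(1)] ev[of t] t by (simp add: typed_def)
qed

lemma typed_sum [simp]:
  "typed D (presentation_sum P P') (map_trm Inl t) m n \<longleftrightarrow> typed D P t m n"
  "typed D (presentation_sum P P') (map_trm Inr u) m n \<longleftrightarrow> typed D P' u m n"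
proof -
  have [simp]: "tdom (presentation_sum P P') (map_trm Inl t) = tdom P t"
    "tcod (presentation_sum P P') (map_trm Inl t) = tcod P t" for t
    by (induction t) (auto simp: presentation_sum_def)
  have [simp]: "tdom (presentation_sum P P') (map_trm Inr t) = tdom P' t"
    "tcod (presentation_sum P P') (map_trm Inr t) = tcod P' t" for t
    by (induction t) (auto simp: presentation_sum_def)
  have [simp]: "g \<in> gens P \<Longrightarrow> Inl g \<in> gens (presentation_sum P P')"
     "Inl g \<in> gens (presentation_sum P P') \<longleftrightarrow> g \<in> gens P"
     "Inr c \<in> gens (presentation_sum P P') \<longleftrightarrow> c \<in> gens P'" for g c
    by (auto simp: presentation_sum_def)
  have "well_formed D (presentation_sum P P') (map_trm Inl t) = well_formed D P t" for t
    by (induction t) auto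
  moreover have "well_formed D (presentation_sum P P') (map_trm Inr t) = well_formed D P' t" for t
    by (induction t) auto
  ultimately show "typed D (presentation_sum P P') (map_trm Inl t) m n \<longleftrightarrow> typed D P t m n"
    "typed D (presentation_sum P P') (map_trm Inr u) m n \<longleftrightarrow> typed D P' u m n"
    by (simp_all add: typed_def)
qed

lemma tdom_tcod_sum [simp]:
  "tdom (presentation_sum P P') (map_trm Inl t) = tdom P t \<and>
   tcod (presentation_sum P P') (map_trm Inl t) = tcod P t"
  "tdom (presentation_sum P P') (map_trm Inr u) = tdom P' u \<and>
   tcod (presentation_sum P P') (map_trm Inr u) = tcod P' u"
  subgoal by (induction t) (auto simp: presentation_sum_def)
  subgoal by (induction u) (auto simp: presentation_sum_def)
  done

lemma eval_sum [simp]: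
  "eval (presentation_sum P P') Q \<gamma> (map_trm Inl t) = eval P Q (\<lambda>g. \<gamma> (Inl g)) t"
  "eval (presentation_sum P P') Q \<gamma> (map_trm Inr u) = eval P' Q (\<lambda>g. \<gamma> (Inr g)) u"
  subgoal by (induction t) simp_all
  subgoal by (induction u) simp_all
  done

lemma is_model_sum:
  "is_model D (presentation_sum P P') Q \<gamma> \<longleftrightarrow>
     is_model D P Q (\<lambda>g. \<gamma> (Inl g)) \<and> is_model D P' Q (\<lambda>g. \<gamma> (Inr g))"
proof -
  let ?S = "presentation_sum P P'"
  have "(\<forall>g\<in>gens ?S. \<gamma> g \<in> hom Q (arity ?S g) (coarity ?S g)) \<longleftrightarrow>
     (\<forall>g\<in>gens P. \<gamma> (Inl g) \<in> hom Q (arity P g) (coarity P g)) \<and>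
     (\<forall>g\<in>gens P'. \<gamma> (Inr g) \<in> hom Q (arity P' g) (coarity P' g))"
    by (simp add: presentation_sum_def Plus_def ball_Un)
  moreover have "equations ?S = map_prod (map_trm Inl) (map_trm Inl) ` equations P \<union>
                 map_prod (map_trm Inr) (map_trm Inr) ` equations P'"
    by (simp add: presentation_sum_def)
  ultimately show ?thesis
    by (simp add: is_model_def ball_Un case_prod_unfold conj_ac)
qed

lemma eval_free_presentation [simp]: "eval (free_presentation \<Sigma>) Q \<gamma> t = eval \<Sigma> Q \<gamma> t"
proof -
  have [simp]: "tdom (free_presentation \<Sigma>) t = tdom \<Sigma> t \<and> tcod (free_presentation \<Sigma>) t = tcod \<Sigma> t" for t
    by (induction t) (auto simp: free_presentation_def signature.defs)
  show ?thesis by (induction t) simp_all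
qed

lemma is_model_comon: "is_model D comon_presentation Q \<gamma> \<longleftrightarrow> is_model D' comon_presentation Q \<gamma>"
proof -
  have *: "typed D comon_presentation s m n = typed D' comon_presentation s m n \<and>
       typed D comon_presentation t m n = typed D' comon_presentation t m n"
    if "(s, t) \<in> equations comon_presentation" for s t m n
    using that by (auto simp: typed_def comon_presentation_def)
  have "(\<forall>p\<in>equations comon_presentation. case p of (s, t) \<Rightarrow> \<forall>m n.
        typed D comon_presentation s m n \<longrightarrow> typed D comon_presentation t m n \<longrightarrow>
        eval comon_presentation Q \<gamma> s = eval comon_presentation Q \<gamma> t) \<longleftrightarrow>
     (\<forall>p\<in>equations comon_presentation. case p of (s, t) \<Rightarrow> \<forall>m n.
        typed D' comon_presentation s m n \<longrightarrow> typed D' comon_presentation t m n \<longrightarrow>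
        eval comon_presentation Q \<gamma> s = eval comon_presentation Q \<gamma> t)"
  proof (rule ball_cong[OF refl], goal_cases)
    case (1 p)
    obtain s t where p: "p = (s, t)" by (cases p)
    show ?case unfolding p case_prod_conv using *[of s t] 1 by (simp only: p)
  qed
  then show ?thesis by (simp only: is_model_def)
qed

text \<open>
  \<open>STMC_CComon \<Sigma>\<close> with its coprojections is the coproduct: a pair of a morphism of traced PROPs out of
  \<open>STMC \<Sigma>\<close> and a morphism of PROPs out of \<open>CComon\<close> factors uniquely through it.
\<close>

theorem STMC_CComon_coproduct:
  assumes Q: "traced_prop_cat Q" and F: "traced_prop_morphism (STMC \<Sigma>) Q F"
    and G: "prop_morphism CComon Q G"
  shows "traced_prop_morphism (STMC \<Sigma>) (STMC_CComon \<Sigma>) (STMC_inl \<Sigma>)"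
    and "prop_morphism CComon (STMC_CComon \<Sigma>) (CComon_inr \<Sigma>)"
    and "traced_prop_morphism (STMC_CComon \<Sigma>) Q (copairing \<Sigma> Q F G)"
    and "X \<in> hom (STMC \<Sigma>) m n \<Longrightarrow> copairing \<Sigma> Q F G (STMC_inl \<Sigma> X) = F X"
    and "Y \<in> hom CComon m n \<Longrightarrow> copairing \<Sigma> Q F G (CComon_inr \<Sigma> Y) = G Y"
    and "traced_prop_morphism (STMC_CComon \<Sigma>) Q H \<Longrightarrow>
         (\<And>m n X. X \<in> hom (STMC \<Sigma>) m n \<Longrightarrow> H (STMC_inl \<Sigma> X) = F X) \<Longrightarrow>
         (\<And>m n Y. Y \<in> hom CComon m n \<Longrightarrow> H (CComon_inr \<Sigma> Y) = G Y) \<Longrightarrow>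
         Z \<in> hom (STMC_CComon \<Sigma>) m n \<Longrightarrow> H Z = copairing \<Sigma> Q F G Z"
proof -
  let ?P = "free_presentation \<Sigma>" and ?S = "STMC_CComon_presentation \<Sigma>"
  let ?R = "STMC_CComon \<Sigma>"
  have Qc: "is_cat D Q" for D
    using Q by (simp add: is_cat_def traced_prop_cat_def)
  have Rc: "is_cat D ?R" for D
    using traced_prop_cat_presented[of ?S]
    by (simp add: is_cat_def STMC_CComon_def traced_prop_cat.axioms(1))
  have F': "is_morphism Traced ?P Q F" using F by (simp add: is_morphism_def STMC_def)
  have G': "is_morphism Sym_Mon comon_presentation Q G" using G by (simp add: is_morphism_def CComon_def)
  note mF = is_model_of_morphism[OF F'] and mG = is_model_of_morphism[OF G']
  let ?\<gamma> = "case_sum (\<lambda>g. F (term_class Traced ?P (Gen g)))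
               (\<lambda>c. G (term_class Sym_Mon comon_presentation (Gen c)))"
  have m: "is_model Traced ?S Q ?\<gamma>"
    using mF mG is_model_comon[of Traced Q _ Sym_Mon] by (simp add: is_model_sum)
  have cop: "copairing \<Sigma> Q F G = induced ?S Q ?\<gamma>" by (simp add: copairing_def)
  have ind: "induced \<Sigma> ?R = induced ?P ?R" by (auto simp: fun_eq_iff induced_def)
  have "is_morphism Traced ?S ?R (\<lambda>X. X)"
    by (simp add: is_morphism_def STMC_CComon_def traced_prop_morphism_def prop_morphism_def)
  from is_model_of_morphism[OF this]
  have mR: "is_model Traced ?P ?R (\<lambda>g. term_class Traced ?S (Gen (Inl g)))"
    "is_model Traced comon_presentation ?R (\<lambda>c. term_class Traced ?S (Gen (Inr c)))"
    by (simp_all add: is_model_sum)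
  have mR2: "is_model Sym_Mon comon_presentation ?R (\<lambda>c. term_class Traced ?S (Gen (Inr c)))"
    using mR(2) is_model_comon[of Sym_Mon ?R _ Traced] by simp
  have evR: "eval ?S ?R (\<lambda>g. term_class Traced ?S (Gen g)) t = term_class Traced ?S t"
    if "typed Traced ?S t m n" for t m n
    using eval_term_class_traced[OF that] by (simp add: STMC_CComon_def)
  have inl: "STMC_inl \<Sigma> (term_class Traced ?P t) = term_class Traced ?S (map_trm Inl t)"
    if "typed Traced ?P t m n" for t m n
    unfolding STMC_inl_def ind induced_class[OF Rc mR(1) that]
    using evR[of "map_trm Inl t"] that by simp
  have ty: "typed Traced comon_presentation t m n" if "typed Sym_Mon comon_presentation t m n" for t m n
  proof -
    have "well_formed Sym_Mon comon_presentation t \<Longrightarrow> well_formed Traced comon_presentation t" for t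
      by (induction t) auto
    then show ?thesis using that by (simp add: typed_def)
  qed
  have inr: "CComon_inr \<Sigma> (term_class Sym_Mon comon_presentation t) = term_class Traced ?S (map_trm Inr t)"
    if "typed Sym_Mon comon_presentation t m n" for t m n
    unfolding CComon_inr_def induced_class[OF Rc mR2 that]
    using evR[of "map_trm Inr t"] ty[OF that] by simp
  show "traced_prop_morphism (STMC \<Sigma>) ?R (STMC_inl \<Sigma>)"
    using is_morphism_induced[OF Rc mR(1)] by (simp add: STMC_inl_def ind is_morphism_def STMC_def)
  show "prop_morphism CComon ?R (CComon_inr \<Sigma>)"
    using is_morphism_induced[OF Rc mR2] by (simp add: CComon_inr_def is_morphism_def CComon_def)
  show "traced_prop_morphism ?R Q (copairing \<Sigma> Q F G)"
    using is_morphism_induced[OF Qc m] by (simp add: cop is_morphism_def STMC_CComon_def)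
  show "copairing \<Sigma> Q F G (STMC_inl \<Sigma> X) = F X" if X: "X \<in> hom (STMC \<Sigma>) m n" for X m n
  proof -
    obtain t where t: "typed Traced ?P t m n" "X = term_class Traced ?P t"
      using X unfolding STMC_def presented_traced_simps by (rule presented_homE)
    show ?thesis
      using induced_class[OF Qc m, of "map_trm Inl t"] is_morphism_eval[OF F' t(1)] t
      by (simp add: cop inl)
  qed
  show "copairing \<Sigma> Q F G (CComon_inr \<Sigma> Y) = G Y" if Y: "Y \<in> hom CComon m n" for Y m n
  proof -
    obtain t where t: "typed Sym_Mon comon_presentation t m n" "Y = term_class Sym_Mon comon_presentation t"
      using Y unfolding CComon_def by (rule presented_homE)
    show ?thesis
      using induced_class[OF Qc m, of "map_trm Inr t"] is_morphism_eval[OF G' t(1)] t ty[OF t(1)]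
      by (simp add: cop inr)
  qed
  show "H Z = copairing \<Sigma> Q F G Z"
    if H: "traced_prop_morphism ?R Q H"
      and HF: "\<And>m n X. X \<in> hom (STMC \<Sigma>) m n \<Longrightarrow> H (STMC_inl \<Sigma> X) = F X"
      and HG: "\<And>m n Y. Y \<in> hom CComon m n \<Longrightarrow> H (CComon_inr \<Sigma> Y) = G Y"
      and Z: "Z \<in> hom ?R m n" for H Z m n
    unfolding cop
  proof (rule induced_unique[OF _ Qc])
    show "is_morphism Traced ?S Q H" using H by (simp add: is_morphism_def STMC_CComon_def)
    show "Z \<in> hom (presented Traced ?S) m n" using Z by (simp add: STMC_CComon_def)
    fix g assume g: "g \<in> gens ?S"
    show "H (term_class Traced ?S (Gen g)) = ?\<gamma> g"
    proof (cases g)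
      case (Inl a)
      then have t: "typed Traced ?P (Gen a) (arity ?P a) (coarity ?P a)"
        using g by (auto simp: typed_def presentation_sum_def)
      show ?thesis
        using HF[unfolded STMC_def presented_traced_simps, OF presented_hom[OF t]] inl[OF t] Inl by simp
    next
      case (Inr c)
      then have t: "typed Sym_Mon comon_presentation (Gen c) (arity comon_presentation c) (coarity comon_presentation c)"
        using g by (auto simp: typed_def presentation_sum_def)
      show ?thesis
        using HG[unfolded CComon_def, OF presented_hom[OF t]] inr[OF t] Inr by simp
    qed
  qed
qed

end

theory Submission
  imports Defs "HOL-Library.Multiset"
begin

text \<open>
  Every arrow of \<open>STMC_CComon \<Sigma>\<close> has a normal form, a net: a list of boxes whose input and output wires
  carry names, closed by a single trace over all the outputs of boxes. Names are unique among the
  outputs of boxes and the left interface, so every input of a box and every wire of the right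
  interface is a copy of exactly one source, and a wiring of this kind is a function, which is what a
  commutative comonoid can realise. Nets are closed under composition, tensor and trace; a traced wire
  that is connected to itself leaves behind the box \<open>Tr\<^sup>1(copy) : 0 \<rightarrow> 1\<close>. Permuting the boxes and renaming the
  wires injectively does not change the value of a net.

  The interpretation of a net is the cospan whose vertices are the names and whose hyperedges are the
  boxes labelled by generators, the uniqueness of names being partial left-monogamy. Hence the image
  consists of the partial left-monogamous cospans, which therefore form a traced sub-PROP, and an
  isomorphism between the cospans of two nets amounts to a renaming of wires and a permutation of
  boxes, so the two nets denote the same arrow.
\<close>


subsection \<open>Whiskering and exchange in a PROP\<close>

text \<open>Generators are not comonoid homomorphisms, so a box can be neither duplicated nor
  dropped; only the wiring between boxes can be simplified freely. Feeding all outputs back through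
  one trace separates the two: the boxes form a plain tensor product, and the rest is one function
  between lists of names. No order along the data flow is required, so cycles cause no trouble.
  Closure under composition is not shown by gluing: \<open>f\<close> followed by \<open>g\<close> is
  the trace of a crossing followed by the tensor of \<open>f\<close> and \<open>g\<close>. Closure
  under trace is reduced to one wire, which either merges two names or is a loop.

  On the side of cospans the obstacle is that composites are isomorphism classes of pushouts, known
  only by a universal property, and the canonical trace stacks two of them. Quotients are therefore
  delayed: a class is given by a cospan and a relation on its vertices that is still to be
  collapsed. Closure of the image under the operations is not checked on in-degrees; it is inherited
  from the free side.\<close>

context prop_cat
begin

text \<open>Domain and codomain as total functions turn the typing premises of the PROP axioms into
  side conditions that rewriting can decide; on non-arrows \<open>dm\<close> and \<open>cd\<close>
  are arbitrary.\<close>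

definition ar :: "'a \<Rightarrow> bool" where "ar f \<longleftrightarrow> (\<exists>m n. f \<in> hom P m n)"
definition dm :: "'a \<Rightarrow> nat" where "dm f = (THE m. \<exists>n. f \<in> hom P m n)"
definition cd :: "'a \<Rightarrow> nat" where "cd f = (THE n. \<exists>m. f \<in> hom P m n)"

lemma hom_iff: "f \<in> hom P m n \<longleftrightarrow> ar f \<and> dm f = m \<and> cd f = n"
proof -
  have "dm f = m \<and> cd f = n" if "f \<in> hom P m n" for m n
    using that unfolding dm_def cd_def by (blast intro: the_equality dest: hom_disjoint)
  then show ?thesis unfolding ar_def by blast
qed

lemma ident_ar [simp]: "ar (ident P n)" "dm (ident P n) = n" "cd (ident P n) = n"
  using ident_hom[of n] by (simp_all add: hom_iff)

lemma swap_ar [simp]: "ar (swap P m n)" "dm (swap P m n) = m + n" "cd (swap P m n) = n + m"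
  using swap_hom[of m n] by (simp_all add: hom_iff)

lemma comp_ar [simp]:
  assumes "ar f" "ar g" "cd f = dm g"
  shows "ar (f \<Zcomp> g)" "dm (f \<Zcomp> g) = dm f" "cd (f \<Zcomp> g) = cd g"
  using compose_hom[of f "dm f" "cd f" g "cd g"] assms by (simp_all add: hom_iff)

lemma tens_ar [simp]:
  assumes "ar f" "ar g"
  shows "ar (f \<otimes> g)" "dm (f \<otimes> g) = dm f + dm g" "cd (f \<otimes> g) = cd f + cd g"
  using tensor_hom[of f "dm f" "cd f" g "dm g" "cd g"] assms by (simp_all add: hom_iff)

lemma ident_comp [simp]: "ar f \<Longrightarrow> dm f = m \<Longrightarrow> ident P m \<Zcomp> f = f"
  using ident_compose[of f m "cd f"] by (simp add: hom_iff)

lemma comp_ident [simp]: "ar f \<Longrightarrow> cd f = m \<Longrightarrow> f \<Zcomp> ident P m = f"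
  using compose_ident[of f "dm f" m] by (simp add: hom_iff)

lemma comp_assoc [simp]:
  "ar f \<Longrightarrow> ar g \<Longrightarrow> ar h \<Longrightarrow> cd f = dm g \<Longrightarrow> cd g = dm h \<Longrightarrow> (f \<Zcomp> g) \<Zcomp> h = f \<Zcomp> (g \<Zcomp> h)"
  using compose_assoc[of f "dm f" "cd f" g "cd g" h "cd h"] by (simp add: hom_iff)

lemma tens_ident [simp]: "ident P m \<otimes> ident P n = ident P (m + n)"
  by (rule tensor_ident)

lemma ichange:
  "ar f \<Longrightarrow> ar g \<Longrightarrow> ar f' \<Longrightarrow> ar g' \<Longrightarrow> cd f = dm g \<Longrightarrow> cd f' = dm g' \<Longrightarrow>
   (f \<otimes> f') \<Zcomp> (g \<otimes> g') = (f \<Zcomp> g) \<otimes> (f' \<Zcomp> g')"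
  using interchange[of f "dm f" "cd f" g "cd g" f' "dm f'" "cd f'" g' "cd g'"] by (simp add: hom_iff)

lemma tens_assoc [simp]: "ar f \<Longrightarrow> ar g \<Longrightarrow> ar h \<Longrightarrow> (f \<otimes> g) \<otimes> h = f \<otimes> (g \<otimes> h)"
  using tensor_assoc[of f "dm f" "cd f" g "dm g" "cd g" h "dm h" "cd h"] by (simp add: hom_iff)

lemma tens_unit [simp]: "ar f \<Longrightarrow> ident P 0 \<otimes> f = f" "ar f \<Longrightarrow> f \<otimes> ident P 0 = f"
  using unit_tensor[of f "dm f" "cd f"] tensor_unit[of f "dm f" "cd f"] by (simp_all add: hom_iff)

lemma swap_nat:
  "ar f \<Longrightarrow> ar g \<Longrightarrow> n = cd f \<Longrightarrow> q = cd g \<Longrightarrow> (f \<otimes> g) \<Zcomp> swap P n q = swap P (dm f) (dm g) \<Zcomp> (g \<otimes> f)"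
  using swap_natural[of f "dm f" "cd f" g "dm g" "cd g"] by (simp add: hom_iff)

lemma swap_inv [simp]: "swap P m n \<Zcomp> swap P n m = ident P (m + n)"
  by (rule swap_swap)

text \<open>Whiskering. Diagrams are written as composites of layers, each a single arrow with
  \<open>k\<close> identity wires before it and \<open>l\<close> after it; \<open>w_w\<close> and
  \<open>w_comp\<close> normalise layers, and interchange takes the form
  \<open>exch\<close>.\<close>

definition w :: "nat \<Rightarrow> 'a \<Rightarrow> nat \<Rightarrow> 'a" where
  "w k f l = ident P k \<otimes> (f \<otimes> ident P l)"

lemma w_ar [simp]:
  assumes "ar f"
  shows "ar (w k f l)" "dm (w k f l) = k + dm f + l" "cd (w k f l) = k + cd f + l"
  using assms by (simp_all add: w_def)

lemma w_00 [simp]: "ar f \<Longrightarrow> w 0 f 0 = f"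
  by (simp add: w_def)

lemma w_w [simp]: "ar f \<Longrightarrow> w k (w k' f l') l = w (k + k') f (l' + l)"
  by (simp add: w_def flip: tens_ident)

lemma w_ident [simp]: "w k (ident P n) l = ident P (k + n + l)"
  by (simp add: w_def add.assoc)

lemma w_comp: "ar f \<Longrightarrow> ar g \<Longrightarrow> cd f = dm g \<Longrightarrow> w k (f \<Zcomp> g) l = w k f l \<Zcomp> w k g l"
  by (simp add: w_def ichange)

lemma w_comp_assoc:
  assumes "ar f" "ar g" "ar r" "cd f = dm g" "dm r = k + cd g + l"
  shows "w k f l \<Zcomp> (w k g l \<Zcomp> r) = w k (f \<Zcomp> g) l \<Zcomp> r"
  using assms by (simp add: w_comp)

lemmas w_fold = w_comp[symmetric] w_comp_assoc

lemma tens_w1: "ar f \<Longrightarrow> ar g \<Longrightarrow> f \<otimes> g = w 0 f (dm g) \<Zcomp> w (cd f) g 0"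
  by (simp add: w_def ichange)

lemma tens_w2: "ar f \<Longrightarrow> ar g \<Longrightarrow> f \<otimes> g = w (dm f) g 0 \<Zcomp> w 0 f (cd g)"
  by (simp add: w_def ichange)

lemma ident_tens: "ar f \<Longrightarrow> ident P k \<otimes> f = w k f 0"
  by (simp add: w_def)

lemma tens_ident_w: "ar f \<Longrightarrow> f \<otimes> ident P k = w 0 f k"
  by (simp add: w_def)

text \<open>Both orders are the tensor product of \<open>f\<close> with \<open>g\<close> and the
  \<open>j\<close> wires that separate them; the two ways to cut a tensor product into layers give
  the two sides.\<close>

lemma exch:
  assumes "ar f" "ar g" "k' = k + cd f + j" "l = j + dm g + l'"
  shows "w k f l \<Zcomp> w k' g l' = w (k + dm f + j) g l' \<Zcomp> w k f (j + cd g + l')"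
proof -
  have "w k f l \<Zcomp> w k' g l' = w k (w 0 f (j + dm g) \<Zcomp> w (cd f) (w j g 0) 0) l'"
    using assms by (simp add: w_comp add.assoc)
  also have "\<dots> = w k (f \<otimes> w j g 0) l'"
    using assms(1,2) by (subst tens_w1) simp_all
  also have "\<dots> = w k (w (dm f) (w j g 0) 0 \<Zcomp> w 0 f (j + cd g)) l'"
    using assms(1,2) by (subst tens_w2) simp_all
  also have "\<dots> = w (k + dm f + j) g l' \<Zcomp> w k f (j + cd g + l')"
    using assms by (simp add: w_comp add.assoc)
  finally show ?thesis .
qed

text \<open>Composites are kept nested to the right, where \<open>a \<Zcomp> b\<close> is no longer
  a subterm; this applies an equation at the head of a longer composite.\<close>

lemma assocL:
  assumes "a \<Zcomp> b = c" "ar a" "ar b" "ar r" "cd a = dm b" "cd b = dm r"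
  shows "a \<Zcomp> (b \<Zcomp> r) = c \<Zcomp> r"
  using comp_assoc[OF assms(2-6)] assms(1) by simp

section \<open>Crossings of bundles of wires\<close>

lemma swap_0 [simp]: "swap P m 0 = ident P m" "swap P 0 m = ident P m"
proof -
  \<comment> \<open>The hexagon with two empty bundles makes \<open>swap P m 0\<close> idempotent;
    being invertible, it is the identity.\<close>
  have e: "swap P m 0 \<Zcomp> swap P m 0 = swap P m 0"
    using hexagon[of m 0 0] by simp
  have "swap P m 0 = (swap P m 0 \<Zcomp> swap P m 0) \<Zcomp> swap P 0 m"
    by (subst comp_assoc) simp_all
  then show *: "swap P m 0 = ident P m" by (simp only: e swap_inv) simp
  show "swap P 0 m = ident P m"
    using swap_inv[of m 0] * by simp
qed

lemma swap_addR: "swap P m (n + p) = w 0 (swap P m n) p \<Zcomp> w n (swap P m p) 0"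
  using hexagon[of m n p] by (simp add: tens_ident_w ident_tens)

text \<open>Only one hexagon is an axiom. The other is its inverse: the right-hand side composes
  with \<open>swap P p (m + n)\<close> to an identity.\<close>

lemma swap_addL: "swap P (m + n) p = w m (swap P n p) 0 \<Zcomp> w 0 (swap P m p) n"
proof -
  let ?r = "w m (swap P n p) 0 \<Zcomp> w 0 (swap P m p) n"
  have "swap P p (m + n) \<Zcomp> ?r = ident P (p + m + n)"
    by (simp add: swap_addR w_fold add_ac)
  then have "swap P (m + n) p \<Zcomp> (swap P p (m + n) \<Zcomp> ?r) = swap P (m + n) p"
    by (simp add: ac_simps)
  then show ?thesis
    by (subst (asm) comp_assoc[symmetric]) (simp_all add: ac_simps)
qed

lemma slideL: "ar f \<Longrightarrow> w 0 f y \<Zcomp> swap P (cd f) y = swap P (dm f) y \<Zcomp> w y f 0"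
  using swap_nat[of f "ident P y"] by (simp add: tens_ident_w ident_tens)

lemma slideR: "ar f \<Longrightarrow> w y f 0 \<Zcomp> swap P y (cd f) = swap P y (dm f) \<Zcomp> w 0 f y"
  using swap_nat[of "ident P y" f] by (simp add: tens_ident_w ident_tens)

lemma exch_assoc:
  assumes "ar f" "ar g" "ar r" "k' = k + cd f + j" "l = j + dm g + l'" "dm r = k + cd f + j + cd g + l'"
  shows "w k f l \<Zcomp> (w k' g l' \<Zcomp> r) = w (k + dm f + j) g l' \<Zcomp> (w k f (j + cd g + l') \<Zcomp> r)"
proof -
  have "w k f l \<Zcomp> (w k' g l' \<Zcomp> r) = (w k f l \<Zcomp> w k' g l') \<Zcomp> r"
    using assms by simp
  also have "\<dots> = (w (k + dm f + j) g l' \<Zcomp> w k f (j + cd g + l')) \<Zcomp> r"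
    by (subst exch[OF assms(1,2,4,5)]) simp
  finally show ?thesis using assms by simp
qed

lemma comp_tens:
  assumes "ar f" "ar g" "ar h" "cd f = dm g"
  shows "(f \<Zcomp> g) \<otimes> h = (f \<otimes> h) \<Zcomp> w 0 g (cd h)" "h \<otimes> (f \<Zcomp> g) = (h \<otimes> f) \<Zcomp> w (cd h) g 0"
  using ichange[of f g h "ident P (cd h)"] ichange[of h "ident P (cd h)" f g] assms
  by (simp_all add: tens_ident_w ident_tens)

lemma comp_tens':
  assumes "ar f" "ar g" "ar h" "cd f = dm g"
  shows "(f \<Zcomp> g) \<otimes> h = w 0 f (dm h) \<Zcomp> (g \<otimes> h)" "h \<otimes> (f \<Zcomp> g) = w (dm h) f 0 \<Zcomp> (h \<otimes> g)"
  using ichange[of f g "ident P (dm h)" h] ichange[of "ident P (dm h)" h f g] assms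
  by (simp_all add: tens_ident_w ident_tens)

text \<open>The crossing of two bundles \<open>x + y\<close> consists of four crossings of parts,
  and the first of these is inverse to the given middle crossing.\<close>

lemma swap_interleave:
  "w x (swap P x y) y \<Zcomp> swap P (x + y) (x + y) =
   w 0 (swap P x x) (y + y) \<Zcomp> (w (x + x) (swap P y y) 0 \<Zcomp> w x (swap P x y) y)"
proof -
  have "swap P (x + y) (x + y) = w x (swap P y x) y \<Zcomp> (w 0 (swap P x x) (y + y) \<Zcomp>
      (w (x + x) (swap P y y) 0 \<Zcomp> w x (swap P x y) y))"
    by (subst swap_addR) (simp add: swap_addL w_comp add_ac)
  then show ?thesis
    by (simp add: w_fold add_ac)
qed

lemma swap_interleave':
  "swap P (x + y) (x + y) \<Zcomp> w x (swap P y x) y =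
   w x (swap P y x) y \<Zcomp> (w 0 (swap P x x) (y + y) \<Zcomp> w (x + x) (swap P y y) 0)"
proof -
  have "swap P (x + y) (x + y) = w x (swap P y x) y \<Zcomp> (w 0 (swap P x x) (y + y) \<Zcomp>
      (w (x + x) (swap P y y) 0 \<Zcomp> w x (swap P x y) y))"
    by (subst swap_addR) (simp add: swap_addL w_comp add_ac)
  then show ?thesis
    by (simp add: w_fold add_ac)
qed

text \<open>The recursion for \<open>C\<close> is the one that \<^const>\<open>copy_power\<close> and \<^const>\<open>cup\<close> satisfy; the dual one belongs to \<^const>\<open>cap\<close>.\<close>

lemma interleave_add:
  assumes C: "C 0 = ident P 0" "\<And>n. ar (C n)" "\<And>n. cd (C n) = n + n"
    and S: "\<And>n. C (Suc n) = (C 1 \<otimes> C n) \<Zcomp> w 1 (swap P 1 n) n"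
  shows "C (p + q) = (C p \<otimes> C q) \<Zcomp> w p (swap P p q) q"
proof (induction p)
  case 0
  show ?case by (simp add: C w_def)
next
  case (Suc p)
  have "C (Suc p + q) = ((C 1 \<otimes> (C p \<otimes> C q)) \<Zcomp> w (1 + 1) (w p (swap P p q) q) 0) \<Zcomp> w 1 (swap P 1 (p + q)) (p + q)"
    by (simp add: S[of "p + q"] Suc comp_tens C)
  also have "\<dots> = (C 1 \<otimes> (C p \<otimes> C q)) \<Zcomp> (w (2 + p) (swap P p q) q \<Zcomp>
      (w 1 (swap P 1 p) (q + p + q) \<Zcomp> w (1 + p) (swap P 1 q) (p + q)))"
    by (simp add: C w_comp swap_addR add_ac)
  also have "w (2 + p) (swap P p q) q \<Zcomp> (w 1 (swap P 1 p) (q + p + q) \<Zcomp> w (1 + p) (swap P 1 q) (p + q))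
     = w 1 (swap P 1 p) (p + q + q) \<Zcomp> (w (2 + p) (swap P p q) q \<Zcomp> w (1 + p) (swap P 1 q) (p + q))"
    by (subst (2) exch_assoc[where j = 0]) (simp_all add: add_ac)
  also have "(C 1 \<otimes> (C p \<otimes> C q)) \<Zcomp> \<dots> = (C (Suc p) \<otimes> C q) \<Zcomp> w (Suc p) (swap P (Suc p) q) q"
    by (simp add: S[of p] C comp_tens w_comp swap_addL[of 1 p q, simplified] add_ac)
  finally show ?case .
qed

lemma interleave_add':
  assumes C: "C 0 = ident P 0" "\<And>n. ar (C n)" "\<And>n. dm (C n) = n + n"
    and S: "\<And>n. C (Suc n) = w 1 (swap P n 1) n \<Zcomp> (C 1 \<otimes> C n)"
  shows "C (p + q) = w p (swap P q p) q \<Zcomp> (C p \<otimes> C q)"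
proof (induction p)
  case 0
  show ?case by (simp add: C w_def)
next
  case (Suc p)
  have "C (Suc p + q) = w 1 (swap P (p + q) 1) (p + q) \<Zcomp> (w (1 + 1) (w p (swap P q p) q) 0 \<Zcomp> (C 1 \<otimes> (C p \<otimes> C q)))"
    by (simp add: S[of "p + q"] Suc comp_tens' C)
  also have "\<dots> = w (1 + p) (swap P q 1) (p + q) \<Zcomp> ((w 1 (swap P p 1) (q + p + q) \<Zcomp>
      w (2 + p) (swap P q p) q) \<Zcomp> (C 1 \<otimes> (C p \<otimes> C q)))"
    by (simp add: C w_comp swap_addL add_ac)
  also have "w 1 (swap P p 1) (q + p + q) \<Zcomp> w (2 + p) (swap P q p) q
     = w (2 + p) (swap P q p) q \<Zcomp> w 1 (swap P p 1) (p + q + q)"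
    by (subst exch[where j = 0]) (simp_all add: add_ac)
  also have "w (1 + p) (swap P q 1) (p + q) \<Zcomp> ((w (2 + p) (swap P q p) q \<Zcomp> w 1 (swap P p 1) (p + q + q)) \<Zcomp> (C 1 \<otimes> (C p \<otimes> C q)))
     = w (Suc p) (swap P q (Suc p)) q \<Zcomp> (C (Suc p) \<otimes> C q)"
    by (simp add: S[of p] C comp_tens' w_comp swap_addR[of q 1 p, simplified] add_ac)
  finally show ?case .
qed

end

subsection \<open>The canonical trace of a compact closed PROP\<close>

text \<open>Self-dual compact structure with laws for one wire only and a recursion that interleaves
  wires; symmetry and the zigzag for all bundles follow by induction, and the second zigzag follows
  from the first by symmetry.\<close>

locale compact_prop = prop_cat P
  for P :: "('a, 'm) prop_data_scheme" (structure) +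
  fixes cu ca :: "nat \<Rightarrow> 'a"
  assumes cu_hom: "cu x \<in> hom P 0 (x + x)" and ca_hom: "ca x \<in> hom P (x + x) 0"
    and cu_0: "cu 0 = ident P 0" and ca_0: "ca 0 = ident P 0"
    and cu_Suc: "cu (Suc n) = (cu 1 \<otimes> cu n) \<Zcomp> (ident P 1 \<otimes> swap P 1 n \<otimes> ident P n)"
    and ca_Suc: "ca (Suc n) = (ident P 1 \<otimes> swap P n 1 \<otimes> ident P n) \<Zcomp> (ca 1 \<otimes> ca n)"
    and cu_sym1: "cu 1 \<Zcomp> swap P 1 1 = cu 1"
    and ca_sym1: "swap P 1 1 \<Zcomp> ca 1 = ca 1"
    and snake1: "(cu 1 \<otimes> ident P 1) \<Zcomp> (ident P 1 \<otimes> ca 1) = ident P 1"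
begin

lemma cu_ar [simp]: "ar (cu x)" "dm (cu x) = 0" "cd (cu x) = x + x"
  using cu_hom[of x] by (simp_all add: hom_iff)

lemma ca_ar [simp]: "ar (ca x)" "dm (ca x) = x + x" "cd (ca x) = 0"
  using ca_hom[of x] by (simp_all add: hom_iff)

lemma cu_Suc': "cu (Suc n) = (cu 1 \<otimes> cu n) \<Zcomp> w 1 (swap P 1 n) n"
  by (subst cu_Suc) (simp add: w_def)

lemma ca_Suc': "ca (Suc n) = w 1 (swap P n 1) n \<Zcomp> (ca 1 \<otimes> ca n)"
  by (subst ca_Suc) (simp add: w_def)

lemma cu_add: "cu (p + q) = (cu p \<otimes> cu q) \<Zcomp> w p (swap P p q) q"
  by (rule interleave_add[OF cu_0 _ _ cu_Suc']) simp_all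

lemma ca_add: "ca (p + q) = w p (swap P q p) q \<Zcomp> (ca p \<otimes> ca q)"
  by (rule interleave_add'[OF ca_0 _ _ ca_Suc']) simp_all

text \<open>The cup is an arrow out of 0, so \<open>y\<close> wires pass across it freely; undoing
  their crossing with one of its legs leaves the crossing with the other.\<close>

lemma cu_slide: "w 0 (cu x) y \<Zcomp> w x (swap P x y) 0 = w y (cu x) 0 \<Zcomp> w 0 (swap P y x) x"
proof -
  have "w 0 (cu x) y \<Zcomp> swap P (x + x) y = w y (cu x) 0"
    using slideL[of "cu x" y] by simp
  then have "(w 0 (cu x) y \<Zcomp> swap P (x + x) y) \<Zcomp> w 0 (swap P y x) x = w y (cu x) 0 \<Zcomp> w 0 (swap P y x) x"
    by simp
  then show ?thesis by (simp add: swap_addL w_fold add_ac)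
qed

lemma ca_slide: "w x (swap P y x) 0 \<Zcomp> w 0 (ca x) y = w 0 (swap P x y) x \<Zcomp> w y (ca x) 0"
proof -
  have "swap P (x + x) y \<Zcomp> w y (ca x) 0 = w 0 (ca x) y"
    using slideL[of "ca x" y] by simp
  then have "w x (swap P y x) 0 \<Zcomp> (swap P (x + x) y \<Zcomp> w y (ca x) 0) = w x (swap P y x) 0 \<Zcomp> w 0 (ca x) y"
    by simp
  then show ?thesis by (simp add: swap_addL w_fold add_ac)
qed

lemma cu_sym: "cu x \<Zcomp> swap P x x = cu x"
proof (induction x)
  case (Suc n)
  have "cu (1 + n) \<Zcomp> swap P (1 + n) (1 + n) =
     (w 0 (cu 1) 0 \<Zcomp> w (1 + 1) (cu n) 0) \<Zcomp> (w 1 (swap P 1 n) n \<Zcomp> swap P (1 + n) (1 + n))"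
    by (subst cu_add) (simp add: tens_w1)
  also have "\<dots> = w 0 (cu 1) 0 \<Zcomp> (w (1 + 1) (cu n) 0 \<Zcomp> (w 0 (swap P 1 1) (n + n) \<Zcomp> (w (1 + 1) (swap P n n) 0 \<Zcomp> w 1 (swap P 1 n) n)))"
    by (subst swap_interleave) simp
  also have "w (1 + 1) (cu n) 0 \<Zcomp> (w 0 (swap P 1 1) (n + n) \<Zcomp> (w (1 + 1) (swap P n n) 0 \<Zcomp> w 1 (swap P 1 n) n))
     = w 0 (swap P 1 1) 0 \<Zcomp> (w (1 + 1) (cu n) 0 \<Zcomp> (w (1 + 1) (swap P n n) 0 \<Zcomp> w 1 (swap P 1 n) n))"
    using exch_assoc[of "swap P 1 1" "cu n" "w (1 + 1) (swap P n n) 0 \<Zcomp> w 1 (swap P 1 n) n" "1 + 1" 0 0 0 0]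
    by simp
  also have "w 0 (cu 1) 0 \<Zcomp> \<dots> = (w 0 (cu 1) 0 \<Zcomp> w (1 + 1) (cu n) 0) \<Zcomp> w 1 (swap P 1 n) n"
    using cu_sym1 Suc by (simp add: w_fold assocL[OF cu_sym1[simplified]])
  also have "\<dots> = cu (1 + n)"
    by (subst cu_add) (simp add: tens_w1)
  finally show ?case by simp
qed (simp add: cu_0)

lemma ca_sym: "swap P x x \<Zcomp> ca x = ca x"
proof (induction x)
  case (Suc n)
  have "swap P (1 + n) (1 + n) \<Zcomp> ca (1 + n) =
     (swap P (1 + n) (1 + n) \<Zcomp> w 1 (swap P n 1) n) \<Zcomp> (w (1 + 1) (ca n) 0 \<Zcomp> w 0 (ca 1) 0)"
    by (subst ca_add) (simp add: tens_w2)
  also have "\<dots> = w 1 (swap P n 1) n \<Zcomp> (w 0 (swap P 1 1) (n + n) \<Zcomp> (w (1 + 1) (swap P n n) 0 \<Zcomp> (w (1 + 1) (ca n) 0 \<Zcomp> w 0 (ca 1) 0)))"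
    by (subst swap_interleave') simp
  also have "w 0 (swap P 1 1) (n + n) \<Zcomp> (w (1 + 1) (swap P n n) 0 \<Zcomp> (w (1 + 1) (ca n) 0 \<Zcomp> w 0 (ca 1) 0))
     = w (1 + 1) (ca n) 0 \<Zcomp> ca 1"
    using ca_sym1 Suc by (simp add: w_fold) (subst exch_assoc[where j = 0], simp_all)
  finally show ?case
    using ca_add[of 1 n] by (simp add: tens_w2)
qed (simp add: ca_0)

text \<open>Induction with a single wire on the outside. The crossings that interleave its cup and
  cap with those of the remaining wires must be cleared before the two zigzags can be straightened
  separately.\<close>

lemma snake: "w 0 (cu x) x \<Zcomp> w x (ca x) 0 = ident P x"
proof (induction x)
  case 0
  then show ?case by (simp add: cu_0 ca_0)
next
  case (Suc y)
  let ?x = "1::nat"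
  have 1: "w 0 (cu ?x) ?x \<Zcomp> w ?x (ca ?x) 0 = ident P ?x"
    using snake1 by (simp add: tens_ident_w ident_tens)
  \<comment> \<open>\<open>ca_slide\<close> moves the cap of the single wire across the
    \<open>y\<close> wires, so that the two crossings become one crossing with the whole bundle
    \<open>y + y\<close>. These wires are the two legs of \<open>cu y\<close>, which passes the
    crossing by naturality.\<close>
  have slide: "w ?x (swap P ?x y) (y + ?x + y) \<Zcomp> (w (?x + y + ?x) (swap P y ?x) y \<Zcomp> w (?x + y) (ca ?x) (y + y))
      = w (?x + ?x) (swap P (y + y) ?x) y \<Zcomp> w ?x (ca ?x) (y + y + y)"
  proof -
    have "w ?x (swap P ?x y) (y + ?x + y) \<Zcomp> (w (?x + y + ?x) (swap P y ?x) y \<Zcomp> w (?x + y) (ca ?x) (y + y))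
      = w ?x (w 0 (swap P ?x y) (y + ?x) \<Zcomp> w y (w ?x (swap P y ?x) 0 \<Zcomp> w 0 (ca ?x) y) 0) y"
      by (simp add: w_comp add_ac)
    also have "\<dots> = w ?x (w 0 (swap P ?x y) (y + ?x) \<Zcomp> (w y (swap P ?x y) ?x \<Zcomp> w (y + y) (ca ?x) 0)) y"
      unfolding ca_slide by (simp add: w_comp add_ac)
    also have "\<dots> = w ?x (w 0 (swap P ?x (y + y)) ?x \<Zcomp> w (y + y) (ca ?x) 0) y"
      by (simp add: swap_addR w_comp add_ac)
    also have "\<dots> = w ?x (w ?x (swap P (y + y) ?x) 0 \<Zcomp> w 0 (ca ?x) (y + y)) y"
      unfolding ca_slide ..
    finally show ?thesis by (simp add: w_comp add_ac)
  qed
  have "w 0 (cu (?x + y)) (?x + y) \<Zcomp> w (?x + y) (ca (?x + y)) 0 =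
    w 0 (cu ?x) (?x + y) \<Zcomp> (w (?x + ?x) (cu y) (?x + y) \<Zcomp> ((w ?x (swap P ?x y) (y + ?x + y) \<Zcomp>
     (w (?x + y + ?x) (swap P y ?x) y \<Zcomp> w (?x + y) (ca ?x) (y + y))) \<Zcomp> w (?x + y) (ca y) 0))"
    by (simp only: cu_add ca_add) (simp add: tens_w1 w_comp add_ac)
  also have "\<dots> = w 0 (cu ?x) (?x + y) \<Zcomp> (w (?x + ?x) (w 0 (cu y) ?x \<Zcomp> swap P (y + y) ?x) y \<Zcomp> (w ?x (ca ?x) (y + y + y) \<Zcomp> w (?x + y) (ca y) 0))"
    unfolding slide by (simp add: w_comp add_ac)
  also have "w 0 (cu y) ?x \<Zcomp> swap P (y + y) ?x = w ?x (cu y) 0"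
    using slideL[of "cu y" ?x] by simp
  also have "w 0 (cu ?x) (?x + y) \<Zcomp> (w (?x + ?x) (w ?x (cu y) 0) y \<Zcomp> (w ?x (ca ?x) (y + y + y) \<Zcomp> w (?x + y) (ca y) 0))
    = w 0 (cu ?x) (?x + y) \<Zcomp> ((w (?x + ?x + ?x) (cu y) y \<Zcomp> w ?x (ca ?x) (y + y + y)) \<Zcomp> w (?x + y) (ca y) 0)"
    by (simp add: add_ac)
  also have "w (?x + ?x + ?x) (cu y) y \<Zcomp> w ?x (ca ?x) (y + y + y) = w ?x (ca ?x) y \<Zcomp> w ?x (cu y) y"
    by (subst exch[of "ca ?x" "cu y" _ _ 0 _ y]) (simp_all add: add_ac)
  also have "w 0 (cu ?x) (?x + y) \<Zcomp> ((w ?x (ca ?x) y \<Zcomp> w ?x (cu y) y) \<Zcomp> w (?x + y) (ca y) 0)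
     = w 0 (w 0 (cu ?x) ?x \<Zcomp> w ?x (ca ?x) 0) y \<Zcomp> w ?x (w 0 (cu y) y \<Zcomp> w y (ca y) 0) 0"
    by (simp add: w_comp add_ac)
  finally show ?case unfolding 1 Suc by simp
qed

text \<open>Symmetry of cup and cap turns one zigzag into the other.\<close>

lemma snake': "w x (cu x) 0 \<Zcomp> w 0 (ca x) x = ident P x"
proof -
  have "w x (cu x) 0 \<Zcomp> w 0 (ca x) x = w x (cu x \<Zcomp> swap P x x) 0 \<Zcomp> w 0 (ca x) x"
    by (simp only: cu_sym)
  also have "\<dots> = w x (cu x) 0 \<Zcomp> (w x (swap P x x) 0 \<Zcomp> w 0 (ca x) x)"
    by (simp add: w_comp)
  also have "\<dots> = (w x (cu x) 0 \<Zcomp> w 0 (swap P x x) x) \<Zcomp> w x (ca x) 0"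
    unfolding ca_slide by simp
  also have "\<dots> = w 0 (cu x) x \<Zcomp> w x (swap P x x \<Zcomp> ca x) 0"
    unfolding cu_slide[symmetric] by (simp add: w_comp)
  finally show ?thesis by (simp add: ca_sym snake)
qed

text \<open>Vanishing takes the trace over \<open>x\<close> inside the one over \<open>y\<close>, so
  the \<open>x\<close> part of the cup has to be nested in the \<open>y\<close> part instead of
  interleaved with it.\<close>

lemma cu_nest: "cu (x + y) = cu y \<Zcomp> (w y (cu x) y \<Zcomp> w 0 (swap P y x) (x + y))"
proof -
  have "cu (x + y) = cu y \<Zcomp> w 0 (w 0 (cu x) y \<Zcomp> w x (swap P x y) 0) y"
    by (simp add: cu_add tens_w2 w_comp add_ac)
  then show ?thesis unfolding cu_slide by (simp add: w_comp add_ac)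
qed

lemma ca_nest: "ca (x + y) = w 0 (swap P x y) (x + y) \<Zcomp> (w y (ca x) y \<Zcomp> ca y)"
proof -
  have "ca (x + y) = w 0 (w x (swap P y x) 0 \<Zcomp> w 0 (ca x) y) y \<Zcomp> ca y"
    by (simp add: ca_add tens_w1 w_comp add_ac)
  then show ?thesis unfolding ca_slide by (simp add: w_comp add_ac)
qed

text \<open>The transpose of \<open>f\<close>: both ends are bent round, one by a cup and one by a
  cap.\<close>

definition dual :: "'a \<Rightarrow> 'a" where
  "dual f = w 0 (cu (dm f)) (cd f) \<Zcomp> (w (dm f) f (cd f) \<Zcomp> w (dm f) (ca (cd f)) 0)"

lemma dual_ar [simp]: "ar f \<Longrightarrow> ar (dual f)" "ar f \<Longrightarrow> dm (dual f) = cd f" "ar f \<Longrightarrow> cd (dual f) = dm f"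
  by (simp_all add: dual_def)

text \<open>The cap inside \<open>dual f\<close> meets \<open>cu y\<close>, and this zigzag on
  \<open>y\<close> straightens.\<close>

lemma cu_dual:
  assumes "ar f" "dm f = x" "cd f = y"
  shows "cu y \<Zcomp> w 0 (dual f) y = cu x \<Zcomp> w x f 0"
proof -
  have "cu y \<Zcomp> w 0 (dual f) y = cu y \<Zcomp> (w 0 (cu x) (y + y) \<Zcomp> (w x f (y + y) \<Zcomp> w x (ca y) y))"
    using assms by (simp add: dual_def w_comp add_ac)
  also have "\<dots> = cu x \<Zcomp> ((w (x + x) (cu y) 0 \<Zcomp> w x f (y + y)) \<Zcomp> w x (ca y) y)"
    using assms exch_assoc[of "cu x" "cu y" "w x f (y + y) \<Zcomp> w x (ca y) y" "x + x" 0 0 0 0] by simp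
  also have "w (x + x) (cu y) 0 \<Zcomp> w x f (y + y) = w x f 0 \<Zcomp> w (x + y) (cu y) 0"
    using assms by (subst exch[of f "cu y" _ _ 0 _ 0]) (simp_all add: add_ac)
  also have "cu x \<Zcomp> ((w x f 0 \<Zcomp> w (x + y) (cu y) 0) \<Zcomp> w x (ca y) y) = cu x \<Zcomp> (w x f 0 \<Zcomp> w x (w y (cu y) 0 \<Zcomp> w 0 (ca y) y) 0)"
    using assms by (simp add: w_comp add_ac)
  finally show ?thesis using assms by (simp add: snake')
qed

text \<open>The bending here is to the other side than in the definition of \<open>dual\<close>, so
  the symmetry of cap and cup turns \<open>dual f\<close> round before the zigzag on
  \<open>x\<close> straightens.\<close>

lemma dual_ca:
  assumes "ar f" "dm f = x" "cd f = y"
  shows "w 0 (dual f) x \<Zcomp> ca x = w y f 0 \<Zcomp> ca y"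
proof -
  define g where "g = w y f 0 \<Zcomp> ca y"
  have g: "ar g" "dm g = y + x" "cd g = 0" using assms by (simp_all add: g_def)
  have "dual f = w 0 (cu x) y \<Zcomp> w x (w 0 f y \<Zcomp> ca y) 0"
    using assms by (simp add: dual_def w_comp)
  also have "w 0 f y \<Zcomp> ca y = w 0 f y \<Zcomp> (swap P y y \<Zcomp> ca y)" by (simp add: ca_sym)
  also have "\<dots> = swap P x y \<Zcomp> g"
    using slideL[of f y] assms by (simp add: g_def flip: comp_assoc)
  also have "w 0 (cu x) y \<Zcomp> w x (swap P x y \<Zcomp> g) 0 = (w 0 (cu x) y \<Zcomp> w x (swap P x y) 0) \<Zcomp> w x g 0"
    using g by (simp add: w_comp)
  also have "\<dots> = w y (cu x) 0 \<Zcomp> (w 0 (swap P y x) x \<Zcomp> w x g 0)"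
    unfolding cu_slide using g by simp
  also have "w x g 0 = swap P x (y + x) \<Zcomp> w 0 g x"
    using slideR[of g x] g by simp
  also have "w 0 (swap P y x) x \<Zcomp> (swap P x (y + x) \<Zcomp> w 0 g x) = w y (swap P x x) 0 \<Zcomp> w 0 g x"
    using g by (subst swap_addR) (simp add: w_fold add_ac)
  also have "w y (cu x) 0 \<Zcomp> (w y (swap P x x) 0 \<Zcomp> w 0 g x) = w y (cu x) 0 \<Zcomp> w 0 g x"
    using g by (simp add: w_fold cu_sym add_ac)
  finally have "w 0 (dual f) x \<Zcomp> ca x = w y (cu x) x \<Zcomp> (w 0 g (x + x) \<Zcomp> w 0 (ca x) 0)"
    using g by (simp add: w_comp add_ac)
  also have "w 0 g (x + x) \<Zcomp> w 0 (ca x) 0 = w (y + x) (ca x) 0 \<Zcomp> g"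
    using g by (subst exch[of g "ca x" _ _ 0 _ 0]) (simp_all add: add_ac)
  also have "w y (cu x) x \<Zcomp> (w (y + x) (ca x) 0 \<Zcomp> g) = w y (w 0 (cu x) x \<Zcomp> w x (ca x) 0) 0 \<Zcomp> g"
    using g by (simp add: w_comp add_ac)
  finally show ?thesis using g by (simp add: snake g_def)
qed

section \<open>The trace axioms for the canonical trace\<close>

definition tr :: "nat \<Rightarrow> nat \<Rightarrow> nat \<Rightarrow> 'a \<Rightarrow> 'a" where
  "tr x m n h = w 0 (cu x) m \<Zcomp> (w x h 0 \<Zcomp> w 0 (ca x) n)"

lemma tr_ar [simp]:
  assumes "ar h" "dm h = x + m" "cd h = x + n"
  shows "ar (tr x m n h)" "dm (tr x m n h) = m" "cd (tr x m n h) = n"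
  using assms by (simp_all add: tr_def add_ac)

lemma tr_tightening:
  assumes "ar f" "dm f = m" "cd f = m'" "ar h" "dm h = x + m'" "cd h = x + n'" "ar g" "dm g = n'" "cd g = n"
  shows "tr x m n (w x f 0 \<Zcomp> (h \<Zcomp> w x g 0)) = f \<Zcomp> (tr x m' n' h \<Zcomp> g)"
proof -
  have "tr x m n (w x f 0 \<Zcomp> (h \<Zcomp> w x g 0)) =
     w 0 (cu x) m \<Zcomp> (w (x + x) f 0 \<Zcomp> (w x h 0 \<Zcomp> (w (x + x) g 0 \<Zcomp> w 0 (ca x) n)))"
    using assms by (simp add: tr_def w_comp add_ac)
  also have "w (x + x) g 0 \<Zcomp> w 0 (ca x) n = w 0 (ca x) n' \<Zcomp> w 0 g 0"
    by (subst (2) exch[where j = 0]) (simp_all add: assms)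
  also have "w 0 (cu x) m \<Zcomp> (w (x + x) f 0 \<Zcomp> (w x h 0 \<Zcomp> (w 0 (ca x) n' \<Zcomp> w 0 g 0))) =
     w 0 f 0 \<Zcomp> (w 0 (cu x) m' \<Zcomp> (w x h 0 \<Zcomp> (w 0 (ca x) n' \<Zcomp> w 0 g 0)))"
    by (subst exch_assoc[where j = 0]) (simp_all add: assms add_ac)
  finally show ?thesis using assms by (simp add: tr_def)
qed

text \<open>At the cup \<open>f\<close> becomes its transpose on the returning strand, where it
  commutes with \<open>h\<close>; at the cap it becomes \<open>f\<close> again.\<close>

lemma tr_sliding:
  assumes "ar f" "dm f = x" "cd f = y" "ar h" "dm h = y + m" "cd h = x + n"
  shows "tr x m n (w 0 f m \<Zcomp> h) = tr y m n (h \<Zcomp> w 0 f n)"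
proof -
  have "tr x m n (w 0 f m \<Zcomp> h) = w 0 (cu x \<Zcomp> w x f 0) m \<Zcomp> (w x h 0 \<Zcomp> w 0 (ca x) n)"
    using assms by (simp add: tr_def w_comp add_ac)
  also have "\<dots> = w 0 (cu y) m \<Zcomp> (w 0 (dual f) (y + m) \<Zcomp> (w x h 0 \<Zcomp> w 0 (ca x) n))"
    unfolding cu_dual[OF assms(1-3), symmetric] using assms by (simp add: w_comp)
  also have "w 0 (dual f) (y + m) \<Zcomp> (w x h 0 \<Zcomp> w 0 (ca x) n) = w y h 0 \<Zcomp> (w 0 (dual f) (x + n) \<Zcomp> w 0 (ca x) n)"
    using assms by (subst exch_assoc[where j = 0]) (simp_all add: add_ac)
  also have "w 0 (dual f) (x + n) \<Zcomp> w 0 (ca x) n = w 0 (w 0 (dual f) x \<Zcomp> ca x) n"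
    using assms by (simp add: w_comp)
  also have "w 0 (dual f) x \<Zcomp> ca x = w y f 0 \<Zcomp> ca y"
    by (rule dual_ca[OF assms(1-3)])
  finally show ?thesis using assms by (simp add: tr_def w_comp add_ac)
qed

text \<open>After nesting, the returning strands of \<open>x\<close> and \<open>y\<close> cross
  before and after \<open>h\<close>. As \<open>h\<close> does not touch these strands, the two
  crossings meet and cancel.\<close>

lemma tr_add:
  assumes "ar h" "dm h = x + y + m" "cd h = x + y + n"
  shows "tr (x + y) m n h = tr y m n (tr x (y + m) (y + n) h)"
proof -
  have "tr (x + y) m n h = w 0 (cu y) m \<Zcomp> (w y (cu x) (y + m) \<Zcomp> (w 0 (swap P y x) (x + y + m) \<Zcomp>
     (w (x + y) h 0 \<Zcomp> (w 0 (swap P x y) (x + y + n) \<Zcomp> (w y (ca x) (y + n) \<Zcomp> w 0 (ca y) n)))))"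
    using assms unfolding tr_def cu_nest ca_nest by (simp add: w_comp add_ac)
  also have "w 0 (swap P y x) (x + y + m) \<Zcomp> (w (x + y) h 0 \<Zcomp> (w 0 (swap P x y) (x + y + n) \<Zcomp> (w y (ca x) (y + n) \<Zcomp> w 0 (ca y) n)))
     = w (y + x) h 0 \<Zcomp> (w 0 (swap P y x) (x + y + n) \<Zcomp> (w 0 (swap P x y) (x + y + n) \<Zcomp> (w y (ca x) (y + n) \<Zcomp> w 0 (ca y) n)))"
    using assms by (subst exch_assoc[where j = 0]) (simp_all add: add_ac)
  also have "w 0 (swap P y x) (x + y + n) \<Zcomp> (w 0 (swap P x y) (x + y + n) \<Zcomp> (w y (ca x) (y + n) \<Zcomp> w 0 (ca y) n))
     = w y (ca x) (y + n) \<Zcomp> w 0 (ca y) n"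
    by (simp add: w_fold add_ac)
  finally show ?thesis using assms by (simp add: tr_def w_comp add_ac)
qed

lemma tr_superposing:
  assumes "ar h" "dm h = x + m" "cd h = x + n" "ar g" "dm g = p" "cd g = q"
  shows "tr x (m + p) (n + q) (h \<otimes> g) = tr x m n h \<otimes> g"
proof -
  have "tr x (m + p) (n + q) (h \<otimes> g) = w 0 (cu x) (m + p) \<Zcomp> (w x h p \<Zcomp> (w (x + (x + n)) g 0 \<Zcomp> w 0 (ca x) (n + q)))"
    using assms by (simp add: tr_def tens_w1 w_comp add_ac)
  also have "w (x + (x + n)) g 0 \<Zcomp> w 0 (ca x) (n + q) = w 0 (ca x) (n + p) \<Zcomp> w n g 0"
    by (subst (2) exch[where j = n]) (simp_all add: assms add_ac)
  finally show ?thesis using assms by (simp add: tr_def comp_tens' tens_w1 w_comp add_ac)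
qed

text \<open>The symmetric cup absorbs the crossing, and what remains is a zigzag.\<close>

lemma tr_yanking: "tr x x x (swap P x x) = ident P x"
proof -
  have "tr x x x (swap P x x) = w 0 (cu x) x \<Zcomp> (w 0 (swap P x x) x \<Zcomp> w x (ca x) 0)"
    unfolding tr_def ca_slide ..
  also have "\<dots> = w 0 (cu x \<Zcomp> swap P x x) x \<Zcomp> w x (ca x) 0"
    by (simp add: w_comp)
  finally show ?thesis by (simp add: cu_sym snake)
qed

text \<open>\<open>Q\<close> stands for \<open>P\<close> equipped with a trace. Its trace is
  compared with \<open>tr\<close> on well-typed arrows only, as the whiskered form is obtained by
  rewriting with types.\<close>

lemma traced_prop_cat_canonical:
  assumes Q [simp]: "hom Q = hom P" "ident Q = ident P" "compose Q = compose P" "tensor Q = tensor P" "swap Q = swap P"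
    and t: "\<And>x m n h. h \<in> hom P (x + m) (x + n) \<Longrightarrow> trace Q x m n h = tr x m n h"
  shows "traced_prop_cat Q"
proof -
  interpret Q: prop_cat Q
    by (rule prop_cat_cong[OF prop_cat_axioms]) simp_all
  have t': "trace Q x m n h = tr x m n h" if "ar h" "dm h = x + m" "cd h = x + n" for x m n h
    using that t by (simp add: hom_iff)
  show ?thesis
  proof (unfold_locales, unfold Q, goal_cases)
    case (1 h x m n)
    then show ?case by (simp add: hom_iff t')
  next
    case (2 f m m' h x n' g n)
    then show ?case by (simp add: hom_iff t' ident_tens tr_tightening)
  next
    case (3 f x y h m n)
    then show ?case by (simp add: hom_iff t' tens_ident_w tr_sliding)
  next
    case (4 h m n)
    then show ?case using t'[of h 0 m n] by (simp add: hom_iff tr_def cu_0 ca_0)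
  next
    case (5 h x y m n)
    then show ?case using t'[of h "x + y" m n] t'[of h x "y + m" "y + n"] by (simp add: hom_iff t' tr_add add_ac)
  next
    case (6 h x m n g p q)
    then show ?case using tr_superposing[of h x m n g p q] by (simp add: hom_iff t' add_ac)
  next
    case (7 x)
    show ?case using tr_yanking by (simp add: t')
  qed
qed

end

subsection \<open>Wirings of a commutative comonoid\<close>

text \<open>An absent name gets the length of the list as its index, so that
  \<open>idx_append\<close> holds for absent names as well.\<close>

primrec idx :: "'v list \<Rightarrow> 'v \<Rightarrow> nat" where
  "idx [] y = 0"
| "idx (x # xs) y = (if x = y then 0 else Suc (idx xs y))"

lemma idx_less: "y \<in> set xs \<Longrightarrow> idx xs y < length xs"
  by (induction xs) auto

lemma nth_idx [simp]: "y \<in> set xs \<Longrightarrow> xs ! idx xs y = y"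
  by (induction xs) auto

lemma idx_nth [simp]: "distinct xs \<Longrightarrow> i < length xs \<Longrightarrow> idx xs (xs ! i) = i"
  by (simp add: idx_less nth_eq_iff_index_eq[symmetric])

lemma idx_append: "idx (xs @ ys) y = (if y \<in> set xs then idx xs y else length xs + idx ys y)"
  by (induction xs) auto

lemma idx_map: "inj_on f (insert y (set xs)) \<Longrightarrow> idx (map f xs) (f y) = idx xs y"
  by (induction xs) (auto simp: inj_on_def)

lemma map_idx: "distinct xs \<Longrightarrow> map (idx xs) xs = [0..<length xs]"
  by (rule nth_equalityI) simp_all

lemma idx_upt: "y < p \<Longrightarrow> idx [0..<p] y = y"
  using idx_nth[of "[0..<p]" y] by simp

lemma map_eq_append4:
  assumes "map f zs = as @ bs @ cs @ ds"
  obtains as' bs' cs' ds' where "zs = as' @ bs' @ cs' @ ds'"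
    "map f as' = as" "map f bs' = bs" "map f cs' = cs" "map f ds' = ds"
proof -
  from assms obtain as' r where 1: "zs = as' @ r" "map f as' = as" "map f r = bs @ cs @ ds"
    by (metis map_eq_append_conv)
  from 1(3) obtain bs' r' where 2: "r = bs' @ r'" "map f bs' = bs" "map f r' = cs @ ds"
    by (metis map_eq_append_conv)
  from 2(3) obtain cs' ds' where 3: "r' = cs' @ ds'" "map f cs' = cs" "map f ds' = ds"
    by (metis map_eq_append_conv)
  show thesis using that 1 2 3 by simp
qed

locale comonoid_prop = prop_cat P
  for P :: "('a, 'm) prop_data_scheme" (structure) +
  fixes cp dc :: 'a
  assumes cp_hom: "cp \<in> hom P 1 2" and dc_hom: "dc \<in> hom P 1 0"
    and coassoc: "cp \<Zcomp> (cp \<otimes> ident P 1) = cp \<Zcomp> (ident P 1 \<otimes> cp)"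
    and counit_left: "cp \<Zcomp> (dc \<otimes> ident P 1) = ident P 1"
    and counit_right: "cp \<Zcomp> (ident P 1 \<otimes> dc) = ident P 1"
    and cocomm: "cp \<Zcomp> swap P 1 1 = cp"
begin

abbreviation "\<Delta> \<equiv> copy_power P cp"
abbreviation "\<E> \<equiv> tensor_power P dc"

lemma cp_ar [simp]: "ar cp" "dm cp = Suc 0" "cd cp = Suc (Suc 0)"
  using cp_hom by (simp_all add: hom_iff)

lemma dc_ar [simp]: "ar dc" "dm dc = Suc 0" "cd dc = 0"
  using dc_hom by (simp_all add: hom_iff)

lemma Dl_ar [simp]: "ar (\<Delta> n)" "dm (\<Delta> n) = n" "cd (\<Delta> n) = n + n"
  by (induction n) simp_all

lemma Ec_ar [simp]: "ar (\<E> n)" "dm (\<E> n) = n" "cd (\<E> n) = 0"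
  by (induction n) simp_all

lemma Dl_1: "\<Delta> (Suc 0) = cp"
  by simp

lemma Dl_Suc: "\<Delta> (Suc n) = (\<Delta> 1 \<otimes> \<Delta> n) \<Zcomp> w 1 (swap P 1 n) n"
  unfolding One_nat_def Dl_1 by (simp add: w_def)

lemma Dl_add: "\<Delta> (p + q) = (\<Delta> p \<otimes> \<Delta> q) \<Zcomp> w p (swap P p q) q"
  by (rule interleave_add[OF _ _ _ Dl_Suc]) simp_all

declare copy_power.simps(2) [simp del]

declare Dl_1 [simp]

lemma Ec_1 [simp]: "\<E> (Suc 0) = dc"
  by simp

lemma Ec_add: "\<E> (p + q) = \<E> p \<otimes> \<E> q"
  by (induction p) simp_all

declare tensor_power.simps(2) [simp del]

section \<open>Counits and comonoid homomorphisms\<close>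

lemma Dl_counit: "\<Delta> n \<Zcomp> (\<E> n \<otimes> ident P n) = ident P n" "\<Delta> n \<Zcomp> (ident P n \<otimes> \<E> n) = ident P n"
proof (induction n)
  case (Suc n)
  have e: "\<E> (Suc n) = dc \<otimes> \<E> n" by (simp add: tensor_power.simps)
  have "\<Delta> (Suc n) \<Zcomp> (\<E> (Suc n) \<otimes> ident P (Suc n)) =
    (cp \<otimes> \<Delta> n) \<Zcomp> ((ident P 1 \<otimes> (swap P 1 n \<otimes> ident P n)) \<Zcomp> (dc \<otimes> ((\<E> n \<otimes> ident P 1) \<otimes> ident P n)))"
    using Dl_Suc[of n] by (simp add: e w_def)
  also have "(ident P 1 \<otimes> (swap P 1 n \<otimes> ident P n)) \<Zcomp> (dc \<otimes> ((\<E> n \<otimes> ident P 1) \<otimes> ident P n))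
     = dc \<otimes> ((swap P 1 n \<Zcomp> (\<E> n \<otimes> ident P 1)) \<otimes> ident P n)"
    by (simp add: ichange del: tens_assoc)
  also have "swap P 1 n \<Zcomp> (\<E> n \<otimes> ident P 1) = ident P 1 \<otimes> \<E> n"
    using swap_nat[of "ident P 1" "\<E> n"] by simp
  also have "(cp \<otimes> \<Delta> n) \<Zcomp> (dc \<otimes> ((ident P 1 \<otimes> \<E> n) \<otimes> ident P n))
     = (cp \<Zcomp> (dc \<otimes> ident P 1)) \<otimes> (\<Delta> n \<Zcomp> (\<E> n \<otimes> ident P n))"
    by (subst ichange[symmetric]) simp_all
  finally show "\<Delta> (Suc n) \<Zcomp> (\<E> (Suc n) \<otimes> ident P (Suc n)) = ident P (Suc n)"
    using Suc counit_left by simp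
  have "\<Delta> (Suc n) \<Zcomp> (ident P (Suc n) \<otimes> \<E> (Suc n)) =
    (cp \<otimes> \<Delta> n) \<Zcomp> ((ident P 1 \<otimes> (swap P 1 n \<otimes> ident P n)) \<Zcomp> (ident P 1 \<otimes> ((ident P n \<otimes> dc) \<otimes> \<E> n)))"
    using Dl_Suc[of n] tens_ident[of 1 n] by (simp add: e w_def del: tens_ident flip: tens_assoc)
  also have "(ident P 1 \<otimes> (swap P 1 n \<otimes> ident P n)) \<Zcomp> (ident P 1 \<otimes> ((ident P n \<otimes> dc) \<otimes> \<E> n))
     = ident P 1 \<otimes> ((swap P 1 n \<Zcomp> (ident P n \<otimes> dc)) \<otimes> \<E> n)"
    by (simp add: ichange del: tens_assoc)
  also have "swap P 1 n \<Zcomp> (ident P n \<otimes> dc) = dc \<otimes> ident P n"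
    using swap_nat[of dc "ident P n"] by simp
  also have "(cp \<otimes> \<Delta> n) \<Zcomp> (ident P 1 \<otimes> ((dc \<otimes> ident P n) \<otimes> \<E> n))
     = (cp \<Zcomp> (ident P 1 \<otimes> dc)) \<otimes> (\<Delta> n \<Zcomp> (ident P n \<otimes> \<E> n))"
    by (subst ichange[symmetric]) simp_all
  finally show "\<Delta> (Suc n) \<Zcomp> (ident P (Suc n) \<otimes> \<E> (Suc n)) = ident P (Suc n)"
    using Suc counit_right by simp
qed simp_all

text \<open>Comonoid homomorphisms, the arrows for which \<open>\<Delta>\<close> and
  \<open>\<E>\<close> are natural. Among them the tensor product is the cartesian product (Fox), so
  an arrow is determined by its components. Boxes are not assumed to be of this kind.\<close>

definition hm :: "'a \<Rightarrow> bool" where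
  "hm f \<longleftrightarrow> ar f \<and> f \<Zcomp> \<Delta> (cd f) = \<Delta> (dm f) \<Zcomp> (f \<otimes> f) \<and> f \<Zcomp> \<E> (cd f) = \<E> (dm f)"

lemma hm_ar [simp]: "hm f \<Longrightarrow> ar f"
  by (simp add: hm_def)

lemma hm_ident [simp]: "hm (ident P n)"
  by (simp add: hm_def)

lemma hm_comp [simp]:
  assumes "hm f" "hm g" "cd f = dm g"
  shows "hm (f \<Zcomp> g)"
proof -
  have f: "ar f" "f \<Zcomp> \<Delta> (dm g) = \<Delta> (dm f) \<Zcomp> (f \<otimes> f)" "f \<Zcomp> \<E> (dm g) = \<E> (dm f)"
    and g: "ar g" "g \<Zcomp> \<Delta> (cd g) = \<Delta> (dm g) \<Zcomp> (g \<otimes> g)" "g \<Zcomp> \<E> (cd g) = \<E> (dm g)"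
    using assms unfolding hm_def by auto
  have "(f \<Zcomp> g) \<Zcomp> \<Delta> (cd g) = (f \<Zcomp> \<Delta> (dm g)) \<Zcomp> (g \<otimes> g)"
    using f(1) g(1,2) assms(3) by simp
  also have "\<dots> = \<Delta> (dm f) \<Zcomp> ((f \<Zcomp> g) \<otimes> (f \<Zcomp> g))"
    unfolding f(2) using f(1) g(1) assms(3) by (simp add: ichange)
  finally show ?thesis
    unfolding hm_def using f(1,3) g(1,3) assms(3) by simp
qed

text \<open>Expand the crossing of the doubled bundles into four crossings; the last of them is
  cancelled by the middle crossing that follows.\<close>

lemma swap_double:
  "w p (swap P p q) q \<Zcomp> (swap P p q \<otimes> swap P p q) = swap P (p + p) (q + q) \<Zcomp> w q (swap P q p) p"
proof -
  have "swap P (p + p) (q + q) = w p (swap P p q) q \<Zcomp> (w (p + q) (swap P p q) 0 \<Zcomp> (w 0 (swap P p q) (q + p) \<Zcomp> w q (swap P p q) p))"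
    by (subst swap_addL) (simp add: swap_addR w_comp add_ac)
  moreover have "w (p + q) (swap P p q) 0 \<Zcomp> w 0 (swap P p q) (q + p) = swap P p q \<otimes> swap P p q"
    by (subst tens_w2) (simp_all add: add_ac)
  ultimately show ?thesis
    by (simp add: w_fold add_ac tens_w2)
qed

lemma hm_swap [simp]: "hm (swap P p q)"
proof -
  have "swap P p q \<Zcomp> \<Delta> (q + p) = (swap P p q \<Zcomp> (\<Delta> q \<otimes> \<Delta> p)) \<Zcomp> w q (swap P q p) p"
    by (simp add: Dl_add)
  also have "swap P p q \<Zcomp> (\<Delta> q \<otimes> \<Delta> p) = (\<Delta> p \<otimes> \<Delta> q) \<Zcomp> swap P (p + p) (q + q)"
    using swap_nat[of "\<Delta> p" "\<Delta> q"] by simp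
  also have "((\<Delta> p \<otimes> \<Delta> q) \<Zcomp> swap P (p + p) (q + q)) \<Zcomp> w q (swap P q p) p
     = (\<Delta> p \<otimes> \<Delta> q) \<Zcomp> (swap P (p + p) (q + q) \<Zcomp> w q (swap P q p) p)"
    by simp
  also have "\<dots> = \<Delta> (p + q) \<Zcomp> (swap P p q \<otimes> swap P p q)"
    unfolding swap_double[symmetric] by (subst Dl_add, subst comp_assoc) simp_all
  finally have d: "swap P p q \<Zcomp> \<Delta> (q + p) = \<Delta> (p + q) \<Zcomp> (swap P p q \<otimes> swap P p q)" .
  have "swap P p q \<Zcomp> \<E> (q + p) = \<E> (p + q)"
    unfolding Ec_add using swap_nat[of "\<E> p" "\<E> q" 0 0] by simp
  with d show ?thesis
    unfolding hm_def swap_ar by (intro conjI swap_ar)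
qed

lemma hm_tens [simp]:
  assumes "hm f" "hm g"
  shows "hm (f \<otimes> g)"
proof -
  let ?p = "dm f" and ?q = "cd f" and ?p' = "dm g" and ?q' = "cd g"
  have f: "ar f" "f \<Zcomp> \<Delta> ?q = \<Delta> ?p \<Zcomp> (f \<otimes> f)" "f \<Zcomp> \<E> ?q = \<E> ?p"
    and g: "ar g" "g \<Zcomp> \<Delta> ?q' = \<Delta> ?p' \<Zcomp> (g \<otimes> g)" "g \<Zcomp> \<E> ?q' = \<E> ?p'"
    using assms unfolding hm_def by auto
  have "(f \<otimes> g) \<Zcomp> \<Delta> (?q + ?q') = ((f \<Zcomp> \<Delta> ?q) \<otimes> (g \<Zcomp> \<Delta> ?q')) \<Zcomp> w ?q (swap P ?q ?q') ?q'"
    using f(1) g(1) by (simp add: Dl_add flip: ichange)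
  also have "\<dots> = (\<Delta> ?p \<otimes> \<Delta> ?p') \<Zcomp> ((f \<otimes> ((f \<otimes> g) \<otimes> g)) \<Zcomp> (ident P ?q \<otimes> (swap P ?q ?q' \<otimes> ident P ?q')))"
    unfolding f(2) g(2) using f(1) g(1) by (simp add: w_def flip: ichange)
  also have "(f \<otimes> ((f \<otimes> g) \<otimes> g)) \<Zcomp> (ident P ?q \<otimes> (swap P ?q ?q' \<otimes> ident P ?q'))
     = f \<otimes> (((f \<otimes> g) \<Zcomp> swap P ?q ?q') \<otimes> g)"
    using f(1) g(1) by (simp add: ichange del: tens_assoc)
  also have "(f \<otimes> g) \<Zcomp> swap P ?q ?q' = swap P ?p ?p' \<Zcomp> (g \<otimes> f)"
    using f(1) g(1) by (simp add: swap_nat)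
  also have "f \<otimes> ((swap P ?p ?p' \<Zcomp> (g \<otimes> f)) \<otimes> g) = w ?p (swap P ?p ?p') ?p' \<Zcomp> (f \<otimes> ((g \<otimes> f) \<otimes> g))"
    using f(1) g(1) by (simp add: w_def ichange del: tens_assoc)
  also have "(\<Delta> ?p \<otimes> \<Delta> ?p') \<Zcomp> \<dots> = \<Delta> (?p + ?p') \<Zcomp> ((f \<otimes> g) \<otimes> (f \<otimes> g))"
    using f(1) g(1) by (simp add: Dl_add)
  finally show ?thesis
    unfolding hm_def using f(1,3) g(1,3) by (simp add: Ec_add ichange)
qed

text \<open>Coassociativity rearranges the fourfold copy so that the two middle outputs come from
  the same \<open>cp\<close>; cocommutativity then absorbs the crossing contained in
  \<open>\<Delta> (1 + 1)\<close>.\<close>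

lemma hm_cp [simp]: "hm cp"
proof -
  have co: "cp \<Zcomp> w 0 cp (Suc 0) = cp \<Zcomp> w (Suc 0) cp 0"
    using coassoc by (simp add: tens_ident_w ident_tens)
  have "cp \<Zcomp> (cp \<otimes> cp) = (cp \<Zcomp> w 0 cp (Suc 0)) \<Zcomp> w (Suc (Suc 0)) cp 0"
    by (simp add: tens_w1)
  also have "\<dots> = cp \<Zcomp> w (Suc 0) (cp \<Zcomp> w (Suc 0) cp 0) 0"
    unfolding co by (simp add: w_comp)
  also have "\<dots> = cp \<Zcomp> (w (Suc 0) cp 0 \<Zcomp> w (Suc 0) cp (Suc 0))"
    unfolding co[symmetric] by (simp add: w_comp)
  finally have e: "cp \<Zcomp> (cp \<otimes> cp) = cp \<Zcomp> (w (Suc 0) cp 0 \<Zcomp> w (Suc 0) cp (Suc 0))" .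
  have "cp \<Zcomp> \<Delta> (1 + 1) = (cp \<Zcomp> (cp \<otimes> cp)) \<Zcomp> w 1 (swap P 1 1) 1"
    by (subst Dl_add) simp
  also have "\<dots> = cp \<Zcomp> (w (Suc 0) cp 0 \<Zcomp> w (Suc 0) (cp \<Zcomp> swap P 1 1) (Suc 0))"
    unfolding e by (simp add: w_comp)
  finally have "cp \<Zcomp> \<Delta> (1 + 1) = cp \<Zcomp> (cp \<otimes> cp)"
    unfolding cocomm e .
  moreover have "cp \<Zcomp> \<E> (1 + 1) = (cp \<Zcomp> (dc \<otimes> ident P 1)) \<Zcomp> dc"
    by (subst Ec_add) (simp add: tens_w1 tens_ident_w)
  ultimately show ?thesis
    by (simp add: hm_def counit_left[simplified])
qed

lemma hm_dc [simp]: "hm dc"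
proof -
  have "cp \<Zcomp> \<E> (1 + 1) = (cp \<Zcomp> (dc \<otimes> ident P 1)) \<Zcomp> dc"
    by (subst Ec_add) (simp add: tens_w1 tens_ident_w)
  then have "cp \<Zcomp> (dc \<otimes> dc) = dc"
    by (simp add: Ec_add[of "Suc 0" "Suc 0", simplified] counit_left[simplified])
  then show ?thesis by (simp add: hm_def)
qed

lemma hm_Dl [simp]: "hm (\<Delta> n)"
proof (induction n)
  case (Suc n)
  then show ?case using Dl_Suc[of n] by (simp add: w_def)
qed simp

lemma hm_Ec [simp]: "hm (\<E> n)"
  by (induction n) (simp_all add: tensor_power.simps)

lemma hm_Ec_comp: "hm f \<Longrightarrow> cd f = n \<Longrightarrow> f \<Zcomp> \<E> n = \<E> (dm f)"
  by (auto simp: hm_def)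

lemma Dl_pair:
  assumes "ar f" "dm f = p"
  shows "\<Delta> p \<Zcomp> (f \<otimes> \<E> p) = f" "\<Delta> p \<Zcomp> (\<E> p \<otimes> f) = f"
proof -
  have "\<Delta> p \<Zcomp> (f \<otimes> \<E> p) = (\<Delta> p \<Zcomp> (ident P p \<otimes> \<E> p)) \<Zcomp> f"
    using assms by (simp add: tens_w2 ident_tens)
  then show "\<Delta> p \<Zcomp> (f \<otimes> \<E> p) = f" using assms by (simp only: Dl_counit) simp
  have "\<Delta> p \<Zcomp> (\<E> p \<otimes> f) = (\<Delta> p \<Zcomp> (\<E> p \<otimes> ident P p)) \<Zcomp> f"
    using assms by (simp add: tens_w1 tens_ident_w)
  then show "\<Delta> p \<Zcomp> (\<E> p \<otimes> f) = f" using assms by (simp only: Dl_counit) simp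
qed

section \<open>Projections and functions between wires\<close>

definition pr :: "nat \<Rightarrow> nat \<Rightarrow> 'a" where
  "pr p i = \<E> i \<otimes> (ident P 1 \<otimes> \<E> (p - Suc i))"

lemma pr_ar [simp]:
  assumes "i < p"
  shows "ar (pr p i)" "dm (pr p i) = p" "cd (pr p i) = Suc 0" "hm (pr p i)"
  using assms by (simp_all add: pr_def)

lemma pr_left: "i < p \<Longrightarrow> pr (p + q) i = pr p i \<otimes> \<E> q"
proof -
  assume "i < p"
  then have "p + q - Suc i = (p - Suc i) + q" by simp
  then show ?thesis by (simp only: pr_def Ec_add) simp
qed

lemma pr_right: "i < q \<Longrightarrow> pr (p + q) (p + i) = \<E> p \<otimes> pr q i"
  by (simp add: pr_def Ec_add)

text \<open>The identity on \<open>Suc q\<close> wires is the pairing of the first projection with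
  the projection to the rest. A homomorphism commutes with the copying in this pairing and so splits
  into two components, to the second of which the induction applies.\<close>

lemma hm_eqI:
  assumes "hm f" "hm g" "dm f = dm g" "cd f = q" "cd g = q" "\<And>i. i < q \<Longrightarrow> f \<Zcomp> pr q i = g \<Zcomp> pr q i"
  shows "f = g"
  using assms
proof (induction q arbitrary: f g)
  case 0
  then show ?case using hm_Ec_comp[of f 0] hm_Ec_comp[of g 0] by simp
next
  case (Suc q)
  let ?a = "ident P 1 \<otimes> \<E> q" and ?b = "dc \<otimes> ident P q"
  have split: "\<Delta> (Suc q) \<Zcomp> (?a \<otimes> ?b) = ident P (Suc q)"
  proof -
    have "\<Delta> (Suc q) \<Zcomp> (?a \<otimes> ?b) = (cp \<otimes> \<Delta> q) \<Zcomp> ((ident P 1 \<otimes> (swap P 1 q \<otimes> ident P q)) \<Zcomp> (ident P 1 \<otimes> ((\<E> q \<otimes> dc) \<otimes> ident P q)))"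
      using Dl_Suc[of q] by (simp add: w_def)
    also have "(ident P 1 \<otimes> (swap P 1 q \<otimes> ident P q)) \<Zcomp> (ident P 1 \<otimes> ((\<E> q \<otimes> dc) \<otimes> ident P q))
       = ident P 1 \<otimes> ((swap P 1 q \<Zcomp> (\<E> q \<otimes> dc)) \<otimes> ident P q)"
      by (simp add: ichange del: tens_assoc)
    also have "swap P 1 q \<Zcomp> (\<E> q \<otimes> dc) = dc \<otimes> \<E> q"
      using swap_nat[of dc "\<E> q"] by simp
    also have "(cp \<otimes> \<Delta> q) \<Zcomp> (ident P 1 \<otimes> ((dc \<otimes> \<E> q) \<otimes> ident P q))
       = (cp \<Zcomp> (ident P 1 \<otimes> dc)) \<otimes> (\<Delta> q \<Zcomp> (\<E> q \<otimes> ident P q))"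
      by (subst ichange[symmetric]) simp_all
    finally show ?thesis using Dl_counit(1)[of q] counit_right by simp
  qed
  have dec: "f = \<Delta> (dm f) \<Zcomp> ((f \<Zcomp> ?a) \<otimes> (f \<Zcomp> ?b))" if "hm f" "cd f = Suc q" for f
  proof -
    have "f = f \<Zcomp> (\<Delta> (Suc q) \<Zcomp> (?a \<otimes> ?b))" using that by (subst split) simp
    also have "\<dots> = (f \<Zcomp> \<Delta> (cd f)) \<Zcomp> (?a \<otimes> ?b)" using that by simp
    also have "f \<Zcomp> \<Delta> (cd f) = \<Delta> (dm f) \<Zcomp> (f \<otimes> f)" using that by (simp add: hm_def)
    finally show ?thesis using that by (simp add: ichange del: tens_assoc)
  qed
  have a: "?a = pr (Suc q) 0"
    by (simp add: pr_def)
  have b: "(h \<Zcomp> ?b) \<Zcomp> pr q i = h \<Zcomp> pr (Suc q) (Suc i)" if "i < q" "ar h" "cd h = Suc q" for h i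
    using that pr_right[of i q 1] by (simp add: ichange tens_w1 tens_ident_w)
  have eb: "f \<Zcomp> ?b = g \<Zcomp> ?b"
  proof (rule Suc.IH)
    fix i assume "i < q"
    then show "(f \<Zcomp> ?b) \<Zcomp> pr q i = (g \<Zcomp> ?b) \<Zcomp> pr q i"
      using Suc.prems(6)[of "Suc i"] by (simp only: b Suc.prems(1,2,4,5) hm_ar Suc_less_eq)
  qed (use Suc.prems in simp_all)
  have ea: "f \<Zcomp> ?a = g \<Zcomp> ?a"
    unfolding a by (rule Suc.prems(6)) simp
  have "f = \<Delta> (dm f) \<Zcomp> ((f \<Zcomp> ?a) \<otimes> (f \<Zcomp> ?b))"
    by (rule dec[OF Suc.prems(1,4)])
  also have "\<dots> = \<Delta> (dm g) \<Zcomp> ((g \<Zcomp> ?a) \<otimes> (g \<Zcomp> ?b))"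
    by (simp only: ea eb Suc.prems(3))
  also have "\<dots> = g"
    by (rule dec[OF Suc.prems(2,5), symmetric])
  finally show ?case .
qed

text \<open>A tuple of projections, encoding the function that sends output \<open>j\<close> to
  input \<open>xs ! j\<close>; equations between such arrows become equations between lists.\<close>

primrec fn :: "nat \<Rightarrow> nat list \<Rightarrow> 'a" where
  "fn p [] = \<E> p"
| "fn p (x # xs) = \<Delta> p \<Zcomp> (pr p x \<otimes> fn p xs)"

lemma fn_ar [simp]:
  assumes "set xs \<subseteq> {..<p}"
  shows "ar (fn p xs)" "dm (fn p xs) = p" "cd (fn p xs) = length xs" "hm (fn p xs)"
  using assms by (induction xs) simp_all

lemma fn_pr:
  assumes "set xs \<subseteq> {..<p}" "i < length xs"
  shows "fn p xs \<Zcomp> pr (length xs) i = pr p (xs ! i)"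
  using assms
proof (induction xs arbitrary: i)
  case (Cons x xs)
  then have x: "x < p" "set xs \<subseteq> {..<p}" by auto
  show ?case
  proof (cases i)
    case 0
    have "fn p (x # xs) \<Zcomp> pr (length (x # xs)) 0 = \<Delta> p \<Zcomp> ((pr p x \<otimes> fn p xs) \<Zcomp> (ident P 1 \<otimes> \<E> (length xs)))"
      using x by (simp add: pr_def)
    also have "(pr p x \<otimes> fn p xs) \<Zcomp> (ident P 1 \<otimes> \<E> (length xs)) = pr p x \<otimes> \<E> p"
      using x hm_Ec_comp[of "fn p xs"] by (subst ichange) simp_all
    finally show ?thesis using x 0 by (simp add: Dl_pair)
  next
    case (Suc j)
    have "fn p (x # xs) \<Zcomp> pr (length (x # xs)) i = \<Delta> p \<Zcomp> ((pr p x \<otimes> fn p xs) \<Zcomp> (\<E> 1 \<otimes> pr (length xs) j))"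
      using x Suc Cons.prems pr_right[of j "length xs" 1] by simp
    also have "(pr p x \<otimes> fn p xs) \<Zcomp> (\<E> 1 \<otimes> pr (length xs) j) = \<E> p \<otimes> pr p (xs ! j)"
      using x Suc Cons hm_Ec_comp[of "pr p x" "Suc 0"] by (subst ichange) simp_all
    finally show ?thesis using x(2) Suc Cons.prems nth_mem[of j xs] by (simp add: Dl_pair subset_iff)
  qed
qed simp

lemma fn_ident: "fn p [0..<p] = ident P p"
proof (rule hm_eqI)
  fix i assume "i < p"
  then show "fn p [0..<p] \<Zcomp> pr p i = ident P p \<Zcomp> pr p i"
    using fn_pr[of "[0..<p]" p i] by (simp add: atLeast0LessThan)
qed (simp_all add: atLeast0LessThan)

text \<open>Compared component by component with \<open>hm_eqI\<close> and \<open>fn_pr\<close>; the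
  same argument treats tensor products and crossings below.\<close>

lemma fn_comp:
  assumes "set xs \<subseteq> {..<p}" "set ys \<subseteq> {..<length xs}"
  shows "fn p xs \<Zcomp> fn (length xs) ys = fn p (map ((!) xs) ys)"
proof (rule hm_eqI)
  have s: "set (map ((!) xs) ys) \<subseteq> {..<p}"
    using assms nth_mem by (fastforce simp: subset_iff)
  show "hm (fn p (map ((!) xs) ys))" "dm (fn p xs \<Zcomp> fn (length xs) ys) = dm (fn p (map ((!) xs) ys))"
    "cd (fn p (map ((!) xs) ys)) = length ys"
    using assms s by simp_all
  fix i assume i: "i < length ys"
  then have "ys ! i < length xs" using assms(2) nth_mem by fastforce
  then show "(fn p xs \<Zcomp> fn (length xs) ys) \<Zcomp> pr (length ys) i = fn p (map ((!) xs) ys) \<Zcomp> pr (length ys) i"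
    using i assms fn_pr[OF s, of i] by (simp add: fn_pr)
qed (use assms in simp_all)

lemma fn_tens:
  assumes "set xs \<subseteq> {..<p}" "set ys \<subseteq> {..<q}"
  shows "fn p xs \<otimes> fn q ys = fn (p + q) (xs @ map ((+) p) ys)"
proof (rule hm_eqI)
  have s: "set (xs @ map ((+) p) ys) \<subseteq> {..<p + q}"
    using assms by auto
  show "hm (fn (p + q) (xs @ map ((+) p) ys))" "dm (fn p xs \<otimes> fn q ys) = dm (fn (p + q) (xs @ map ((+) p) ys))"
    "cd (fn (p + q) (xs @ map ((+) p) ys)) = length xs + length ys"
    using assms fn_ar[OF s] by simp_all
  fix i assume i: "i < length xs + length ys"
  have r: "fn (p + q) (xs @ map ((+) p) ys) \<Zcomp> pr (length xs + length ys) i = pr (p + q) ((xs @ map ((+) p) ys) ! i)"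
    using fn_pr[OF s, of i] i by simp
  show "(fn p xs \<otimes> fn q ys) \<Zcomp> pr (length xs + length ys) i =
      fn (p + q) (xs @ map ((+) p) ys) \<Zcomp> pr (length xs + length ys) i"
  proof (cases "i < length xs")
    case True
    then have "xs ! i < p" using assms(1) nth_mem by fastforce
    then show ?thesis
      unfolding r using True assms hm_Ec_comp[of "fn q ys"]
      by (simp add: pr_left ichange fn_pr nth_append)
  next
    case False
    define j where "j = i - length xs"
    with False i have j: "i = length xs + j" "j < length ys" by auto
    then have "ys ! j < q" using assms(2) nth_mem by fastforce
    then show ?thesis
      unfolding r using j assms hm_Ec_comp[of "fn p xs"]
      by (simp add: pr_right ichange fn_pr nth_append)
  qed
qed (use assms in simp_all)

lemma fn_swap: "swap P m n = fn (m + n) ([m..<m + n] @ [0..<m])"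
proof (rule hm_eqI)
  let ?xs = "[m..<m + n] @ [0..<m]"
  have s: "set ?xs \<subseteq> {..<m + n}" by auto
  show "hm (fn (m + n) ?xs)" "dm (swap P m n) = dm (fn (m + n) ?xs)" "cd (fn (m + n) ?xs) = n + m"
    using fn_ar[OF s] by simp_all
  fix i assume i: "i < n + m"
  have r: "fn (m + n) ?xs \<Zcomp> pr (n + m) i = pr (m + n) (?xs ! i)"
    using fn_pr[OF s, of i] i by simp
  show "swap P m n \<Zcomp> pr (n + m) i = fn (m + n) ?xs \<Zcomp> pr (n + m) i"
  proof (cases "i < n")
    case True
    then show ?thesis
      unfolding r using swap_nat[of "\<E> m" "pr n i" 0 "Suc 0"] by (simp add: pr_left pr_right nth_append)
  next
    case False
    define j where "j = i - n"
    with False i have j: "i = n + j" "j < m" by auto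
    then show ?thesis
      unfolding r using swap_nat[of "pr m j" "\<E> n" "Suc 0" 0] by (simp add: pr_left pr_right nth_append)
  qed
qed simp_all

lemma fn_dc: "dc = fn 1 []"
  by simp

lemma fn_cp: "cp = fn 1 [0, 0]"
proof -
  have "pr 1 0 = ident P 1" by (simp add: pr_def)
  then show ?thesis using Dl_pair(1)[of "ident P 1" 1] by simp
qed

text \<open>Wirings with named wires: the \<open>j\<close>-th output is a copy of the input whose name is \<open>ys ! j\<close>.\<close>

definition wire :: "'v list \<Rightarrow> 'v list \<Rightarrow> 'a" where
  "wire xs ys = fn (length xs) (map (idx xs) ys)"

lemma map_idx_subset: "set ys \<subseteq> set xs \<Longrightarrow> set (map (idx xs) ys) \<subseteq> {..<length xs}"
  by (auto intro: idx_less)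

lemma wire_ar [simp]:
  assumes "set ys \<subseteq> set xs"
  shows "ar (wire xs ys)" "dm (wire xs ys) = length xs" "cd (wire xs ys) = length ys"
  using fn_ar[OF map_idx_subset[OF assms]] by (simp_all add: wire_def)

lemma wire_ident [simp]: "distinct xs \<Longrightarrow> wire xs xs = ident P (length xs)"
  by (simp add: wire_def map_idx fn_ident)

text \<open>The middle names \<open>zs\<close> may be finer than the outer ones: \<open>f\<close>
  sends a middle wire to its source, so one input can be split into several independently named
  copies. The computation of traces of wirings rests on this.\<close>

lemma wire_comp_map:
  assumes "distinct zs" "set ws \<subseteq> set zs" "f ` set zs \<subseteq> set xs"
  shows "wire xs (map f zs) \<Zcomp> wire zs ws = wire xs (map f ws)"
proof -
  have l: "length zs = length (map (idx xs) (map f zs))" by simp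
  have "wire xs (map f zs) \<Zcomp> wire zs ws = fn (length xs) (map ((!) (map (idx xs) (map f zs))) (map (idx zs) ws))"
    unfolding wire_def l
    by (rule fn_comp) (use assms idx_less[of _ zs] in \<open>auto intro: idx_less\<close>)
  also have "map ((!) (map (idx xs) (map f zs))) (map (idx zs) ws) = map (idx xs) (map f ws)"
    using assms(2) by (auto simp: idx_less subset_iff)
  finally show ?thesis by (simp add: wire_def)
qed

lemma wire_comp:
  "distinct zs \<Longrightarrow> set ws \<subseteq> set zs \<Longrightarrow> set zs \<subseteq> set xs \<Longrightarrow> wire xs zs \<Zcomp> wire zs ws = wire xs ws"
  using wire_comp_map[of zs ws "\<lambda>x. x" xs] by simp

lemma wire_tens:
  assumes "set xs \<inter> set xs' = {}" "set ys \<subseteq> set xs" "set ys' \<subseteq> set xs'"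
  shows "wire xs ys \<otimes> wire xs' ys' = wire (xs @ xs') (ys @ ys')"
proof -
  have "wire xs ys \<otimes> wire xs' ys' = fn (length (xs @ xs')) (map (idx xs) ys @ map ((+) (length xs)) (map (idx xs') ys'))"
    unfolding wire_def using assms(2,3) by (subst fn_tens) (auto intro: idx_less)
  also have "map (idx xs) ys @ map ((+) (length xs)) (map (idx xs') ys') = map (idx (xs @ xs')) (ys @ ys')"
    using assms by (auto simp: idx_append)
  finally show ?thesis by (simp add: wire_def)
qed

lemma wire_swap:
  assumes "distinct (xs @ ys)"
  shows "wire (xs @ ys) (ys @ xs) = swap P (length xs) (length ys)"
proof -
  have "map (idx (xs @ ys)) ys = [length xs..<length xs + length ys]"
    using assms by (intro nth_equalityI) (auto simp: idx_append disjoint_iff)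
  moreover have "map (idx (xs @ ys)) xs = [0..<length xs]"
    using assms by (intro nth_equalityI) (auto simp: idx_append)
  ultimately have "map (idx (xs @ ys)) (ys @ xs) = [length xs..<length xs + length ys] @ [0..<length xs]"
    by simp
  then show ?thesis by (simp add: wire_def fn_swap)
qed

lemma wire_rename:
  assumes "inj_on f (set xs)" "set ys \<subseteq> set xs"
  shows "wire (map f xs) (map f ys) = wire xs ys"
proof -
  have "idx (map f xs) (f y) = idx xs y" if "y \<in> set ys" for y
    using assms that by (intro idx_map) (simp add: insert_absorb subset_iff)
  then show ?thesis by (simp add: wire_def comp_def cong: map_cong)
qed

lemma fn_wire: "set ys \<subseteq> {..<p} \<Longrightarrow> fn p ys = wire [0..<p] ys"
proof -
  assume "set ys \<subseteq> {..<p}"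
  then have "map (idx [0..<p]) ys = ys" by (intro map_idI) (auto simp: idx_upt)
  then show ?thesis by (simp add: wire_def)
qed

lemma w_swap_wire:
  assumes "distinct (as @ bs @ cs @ ds)"
  shows "w (length as) (swap P (length bs) (length cs)) (length ds) = wire (as @ bs @ cs @ ds) (as @ cs @ bs @ ds)"
proof -
  have "w (length as) (swap P (length bs) (length cs)) (length ds) =
     wire as as \<otimes> (wire (bs @ cs) (cs @ bs) \<otimes> wire ds ds)"
  proof -
    have "distinct (bs @ cs)" using assms by auto
    with assms show ?thesis by (simp add: wire_swap w_def)
  qed
  also have "\<dots> = wire (as @ (bs @ cs) @ ds) (as @ (cs @ bs) @ ds)"
  proof -
    have "wire (bs @ cs) (cs @ bs) \<otimes> wire ds ds = wire ((bs @ cs) @ ds) ((cs @ bs) @ ds)"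
      by (rule wire_tens) (use assms in auto)
    moreover have "wire as as \<otimes> wire (bs @ cs @ ds) (cs @ bs @ ds) = wire (as @ bs @ cs @ ds) (as @ cs @ bs @ ds)"
      by (rule wire_tens) (use assms in auto)
    ultimately show ?thesis by (simp only: append_assoc)
  qed
  finally show ?thesis by simp
qed

text \<open>Names in the list may repeat, so they cannot name the wires between the two factors;
  positions serve as distinct names there and are mapped back by indexing.\<close>

lemma wire_w_swap:
  assumes "set (as @ bs @ cs @ ds) \<subseteq> set xs"
  shows "wire xs (as @ bs @ cs @ ds) \<Zcomp> w (length as) (swap P (length bs) (length cs)) (length ds) = wire xs (as @ cs @ bs @ ds)"
proof -
  let ?ys = "as @ bs @ cs @ ds"
  have "map ((!) ?ys) [0..<length ?ys] = ?ys" by (rule map_nth)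
  then obtain as' bs' cs' ds' where z: "[0..<length ?ys] = as' @ bs' @ cs' @ ds'"
    and m: "map ((!) ?ys) as' = as" "map ((!) ?ys) bs' = bs" "map ((!) ?ys) cs' = cs" "map ((!) ?ys) ds' = ds"
    by (rule map_eq_append4)
  have l: "length as = length as'" "length bs = length bs'" "length cs = length cs'" "length ds = length ds'"
    using m by (metis length_map)+
  have d: "distinct (as' @ bs' @ cs' @ ds')" by (simp flip: z)
  have "wire xs (map ((!) ?ys) (as' @ bs' @ cs' @ ds')) \<Zcomp> wire (as' @ bs' @ cs' @ ds') (as' @ cs' @ bs' @ ds')
    = wire xs (map ((!) ?ys) (as' @ cs' @ bs' @ ds'))"
  proof (rule wire_comp_map[OF d])
    have "(!) ?ys ` set (as' @ bs' @ cs' @ ds') = set ?ys"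
      unfolding z[symmetric] set_map[symmetric] map_nth ..
    then show "(!) ?ys ` set (as' @ bs' @ cs' @ ds') \<subseteq> set xs" using assms by simp
  qed auto
  then show ?thesis
    unfolding l w_swap_wire[OF d] map_append m .
qed

end

subsection \<open>Nets\<close>

text \<open>A net is a list of boxes \<open>(b, S, T)\<close> with the names \<open>S\<close>, \<open>T\<close> of their input and output wires.\<close>

definition ins :: "('b \<times> 'v list \<times> 'v list) list \<Rightarrow> 'v list" where
  "ins Bs = concat (map (\<lambda>(b, S, T). S) Bs)"

definition outs :: "('b \<times> 'v list \<times> 'v list) list \<Rightarrow> 'v list" where
  "outs Bs = concat (map (\<lambda>(b, S, T). T) Bs)"

definition rename :: "('v \<Rightarrow> 'w) \<Rightarrow> 'b \<times> 'v list \<times> 'v list \<Rightarrow> 'b \<times> 'w list \<times> 'w list" where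
  "rename f = (\<lambda>(b, S, T). (b, map f S, map f T))"

lemma ins_simps [simp]:
  "ins [] = []" "ins ((b, S, T) # Bs) = S @ ins Bs" "ins (As @ Bs) = ins As @ ins Bs"
  by (simp_all add: ins_def)

lemma outs_simps [simp]:
  "outs [] = []" "outs ((b, S, T) # Bs) = T @ outs Bs" "outs (As @ Bs) = outs As @ outs Bs"
  by (simp_all add: outs_def)

lemma rename_simp [simp]: "rename f (b, S, T) = (b, map f S, map f T)"
  by (simp add: rename_def)

lemma ins_rename [simp]: "ins (map (rename f) Bs) = map f (ins Bs)"
  by (induction Bs) auto

lemma outs_rename [simp]: "outs (map (rename f) Bs) = map f (outs Bs)"
  by (induction Bs) auto

locale net_prop = traced_prop_cat P + comonoid_prop P cp dc
  for P :: "('a, 'm) traced_prop_data_scheme" (structure) and cp dc +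
  fixes bx :: "'b \<Rightarrow> 'a"
begin

section \<open>Derived rules for traces\<close>

lemma swap_inv_assoc [simp]: "ar r \<Longrightarrow> dm r = m + n \<Longrightarrow> swap P m n \<Zcomp> (swap P n m \<Zcomp> r) = r"
  by (simp add: assocL[OF swap_inv] add.commute)

lemma tr_ar:
  assumes "ar h" "dm h = x + m" "cd h = x + n"
  shows "ar (trace P x m n h)" "dm (trace P x m n h) = m" "cd (trace P x m n h) = n"
  using trace_hom[of h x m n] assms by (simp_all add: hom_iff)

lemma tr_tight:
  assumes "ar f" "dm f = m" "cd f = m'" "ar h" "dm h = x + m'" "cd h = x + n'" "ar g" "dm g = n'" "cd g = n"
  shows "trace P x m n (w x f 0 \<Zcomp> (h \<Zcomp> w x g 0)) = f \<Zcomp> (trace P x m' n' h \<Zcomp> g)"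
proof -
  have "(ident P x \<otimes> f) \<Zcomp> h \<Zcomp> (ident P x \<otimes> g) = w x f 0 \<Zcomp> (h \<Zcomp> w x g 0)"
    using assms by (simp add: ident_tens)
  moreover have "f \<Zcomp> trace P x m' n' h \<Zcomp> g = f \<Zcomp> (trace P x m' n' h \<Zcomp> g)"
    using assms tr_ar[of h x m' n'] by simp
  ultimately show ?thesis
    using tightening[of f m m' h x n' g n] assms by (simp add: hom_iff)
qed

lemma tr_tightL:
  assumes "ar f" "dm f = m" "cd f = m'" "ar h" "dm h = x + m'" "cd h = x + n"
  shows "trace P x m n (w x f 0 \<Zcomp> h) = f \<Zcomp> trace P x m' n h"
  using tr_tight[OF assms, of "ident P n" n] assms tr_ar[of h x m' n] by (simp add: add_ac)

lemma tr_tightR: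
  assumes "ar h" "dm h = x + m" "cd h = x + n'" "ar g" "dm g = n'" "cd g = n"
  shows "trace P x m n (h \<Zcomp> w x g 0) = trace P x m n' h \<Zcomp> g"
  using tr_tight[of "ident P m" m m h x n' g n] assms tr_ar[of h x m n'] by (simp add: add_ac)

lemma tr_slide:
  assumes "ar f" "dm f = x" "cd f = y" "ar h" "dm h = y + m" "cd h = x + n"
  shows "trace P x m n (w 0 f m \<Zcomp> h) = trace P y m n (h \<Zcomp> w 0 f n)"
  using sliding[of f x y h m n] assms by (simp add: hom_iff tens_ident_w)

text \<open>Sliding \<open>g\<close> round the loop places it after \<open>f\<close>, where the two
  cancel. In particular the traced wires may be permuted.\<close>

lemma tr_conj:
  assumes "ar f" "dm f = x" "cd f = y" "ar g" "dm g = y" "cd g = x" "f \<Zcomp> g = ident P x"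
    "ar h" "dm h = x + m" "cd h = x + n"
  shows "trace P y m n (w 0 g m \<Zcomp> (h \<Zcomp> w 0 f n)) = trace P x m n h"
proof -
  have "trace P y m n (w 0 g m \<Zcomp> (h \<Zcomp> w 0 f n)) = trace P x m n ((h \<Zcomp> w 0 f n) \<Zcomp> w 0 g n)"
    using assms by (intro tr_slide) auto
  also have "(h \<Zcomp> w 0 f n) \<Zcomp> w 0 g n = h \<Zcomp> w 0 (f \<Zcomp> g) n"
    using assms(1-6,8-) by (simp add: w_comp)
  finally show ?thesis using assms by simp
qed

lemma tr_super:
  assumes "ar h" "dm h = x + m" "cd h = x + n" "ar g" "dm g = p" "cd g = q"
  shows "trace P x (m + p) (n + q) (h \<otimes> g) = trace P x m n h \<otimes> g"
  using superposing[of h x m n g p q] assms by (simp add: hom_iff)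

lemma tr_vanish:
  assumes "ar h" "dm h = x + y + m" "cd h = x + y + n"
  shows "trace P (x + y) m n h = trace P y m n (trace P x (y + m) (y + n) h)"
  using vanishing_add[of h x y m n] assms by (simp add: hom_iff)

lemma tr_0: "ar h \<Longrightarrow> dm h = m \<Longrightarrow> cd h = n \<Longrightarrow> trace P 0 m n h = h"
  using vanishing_zero[of h m n] by (simp add: hom_iff)

text \<open>Superposing adds wires after the traced arrow only; wires before it are crossed over to
  the other side and back.\<close>

lemma tr_ident_tens:
  assumes "ar h" "dm h = x + m" "cd h = x + n"
  shows "w k (trace P x m n h) 0 =
    trace P x (k + m) (k + n) (w 0 (swap P x k) m \<Zcomp> (w k h 0 \<Zcomp> w 0 (swap P k x) n))"
proof -
  let ?t = "trace P x m n h"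
  note t = tr_ar[OF assms]
  have "w k ?t 0 = (swap P k m \<Zcomp> swap P m k) \<Zcomp> w k ?t 0"
    using t by (simp add: add_ac)
  also have "\<dots> = swap P k m \<Zcomp> (w 0 ?t k \<Zcomp> swap P n k)"
    using t slideL[of ?t k] by simp
  also have "w 0 ?t k = trace P x (m + k) (n + k) (w 0 h k)"
    using tr_super[OF assms, of "ident P k" k k] assms t by (simp add: tens_ident_w)
  also have "swap P k m \<Zcomp> (\<dots> \<Zcomp> swap P n k) =
     trace P x (k + m) (k + n) (w x (swap P k m) 0 \<Zcomp> (w 0 h k \<Zcomp> w x (swap P n k) 0))"
    using assms by (subst tr_tight) (simp_all add: add_ac)
  also have "w x (swap P k m) 0 \<Zcomp> (w 0 h k \<Zcomp> w x (swap P n k) 0) =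
     w 0 (swap P x k) m \<Zcomp> (w k h 0 \<Zcomp> w 0 (swap P k x) n)"
  proof -
    have "w 0 h k = (w 0 h k \<Zcomp> swap P (x + n) k) \<Zcomp> swap P k (x + n)"
      using assms by simp
    also have "w 0 h k \<Zcomp> swap P (x + n) k = swap P (x + m) k \<Zcomp> w k h 0"
      using slideL[of h k] assms by simp
    finally have a: "w 0 h k = swap P (x + m) k \<Zcomp> (w k h 0 \<Zcomp> swap P k (x + n))"
      using assms by simp
    have "w x (swap P k m) 0 \<Zcomp> swap P (x + m) k = w 0 (swap P x k) m"
      by (subst swap_addL) (simp add: w_fold add_ac)
    moreover have "swap P k (x + n) \<Zcomp> w x (swap P n k) 0 = w 0 (swap P k x) n"
      by (subst swap_addR) (simp add: w_fold add_ac)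
    ultimately show ?thesis
      unfolding a using assms by (simp add: add_ac assocL[of _ _ "w 0 (swap P x k) m"])
  qed
  finally show ?thesis .
qed

text \<open>Vanishing merges the two loops into one; the crossings bring the traced wires of
  \<open>h\<close> next to those of \<open>f\<close>.\<close>

lemma tr_tens:
  assumes f: "ar f" "dm f = x + m" "cd f = x + n" and h: "ar h" "dm h = y + m'" "cd h = y + n'"
  shows "trace P x m n f \<otimes> trace P y m' n' h =
    trace P (x + y) (m + m') (n + n')
      (w x (swap P y m) m' \<Zcomp> ((f \<otimes> h) \<Zcomp> w x (swap P n y) n'))"
proof -
  note tf = tr_ar[OF f] and th = tr_ar[OF h]
  let ?H = "w 0 (swap P y n) m' \<Zcomp> (w n h 0 \<Zcomp> w 0 (swap P n y) n')"
  have "trace P x m n f \<otimes> trace P y m' n' h = w 0 (trace P x m n f) m' \<Zcomp> w n (trace P y m' n' h) 0"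
    using tf th by (simp add: tens_w1)
  also have "w n (trace P y m' n' h) 0 = trace P y (n + m') (n + n') ?H"
    by (rule tr_ident_tens[OF h])
  also have "w 0 (trace P x m n f) m' \<Zcomp> \<dots> = trace P y (m + m') (n + n') (w y (trace P x m n f) m' \<Zcomp> ?H)"
    using tf h by (subst tr_tightL[symmetric]) (simp_all add: add_ac)
  also have "w y (trace P x m n f) m' \<Zcomp> ?H =
     w 0 (w y (trace P x m n f) 0 \<Zcomp> swap P y n) m' \<Zcomp> (w n h 0 \<Zcomp> w 0 (swap P n y) n')"
    using tf h by (simp add: w_comp add_ac)
  also have "w y (trace P x m n f) 0 \<Zcomp> swap P y n = swap P y m \<Zcomp> w 0 (trace P x m n f) y"
    using slideR[of "trace P x m n f" y] tf by simp
  also have "w 0 (swap P y m \<Zcomp> w 0 (trace P x m n f) y) m' \<Zcomp> (w n h 0 \<Zcomp> w 0 (swap P n y) n') =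
     w 0 (swap P y m) m' \<Zcomp> ((trace P x m n f \<otimes> h) \<Zcomp> w 0 (swap P n y) n')"
    using tf h by (simp add: w_comp tens_w1 add_ac)
  also have "trace P x m n f \<otimes> h = trace P x (m + (y + m')) (n + (y + n')) (f \<otimes> h)"
    using tr_super[OF f h] by simp
  also have "w 0 (swap P y m) m' \<Zcomp> (\<dots> \<Zcomp> w 0 (swap P n y) n') =
     trace P x (y + (m + m')) (y + (n + n')) (w x (swap P y m) m' \<Zcomp> ((f \<otimes> h) \<Zcomp> w x (swap P n y) n'))"
    using f h by (subst tr_tight[symmetric]) (simp_all add: add_ac)
  finally show ?thesis
    using f h by (subst tr_vanish) (simp_all add: add_ac)
qed

text \<open>Tightening reduces the loop to the trace of a crossing, which yanking straightens.
  Composition of nets thereby becomes a case of tensor product, reordering and trace.\<close>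

lemma comp_as_trace:
  assumes f: "ar f" "dm f = m" "cd f = n" and g: "ar g" "dm g = n" "cd g = p"
  shows "f \<Zcomp> g = trace P n m p (swap P n m \<Zcomp> (f \<otimes> g))"
proof -
  have "swap P n m \<Zcomp> (f \<otimes> g) = (swap P n m \<Zcomp> w 0 f n) \<Zcomp> w n g 0"
    using f g by (simp add: tens_w1)
  also have "swap P n m \<Zcomp> w 0 f n = w n f 0 \<Zcomp> swap P n n"
    using slideR[of f n] f by simp
  also have "(w n f 0 \<Zcomp> swap P n n) \<Zcomp> w n g 0 = w n f 0 \<Zcomp> (swap P n n \<Zcomp> w n g 0)"
    using f g by simp
  finally show ?thesis
    using f g by (simp add: tr_tight[of f m n "swap P n n" n n g p] yanking)
qed

section \<open>The value of a net and its invariance\<close>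

definition okb :: "'b \<times> 'v list \<times> 'v list \<Rightarrow> bool" where
  "okb = (\<lambda>(b, S, T). bx b \<in> hom P (length S) (length T))"

primrec par :: "('b \<times> 'v list \<times> 'v list) list \<Rightarrow> 'a" where
  "par [] = ident P 0"
| "par (B # Bs) = bx (fst B) \<otimes> par Bs"

definition valid :: "('b \<times> 'v list \<times> 'v list) list \<Rightarrow> 'v list \<Rightarrow> 'v list \<Rightarrow> bool" where
  "valid Bs L R \<longleftrightarrow> (\<forall>B\<in>set Bs. okb B) \<and> distinct (outs Bs @ L) \<and> set (ins Bs @ R) \<subseteq> set (outs Bs @ L)"

text \<open>The wiring comes before the boxes, so an output reaches an input, be it of its own box,
  or the right interface only through the loop.\<close>

definition net :: "('b \<times> 'v list \<times> 'v list) list \<Rightarrow> 'v list \<Rightarrow> 'v list \<Rightarrow> 'a" where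
  "net Bs L R = trace P (length (outs Bs)) (length L) (length R)
     (wire (outs Bs @ L) (ins Bs @ R) \<Zcomp> w 0 (par Bs) (length R))"

lemma okb_simp [simp]: "okb (b, S, T) \<longleftrightarrow> ar (bx b) \<and> dm (bx b) = length S \<and> cd (bx b) = length T"
  by (simp add: okb_def hom_iff)

lemma par_ar [simp]:
  assumes "\<forall>B\<in>set Bs. okb B"
  shows "ar (par Bs)" "dm (par Bs) = length (ins Bs)" "cd (par Bs) = length (outs Bs)"
  using assms by (induction Bs) auto

lemma par_append: "\<forall>B\<in>set (As @ Bs). okb B \<Longrightarrow> par (As @ Bs) = par As \<otimes> par Bs"
  by (induction As) auto

lemma net_ar [simp]:
  assumes "valid Bs L R"
  shows "ar (net Bs L R)" "dm (net Bs L R) = length L" "cd (net Bs L R) = length R"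
  using assms tr_ar[of "wire (outs Bs @ L) (ins Bs @ R) \<Zcomp> w 0 (par Bs) (length R)" "length (outs Bs)" "length L" "length R"]
  by (auto simp: net_def valid_def)

lemma par_swap:
  assumes "\<forall>B\<in>set (As @ Bs @ Cs @ Ds). okb B"
  shows "par (As @ Bs @ Cs @ Ds) =
    w (length (ins As)) (swap P (length (ins Bs)) (length (ins Cs))) (length (ins Ds)) \<Zcomp>
    (par (As @ Cs @ Bs @ Ds) \<Zcomp> w (length (outs As)) (swap P (length (outs Cs)) (length (outs Bs))) (length (outs Ds)))"
proof -
  have ok: "\<forall>B\<in>set As. okb B" "\<forall>B\<in>set Bs. okb B" "\<forall>B\<in>set Cs. okb B" "\<forall>B\<in>set Ds. okb B"
    using assms by auto
  let ?s = "swap P (length (ins Bs)) (length (ins Cs))" and ?t = "swap P (length (outs Cs)) (length (outs Bs))"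
  have "par Bs \<otimes> par Cs = ((par Bs \<otimes> par Cs) \<Zcomp> swap P (length (outs Bs)) (length (outs Cs))) \<Zcomp> ?t"
    using ok by simp
  also have "\<dots> = ?s \<Zcomp> ((par Cs \<otimes> par Bs) \<Zcomp> ?t)"
    using ok by (subst swap_nat) simp_all
  finally have e: "par Bs \<otimes> par Cs = ?s \<Zcomp> ((par Cs \<otimes> par Bs) \<Zcomp> ?t)" .
  have "par (As @ Bs @ Cs @ Ds) = par As \<otimes> ((par Bs \<otimes> par Cs) \<otimes> par Ds)"
    using ok by (simp add: par_append ball_Un)
  also have "\<dots> = w (length (ins As)) ?s (length (ins Ds)) \<Zcomp> (par As \<otimes> (((par Cs \<otimes> par Bs) \<Zcomp> ?t) \<otimes> par Ds))"
    unfolding e using ok by (simp add: comp_tens' del: tens_assoc)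
  also have "par As \<otimes> (((par Cs \<otimes> par Bs) \<Zcomp> ?t) \<otimes> par Ds) =
    (par As \<otimes> ((par Cs \<otimes> par Bs) \<otimes> par Ds)) \<Zcomp> w (length (outs As)) ?t (length (outs Ds))"
    using ok by (simp add: comp_tens del: tens_assoc)
  finally show ?thesis using ok by (simp add: par_append ball_Un)
qed

text \<open>Naturality trades a reordering of the boxes for a crossing of their inputs and one of
  their outputs. The first is absorbed by the wiring at once, the second after sliding round the
  trace.\<close>

lemma net_swap:
  assumes v: "valid (As @ Bs @ Cs @ Ds) L R"
  shows "net (As @ Bs @ Cs @ Ds) L R = net (As @ Cs @ Bs @ Ds) L R" "valid (As @ Cs @ Bs @ Ds) L R"
proof -
  show v': "valid (As @ Cs @ Bs @ Ds) L R" using v by (auto simp: valid_def)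
  have ok: "\<forall>B\<in>set (As @ Bs @ Cs @ Ds). okb B" "\<forall>B\<in>set (As @ Cs @ Bs @ Ds). okb B"
    and d: "distinct (outs (As @ Bs @ Cs @ Ds) @ L)" "distinct (outs (As @ Cs @ Bs @ Ds) @ L)"
    and s: "set (ins (As @ Bs @ Cs @ Ds) @ R) \<subseteq> set (outs (As @ Bs @ Cs @ Ds) @ L)"
    using v v' by (auto simp: valid_def)
  let ?X = "outs (As @ Bs @ Cs @ Ds) @ L" and ?X' = "outs (As @ Cs @ Bs @ Ds) @ L" and ?n = "length R" and ?m = "length L"
  let ?f = "w (length (outs As)) (swap P (length (outs Cs)) (length (outs Bs))) (length (outs Ds))"
  let ?p = "w 0 (par (As @ Cs @ Bs @ Ds)) ?n"
  define h where "h = wire ?X (ins (As @ Cs @ Bs @ Ds) @ R) \<Zcomp> ?p"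
  have W: "wire ?X (ins (As @ Bs @ Cs @ Ds) @ R) \<Zcomp>
    w (length (ins As)) (swap P (length (ins Bs)) (length (ins Cs))) (length (ins Ds) + ?n) = wire ?X (ins (As @ Cs @ Bs @ Ds) @ R)"
    using wire_w_swap[of "ins As" "ins Bs" "ins Cs" "ins Ds @ R" ?X] s by simp
  have s': "set (ins (As @ Cs @ Bs @ Ds) @ R) \<subseteq> set ?X" using s by auto
  have h: "ar h" "dm h = length (outs (As @ Bs @ Cs @ Ds)) + ?m" "cd h = length (outs (As @ Bs @ Cs @ Ds)) + ?n"
    using s' ok(2) by (auto simp: h_def simp del: ins_simps(3))
  have "wire ?X (ins (As @ Bs @ Cs @ Ds) @ R) \<Zcomp> w 0 (par (As @ Bs @ Cs @ Ds)) ?n =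
    (wire ?X (ins (As @ Bs @ Cs @ Ds) @ R) \<Zcomp> w (length (ins As)) (swap P (length (ins Bs)) (length (ins Cs))) (length (ins Ds) + ?n)) \<Zcomp> (?p \<Zcomp> w 0 ?f ?n)"
    unfolding par_swap[OF ok(1)] using s ok(2) by (simp add: w_comp add_ac)
  also have "\<dots> = h \<Zcomp> w 0 ?f ?n"
    unfolding W h_def using s' ok(2) by (simp add: add_ac)
  finally have e: "wire ?X (ins (As @ Bs @ Cs @ Ds) @ R) \<Zcomp> w 0 (par (As @ Bs @ Cs @ Ds)) ?n = h \<Zcomp> w 0 ?f ?n" .
  have "net (As @ Bs @ Cs @ Ds) L R = trace P (length (outs (As @ Cs @ Bs @ Ds))) ?m ?n (w 0 ?f ?m \<Zcomp> h)"
    unfolding net_def e using h by (intro tr_slide[symmetric]) simp_all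
  also have "w 0 ?f ?m = wire ?X' ?X"
    using w_swap_wire[of "outs As" "outs Cs" "outs Bs" "outs Ds @ L"] d by simp
  also have "wire ?X' ?X \<Zcomp> h = (wire ?X' ?X \<Zcomp> wire ?X (ins (As @ Cs @ Bs @ Ds) @ R)) \<Zcomp> ?p"
  proof -
    have "set ?X \<subseteq> set ?X'" by auto
    then show ?thesis unfolding h_def using s' ok(2)
      by (subst comp_assoc) (simp_all del: ins_simps(3) outs_simps(3) add: add_ac)
  qed
  also have "wire ?X' ?X \<Zcomp> wire ?X (ins (As @ Cs @ Bs @ Ds) @ R) = wire ?X' (ins (As @ Cs @ Bs @ Ds) @ R)"
    using d(1) s' by (intro wire_comp) auto
  finally show "net (As @ Bs @ Cs @ Ds) L R = net (As @ Cs @ Bs @ Ds) L R"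
    by (simp add: net_def)
qed

text \<open>The prefix \<open>As\<close> keeps the boxes already placed, so each step has to move a
  single box only.\<close>

lemma net_perm_prefix:
  "mset Bs = mset Bs' \<Longrightarrow> valid (As @ Bs) L R \<Longrightarrow>
    valid (As @ Bs') L R \<and> net (As @ Bs) L R = net (As @ Bs') L R"
proof (induction Bs arbitrary: As Bs')
  case (Cons B Bs)
  have "B \<in> set Bs'" using Cons.prems(1) by (metis list.set_intros(1) set_mset_mset)
  then obtain xs ys where s: "Bs' = xs @ B # ys" by (auto dest: split_list)
  then have "mset Bs = mset (xs @ ys)" using Cons.prems(1) by simp
  then have "valid ((As @ [B]) @ (xs @ ys)) L R \<and> net ((As @ [B]) @ Bs) L R = net ((As @ [B]) @ (xs @ ys)) L R"
    using Cons.prems(2) by (intro Cons.IH) simp_all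
  then show ?case
    using net_swap[of As "[B]" xs ys L R] s by simp
qed simp

lemma net_perm: "mset Bs = mset Bs' \<Longrightarrow> valid Bs L R \<Longrightarrow> net Bs L R = net Bs' L R"
  using net_perm_prefix[of Bs Bs' "[]"] by simp

lemma par_rename [simp]: "par (map (rename f) Bs) = par Bs"
  by (induction Bs) (auto simp: rename_def split: prod.splits)

lemma okb_rename [simp]: "okb (rename f B) \<longleftrightarrow> okb B"
  by (cases B) simp

lemma net_rename:
  assumes v: "valid Bs L R" and f: "inj_on f (set (outs Bs @ L))"
  shows "net (map (rename f) Bs) (map f L) (map f R) = net Bs L R"
    and "valid (map (rename f) Bs) (map f L) (map f R)"
proof -
  have "wire (map f (outs Bs @ L)) (map f (ins Bs @ R)) = wire (outs Bs @ L) (ins Bs @ R)"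
    using v f by (intro wire_rename) (auto simp: valid_def)
  then show "net (map (rename f) Bs) (map f L) (map f R) = net Bs L R"
    by (simp add: net_def)
  have "distinct (map f (outs Bs @ L))"
    using v f by (simp only: distinct_map valid_def)
  moreover have "f ` set (ins Bs @ R) \<subseteq> f ` set (outs Bs @ L)"
    using v by (intro image_mono) (simp only: valid_def)
  ultimately show "valid (map (rename f) Bs) (map f L) (map f R)"
    using v unfolding valid_def by (simp add: image_Un)
qed

lemma net_Nil: "distinct L \<Longrightarrow> set R \<subseteq> set L \<Longrightarrow> net [] L R = wire L R"
  by (simp add: net_def tr_0)

text \<open>With distinct names the wiring is a crossing, and the loop is that of
  \<open>comp_as_trace\<close> for \<open>bx b\<close> followed by an identity.\<close>

lemma net_box:
  assumes "okb (b, S, T)" "distinct (T @ S)"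
  shows "net [(b, S, T)] S T = bx b"
  using comp_as_trace[of "bx b" "length S" "length T" "ident P (length T)" "length T"] assms
  by (simp add: net_def wire_swap tens_ident_w)

text \<open>Vanishing separates the loop of the last box from the other loops; for the remaining net
  \<open>T\<close> belongs to the left interface and \<open>S\<close> to the right one. Nets are
  interpreted along this recursion.\<close>

lemma net_snoc:
  assumes v: "valid (Bs @ [(b, S, T)]) L R"
  shows "valid Bs (T @ L) (S @ R)"
    and "net (Bs @ [(b, S, T)]) L R =
      trace P (length T) (length L) (length R) (net Bs (T @ L) (S @ R) \<Zcomp> w 0 (bx b) (length R))"
proof -
  show v': "valid Bs (T @ L) (S @ R)" using v by (auto simp: valid_def)
  have b: "ar (bx b)" "dm (bx b) = length S" "cd (bx b) = length T" and ok: "\<forall>B\<in>set Bs. okb B"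
    and s: "set (ins Bs @ S @ R) \<subseteq> set (outs Bs @ T @ L)"
    using v by (auto simp: valid_def)
  let ?W = "wire (outs Bs @ T @ L) (ins Bs @ S @ R)"
  have W: "ar ?W" "dm ?W = length (outs Bs) + length T + length L" "cd ?W = length (ins Bs) + length S + length R"
    using s by simp_all
  have "net (Bs @ [(b, S, T)]) L R = trace P (length (outs Bs) + length T) (length L) (length R)
     (?W \<Zcomp> w 0 (par Bs \<otimes> bx b) (length R))"
    using b ok by (simp add: net_def par_append)
  also have "?W \<Zcomp> w 0 (par Bs \<otimes> bx b) (length R) =
     (?W \<Zcomp> w 0 (par Bs) (length (S @ R))) \<Zcomp> w (length (outs Bs)) (w 0 (bx b) (length R)) 0"
    using W b ok by (simp add: tens_w1 w_comp add_ac)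
  also have "trace P (length (outs Bs) + length T) (length L) (length R) \<dots> =
     trace P (length T) (length L) (length R) (trace P (length (outs Bs)) (length T + length L) (length T + length R) \<dots>)"
    using W b ok by (intro tr_vanish) (simp_all add: add_ac)
  also have "trace P (length (outs Bs)) (length T + length L) (length T + length R)
      ((?W \<Zcomp> w 0 (par Bs) (length (S @ R))) \<Zcomp> w (length (outs Bs)) (w 0 (bx b) (length R)) 0) =
     net Bs (T @ L) (S @ R) \<Zcomp> w 0 (bx b) (length R)"
    unfolding net_def using W b ok by (subst tr_tightR) (simp_all add: add_ac)
  finally show "net (Bs @ [(b, S, T)]) L R =
      trace P (length T) (length L) (length R) (net Bs (T @ L) (S @ R) \<Zcomp> w 0 (bx b) (length R))" .
qed

text \<open>\<open>tr_tens\<close> joins the loops. As the names are disjoint, the crossing it puts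
  in front is a wiring itself, and the one behind passes the boxes by naturality; both end up in a
  single wiring.\<close>

lemma net_tens:
  assumes v: "valid Bs L R" and v': "valid Bs' L' R'"
    and dj: "set (outs Bs @ L) \<inter> set (outs Bs' @ L') = {}"
  shows "net Bs L R \<otimes> net Bs' L' R' = net (Bs @ Bs') (L @ L') (R @ R')"
    and "valid (Bs @ Bs') (L @ L') (R @ R')"
proof -
  show vv: "valid (Bs @ Bs') (L @ L') (R @ R')" using v v' dj by (auto simp: valid_def)
  let ?T = "outs Bs" and ?T' = "outs Bs'" and ?S = "ins Bs" and ?S' = "ins Bs'"
  let ?m = "length L" and ?m' = "length L'" and ?n = "length R" and ?n' = "length R'"
  have ok: "\<forall>B\<in>set Bs. okb B" "\<forall>B\<in>set Bs'. okb B" and s: "set (?S @ R) \<subseteq> set (?T @ L)" "set (?S' @ R') \<subseteq> set (?T' @ L')"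
    and d: "distinct (?T @ ?T' @ L @ L')"
    using v v' dj by (auto simp: valid_def)
  let ?W = "wire (?T @ L) (?S @ R)" and ?W' = "wire (?T' @ L') (?S' @ R')"
  let ?X = "?T @ ?T' @ L @ L'"
  have W: "ar ?W" "dm ?W = length ?T + ?m" "cd ?W = length ?S + ?n" "ar ?W'" "dm ?W' = length ?T' + ?m'" "cd ?W' = length ?S' + ?n'"
    using s by simp_all
  have "net Bs L R \<otimes> net Bs' L' R' = trace P (length ?T + length ?T') (?m + ?m') (?n + ?n')
      (w (length ?T) (swap P (length ?T') ?m) ?m' \<Zcomp>
        (((?W \<Zcomp> w 0 (par Bs) ?n) \<otimes> (?W' \<Zcomp> w 0 (par Bs') ?n')) \<Zcomp> w (length ?T) (swap P ?n (length ?T')) ?n'))"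
    unfolding net_def using W ok by (intro tr_tens) simp_all
  also have "w (length ?T) (swap P (length ?T') ?m) ?m' = wire ?X (?T @ L @ ?T' @ L')"
    using d by (simp add: w_swap_wire)
  also have "(?W \<Zcomp> w 0 (par Bs) ?n) \<otimes> (?W' \<Zcomp> w 0 (par Bs') ?n') =
     wire (?T @ L @ ?T' @ L') (?S @ R @ ?S' @ R') \<Zcomp> (par Bs \<otimes> ((ident P ?n \<otimes> par Bs') \<otimes> ident P ?n'))"
    using W ok s dj by (simp add: wire_tens w_def flip: ichange)
  also have "(wire (?T @ L @ ?T' @ L') (?S @ R @ ?S' @ R') \<Zcomp> (par Bs \<otimes> ((ident P ?n \<otimes> par Bs') \<otimes> ident P ?n'))) \<Zcomp>
        w (length ?T) (swap P ?n (length ?T')) ?n' =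
     wire (?T @ L @ ?T' @ L') (?S @ R @ ?S' @ R') \<Zcomp> ((par Bs \<otimes> ((ident P ?n \<otimes> par Bs') \<otimes> ident P ?n')) \<Zcomp>
        w (length ?T) (swap P ?n (length ?T')) ?n')"
  proof -
    have "set (?S @ R @ ?S' @ R') \<subseteq> set (?T @ L @ ?T' @ L')" using s by auto
    from wire_ar[OF this] ok show ?thesis by (subst comp_assoc) simp_all
  qed
  also have "(par Bs \<otimes> ((ident P ?n \<otimes> par Bs') \<otimes> ident P ?n')) \<Zcomp> w (length ?T) (swap P ?n (length ?T')) ?n'
     = par Bs \<otimes> (((ident P ?n \<otimes> par Bs') \<Zcomp> swap P ?n (length ?T')) \<otimes> ident P ?n')"
    using ok by (simp add: w_def ichange del: tens_assoc)
  also have "(ident P ?n \<otimes> par Bs') \<Zcomp> swap P ?n (length ?T') = swap P ?n (length ?S') \<Zcomp> (par Bs' \<otimes> ident P ?n)"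
    using ok by (subst swap_nat) simp_all
  also have "par Bs \<otimes> ((swap P ?n (length ?S') \<Zcomp> (par Bs' \<otimes> ident P ?n)) \<otimes> ident P ?n')
     = w (length ?S) (swap P ?n (length ?S')) ?n' \<Zcomp> (par Bs \<otimes> ((par Bs' \<otimes> ident P ?n) \<otimes> ident P ?n'))"
    using ok by (simp add: w_def ichange del: tens_assoc tens_ident)
  also have "par Bs \<otimes> ((par Bs' \<otimes> ident P ?n) \<otimes> ident P ?n') = w 0 (par (Bs @ Bs')) (?n + ?n')"
    using ok by (simp add: par_append ball_Un w_def)
  also have "wire ?X (?T @ L @ ?T' @ L') \<Zcomp> (wire (?T @ L @ ?T' @ L') (?S @ R @ ?S' @ R') \<Zcomp>
        (w (length ?S) (swap P ?n (length ?S')) ?n' \<Zcomp> w 0 (par (Bs @ Bs')) (?n + ?n'))) =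
     (wire ?X (?T @ L @ ?T' @ L') \<Zcomp> (wire (?T @ L @ ?T' @ L') (?S @ R @ ?S' @ R') \<Zcomp>
        w (length ?S) (swap P ?n (length ?S')) ?n')) \<Zcomp> w 0 (par (Bs @ Bs')) (?n + ?n')"
  proof -
    have "set (?T @ L @ ?T' @ L') \<subseteq> set ?X" "set (?S @ R @ ?S' @ R') \<subseteq> set (?T @ L @ ?T' @ L')" "\<forall>B\<in>set (Bs @ Bs'). okb B"
      using s ok by auto
    then show ?thesis by (simp add: add_ac)
  qed
  also have "wire (?T @ L @ ?T' @ L') (?S @ R @ ?S' @ R') \<Zcomp> w (length ?S) (swap P ?n (length ?S')) ?n' =
     wire (?T @ L @ ?T' @ L') (?S @ ?S' @ R @ R')"
    using s by (intro wire_w_swap) auto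
  also have "wire ?X (?T @ L @ ?T' @ L') \<Zcomp> wire (?T @ L @ ?T' @ L') (?S @ ?S' @ R @ R') = wire ?X (?S @ ?S' @ R @ R')"
    using s d by (intro wire_comp) auto
  finally show "net Bs L R \<otimes> net Bs' L' R' = net (Bs @ Bs') (L @ L') (R @ R')"
    by (simp add: net_def)
qed

text \<open>The traced output is a copy of \<open>b\<close>, a wire other than the traced input
  \<open>a\<close>. The wiring factors into copying \<open>b\<close>, a crossing, and the rest;
  yanking removes the loop and connects \<open>b\<close> to every use of \<open>a\<close>.\<close>

lemma trace_wire:
  fixes xs :: "'v list"
  assumes "distinct (a # xs)" "b \<in> set xs" "set ys \<subseteq> set (a # xs)"
  shows "trace P 1 (length xs) (length ys) (wire (a # xs) (b # ys)) = wire xs (map (\<lambda>y. if y = a then b else y) ys)"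
proof -
  \<comment> \<open>In the intermediate stage \<open>None # Some a # ?xs\<close> the name
    \<open>None\<close> is the copy of \<open>b\<close> bound for the traced output, and
    \<open>Some a\<close> is the traced input. \<open>f\<close> gives the source of each, where
    \<open>None\<close> is reused to name the traced input; \<open>g\<close> renames
    \<open>a\<close> accordingly.\<close>
  define f where "f = (\<lambda>z. case z of None \<Rightarrow> Some b | Some x \<Rightarrow> if x = a then None else Some x)"
  define g where "g = (\<lambda>x. if x = a then None else Some x)"
  let ?xs = "map Some xs"
  have fx: "map f ?xs = ?xs" and gx: "map g xs = ?xs"
    using assms(1) by (auto simp: f_def g_def)
  have fg: "map f (map Some ys) = map g ys"
    by (auto simp: f_def g_def)
  have ab: "b \<noteq> a" using assms by auto
  have "wire (a # xs) (b # ys) = wire (map g (a # xs)) (map g (b # ys))"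
    using assms by (intro wire_rename[symmetric]) (auto simp: g_def inj_on_def)
  also have "\<dots> = wire (None # ?xs) (map f (None # map Some ys))"
    using ab by (simp add: gx fg) (simp add: g_def f_def comp_def)
  also have "\<dots> = wire (None # ?xs) (map f (None # Some a # ?xs)) \<Zcomp> wire (None # Some a # ?xs) (None # map Some ys)"
    using assms by (intro wire_comp_map[symmetric]) (auto simp: f_def distinct_map split: if_splits)
  also have "wire (None # Some a # ?xs) (None # map Some ys) = wire [None :: 'v option] [None] \<otimes> wire (map Some (a # xs)) (map Some ys)"
    using assms by (subst wire_tens) auto
  also have "wire (map Some (a # xs)) (map Some ys) = wire (a # xs) ys"
    using assms(3) by (intro wire_rename) auto
  also have "wire (None # ?xs) (map f (None # Some a # ?xs)) = wire (None # ?xs) (map f (Some a # None # ?xs)) \<Zcomp> wire (Some a # None # ?xs) (None # Some a # ?xs)"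
    using assms by (intro wire_comp_map[symmetric]) (auto simp: f_def distinct_map split: if_splits)
  also have "wire (Some a # None # ?xs) (None # Some a # ?xs) = w 0 (swap P 1 1) (length xs)"
    using w_swap_wire[of "[]" "[Some a]" "[None]" ?xs] assms by (simp add: distinct_map image_iff)
  also have "map f (Some a # None # ?xs) = [None] @ map Some (b # xs)"
    by (simp only: list.map fx append.simps) (simp add: f_def)
  also have "wire (None # ?xs) ([None] @ map Some (b # xs)) = wire [None :: 'v option] [None] \<otimes> wire ?xs (map Some (b # xs))"
    using assms by (subst wire_tens) auto
  also have "wire ?xs (map Some (b # xs)) = wire xs (b # xs)"
    using assms by (intro wire_rename) auto
  finally have e: "wire (a # xs) (b # ys) = w 1 (wire xs (b # xs)) 0 \<Zcomp> (w 0 (swap P 1 1) (length xs) \<Zcomp> w 1 (wire (a # xs) ys) 0)"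
    using assms wire_ar[of "b # xs" xs] wire_ar[of ys "a # xs"] by (simp add: ident_tens insert_absorb)
  have "trace P 1 (length xs) (length ys) (wire (a # xs) (b # ys)) =
     wire xs (b # xs) \<Zcomp> (trace P 1 (1 + length xs) (1 + length xs) (w 0 (swap P 1 1) (length xs)) \<Zcomp> wire (a # xs) ys)"
    unfolding e using assms wire_ar[of "b # xs" xs] wire_ar[of ys "a # xs"]
    by (intro tr_tight) (simp_all add: insert_absorb)
  also have "trace P 1 (1 + length xs) (1 + length xs) (w 0 (swap P 1 1) (length xs)) = ident P (1 + length xs)"
    using tr_super[of "swap P 1 1" 1 1 1 "ident P (length xs)"] by (simp only: tens_ident_w yanking) (simp add: tens_ident_w)
  also have "wire xs (b # xs) \<Zcomp> (\<dots> \<Zcomp> wire (a # xs) ys) = wire xs (map (\<lambda>y. if y = a then b else y) (a # xs)) \<Zcomp> wire (a # xs) ys"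
  proof -
    have "map (\<lambda>y. if y = a then b else y) xs = xs" using assms(1) by (intro map_idI) auto
    then show ?thesis using assms wire_ar[of ys "a # xs"] by simp
  qed
  also have "\<dots> = wire xs (map (\<lambda>y. if y = a then b else y) ys)"
    using assms by (intro wire_comp_map) auto
  finally show ?thesis .
qed

definition un :: 'a where "un = trace P 1 0 1 cp"

lemma un_ar [simp]: "ar un" "dm un = 0" "cd un = Suc 0"
  using tr_ar[of cp 1 0 1] by (simp_all add: un_def)

text \<open>The traced input is copied before anything else; one copy returns through the loop and
  the other serves the remaining uses of \<open>a\<close>, so the loop is the trace of
  \<open>cp\<close> alone.\<close>

lemma trace_wire_loop:
  fixes xs :: "'v list"
  assumes "distinct (a # xs)" "set ys \<subseteq> set (a # xs)"
  shows "trace P 1 (length xs) (length ys) (wire (a # xs) (a # ys)) = w 0 un (length xs) \<Zcomp> wire (a # xs) ys"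
proof -
  \<comment> \<open>\<open>None\<close> names the copy that returns through the loop and
    \<open>Some a\<close> the copy that goes on; both have the source \<open>a\<close>.\<close>
  define f where "f = (\<lambda>z. case z of None \<Rightarrow> a | Some x \<Rightarrow> x)"
  let ?xs = "map Some xs"
  have f: "map f (None # map Some ys) = a # ys" "map f (None # Some a # ?xs) = a # a # xs"
    by (simp_all add: f_def comp_def)
  have "wire (a # xs) (a # ys) = wire (a # xs) (map f (None # Some a # ?xs)) \<Zcomp> wire (None # Some a # ?xs) (None # map Some ys)"
    using assms unfolding f(1)[symmetric]
    by (intro wire_comp_map[symmetric]) (auto simp: f_def distinct_map)
  also have "wire (None # Some a # ?xs) (None # map Some ys) = wire [None :: 'v option] [None] \<otimes> wire (map Some (a # xs)) (map Some ys)"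
    using assms by (subst wire_tens) auto
  also have "wire (map Some (a # xs)) (map Some ys) = wire (a # xs) ys"
    using assms(2) by (intro wire_rename) auto
  also have "wire (a # xs) (map f (None # Some a # ?xs)) = wire [a] [a, a] \<otimes> wire xs xs"
    unfolding f(2) using assms by (subst wire_tens) auto
  also have "wire [a] [a, a] = cp"
    by (simp add: wire_def fn_cp[symmetric, unfolded One_nat_def] del: fn.simps)
  finally have e: "wire (a # xs) (a # ys) = w 0 cp (length xs) \<Zcomp> w 1 (wire (a # xs) ys) 0"
    using assms wire_ar[of ys "a # xs"] by (simp add: ident_tens tens_ident_w)
  have "trace P 1 (length xs) (length ys) (wire (a # xs) (a # ys)) =
     trace P 1 (length xs) (1 + length xs) (w 0 cp (length xs)) \<Zcomp> wire (a # xs) ys"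
    unfolding e using wire_ar[OF assms(2)] by (intro tr_tightR) simp_all
  also have "trace P 1 (length xs) (1 + length xs) (w 0 cp (length xs)) = w 0 un (length xs)"
    using tr_super[of cp 1 0 1 "ident P (length xs)" "length xs" "length xs"] by (simp add: tens_ident_w un_def[symmetric, unfolded One_nat_def])
  finally show ?thesis .
qed

text \<open>The trace over one wire and the trace over the box outputs are merged, reordered by a
  crossing and split in the other order. The single wire then passes beside the boxes, and only the
  wiring is traced over it.\<close>

lemma trace_net:
  assumes v: "valid Bs (a # L) (b # R)"
  shows "trace P 1 (length L) (length R) (net Bs (a # L) (b # R)) =
    trace P (length (outs Bs)) (length L) (length R)
      (trace P 1 (length (outs Bs @ L)) (length (ins Bs @ R)) (wire (a # outs Bs @ L) (b # ins Bs @ R)) \<Zcomp> w 0 (par Bs) (length R))"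
proof -
  let ?T = "outs Bs" and ?S = "ins Bs" and ?m = "length L" and ?n = "length R"
  have ok: "\<forall>B\<in>set Bs. okb B" and d: "distinct (?T @ [a] @ L)" and s: "set (?S @ [b] @ R) \<subseteq> set (?T @ [a] @ L)"
    using v by (auto simp: valid_def)
  have s': "set (b # ?S @ R) \<subseteq> set (a # ?T @ L)" using s by auto
  have s2: "set (?S @ [b] @ R) \<subseteq> set (a # ?T @ L)" using s by auto
  let ?W = "wire (?T @ [a] @ L) (?S @ [b] @ R)"
  note W = wire_ar[OF s] and W' = wire_ar[OF s'] and W2 = wire_ar[OF s2]
  let ?x = "length ?T"
  let ?H = "?W \<Zcomp> w 0 (par Bs) (1 + ?n)"
  have H: "ar ?H" "dm ?H = ?x + 1 + ?m" "cd ?H = ?x + 1 + ?n" using W ok by simp_all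
  have "trace P 1 ?m ?n (net Bs (a # L) (b # R)) = trace P (?x + 1) ?m ?n ?H"
    unfolding net_def using H by (subst tr_vanish) simp_all
  also have "\<dots> = trace P (1 + ?x) ?m ?n (w 0 (swap P 1 ?x) ?m \<Zcomp> (?H \<Zcomp> w 0 (swap P ?x 1) ?n))"
    using H by (intro tr_conj[symmetric]) simp_all
  also have "w 0 (swap P 1 ?x) ?m \<Zcomp> (?H \<Zcomp> w 0 (swap P ?x 1) ?n) =
     (w 0 (swap P 1 ?x) ?m \<Zcomp> ?W) \<Zcomp> w 0 (w 0 (par Bs) 1 \<Zcomp> swap P ?x 1) ?n"
    using W ok by (simp add: w_comp add_ac)
  also have "w 0 (par Bs) 1 \<Zcomp> swap P ?x 1 = swap P (length ?S) 1 \<Zcomp> w 1 (par Bs) 0"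
    using slideL[of "par Bs" 1] ok by simp
  also have "w 0 (swap P 1 ?x) ?m \<Zcomp> ?W = wire (a # ?T @ L) (?S @ [b] @ R)"
  proof -
    have "w 0 (swap P 1 ?x) ?m = wire (a # ?T @ L) (?T @ [a] @ L)"
      using w_swap_wire[of "[]" "[a]" ?T L] d by simp
    moreover have "wire (a # ?T @ L) (?T @ [a] @ L) \<Zcomp> ?W = wire (a # ?T @ L) (?S @ [b] @ R)"
      using d s by (intro wire_comp) auto
    ultimately show ?thesis by simp
  qed
  also have "wire (a # ?T @ L) (?S @ [b] @ R) \<Zcomp> w 0 (swap P (length ?S) 1 \<Zcomp> w 1 (par Bs) 0) ?n =
     (wire (a # ?T @ L) (?S @ [b] @ R) \<Zcomp> w 0 (swap P (length ?S) 1) ?n) \<Zcomp> w 1 (w 0 (par Bs) ?n) 0"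
    using W2 ok by (simp add: w_comp)
  also have "wire (a # ?T @ L) (?S @ [b] @ R) \<Zcomp> w 0 (swap P (length ?S) 1) ?n = wire (a # ?T @ L) (b # ?S @ R)"
    using wire_w_swap[of "[]" ?S "[b]" R "a # ?T @ L"] s2 by simp
  also have "trace P (1 + ?x) ?m ?n (wire (a # ?T @ L) (b # ?S @ R) \<Zcomp> w 1 (w 0 (par Bs) ?n) 0) =
     trace P ?x ?m ?n (trace P 1 (?x + ?m) (?x + ?n) (wire (a # ?T @ L) (b # ?S @ R) \<Zcomp> w 1 (w 0 (par Bs) ?n) 0))"
    using W' ok by (intro tr_vanish) simp_all
  also have "trace P 1 (?x + ?m) (?x + ?n) (wire (a # ?T @ L) (b # ?S @ R) \<Zcomp> w 1 (w 0 (par Bs) ?n) 0) =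
     trace P 1 (length (?T @ L)) (length (?S @ R)) (wire (a # ?T @ L) (b # ?S @ R)) \<Zcomp> w 0 (par Bs) ?n"
    using W' ok by (subst tr_tightR) simp_all
  finally show ?thesis .
qed

lemma trace_net_subst:
  assumes v: "valid Bs (a # L) (b # R)" and ab: "b \<noteq> a"
  defines "f \<equiv> (\<lambda>y. if y = a then b else y)"
  shows "trace P 1 (length L) (length R) (net Bs (a # L) (b # R)) = net (map (rename f) Bs) L (map f R)"
    and "valid (map (rename f) Bs) L (map f R)"
proof -
  have d: "distinct (a # outs Bs @ L)" and s: "set (ins Bs @ R) \<subseteq> set (a # outs Bs @ L)"
    and b: "b \<in> set (outs Bs @ L)" and ok: "\<forall>B\<in>set Bs. okb B"
    using v ab by (auto simp: valid_def)
  have T: "map f (outs Bs) = outs Bs"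
    using d by (intro map_idI) (auto simp: f_def)
  show "trace P 1 (length L) (length R) (net Bs (a # L) (b # R)) = net (map (rename f) Bs) L (map f R)"
    unfolding trace_net[OF v] trace_wire[OF d b s] by (simp add: net_def T f_def[symmetric])
  show "valid (map (rename f) Bs) L (map f R)"
    using d s b ok unfolding valid_def outs_rename ins_rename T by (auto simp: f_def)
qed

text \<open>The box \<open>u\<close> has no inputs, so sliding it along its own loop leaves a trace
  over no wires; the result is the arrow that \<open>trace_wire_loop\<close> produces.\<close>

lemma trace_net_loop:
  assumes v: "valid Bs (a # L) (a # R)" and u: "bx u = un"
  shows "trace P 1 (length L) (length R) (net Bs (a # L) (a # R)) = net ((u, [], [a]) # Bs) L R"
    and "valid ((u, [], [a]) # Bs) L R"
proof -
  let ?T = "outs Bs" and ?S = "ins Bs" and ?m = "length L" and ?n = "length R"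
  have d: "distinct (a # ?T @ L)" and s: "set (?S @ R) \<subseteq> set (a # ?T @ L)" and ok: "\<forall>B\<in>set Bs. okb B"
    using v by (auto simp: valid_def)
  let ?Z = "wire (a # ?T @ L) (?S @ R) \<Zcomp> w 0 (par Bs) ?n"
  note W = wire_ar[OF s]
  have "net ((u, [], [a]) # Bs) L R = trace P (1 + length ?T) ?m ?n
      (wire (a # ?T @ L) (?S @ R) \<Zcomp> w 0 (un \<otimes> par Bs) ?n)"
    by (simp add: net_def u)
  also have "wire (a # ?T @ L) (?S @ R) \<Zcomp> w 0 (un \<otimes> par Bs) ?n = ?Z \<Zcomp> w 0 un (length ?T + ?n)"
    using W ok by (simp add: tens_w2 w_comp)
  also have "trace P (1 + length ?T) ?m ?n \<dots> =
     trace P (length ?T) ?m ?n (trace P 1 (length ?T + ?m) (length ?T + ?n) \<dots>)"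
    using W ok by (intro tr_vanish) simp_all
  also have "trace P 1 (length ?T + ?m) (length ?T + ?n) (?Z \<Zcomp> w 0 un (length ?T + ?n)) =
     trace P 0 (length ?T + ?m) (length ?T + ?n) (w 0 un (length ?T + ?m) \<Zcomp> ?Z)"
    using W ok by (intro tr_slide[symmetric]) simp_all
  also have "\<dots> = (w 0 un (length (?T @ L)) \<Zcomp> wire (a # ?T @ L) (?S @ R)) \<Zcomp> w 0 (par Bs) ?n"
    using W ok by (subst tr_0) simp_all
  finally show "trace P 1 (length L) (length R) (net Bs (a # L) (a # R)) = net ((u, [], [a]) # Bs) L R"
    unfolding trace_net[OF v] trace_wire_loop[OF d s] ..
  show "valid ((u, [], [a]) # Bs) L R"
    using d s ok u unfolding valid_def by auto
qed

text \<open>Tightening takes the crossing under the trace, where the wiring absorbs it.\<close>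

lemma swap_net:
  assumes v: "valid Bs (L @ L') R"
  shows "swap P (length L') (length L) \<Zcomp> net Bs (L @ L') R = net Bs (L' @ L) R"
    and "valid Bs (L' @ L) R"
proof -
  let ?T = "outs Bs" and ?S = "ins Bs" and ?n = "length R"
  have d: "distinct (?T @ L' @ L)" and s: "set (?S @ R) \<subseteq> set (?T @ L @ L')" and ok: "\<forall>B\<in>set Bs. okb B"
    using v by (auto simp: valid_def)
  let ?W = "wire (?T @ L @ L') (?S @ R)"
  note W = wire_ar[OF s]
  have "swap P (length L') (length L) \<Zcomp> net Bs (L @ L') R = trace P (length ?T) (length L' + length L) ?n
      (w (length ?T) (swap P (length L') (length L)) 0 \<Zcomp> (?W \<Zcomp> w 0 (par Bs) ?n))"
    unfolding net_def using W ok by (subst tr_tightL) simp_all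
  also have "\<dots> = trace P (length ?T) (length L' + length L) ?n
      ((w (length ?T) (swap P (length L') (length L)) 0 \<Zcomp> ?W) \<Zcomp> w 0 (par Bs) ?n)"
    using W ok by (simp add: add_ac)
  also have "w (length ?T) (swap P (length L') (length L)) 0 = wire (?T @ L' @ L) (?T @ L @ L')"
    using w_swap_wire[of ?T L' L "[]"] d by simp
  also have "wire (?T @ L' @ L) (?T @ L @ L') \<Zcomp> ?W = wire (?T @ L' @ L) (?S @ R)"
    using d s by (intro wire_comp) auto
  finally show "swap P (length L') (length L) \<Zcomp> net Bs (L @ L') R = net Bs (L' @ L) R"
    by (simp add: net_def)
  show "valid Bs (L' @ L) R" using v by (auto simp: valid_def)
qed

text \<open>Names are fixed to be natural numbers so that two nets can be made disjoint by a
  shift.\<close>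

definition rep :: "nat \<Rightarrow> nat \<Rightarrow> 'a \<Rightarrow> bool" where
  "rep m n f \<longleftrightarrow> (\<exists>(Bs :: ('b \<times> nat list \<times> nat list) list) L R.
     valid Bs L R \<and> length L = m \<and> length R = n \<and> net Bs L R = f)"

lemma rep_ar: "rep m n f \<Longrightarrow> ar f \<and> dm f = m \<and> cd f = n"
  by (auto simp: rep_def)

lemma rep_fn: "set xs \<subseteq> {..<p} \<Longrightarrow> rep p (length xs) (fn p xs)"
  unfolding rep_def
  by (rule exI[of _ "[]"], rule exI[of _ "[0..<p]"], rule exI[of _ xs])
     (auto simp: net_Nil fn_wire valid_def atLeast0LessThan)

lemma rep_box:
  assumes "bx b \<in> hom P k l"
  shows "rep k l (bx b)"
proof -
  let ?S = "[0..<k]" and ?T = "[k..<k + l]"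
  have "okb (b, ?S, ?T)" using assms by (simp add: hom_iff)
  moreover have "distinct (?T @ ?S)" by auto
  ultimately show ?thesis
    unfolding rep_def using net_box[of b ?S ?T]
    by (intro exI[of _ "[(b, ?S, ?T)]"] exI[of _ ?S] exI[of _ ?T]) (auto simp: valid_def)
qed

lemma rep_tens:
  assumes "rep m n f" "rep p q g"
  shows "rep (m + p) (n + q) (f \<otimes> g)"
proof -
  obtain Bs Bs' :: "('b \<times> nat list \<times> nat list) list" and L R L' R'
    where 1: "valid Bs L R" "length L = m" "length R = n" "net Bs L R = f"
      and 2: "valid Bs' L' R'" "length L' = p" "length R' = q" "net Bs' L' R' = g"
    using assms unfolding rep_def by metis
  \<comment> \<open>\<open>N\<close> exceeds every name of the first net; the leading 0 keeps
    \<open>Max\<close> away from the empty set.\<close>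
  define N where "N = Suc (Max (set (0 # outs Bs @ L)))"
  have N: "x < N" if "x \<in> set (outs Bs @ L)" for x
    using that unfolding N_def by (intro le_imp_less_Suc Max_ge) auto
  have inj: "inj_on ((+) N) A" for A by simp
  note r = net_rename[OF 2(1) inj]
  have "set (outs Bs @ L) \<inter> set (outs (map (rename ((+) N)) Bs') @ map ((+) N) L') = {}"
    using N by fastforce
  note t = net_tens[OF 1(1) r(2) this]
  show ?thesis
    unfolding rep_def
    by (rule exI[of _ "Bs @ map (rename ((+) N)) Bs'"], rule exI[of _ "L @ map ((+) N) L'"],
        rule exI[of _ "R @ map ((+) N) R'"]) (use t r 1 2 in simp)
qed

lemma rep_swap:
  assumes "rep (m + n) p f"
  shows "rep (n + m) p (swap P n m \<Zcomp> f)"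
proof -
  obtain Bs :: "('b \<times> nat list \<times> nat list) list" and L R
    where 1: "valid Bs L R" "length L = m + n" "length R = p" "net Bs L R = f"
    using assms unfolding rep_def by metis
  have v: "valid Bs (take m L @ drop m L) R" using 1 by simp
  show ?thesis
    unfolding rep_def
    by (rule exI[of _ Bs], rule exI[of _ "drop m L @ take m L"], rule exI[of _ R])
       (use swap_net[OF v] 1 in simp)
qed

text \<open>The traced input and the traced output carry the same name, which is a loop, or
  different names, and then one is substituted for the other.\<close>

lemma rep_trace_1:
  assumes u: "bx u = un" and r: "rep (Suc m) (Suc n) f"
  shows "rep m n (trace P 1 m n f)"
proof -
  obtain Bs :: "('b \<times> nat list \<times> nat list) list" and L' R'
    where 0: "valid Bs L' R'" "length L' = Suc m" "length R' = Suc n" "net Bs L' R' = f"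
    using r unfolding rep_def by metis
  obtain a L where L: "L' = a # L" "length L = m" using 0(2) by (cases L') auto
  obtain b R where R: "R' = b # R" "length R = n" using 0(3) by (cases R') auto
  note 1 = 0(1)[unfolded L(1) R(1)] L(2) R(2) 0(4)[unfolded L(1) R(1)]
  show ?thesis
  proof (cases "b = a")
    case True
    note t = trace_net_loop[OF 1(1)[unfolded True] u]
    have e: "trace P 1 m n f = net ((u, [], [a]) # Bs) L R"
      unfolding t(1)[symmetric] 1(2,3) 1(4)[symmetric] True ..
    show ?thesis
      unfolding rep_def by (intro exI conjI, rule t(2), rule 1(2), rule 1(3), rule e[symmetric])
  next
    case False
    note t = trace_net_subst[OF 1(1) False]
    have e: "trace P 1 m n f = net (map (rename (\<lambda>y. if y = a then b else y)) Bs) L (map (\<lambda>y. if y = a then b else y) R)"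
      unfolding t(1)[symmetric] 1(2,3) 1(4)[symmetric] ..
    have l: "length (map (\<lambda>y. if y = a then b else y) R) = n" using 1(3) by simp
    show ?thesis
      unfolding rep_def by (intro exI conjI, rule t(2), rule 1(2), rule l, rule e[symmetric])
  qed
qed

lemma rep_trace:
  assumes u: "bx u = un"
  shows "rep (x + m) (x + n) f \<Longrightarrow> rep m n (trace P x m n f)"
proof (induction x arbitrary: f)
  case 0
  then show ?case using rep_ar[OF 0] by (simp add: tr_0)
next
  case (Suc x)
  have "trace P (1 + x) m n f = trace P x m n (trace P 1 (x + m) (x + n) f)"
    using rep_ar[OF Suc.prems] by (intro tr_vanish) simp_all
  moreover have "rep (x + m) (x + n) (trace P 1 (x + m) (x + n) f)"
    using Suc.prems by (intro rep_trace_1[OF u]) simp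
  ultimately show ?case using Suc.IH by simp
qed

lemma rep_comp:
  assumes u: "bx u = un" and "rep m n f" "rep n p g"
  shows "rep m p (f \<Zcomp> g)"
proof -
  have "f \<Zcomp> g = trace P n m p (swap P n m \<Zcomp> (f \<otimes> g))"
    using rep_ar[OF assms(2)] rep_ar[OF assms(3)] by (intro comp_as_trace) auto
  then show ?thesis
    using rep_trace[OF u rep_swap[OF rep_tens[OF assms(2,3)]]] by simp
qed

end

subsection \<open>Quotients of cospans\<close>

text \<open>Reflexive on the whole type, so that no carrier has to accompany the relation.\<close>

definition eqv :: "('v \<times> 'v) set \<Rightarrow> ('v \<times> 'v) set" where
  "eqv R = (R \<union> R\<inverse>)\<^sup>*"

lemma eqv_refl [simp]: "(u, u) \<in> eqv R"
  by (simp add: eqv_def)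

lemma eqv_base: "(u, v) \<in> R \<Longrightarrow> (u, v) \<in> eqv R"
  by (auto simp: eqv_def)

lemma eqv_sym: "(u, v) \<in> eqv R \<Longrightarrow> (v, u) \<in> eqv R"
proof -
  have "sym ((R \<union> R\<inverse>)\<^sup>*)" by (intro sym_rtrancl sym_Un_converse)
  then show "(u, v) \<in> eqv R \<Longrightarrow> (v, u) \<in> eqv R" unfolding eqv_def by (rule symD)
qed

lemma eqv_trans: "(u, v) \<in> eqv R \<Longrightarrow> (v, x) \<in> eqv R \<Longrightarrow> (u, x) \<in> eqv R"
  unfolding eqv_def by (rule rtrancl_trans)

lemma eqv_map:
  assumes "(u, v) \<in> eqv R" "\<And>u v. (u, v) \<in> R \<Longrightarrow> (h u, h v) \<in> eqv S"
  shows "(h u, h v) \<in> eqv S"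
  using assms(1) unfolding eqv_def[of R]
proof (induction rule: rtrancl_induct)
  case (step x y)
  from step.hyps(2) have "(x, y) \<in> R \<or> (y, x) \<in> R" by simp
  then have "(h x, h y) \<in> eqv S"
  proof
    assume "(y, x) \<in> R"
    from eqv_sym[OF assms(2)[OF this]] show ?thesis .
  qed (rule assms(2))
  with step.IH show ?case by (rule eqv_trans)
qed simp

lemma eqv_empty [simp]: "(u, v) \<in> eqv {} \<longleftrightarrow> u = v"
  by (simp add: eqv_def)

lemma eqv_cong:
  assumes "(u, v) \<in> eqv R" "\<And>u v. (u, v) \<in> R \<Longrightarrow> h u = h v"
  shows "h u = h v"
  using eqv_map[of u v R h "{}"] assms by simp

text \<open>
  A cospan whose apex carries a relation \<open>R\<close> on its vertices stands for its quotient; \<open>quots\<close> is the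
  class of all realisations of the quotient. On such representatives composition and trace
  only add pairs to the relation.
\<close>

definition quot :: "('v, 'e, 'g) cospan \<Rightarrow> ('v \<times> 'v) set \<Rightarrow> 'g ncospan \<Rightarrow> ('v \<Rightarrow> nat) \<Rightarrow> ('e \<Rightarrow> nat) \<Rightarrow> bool" where
  "quot c R z hv he \<longleftrightarrow> hyp_morphism (apex c) (apex z) hv he \<and> hv ` verts (apex c) = verts (apex z) \<and>
     bij_betw he (edges (apex c)) (edges (apex z)) \<and>
     (\<forall>u\<in>verts (apex c). \<forall>v\<in>verts (apex c). hv u = hv v \<longleftrightarrow> (u, v) \<in> eqv R) \<and>
     map hv (left_leg c) = left_leg z \<and> map hv (right_leg c) = right_leg z"

definition quots :: "'g signature \<Rightarrow> ('v, 'e, 'g) cospan \<Rightarrow> ('v \<times> 'v) set \<Rightarrow> 'g ncospan set" where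
  "quots \<Sigma> c R = {z. hyp \<Sigma> (apex z) \<and> (\<exists>hv he. quot c R z hv he)}"

lemma quot_cospan:
  assumes "cospan \<Sigma> m n c" "quot c R z hv he"
  shows "cospan \<Sigma> m n z"
proof -
  let ?C = "apex c" and ?Z = "apex z"
  have m: "hyp_morphism ?C ?Z hv he" and V: "hv ` verts ?C = verts ?Z" and E: "he ` edges ?C = edges ?Z"
    and l: "map hv (left_leg c) = left_leg z" "map hv (right_leg c) = right_leg z"
    using assms(2) unfolding quot_def bij_betw_def by auto
  have h: "hyp \<Sigma> ?C" using assms(1) by (simp add: cospan_def)
  have "hyp \<Sigma> ?Z"
    unfolding hyp_def
  proof (intro conjI ballI)
    show "finite (verts ?Z)" "finite (edges ?Z)"
      using h V E unfolding hyp_def by (metis finite_imageI)+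
    fix e assume "e \<in> edges ?Z"
    then obtain d where d: "d \<in> edges ?C" "e = he d" using E by auto
    have s: "set (sources ?C d) \<subseteq> verts ?C" "set (targets ?C d) \<subseteq> verts ?C"
      using h d(1) by (auto simp: hyp_def)
    show "label ?Z e \<in> gens \<Sigma>" "length (sources ?Z e) = arity \<Sigma> (label ?Z e)"
      "length (targets ?Z e) = coarity \<Sigma> (label ?Z e)"
      using d m h by (auto simp: hyp_morphism_def hyp_def)
    show "set (sources ?Z e) \<subseteq> verts ?Z" "set (targets ?Z e) \<subseteq> verts ?Z"
      unfolding V[symmetric] using d m s by (simp_all add: hyp_morphism_def image_mono)
  qed
  then show ?thesis
    using assms(1) l[symmetric] V by (auto simp: cospan_def)
qed

text \<open>Realisations have natural numbers as vertices, so vertices are coded injectively and a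
  class is represented by its least code.\<close>

lemma quots_nonempty:
  fixes c :: "('v, 'e, 'g) cospan"
  assumes "cospan \<Sigma> m n c"
  obtains z hv he where "quot c R z hv he" "z \<in> quots \<Sigma> c R"
proof -
  let ?V = "verts (apex c)" and ?E = "edges (apex c)"
  have f: "finite ?V" "finite ?E" using assms by (auto simp: cospan_def hyp_def)
  obtain i :: "'v \<Rightarrow> nat" where i: "inj_on i ?V" using finite_imp_inj_to_nat_seg[OF f(1)] by blast
  obtain j :: "'e \<Rightarrow> nat" where j: "inj_on j ?E" using finite_imp_inj_to_nat_seg[OF f(2)] by blast
  define r where "r = (\<lambda>u. Min (i ` {v \<in> ?V. (u, v) \<in> eqv R}))"
  have r: "r u = r v \<longleftrightarrow> (u, v) \<in> eqv R" if uv: "u \<in> ?V" "v \<in> ?V" for u v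
  proof
    assume "(u, v) \<in> eqv R"
    then have "(u, x) \<in> eqv R \<longleftrightarrow> (v, x) \<in> eqv R" for x
      by (meson eqv_trans eqv_sym)
    then show "r u = r v" by (simp add: r_def)
  next
    assume e: "r u = r v"
    have "r x \<in> i ` {y \<in> ?V. (x, y) \<in> eqv R}" if "x \<in> ?V" for x
      unfolding r_def using that f by (intro Min_in) auto
    with uv obtain x y where "x \<in> ?V" "(u, x) \<in> eqv R" "r u = i x" "y \<in> ?V" "(v, y) \<in> eqv R" "r v = i y"
      by blast
    moreover from this have "x = y" using e i by (metis inj_onD)
    ultimately show "(u, v) \<in> eqv R" by (meson eqv_sym eqv_trans)
  qed
  define k where "k = inv_into ?E j"
  have k: "k (j e) = e" if "e \<in> ?E" for e using that j by (simp add: k_def)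
  define z where "z = \<lparr>apex = \<lparr>verts = r ` ?V, edges = j ` ?E, label = \<lambda>e. label (apex c) (k e),
      sources = \<lambda>e. map r (sources (apex c) (k e)), targets = \<lambda>e. map r (targets (apex c) (k e))\<rparr>,
      left_leg = map r (left_leg c), right_leg = map r (right_leg c)\<rparr>"
  have q: "quot c R z r j"
    using j by (auto simp: quot_def z_def hyp_morphism_def k bij_betw_def r)
  have "z \<in> quots \<Sigma> c R"
    using q quot_cospan[OF assms q] unfolding quots_def cospan_def by blast
  with q show thesis by (rule that)
qed

text \<open>Both vertex maps identify the same pairs, so each factors through the other.\<close>

lemma quot_unique:
  assumes c: "cospan \<Sigma> m n c" and q: "quot c R z hv he" "quot c R z' hv' he'"
  shows "cospan_iso z z'"
proof -
  let ?C = "apex c" and ?Z = "apex z" and ?Z' = "apex z'"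
  define g where "g = (\<lambda>x. hv' (inv_into (verts ?C) hv x))"
  define k where "k = (\<lambda>e. he' (inv_into (edges ?C) he e))"
  have m: "hyp_morphism ?C ?Z hv he" and V: "hv ` verts ?C = verts ?Z" and E: "bij_betw he (edges ?C) (edges ?Z)"
    and e: "\<And>u v. u \<in> verts ?C \<Longrightarrow> v \<in> verts ?C \<Longrightarrow> hv u = hv v \<longleftrightarrow> (u, v) \<in> eqv R"
    and l: "map hv (left_leg c) = left_leg z" "map hv (right_leg c) = right_leg z"
    using q(1) unfolding quot_def by auto
  have m': "hyp_morphism ?C ?Z' hv' he'" and V': "hv' ` verts ?C = verts ?Z'" and E': "bij_betw he' (edges ?C) (edges ?Z')"
    and e': "\<And>u v. u \<in> verts ?C \<Longrightarrow> v \<in> verts ?C \<Longrightarrow> hv' u = hv' v \<longleftrightarrow> (u, v) \<in> eqv R"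
    and l': "map hv' (left_leg c) = left_leg z'" "map hv' (right_leg c) = right_leg z'"
    using q(2) unfolding quot_def by auto
  have h: "hyp \<Sigma> ?C" and lc: "set (left_leg c) \<subseteq> verts ?C" "set (right_leg c) \<subseteq> verts ?C"
    using c by (auto simp: cospan_def)
  have g: "g (hv u) = hv' u" if "u \<in> verts ?C" for u
  proof -
    have "hv (inv_into (verts ?C) hv (hv u)) = hv u" "inv_into (verts ?C) hv (hv u) \<in> verts ?C"
      using that by (simp_all add: f_inv_into_f inv_into_into)
    then show ?thesis unfolding g_def using e e' that by blast
  qed
  have k: "k (he d) = he' d" if "d \<in> edges ?C" for d
    using that E by (simp add: k_def bij_betw_def)
  have gm: "map g (map hv xs) = map hv' xs" if "set xs \<subseteq> verts ?C" for xs
    using that g by auto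
  have "bij_betw g (verts ?Z) (verts ?Z')"
    unfolding bij_betw_def inj_on_def V[symmetric] V'[symmetric]
    using g e e' by (force simp: image_iff)
  moreover have "bij_betw k (edges ?Z) (edges ?Z')"
  proof -
    have "bij_betw (he' \<circ> inv_into (edges ?C) he) (edges ?Z) (edges ?Z')"
      using bij_betw_trans[OF bij_betw_inv_into[OF E] E'] .
    then show ?thesis by (simp add: k_def comp_def)
  qed
  moreover have "hyp_morphism ?Z ?Z' g k"
    unfolding hyp_morphism_def
  proof (intro conjI ballI)
    show "g ` verts ?Z \<subseteq> verts ?Z'" "k ` edges ?Z \<subseteq> edges ?Z'"
      using calculation by (auto simp: bij_betw_def)
    fix x assume "x \<in> edges ?Z"
    then obtain d where d: "d \<in> edges ?C" "x = he d" using E by (auto simp: bij_betw_def)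
    have s: "set (sources ?C d) \<subseteq> verts ?C" "set (targets ?C d) \<subseteq> verts ?C"
      using h d(1) by (auto simp: hyp_def)
    show "label ?Z' (k x) = label ?Z x" "sources ?Z' (k x) = map g (sources ?Z x)"
      "targets ?Z' (k x) = map g (targets ?Z x)"
      using d m m' gm[OF s(1)] gm[OF s(2)] by (simp_all add: hyp_morphism_def k)
  qed
  moreover have "map g (left_leg z) = left_leg z'" "map g (right_leg z) = right_leg z'"
    unfolding l[symmetric] l'[symmetric] using lc by (simp_all only: gm)
  ultimately show ?thesis unfolding cospan_iso_def by blast
qed

lemma quot_iso:
  assumes q: "quot c R z hv he" and i: "cospan_iso z z'" and c: "cospan \<Sigma> m n c"
  obtains hv' he' where "quot c R z' hv' he'"
proof -
  let ?C = "apex c" and ?Z = "apex z" and ?Z' = "apex z'"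
  have m: "hyp_morphism ?C ?Z hv he" and V: "hv ` verts ?C = verts ?Z" and E: "bij_betw he (edges ?C) (edges ?Z)"
    and e: "\<And>u v. u \<in> verts ?C \<Longrightarrow> v \<in> verts ?C \<Longrightarrow> hv u = hv v \<longleftrightarrow> (u, v) \<in> eqv R"
    and l: "map hv (left_leg c) = left_leg z" "map hv (right_leg c) = right_leg z"
    using q unfolding quot_def by auto
  obtain g k where g: "hyp_morphism ?Z ?Z' g k" "bij_betw g (verts ?Z) (verts ?Z')" "bij_betw k (edges ?Z) (edges ?Z')"
    "map g (left_leg z) = left_leg z'" "map g (right_leg z) = right_leg z'"
    using i unfolding cospan_iso_def by blast
  have "hyp_morphism ?C ?Z' (g \<circ> hv) (k \<circ> he)"
    using m g(1) unfolding hyp_morphism_def by (simp add: image_subset_iff)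
  moreover have "(g \<circ> hv) ` verts ?C = verts ?Z'"
    unfolding image_comp[symmetric] V using g(2) by (simp add: bij_betw_def)
  moreover have "(g \<circ> hv) u = (g \<circ> hv) v \<longleftrightarrow> (u, v) \<in> eqv R" if "u \<in> verts ?C" "v \<in> verts ?C" for u v
  proof -
    have "hv u \<in> verts ?Z" "hv v \<in> verts ?Z" using that V by auto
    from inj_on_eq_iff[OF bij_betw_imp_inj_on[OF g(2)] this] show ?thesis using e[OF that] by simp
  qed
  ultimately have "quot c R z' (g \<circ> hv) (k \<circ> he)"
    unfolding quot_def using bij_betw_trans[OF E g(3)] l g(4,5) by (simp flip: map_map)
  then show thesis by (rule that)
qed

text \<open>Any two realisations are isomorphic, and whatever is isomorphic to a realisation is one;
  so delayed quotients are values of the same kind as the arrows of the PROP of cospans.\<close>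

lemma quots_class:
  assumes c: "cospan \<Sigma> m n c" and z: "z \<in> quots \<Sigma> c R"
  shows "quots \<Sigma> c R = cospan_class \<Sigma> z"
proof -
  obtain hv he where q: "quot c R z hv he" using z by (auto simp: quots_def)
  show ?thesis
    using quot_unique[OF c q] quot_iso[OF q _ c] unfolding quots_def cospan_class_def by blast
qed

lemma cospan_class_quots:
  assumes c: "cospan \<Sigma> m n c"
  shows "cospan_class \<Sigma> c = quots \<Sigma> c {}"
proof -
  have "quot c {} z hv he \<longleftrightarrow> hyp_morphism (apex c) (apex z) hv he \<and>
      bij_betw hv (verts (apex c)) (verts (apex z)) \<and> bij_betw he (edges (apex c)) (edges (apex z)) \<and>
      map hv (left_leg c) = left_leg z \<and> map hv (right_leg c) = right_leg z" for z hv he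
    by (auto simp: quot_def bij_betw_def inj_on_def)
  then show ?thesis by (simp add: cospan_class_def quots_def cospan_iso_def)
qed

text \<open>The comparison principle for delayed quotients: \<open>hv\<close> and \<open>kv\<close>
  are mutually inverse up to the relations only. Hyperedges are matched by the bijection
  \<open>he\<close>, so \<open>kv\<close> is a plain map of vertices and not a morphism.\<close>

lemma quots_eqI:
  fixes c :: "('v, 'e, 'g) cospan" and d :: "('w, 'f, 'g) cospan"
  assumes c: "cospan \<Sigma> m n c" and d: "cospan \<Sigma> m n d"
    and hm: "hyp_morphism (apex c) (apex d) hv he" and be: "bij_betw he (edges (apex c)) (edges (apex d))"
    and ll: "map hv (left_leg c) = left_leg d" and rl: "map hv (right_leg c) = right_leg d"
    and hR: "\<And>u v. (u, v) \<in> R \<Longrightarrow> (hv u, hv v) \<in> eqv S"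
    and kV: "\<And>x. x \<in> verts (apex d) \<Longrightarrow> kv x \<in> verts (apex c)"
    and kS: "\<And>x y. (x, y) \<in> S \<Longrightarrow> (kv x, kv y) \<in> eqv R"
    and kh: "\<And>u. u \<in> verts (apex c) \<Longrightarrow> (kv (hv u), u) \<in> eqv R"
    and hk: "\<And>x. x \<in> verts (apex d) \<Longrightarrow> (hv (kv x), x) \<in> eqv S"
  shows "quots \<Sigma> c R = quots \<Sigma> d S"
proof -
  obtain z gv ge where q: "quot d S z gv ge" and z: "z \<in> quots \<Sigma> d S"
    using quots_nonempty[OF d] .
  let ?C = "apex c" and ?D = "apex d" and ?Z = "apex z"
  have m: "hyp_morphism ?D ?Z gv ge" and V: "gv ` verts ?D = verts ?Z" and E: "bij_betw ge (edges ?D) (edges ?Z)"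
    and e: "\<And>u v. u \<in> verts ?D \<Longrightarrow> v \<in> verts ?D \<Longrightarrow> gv u = gv v \<longleftrightarrow> (u, v) \<in> eqv S"
    and l: "map gv (left_leg d) = left_leg z" "map gv (right_leg d) = right_leg z"
    using q unfolding quot_def by auto
  have hV: "hv u \<in> verts ?D" if "u \<in> verts ?C" for u
    using that hm by (auto simp: hyp_morphism_def)
  have "hyp_morphism ?C ?Z (gv \<circ> hv) (ge \<circ> he)"
    using hm m unfolding hyp_morphism_def by (simp add: image_subset_iff)
  moreover have "(gv \<circ> hv) ` verts ?C = verts ?Z"
  proof
    show "(gv \<circ> hv) ` verts ?C \<subseteq> verts ?Z" using hV V by auto
    show "verts ?Z \<subseteq> (gv \<circ> hv) ` verts ?C"
    proof
      fix x assume "x \<in> verts ?Z"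
      then obtain y where y: "y \<in> verts ?D" "x = gv y" using V by auto
      then have "x = gv (hv (kv y))"
        using iffD2[OF e[OF hV[OF kV[OF y(1)]] y(1)] hk[OF y(1)]] by simp
      then show "x \<in> (gv \<circ> hv) ` verts ?C" using kV[OF y(1)] by auto
    qed
  qed
  moreover have "(gv \<circ> hv) u = (gv \<circ> hv) v \<longleftrightarrow> (u, v) \<in> eqv R" if uv: "u \<in> verts ?C" "v \<in> verts ?C" for u v
  proof -
    have "(hv u, hv v) \<in> eqv S \<longleftrightarrow> (u, v) \<in> eqv R"
    proof
      assume "(hv u, hv v) \<in> eqv S"
      then have "(kv (hv u), kv (hv v)) \<in> eqv R" by (rule eqv_map) (rule kS)
      from eqv_trans[OF eqv_sym[OF kh[OF uv(1)]] eqv_trans[OF this kh[OF uv(2)]]]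
      show "(u, v) \<in> eqv R" .
    next
      assume "(u, v) \<in> eqv R"
      then show "(hv u, hv v) \<in> eqv S" by (rule eqv_map) (rule hR)
    qed
    then show ?thesis using e hV uv by simp
  qed
  ultimately have "quot c R z (gv \<circ> hv) (ge \<circ> he)"
    unfolding quot_def using bij_betw_trans[OF be E] l ll rl by (simp flip: map_map)
  then have "z \<in> quots \<Sigma> c R" using z by (auto simp: quots_def)
  then show ?thesis using quots_class[OF c] quots_class[OF d z] by simp
qed

lemma cospan_class_eqI:
  assumes "cospan \<Sigma> m n c" "cospan \<Sigma> m n d"
    and "hyp_morphism (apex c) (apex d) hv he" "bij_betw he (edges (apex c)) (edges (apex d))"
    and "map hv (left_leg c) = left_leg d" "map hv (right_leg c) = right_leg d"
    and "bij_betw hv (verts (apex c)) (verts (apex d))"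
  shows "cospan_class \<Sigma> c = cospan_class \<Sigma> d"
  unfolding cospan_class_quots[OF assms(1)] cospan_class_quots[OF assms(2)]
  by (rule quots_eqI[OF assms(1-6), where kv = "inv_into (verts (apex c)) hv"])
     (use assms(7) in \<open>auto simp: bij_betw_def f_inv_into_f inv_into_into\<close>)

subsection \<open>Composition and tensor\<close>

text \<open>The disjoint union before gluing; collapsing \<open>glue_rel\<close> turns its apex into
  the pushout.\<close>

definition csp_glue :: "('v, 'e, 'g) cospan \<Rightarrow> ('w, 'f, 'g) cospan \<Rightarrow> ('v + 'w, 'e + 'f, 'g) cospan" where
  "csp_glue c d = \<lparr>apex = hyp_sum (apex c) (apex d), left_leg = map Inl (left_leg c), right_leg = map Inr (right_leg d)\<rparr>"

definition sum_rel :: "('v \<times> 'v) set \<Rightarrow> ('w \<times> 'w) set \<Rightarrow> (('v + 'w) \<times> ('v + 'w)) set" where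
  "sum_rel R S = map_prod Inl Inl ` R \<union> map_prod Inr Inr ` S"

definition glue_rel :: "('v, 'e, 'g) cospan \<Rightarrow> ('w, 'f, 'g) cospan \<Rightarrow> (('v + 'w) \<times> ('v + 'w)) set" where
  "glue_rel c d = set (zip (map Inl (right_leg c)) (map Inr (left_leg d)))"

lemma hyp_sum_simps [simp]:
  "verts (hyp_sum F G) = verts F <+> verts G" "edges (hyp_sum F G) = edges F <+> edges G"
  "label (hyp_sum F G) (Inl e) = label F e" "label (hyp_sum F G) (Inr e') = label G e'"
  "sources (hyp_sum F G) (Inl e) = map Inl (sources F e)" "sources (hyp_sum F G) (Inr e') = map Inr (sources G e')"
  "targets (hyp_sum F G) (Inl e) = map Inl (targets F e)" "targets (hyp_sum F G) (Inr e') = map Inr (targets G e')"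
  by (simp_all add: hyp_sum_def)

lemma csp_glue_simps [simp]:
  "apex (csp_glue c d) = hyp_sum (apex c) (apex d)" "left_leg (csp_glue c d) = map Inl (left_leg c)"
  "right_leg (csp_glue c d) = map Inr (right_leg d)"
  by (simp_all add: csp_glue_def)

lemma cospan_sum_simps [simp]:
  "apex (cospan_sum c d) = hyp_sum (apex c) (apex d)"
  "left_leg (cospan_sum c d) = map Inl (left_leg c) @ map Inr (left_leg d)"
  "right_leg (cospan_sum c d) = map Inl (right_leg c) @ map Inr (right_leg d)"
  by (simp_all add: cospan_sum_def)

lemma hyp_hyp_sum: "hyp \<Sigma> F \<Longrightarrow> hyp \<Sigma> G \<Longrightarrow> hyp \<Sigma> (hyp_sum F G)"
  unfolding hyp_def by (auto elim!: PlusE; blast)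

lemma cospan_glue: "cospan \<Sigma> m n c \<Longrightarrow> cospan \<Sigma> n' p d \<Longrightarrow> cospan \<Sigma> m p (csp_glue c d)"
  by (auto simp: cospan_def hyp_hyp_sum)

lemma cospan_cospan_sum: "cospan \<Sigma> m n c \<Longrightarrow> cospan \<Sigma> p q d \<Longrightarrow> cospan \<Sigma> (m + p) (n + q) (cospan_sum c d)"
  by (auto simp: cospan_def hyp_hyp_sum)

lemma ball_Plus: "(\<forall>x\<in>A <+> B. Q x) \<longleftrightarrow> (\<forall>a\<in>A. Q (Inl a)) \<and> (\<forall>b\<in>B. Q (Inr b))"
  by (auto simp: Plus_def)

lemma hyp_morphism_sum:
  "hyp_morphism (hyp_sum F G) H hv he \<longleftrightarrow>
     hyp_morphism F H (hv \<circ> Inl) (he \<circ> Inl) \<and> hyp_morphism G H (hv \<circ> Inr) (he \<circ> Inr)"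
  unfolding hyp_morphism_def image_subset_iff by (simp add: ball_Plus) blast

lemma bij_betw_map_sum:
  assumes "bij_betw f A A'" "bij_betw g B B'"
  shows "bij_betw (map_sum f g) (A <+> B) (A' <+> B')"
proof -
  have "inj_on (map_sum f g) (A <+> B)"
  proof (rule inj_onI)
    fix x y assume "x \<in> A <+> B" "y \<in> A <+> B" "map_sum f g x = map_sum f g y"
    then show "x = y"
      using inj_onD[OF bij_betw_imp_inj_on[OF assms(1)]] inj_onD[OF bij_betw_imp_inj_on[OF assms(2)]]
      by (cases x; cases y) auto
  qed
  moreover have "map_sum f g ` (A <+> B) = f ` A <+> g ` B"
    by (simp add: Plus_def image_Un image_image)
  ultimately show ?thesis using assms by (simp add: bij_betw_def)
qed

text \<open>Collapsing in two stages: realise both summands, then collapse the image of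
  \<open>Z\<close>. The legs and \<open>Z\<close> are left open so that composition and tensor are
  both instances.\<close>

lemma quot_sum:
  assumes c: "cospan \<Sigma> m n c" "quot c R c' hc ec" and cR: "R \<subseteq> verts (apex c) \<times> verts (apex c)"
    and d: "cospan \<Sigma> p q d" "quot d S d' gd ed" and dS: "S \<subseteq> verts (apex d) \<times> verts (apex d)"
    and l: "set l \<subseteq> verts (apex c) <+> verts (apex d)" and r: "set r \<subseteq> verts (apex c) <+> verts (apex d)"
    and Z: "Z \<subseteq> (verts (apex c) <+> verts (apex d)) \<times> (verts (apex c) <+> verts (apex d))"
  shows "quots \<Sigma> \<lparr>apex = hyp_sum (apex c) (apex d), left_leg = l, right_leg = r\<rparr> (sum_rel R S \<union> Z) =
    quots \<Sigma> \<lparr>apex = hyp_sum (apex c') (apex d'), left_leg = map (map_sum hc gd) l, right_leg = map (map_sum hc gd) r\<rparr>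
      (map_prod (map_sum hc gd) (map_sum hc gd) ` Z)"
proof -
  let ?h = "map_sum hc gd"
  let ?R = "sum_rel R S \<union> Z" and ?S = "map_prod ?h ?h ` Z"
  define kc where "kc = inv_into (verts (apex c)) hc"
  define kd where "kd = inv_into (verts (apex d)) gd"
  note qc = c(2)[unfolded quot_def] and qd = d(2)[unfolded quot_def]
  have hyps: "hyp \<Sigma> (apex c)" "hyp \<Sigma> (apex d)" "hyp \<Sigma> (apex c')" "hyp \<Sigma> (apex d')"
    using c(1) d(1) quot_cospan[OF c] quot_cospan[OF d] by (auto simp: cospan_def)
  have Vc: "hc ` verts (apex c) = verts (apex c')" and Vd: "gd ` verts (apex d) = verts (apex d')"
    using qc qd by auto
  have kc: "kc x \<in> verts (apex c)" "hc (kc x) = x" if "x \<in> verts (apex c')" for x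
    using that Vc by (auto simp: kc_def inv_into_into f_inv_into_f)
  have kd: "kd x \<in> verts (apex d)" "gd (kd x) = x" if "x \<in> verts (apex d')" for x
    using that Vd by (auto simp: kd_def inv_into_into f_inv_into_f)
  have kc': "(Inl (kc (hc u)), Inl u) \<in> eqv ?R" if u: "u \<in> verts (apex c)" for u
  proof -
    have "hc u \<in> verts (apex c')" using u Vc by auto
    then have "(kc (hc u), u) \<in> eqv R" using qc kc[of "hc u"] u by auto
    then show ?thesis by (rule eqv_map[where h = Inl]) (auto simp: sum_rel_def intro: eqv_base)
  qed
  have kd': "(Inr (kd (gd u)), Inr u) \<in> eqv ?R" if u: "u \<in> verts (apex d)" for u
  proof -
    have "gd u \<in> verts (apex d')" using u Vd by auto
    then have "(kd (gd u), u) \<in> eqv S" using qd kd[of "gd u"] u by auto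
    then show ?thesis by (rule eqv_map[where h = Inr]) (auto simp: sum_rel_def intro: eqv_base)
  qed
  let ?k = "map_sum kc kd"
  have kh: "(?k (?h u), u) \<in> eqv ?R" if "u \<in> verts (apex c) <+> verts (apex d)" for u
    using that kc' kd' by auto
  have hl: "map_sum hc gd ` (verts (apex c) <+> verts (apex d)) \<subseteq> verts (apex c') <+> verts (apex d')"
    using Vc Vd by auto
  show ?thesis
  proof (rule quots_eqI[where hv = ?h and he = "map_sum ec ed" and kv = ?k and m = "length l" and n = "length r"])
    show "cospan \<Sigma> (length l) (length r) \<lparr>apex = hyp_sum (apex c) (apex d), left_leg = l, right_leg = r\<rparr>"
      using l r hyps by (simp add: cospan_def hyp_hyp_sum)
    show "cospan \<Sigma> (length l) (length r) \<lparr>apex = hyp_sum (apex c') (apex d'),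
        left_leg = map ?h l, right_leg = map ?h r\<rparr>"
      using image_mono[OF l] image_mono[OF r] hyps hl
      by (simp add: cospan_def hyp_hyp_sum order_trans[OF image_mono hl] l r)
    show "hyp_morphism (apex \<lparr>apex = hyp_sum (apex c) (apex d), left_leg = l, right_leg = r\<rparr>)
      (apex \<lparr>apex = hyp_sum (apex c') (apex d'), left_leg = map ?h l, right_leg = map ?h r\<rparr>) ?h (map_sum ec ed)"
      using qc qd unfolding hyp_morphism_def by (auto simp: ball_Plus image_subset_iff)
    have "bij_betw (map_sum ec ed) (edges (apex c) <+> edges (apex d)) (edges (apex c') <+> edges (apex d'))"
      using qc qd by (simp add: bij_betw_map_sum)
    then show "bij_betw (map_sum ec ed) (edges (apex \<lparr>apex = hyp_sum (apex c) (apex d), left_leg = l, right_leg = r\<rparr>))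
      (edges (apex \<lparr>apex = hyp_sum (apex c') (apex d'), left_leg = map ?h l, right_leg = map ?h r\<rparr>))"
      by simp
    show "(?h u, ?h v) \<in> eqv ?S" if "(u, v) \<in> ?R" for u v
      using that
    proof (cases "(u, v) \<in> Z")
      case True
      then show ?thesis by (intro eqv_base) auto
    next
      case False
      with that consider a b where "u = Inl a" "v = Inl b" "(a, b) \<in> R" | a b where "u = Inr a" "v = Inr b" "(a, b) \<in> S"
        by (auto simp: sum_rel_def)
      then have "?h u = ?h v"
      proof cases
        case 1
        then have "(a, b) \<in> eqv R" by (intro eqv_base)
        then show ?thesis using qc 1 cR by auto
      next
        case 2
        then have "(a, b) \<in> eqv S" by (intro eqv_base)
        then show ?thesis using qd 2 dS by auto
      qed
      then show ?thesis by simp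
    qed
    show "?k x \<in> verts (apex \<lparr>apex = hyp_sum (apex c) (apex d), left_leg = l, right_leg = r\<rparr>)"
      if "x \<in> verts (apex \<lparr>apex = hyp_sum (apex c') (apex d'), left_leg = map ?h l, right_leg = map ?h r\<rparr>)" for x
      using that kc kd by auto
    show "(?k x, ?k y) \<in> eqv ?R" if "(x, y) \<in> ?S" for x y
    proof -
      from that obtain u v where u: "(u, v) \<in> Z" "x = ?h u" "y = ?h v" by auto
      with Z have "(?k x, u) \<in> eqv ?R" "(?k y, v) \<in> eqv ?R" using kh by auto
      moreover have "(u, v) \<in> eqv ?R" using u by (auto intro: eqv_base)
      ultimately show ?thesis by (meson eqv_trans eqv_sym)
    qed
    show "(?k (?h u), u) \<in> eqv ?R"
      if "u \<in> verts (apex \<lparr>apex = hyp_sum (apex c) (apex d), left_leg = l, right_leg = r\<rparr>)" for u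
      using that by (intro kh) simp
    show "(?h (?k x), x) \<in> eqv ?S"
      if "x \<in> verts (apex \<lparr>apex = hyp_sum (apex c') (apex d'), left_leg = map ?h l, right_leg = map ?h r\<rparr>)" for x
      using that kc kd by auto
  qed simp_all
qed

text \<open>A competing cocone agrees on glued vertices, hence is constant on the classes; the
  mediating maps are read off on preimages under \<open>hv\<close> and \<open>he\<close>.\<close>

lemma pushout_quot:
  fixes c d :: "'g ncospan"
  assumes c: "cospan \<Sigma> m n c" and d: "cospan \<Sigma> n p d"
    and q: "quot (csp_glue c d) (glue_rel c d) z hv he" and z: "hyp \<Sigma> (apex z)"
  shows "is_pushout \<Sigma> (right_leg c) (left_leg d) (apex c) (apex d) (apex z)
    (hv \<circ> Inl) (he \<circ> Inl) (hv \<circ> Inr) (he \<circ> Inr)"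
    and "left_leg z = map (hv \<circ> Inl) (left_leg c)" "right_leg z = map (hv \<circ> Inr) (right_leg d)"
proof -
  let ?V = "verts (apex c) <+> verts (apex d)" and ?E = "edges (apex c) <+> edges (apex d)"
  have m: "hyp_morphism (hyp_sum (apex c) (apex d)) (apex z) hv he"
    and V: "hv ` ?V = verts (apex z)" and E: "bij_betw he ?E (edges (apex z))"
    and e: "\<And>u v. u \<in> ?V \<Longrightarrow> v \<in> ?V \<Longrightarrow> hv u = hv v \<longleftrightarrow> (u, v) \<in> eqv (glue_rel c d)"
    and l: "map hv (map Inl (left_leg c)) = left_leg z" "map hv (map Inr (right_leg d)) = right_leg z"
    using q unfolding quot_def by auto
  show "left_leg z = map (hv \<circ> Inl) (left_leg c)" "right_leg z = map (hv \<circ> Inr) (right_leg d)"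
    using l by simp_all
  have mc: "hyp_morphism (apex c) (apex z) (hv \<circ> Inl) (he \<circ> Inl)"
    and md: "hyp_morphism (apex d) (apex z) (hv \<circ> Inr) (he \<circ> Inr)"
    using m by (simp_all add: hyp_morphism_sum)
  have lr: "length (right_leg c) = n" "length (left_leg d) = n" "set (right_leg c) \<subseteq> verts (apex c)" "set (left_leg d) \<subseteq> verts (apex d)"
    and hc: "hyp \<Sigma> (apex c)" and gd: "hyp \<Sigma> (apex d)"
    using c d by (auto simp: cospan_def)
  have sq: "map (hv \<circ> Inl) (right_leg c) = map (hv \<circ> Inr) (left_leg d)"
  proof (rule nth_equalityI)
    fix i assume "i < length (map (hv \<circ> Inl) (right_leg c))"
    then have i: "i < n" using lr by simp
    then have "(Inl (right_leg c ! i), Inr (left_leg d ! i)) \<in> glue_rel c d"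
      using lr by (auto simp: glue_rel_def in_set_zip intro!: exI[of _ i])
    moreover have "Inl (right_leg c ! i) \<in> ?V" "Inr (left_leg d ! i) \<in> ?V"
      using i lr nth_mem by (metis InlI subsetD, metis InrI subsetD)
    ultimately have "hv (Inl (right_leg c ! i)) = hv (Inr (left_leg d ! i))"
      using e eqv_base by metis
    then show "map (hv \<circ> Inl) (right_leg c) ! i = map (hv \<circ> Inr) (left_leg d) ! i"
      using i lr by simp
  qed (use lr in simp)
  show "is_pushout \<Sigma> (right_leg c) (left_leg d) (apex c) (apex d) (apex z)
    (hv \<circ> Inl) (he \<circ> Inl) (hv \<circ> Inr) (he \<circ> Inr)"
    unfolding is_pushout_def Let_def
  proof (intro conjI allI impI z mc md sq, goal_cases)
    case (1 K pv pe qv qe)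
    then have pm: "hyp_morphism (apex c) K pv pe" and qm: "hyp_morphism (apex d) K qv qe"
      and pq: "map pv (right_leg c) = map qv (left_leg d)" by auto
    let ?f = "case_sum pv qv" and ?g = "case_sum pe qe"
    define uv where "uv = (\<lambda>x. ?f (inv_into ?V hv x))"
    define ue where "ue = (\<lambda>x. ?g (inv_into ?E he x))"
    have uv: "uv (hv s) = ?f s" if s: "s \<in> ?V" for s
    proof -
      have i: "hv (inv_into ?V hv (hv s)) = hv s" "inv_into ?V hv (hv s) \<in> ?V"
        using s by (simp_all add: f_inv_into_f inv_into_into)
      have "(inv_into ?V hv (hv s), s) \<in> eqv (glue_rel c d)"
        by (rule iffD1[OF e[OF i(2) s] i(1)])
      then show ?thesis unfolding uv_def
      proof (rule eqv_cong)
        fix u v assume "(u, v) \<in> glue_rel c d"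
        then obtain i where "i < n" "u = Inl (right_leg c ! i)" "v = Inr (left_leg d ! i)"
          using lr by (auto simp: glue_rel_def in_set_zip)
        then show "?f u = ?f v" using arg_cong[OF pq, of "\<lambda>xs. xs ! i"] lr by simp
      qed
    qed
    have uvl: "uv (hv (Inl v)) = pv v" if "v \<in> verts (apex c)" for v
      using uv[of "Inl v"] that by auto
    have uvr: "uv (hv (Inr v)) = qv v" if "v \<in> verts (apex d)" for v
      using uv[of "Inr v"] that by auto
    have ue: "ue (he s) = ?g s" if "s \<in> ?E" for s
      using that E by (simp add: ue_def bij_betw_def)
    have uel: "ue (he (Inl a)) = pe a" if "a \<in> edges (apex c)" for a
      using ue[of "Inl a"] that by auto
    have uer: "ue (he (Inr a)) = qe a" if "a \<in> edges (apex d)" for a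
      using ue[of "Inr a"] that by auto
    have um: "hyp_morphism (apex z) K uv ue"
      unfolding hyp_morphism_def
    proof (intro conjI ballI)
      show "uv ` verts (apex z) \<subseteq> verts K"
        unfolding V[symmetric] using uv pm qm by (auto simp: hyp_morphism_def image_subset_iff)
      show "ue ` edges (apex z) \<subseteq> edges K"
        unfolding bij_betw_imp_surj_on[OF E, symmetric] using ue pm qm
        by (auto simp: hyp_morphism_def image_subset_iff)
      fix x assume "x \<in> edges (apex z)"
      then obtain s where s: "s \<in> ?E" "x = he s" using E by (auto simp: bij_betw_def)
      have "label K (ue x) = label (apex z) x \<and> sources K (ue x) = map uv (sources (apex z) x) \<and>
        targets K (ue x) = map uv (targets (apex z) x)"
      proof (cases s)
        case (Inl a)
        then have a: "a \<in> edges (apex c)" using s by auto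
        have "set (sources (apex c) a) \<subseteq> verts (apex c)" "set (targets (apex c) a) \<subseteq> verts (apex c)"
          using a hc by (auto simp: hyp_def)
        then have "map uv (map (hv \<circ> Inl) (sources (apex c) a)) = map pv (sources (apex c) a)"
          "map uv (map (hv \<circ> Inl) (targets (apex c) a)) = map pv (targets (apex c) a)"
          by (auto simp: uvl subset_iff)
        moreover have "ue x = pe a" "label K (pe a) = label (apex c) a" "label (apex z) x = label (apex c) a"
          using s Inl ue[of "Inl a"] pm mc a by (auto simp: hyp_morphism_def)
        ultimately show ?thesis using s Inl pm mc a by (simp add: hyp_morphism_def)
      next
        case (Inr a)
        then have a: "a \<in> edges (apex d)" using s by auto
        have "set (sources (apex d) a) \<subseteq> verts (apex d)" "set (targets (apex d) a) \<subseteq> verts (apex d)"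
          using a gd by (auto simp: hyp_def)
        then have "map uv (map (hv \<circ> Inr) (sources (apex d) a)) = map qv (sources (apex d) a)"
          "map uv (map (hv \<circ> Inr) (targets (apex d) a)) = map qv (targets (apex d) a)"
          by (auto simp: uvr subset_iff)
        moreover have "ue x = qe a" "label K (qe a) = label (apex d) a" "label (apex z) x = label (apex d) a"
          using s Inr ue[of "Inr a"] qm md a by (auto simp: hyp_morphism_def)
        ultimately show ?thesis using s Inr qm md a by (simp add: hyp_morphism_def)
      qed
      then show "label K (ue x) = label (apex z) x" "sources K (ue x) = map uv (sources (apex z) x)"
        "targets K (ue x) = map uv (targets (apex z) x)" by auto
    qed
    show ?case
      by (rule exI[of _ uv], rule exI[of _ ue]) (use um uvl uvr uel uer in simp)
  next
    case (2 K pv pe qv qe uv ue uv' ue')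
    show ?case
    proof (intro ballI)
      fix x assume "x \<in> verts (apex z)"
      then obtain s where "s \<in> ?V" "x = hv s" using V by auto
      then show "uv x = uv' x" using 2 by auto
    qed
  next
    case (3 K pv pe qv qe uv ue uv' ue')
    show ?case
    proof (intro ballI)
      fix x assume "x \<in> edges (apex z)"
      then obtain s where "s \<in> ?E" "x = he s" using E by (auto simp: bij_betw_def)
      then show "ue x = ue' x" using 3 by auto
    qed
  qed
qed

text \<open>The local predicate of \<open>is_pushout\<close> as a constant, so that the universal
  property can be instantiated by name.\<close>

definition mediating :: "('v, 'e, 'g) hypergraph \<Rightarrow> ('w, 'f, 'g) hypergraph \<Rightarrow>
    (nat, nat, 'g) hypergraph \<Rightarrow> ('v \<Rightarrow> nat) \<Rightarrow> ('e \<Rightarrow> nat) \<Rightarrow> ('w \<Rightarrow> nat) \<Rightarrow> ('f \<Rightarrow> nat) \<Rightarrow>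
    (nat, nat, 'g) hypergraph \<Rightarrow> ('v \<Rightarrow> nat) \<Rightarrow> ('e \<Rightarrow> nat) \<Rightarrow> ('w \<Rightarrow> nat) \<Rightarrow> ('f \<Rightarrow> nat) \<Rightarrow>
    (nat \<Rightarrow> nat) \<Rightarrow> (nat \<Rightarrow> nat) \<Rightarrow> bool" where
  "mediating F G H jv je kv ke K pv pe qv qe uv ue \<longleftrightarrow> hyp_morphism H K uv ue \<and>
     (\<forall>v\<in>verts F. uv (jv v) = pv v) \<and> (\<forall>e\<in>edges F. ue (je e) = pe e) \<and>
     (\<forall>v\<in>verts G. uv (kv v) = qv v) \<and> (\<forall>e\<in>edges G. ue (ke e) = qe e)"

lemma pushoutD:
  assumes P: "is_pushout \<Sigma> xs ys F G H jv je kv ke"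
    and K: "hyp \<Sigma> K" "hyp_morphism F K pv pe" "hyp_morphism G K qv qe" "map pv xs = map qv ys"
  shows "\<exists>uv ue. mediating F G H jv je kv ke K pv pe qv qe uv ue"
    and "mediating F G H jv je kv ke K pv pe qv qe uv ue \<Longrightarrow> mediating F G H jv je kv ke K pv pe qv qe uv' ue' \<Longrightarrow>
      (\<forall>v\<in>verts H. uv v = uv' v) \<and> (\<forall>e\<in>edges H. ue e = ue' e)"
proof -
  have "\<forall>K pv pe qv qe. hyp \<Sigma> K \<and> hyp_morphism F K pv pe \<and> hyp_morphism G K qv qe \<and> map pv xs = map qv ys \<longrightarrow>
    (\<exists>uv ue. mediating F G H jv je kv ke K pv pe qv qe uv ue) \<and>
    (\<forall>uv ue uv' ue'. mediating F G H jv je kv ke K pv pe qv qe uv ue \<and> mediating F G H jv je kv ke K pv pe qv qe uv' ue' \<longrightarrow>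
      (\<forall>v\<in>verts H. uv v = uv' v) \<and> (\<forall>e\<in>edges H. ue e = ue' e))"
    using P unfolding is_pushout_def Let_def mediating_def by (elim conjE)
  note this[rule_format, of K pv pe qv qe, OF conjI[OF K(1) conjI[OF K(2) conjI[OF K(3,4)]]]]
  then show "\<exists>uv ue. mediating F G H jv je kv ke K pv pe qv qe uv ue"
    and "mediating F G H jv je kv ke K pv pe qv qe uv ue \<Longrightarrow> mediating F G H jv je kv ke K pv pe qv qe uv' ue' \<Longrightarrow>
      (\<forall>v\<in>verts H. uv v = uv' v) \<and> (\<forall>e\<in>edges H. ue e = ue' e)"
    by (blast, blast)
qed

text \<open>The mediating maps in both directions compose to maps that mediate a pushout to itself,
  as identities do. Both apexes have natural numbers as vertices and hyperedges, hence are
  admissible test objects for each other.\<close>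

lemma pushout_unique:
  assumes P: "is_pushout \<Sigma> xs ys F G H jv je kv ke" and P': "is_pushout \<Sigma> xs ys F G H' jv' je' kv' ke'"
  obtains uv ue where "hyp_morphism H H' uv ue" "bij_betw uv (verts H) (verts H')" "bij_betw ue (edges H) (edges H')"
    "\<And>v. v \<in> verts F \<Longrightarrow> uv (jv v) = jv' v" "\<And>v. v \<in> verts G \<Longrightarrow> uv (kv v) = kv' v"
proof -
  have K: "hyp \<Sigma> H" "hyp_morphism F H jv je" "hyp_morphism G H kv ke" "map jv xs = map kv ys"
    using P by (auto simp: is_pushout_def)
  have K': "hyp \<Sigma> H'" "hyp_morphism F H' jv' je'" "hyp_morphism G H' kv' ke'" "map jv' xs = map kv' ys"
    using P' by (auto simp: is_pushout_def)
  have i: "mediating F G A jv je kv ke A jv je kv ke (\<lambda>x. x) (\<lambda>x. x)" for A jv je kv ke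
    by (simp add: mediating_def hyp_morphism_def)
  obtain uv ue where u: "mediating F G H jv je kv ke H' jv' je' kv' ke' uv ue"
    using pushoutD(1)[OF P K'] by blast
  obtain wv we where w: "mediating F G H' jv' je' kv' ke' H jv je kv ke wv we"
    using pushoutD(1)[OF P' K] by blast
  have "mediating F G H jv je kv ke H jv je kv ke (wv \<circ> uv) (we \<circ> ue)"
    using u w unfolding mediating_def hyp_morphism_def by (simp add: image_subset_iff)
  from pushoutD(2)[OF P K this i] have 1: "v \<in> verts H \<Longrightarrow> wv (uv v) = v" "e \<in> edges H \<Longrightarrow> we (ue e) = e" for v e by auto
  have "mediating F G H' jv' je' kv' ke' H' jv' je' kv' ke' (uv \<circ> wv) (ue \<circ> we)"
    using u w unfolding mediating_def hyp_morphism_def by (simp add: image_subset_iff)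
  from pushoutD(2)[OF P' K' this i] have 2: "v \<in> verts H' \<Longrightarrow> uv (wv v) = v" "e \<in> edges H' \<Longrightarrow> ue (we e) = e" for v e by auto
  have "bij_betw uv (verts H) (verts H')"
    by (rule bij_betw_byWitness[where f' = wv]) (use 1 2 u w in \<open>auto simp: mediating_def hyp_morphism_def\<close>)
  moreover have "bij_betw ue (edges H) (edges H')"
    by (rule bij_betw_byWitness[where f' = we]) (use 1 2 u w in \<open>auto simp: mediating_def hyp_morphism_def\<close>)
  ultimately show thesis using that u by (auto simp: mediating_def)
qed

lemma cospan_composite_iff:
  fixes c d :: "'g ncospan"
  assumes c: "cospan \<Sigma> m n c" and d: "cospan \<Sigma> n p d"
  shows "cospan_composite \<Sigma> c d z \<longleftrightarrow> z \<in> quots \<Sigma> (csp_glue c d) (glue_rel c d)"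
proof
  assume "z \<in> quots \<Sigma> (csp_glue c d) (glue_rel c d)"
  then obtain hv he where "quot (csp_glue c d) (glue_rel c d) z hv he" "hyp \<Sigma> (apex z)"
    by (auto simp: quots_def)
  from pushout_quot[OF c d this] show "cospan_composite \<Sigma> c d z"
    unfolding cospan_composite_def by blast
next
  assume comp: "cospan_composite \<Sigma> c d z"
  then obtain jv je kv ke where P: "is_pushout \<Sigma> (right_leg c) (left_leg d) (apex c) (apex d) (apex z) jv je kv ke"
    and l: "left_leg z = map jv (left_leg c)" "right_leg z = map kv (right_leg d)"
    unfolding cospan_composite_def by blast
  have z: "hyp \<Sigma> (apex z)" using P by (simp add: is_pushout_def)
  have g: "cospan \<Sigma> m p (csp_glue c d)" using c d by (rule cospan_glue)
  obtain z0 hv he where z0: "quot (csp_glue c d) (glue_rel c d) z0 hv he" "z0 \<in> quots \<Sigma> (csp_glue c d) (glue_rel c d)"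
    using quots_nonempty[OF g] .
  have "hyp \<Sigma> (apex z0)" using z0(2) by (simp add: quots_def)
  note P0 = pushout_quot[OF c d z0(1) this]
  obtain uv ue where u: "hyp_morphism (apex z0) (apex z) uv ue" "bij_betw uv (verts (apex z0)) (verts (apex z))"
    "bij_betw ue (edges (apex z0)) (edges (apex z))"
    "\<And>v. v \<in> verts (apex c) \<Longrightarrow> uv ((hv \<circ> Inl) v) = jv v" "\<And>v. v \<in> verts (apex d) \<Longrightarrow> uv ((hv \<circ> Inr) v) = kv v"
    by (rule pushout_unique[OF P0(1) P]) blast
  have "map uv (left_leg z0) = left_leg z" "map uv (right_leg z0) = right_leg z"
    unfolding P0(2,3) l using c d u(4,5) by (auto simp: cospan_def)
  then have "cospan_iso z0 z" unfolding cospan_iso_def using u by blast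
  then show "z \<in> quots \<Sigma> (csp_glue c d) (glue_rel c d)"
    unfolding quots_class[OF g z0(2)] using z by (simp add: cospan_class_def)
qed

lemma glue_rel_image: "glue_rel c d = (\<lambda>(a, b). (Inl a, Inr b)) ` set (zip (right_leg c) (left_leg d))"
  by (simp add: glue_rel_def zip_map_map)

lemma glue_rel_subset:
  assumes "cospan \<Sigma> m n c" "cospan \<Sigma> n' p d"
  shows "glue_rel c d \<subseteq> verts (apex (csp_glue c d)) \<times> verts (apex (csp_glue c d))"
  using assms by (auto simp: glue_rel_image cospan_def dest: set_zip_leftD set_zip_rightD)

lemma sum_rel_subset:
  "R \<subseteq> A \<times> A \<Longrightarrow> S \<subseteq> B \<times> B \<Longrightarrow> sum_rel R S \<subseteq> (A <+> B) \<times> (A <+> B)"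
  by (auto simp: sum_rel_def)

text \<open>The case in which the comparison maps are inverse on the nose and carry each relation
  into the other; the isomorphisms behind associativity, interchange and naturality are of this
  form.\<close>

lemma quots_isoI:
  assumes c: "cospan \<Sigma> m n c" and d: "cospan \<Sigma> m n d"
    and hm: "hyp_morphism (apex c) (apex d) hv he"
    and ll: "map hv (left_leg c) = left_leg d" and rl: "map hv (right_leg c) = right_leg d"
    and hR: "\<And>u v. (u, v) \<in> R \<Longrightarrow> (hv u, hv v) \<in> S"
    and kS: "\<And>x y. (x, y) \<in> S \<Longrightarrow> (kv x, kv y) \<in> R"
    and kV: "\<And>x. x \<in> verts (apex d) \<Longrightarrow> kv x \<in> verts (apex c) \<and> hv (kv x) = x"
    and kE: "\<And>x. x \<in> edges (apex d) \<Longrightarrow> ke x \<in> edges (apex c) \<and> he (ke x) = x"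
    and kh: "\<And>u. u \<in> verts (apex c) \<Longrightarrow> kv (hv u) = u" "\<And>u. u \<in> edges (apex c) \<Longrightarrow> ke (he u) = u"
  shows "quots \<Sigma> c R = quots \<Sigma> d S"
proof (rule quots_eqI[OF c d hm _ ll rl, where kv = kv])
  show "bij_betw he (edges (apex c)) (edges (apex d))"
    using hm kE kh(2) by (intro bij_betw_byWitness[where f' = ke]) (auto simp: hyp_morphism_def)
qed (use hR kS kV kh(1) in \<open>auto intro: eqv_base\<close>)

lemma Csp_simps:
  "hom (Csp_prop \<Sigma>) m n = {cospan_class \<Sigma> c | c :: 'g ncospan. cospan \<Sigma> m n c}"
  "compose (Csp_prop \<Sigma>) X Y = {z. \<exists>c\<in>X. \<exists>d\<in>Y. cospan_composite \<Sigma> c d z}"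
  "tensor (Csp_prop \<Sigma>) X Y = (\<Union>c\<in>X. \<Union>d\<in>Y. cospan_class \<Sigma> (cospan_sum c d))"
  by (simp_all add: Csp_prop_def)

lemma quots_hom:
  assumes "cospan \<Sigma> m n c"
  shows "quots \<Sigma> c R \<in> hom (Csp_prop \<Sigma>) m n"
proof -
  obtain z hv he where z: "quot c R z hv he" "z \<in> quots \<Sigma> c R"
    using quots_nonempty[OF assms] .
  then show ?thesis
    using quots_class[OF assms z(2)] quot_cospan[OF assms z(1)] by (auto simp: Csp_simps)
qed

lemma Csp_homE:
  assumes "X \<in> hom (Csp_prop \<Sigma>) m n"
  obtains c :: "'g ncospan" where "cospan \<Sigma> m n c" "X = quots \<Sigma> c {}"
  using assms cospan_class_quots by (fastforce simp: Csp_simps)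

text \<open>By \<open>quot_sum\<close> the choice of realisations does not matter: any two that are
  glued give the same delayed quotient, and there are some.\<close>

lemma compose_quots:
  assumes c: "cospan \<Sigma> m n c" "R \<subseteq> verts (apex c) \<times> verts (apex c)"
    and d: "cospan \<Sigma> n p d" "S \<subseteq> verts (apex d) \<times> verts (apex d)"
  shows "compose (Csp_prop \<Sigma>) (quots \<Sigma> c R) (quots \<Sigma> d S) =
    quots \<Sigma> (csp_glue c d) (sum_rel R S \<union> glue_rel c d)"
proof -
  have "cospan_composite \<Sigma> c' d' z \<longleftrightarrow> z \<in> quots \<Sigma> (csp_glue c d) (sum_rel R S \<union> glue_rel c d)"
    if c': "c' \<in> quots \<Sigma> c R" and d': "d' \<in> quots \<Sigma> d S" for c' d' z
  proof -
    obtain hc ec where qc: "quot c R c' hc ec" using c' by (auto simp: quots_def)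
    obtain gd ed where qd: "quot d S d' gd ed" using d' by (auto simp: quots_def)
    have l: "set (map Inl (left_leg c)) \<subseteq> verts (apex c) <+> verts (apex d)"
      "set (map Inr (right_leg d)) \<subseteq> verts (apex c) <+> verts (apex d)"
      using c d by (auto simp: cospan_def)
    have Z: "glue_rel c d \<subseteq> (verts (apex c) <+> verts (apex d)) \<times> (verts (apex c) <+> verts (apex d))"
      using glue_rel_subset[OF c(1) d(1)] by simp
    have 1: "quots \<Sigma> (csp_glue c d) (sum_rel R S \<union> glue_rel c d) =
      quots \<Sigma> (csp_glue c' d') (map_prod (map_sum hc gd) (map_sum hc gd) ` glue_rel c d)"
    proof -
      have "left_leg c' = map hc (left_leg c)" "right_leg d' = map gd (right_leg d)"
        using qc qd by (auto simp: quot_def)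
      then show ?thesis
        using quot_sum[OF c(1) qc c(2) d(1) qd d(2) l Z] by (simp add: csp_glue_def comp_def)
    qed
    have 2: "map_prod (map_sum hc gd) (map_sum hc gd) ` glue_rel c d = glue_rel c' d'"
    proof -
      have "right_leg c' = map hc (right_leg c)" "left_leg d' = map gd (left_leg d)"
        using qc qd by (auto simp: quot_def)
      then show ?thesis
        by (simp add: glue_rel_image zip_map_map image_image case_prod_unfold)
    qed
    show ?thesis
      unfolding 1 2 using cospan_composite_iff[OF quot_cospan[OF c(1) qc] quot_cospan[OF d(1) qd]] .
  qed
  moreover obtain c' d' where "c' \<in> quots \<Sigma> c R" "d' \<in> quots \<Sigma> d S"
    using quots_nonempty[OF c(1)] quots_nonempty[OF d(1)] by metis
  ultimately show ?thesis unfolding Csp_simps by blast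
qed

lemma tensor_quots:
  assumes c: "cospan \<Sigma> m n c" "R \<subseteq> verts (apex c) \<times> verts (apex c)"
    and d: "cospan \<Sigma> p q d" "S \<subseteq> verts (apex d) \<times> verts (apex d)"
  shows "tensor (Csp_prop \<Sigma>) (quots \<Sigma> c R) (quots \<Sigma> d S) = quots \<Sigma> (cospan_sum c d) (sum_rel R S)"
proof -
  have "cospan_class \<Sigma> (cospan_sum c' d') = quots \<Sigma> (cospan_sum c d) (sum_rel R S)"
    if c': "c' \<in> quots \<Sigma> c R" and d': "d' \<in> quots \<Sigma> d S" for c' d'
  proof -
    obtain hc ec where qc: "quot c R c' hc ec" using c' by (auto simp: quots_def)
    obtain gd ed where qd: "quot d S d' gd ed" using d' by (auto simp: quots_def)
    have l: "set (left_leg (cospan_sum c d)) \<subseteq> verts (apex c) <+> verts (apex d)"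
      "set (right_leg (cospan_sum c d)) \<subseteq> verts (apex c) <+> verts (apex d)"
      using c d by (auto simp: cospan_def)
    have e: "\<lparr>apex = hyp_sum (apex c') (apex d'), left_leg = map (map_sum hc gd) (left_leg (cospan_sum c d)),
       right_leg = map (map_sum hc gd) (right_leg (cospan_sum c d))\<rparr> = cospan_sum c' d'"
    proof -
      have "left_leg c' = map hc (left_leg c)" "right_leg c' = map hc (right_leg c)"
        "left_leg d' = map gd (left_leg d)" "right_leg d' = map gd (right_leg d)"
        using qc qd by (auto simp: quot_def)
      then show ?thesis by (simp add: cospan_sum_def comp_def)
    qed
    have e': "\<lparr>apex = hyp_sum (apex c) (apex d), left_leg = left_leg (cospan_sum c d),
       right_leg = right_leg (cospan_sum c d)\<rparr> = cospan_sum c d"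
      by (simp add: cospan_sum_def)
    show ?thesis
      using quot_sum[OF c(1) qc c(2) d(1) qd d(2) l, of "{}"]
        cospan_class_quots[OF cospan_cospan_sum[OF quot_cospan[OF c(1) qc] quot_cospan[OF d(1) qd]]]
      unfolding e e' by simp
  qed
  moreover obtain c' d' where "c' \<in> quots \<Sigma> c R" "d' \<in> quots \<Sigma> d S"
    using quots_nonempty[OF c(1)] quots_nonempty[OF d(1)] by metis
  ultimately show ?thesis unfolding Csp_simps by blast
qed

subsection \<open>Discrete cospans\<close>

abbreviation dcl :: "'g signature \<Rightarrow> nat \<Rightarrow> nat list \<Rightarrow> nat list \<Rightarrow> 'g ncospan set" where
  "dcl \<Sigma> n xs ys \<equiv> cospan_class \<Sigma> (discrete_cospan n xs ys)"

lemma discrete_simps [simp]: "verts (discrete n) = {..<n}" "edges (discrete n) = {}"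
  by (simp_all add: discrete_def)

lemma discrete_cospan_simps [simp]:
  "apex (discrete_cospan n xs ys) = discrete n" "left_leg (discrete_cospan n xs ys) = xs"
  "right_leg (discrete_cospan n xs ys) = ys"
  by (simp_all add: discrete_cospan_def)

lemma cospan_discrete: "set xs \<subseteq> {..<k} \<Longrightarrow> set ys \<subseteq> {..<k} \<Longrightarrow> cospan \<Sigma> (length xs) (length ys) (discrete_cospan k xs ys)"
  by (simp add: cospan_def hyp_def)

lemma cospan_update:
  "cospan \<Sigma> m n c \<Longrightarrow> set ys \<subseteq> verts (apex c) \<Longrightarrow> cospan \<Sigma> m (length ys) (c\<lparr>right_leg := ys\<rparr>)"
  "cospan \<Sigma> m n c \<Longrightarrow> set ys \<subseteq> verts (apex c) \<Longrightarrow> cospan \<Sigma> (length ys) n (c\<lparr>left_leg := ys\<rparr>)"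
  by (auto simp: cospan_def)

lemma nth_subset: "set xs \<subseteq> A \<Longrightarrow> set ys \<subseteq> {..<length xs} \<Longrightarrow> set (map ((!) xs) ys) \<subseteq> A"
  by (auto simp: subset_iff)

text \<open>Each vertex of the discrete cospan lies on its left leg once and is glued to a vertex of
  \<open>c\<close>; nothing remains but a reindexing of the right leg.\<close>

lemma compose_discrete:
  assumes c: "cospan \<Sigma> m n c" "R \<subseteq> verts (apex c) \<times> verts (apex c)" and ys: "set ys \<subseteq> {..<n}"
  shows "compose (Csp_prop \<Sigma>) (quots \<Sigma> c R) (dcl \<Sigma> n [0..<n] ys) =
    quots \<Sigma> (c\<lparr>right_leg := map ((!) (right_leg c)) ys\<rparr>) R"
proof -
  let ?d = "discrete_cospan n [0..<n] ys"
  have d: "cospan \<Sigma> n (length ys) ?d"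
    using cospan_discrete[of "[0..<n]" n ys \<Sigma>] ys by (simp add: atLeast0LessThan)
  have l: "length (right_leg c) = n" "set (right_leg c) \<subseteq> verts (apex c)"
    using c by (auto simp: cospan_def)
  have s: "set (map ((!) (right_leg c)) ys) \<subseteq> verts (apex c)"
    using nth_subset[OF l(2)] ys l(1) by simp
  have "quots \<Sigma> (csp_glue c ?d) (sum_rel R {} \<union> glue_rel c ?d) = quots \<Sigma> (c\<lparr>right_leg := map ((!) (right_leg c)) ys\<rparr>) R"
  proof (rule quots_eqI[where hv = "case_sum id ((!) (right_leg c))" and he = "case_sum id undefined" and kv = Inl])
    show "cospan \<Sigma> m (length ys) (csp_glue c ?d)" using c(1) d by (rule cospan_glue)
    show "cospan \<Sigma> m (length ys) (c\<lparr>right_leg := map ((!) (right_leg c)) ys\<rparr>)"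
      using cospan_update(1)[OF c(1) s] by simp
    show "hyp_morphism (apex (csp_glue c ?d)) (apex (c\<lparr>right_leg := map ((!) (right_leg c)) ys\<rparr>))
      (case_sum id ((!) (right_leg c))) (case_sum id undefined)"
      using l by (auto simp: hyp_morphism_def ball_Plus image_subset_iff comp_def subset_iff)
    show "bij_betw (case_sum id undefined) (edges (apex (csp_glue c ?d))) (edges (apex (c\<lparr>right_leg := map ((!) (right_leg c)) ys\<rparr>)))"
      by (intro bij_betw_byWitness[where f' = Inl]) auto
    show "(case_sum id ((!) (right_leg c)) u, case_sum id ((!) (right_leg c)) v) \<in> eqv R"
      if "(u, v) \<in> sum_rel R {} \<union> glue_rel c ?d" for u v
      using that l by (auto simp: sum_rel_def glue_rel_image in_set_zip intro: eqv_base)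
    show "(Inl x, Inl y) \<in> eqv (sum_rel R {} \<union> glue_rel c ?d)" if "(x, y) \<in> R" for x y
      using that by (intro eqv_base) (auto simp: sum_rel_def)
    show "(Inl (case_sum id ((!) (right_leg c)) u), u) \<in> eqv (sum_rel R {} \<union> glue_rel c ?d)"
      if "u \<in> verts (apex (csp_glue c ?d))" for u
    proof (cases u)
      case (Inr i)
      then have "i < n" using that by auto
      then have "(right_leg c ! i, i) \<in> set (zip (right_leg c) [0..<n])"
        using l by (auto simp: in_set_zip intro!: exI[of _ i])
      then have "(Inl (right_leg c ! i), Inr i) \<in> glue_rel c ?d"
        by (force simp: glue_rel_image)
      then show ?thesis using Inr by (auto intro: eqv_base)
    qed simp
  qed (use ys in \<open>auto simp: comp_def\<close>)
  then show ?thesis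
    using compose_quots[OF c d, of "{}"] by (simp add: cospan_class_quots[OF d])
qed

lemma discrete_compose:
  assumes c: "cospan \<Sigma> m n c" "R \<subseteq> verts (apex c) \<times> verts (apex c)" and xs: "set xs \<subseteq> {..<m}"
  shows "compose (Csp_prop \<Sigma>) (dcl \<Sigma> m xs [0..<m]) (quots \<Sigma> c R) =
    quots \<Sigma> (c\<lparr>left_leg := map ((!) (left_leg c)) xs\<rparr>) R"
proof -
  let ?d = "discrete_cospan m xs [0..<m]"
  have d: "cospan \<Sigma> (length xs) m ?d"
    using cospan_discrete[of xs m "[0..<m]" \<Sigma>] xs by (simp add: atLeast0LessThan)
  have l: "length (left_leg c) = m" "set (left_leg c) \<subseteq> verts (apex c)"
    using c by (auto simp: cospan_def)
  have s: "set (map ((!) (left_leg c)) xs) \<subseteq> verts (apex c)"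
    using nth_subset[OF l(2)] xs l(1) by simp
  have "quots \<Sigma> (csp_glue ?d c) (sum_rel {} R \<union> glue_rel ?d c) = quots \<Sigma> (c\<lparr>left_leg := map ((!) (left_leg c)) xs\<rparr>) R"
  proof (rule quots_eqI[where hv = "case_sum ((!) (left_leg c)) id" and he = "case_sum undefined id" and kv = Inr])
    show "cospan \<Sigma> (length xs) n (csp_glue ?d c)" using d c(1) by (rule cospan_glue)
    show "cospan \<Sigma> (length xs) n (c\<lparr>left_leg := map ((!) (left_leg c)) xs\<rparr>)"
      using cospan_update(2)[OF c(1) s] by simp
    show "hyp_morphism (apex (csp_glue ?d c)) (apex (c\<lparr>left_leg := map ((!) (left_leg c)) xs\<rparr>))
      (case_sum ((!) (left_leg c)) id) (case_sum undefined id)"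
      using l by (auto simp: hyp_morphism_def ball_Plus image_subset_iff comp_def subset_iff)
    show "bij_betw (case_sum undefined id) (edges (apex (csp_glue ?d c))) (edges (apex (c\<lparr>left_leg := map ((!) (left_leg c)) xs\<rparr>)))"
      by (intro bij_betw_byWitness[where f' = Inr]) auto
    show "(case_sum ((!) (left_leg c)) id u, case_sum ((!) (left_leg c)) id v) \<in> eqv R"
      if "(u, v) \<in> sum_rel {} R \<union> glue_rel ?d c" for u v
      using that l by (auto simp: sum_rel_def glue_rel_image in_set_zip intro: eqv_base)
    show "(Inr x, Inr y) \<in> eqv (sum_rel {} R \<union> glue_rel ?d c)" if "(x, y) \<in> R" for x y
      using that by (intro eqv_base) (auto simp: sum_rel_def)
    show "(Inr (case_sum ((!) (left_leg c)) id u), u) \<in> eqv (sum_rel {} R \<union> glue_rel ?d c)"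
      if "u \<in> verts (apex (csp_glue ?d c))" for u
    proof (cases u)
      case (Inl i)
      then have "i < m" using that by auto
      then have "(i, left_leg c ! i) \<in> set (zip [0..<m] (left_leg c))"
        using l by (auto simp: in_set_zip intro!: exI[of _ i])
      then have "(Inl i, Inr (left_leg c ! i)) \<in> glue_rel ?d c"
        by (force simp: glue_rel_image)
      then show ?thesis using Inl by (auto intro: eqv_base eqv_sym)
    qed simp
  qed (use xs in \<open>auto simp: comp_def\<close>)
  then show ?thesis
    using compose_quots[OF d _ c, of "{}"] by (simp add: cospan_class_quots[OF d])
qed

lemma tensor_discrete:
  assumes "set xs \<subseteq> {..<n}" "set ys \<subseteq> {..<n}" "set zs \<subseteq> {..<k}" "set ws \<subseteq> {..<k}"
  shows "tensor (Csp_prop \<Sigma>) (dcl \<Sigma> n xs ys) (dcl \<Sigma> k zs ws) =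
    dcl \<Sigma> (n + k) (xs @ map ((+) n) zs) (ys @ map ((+) n) ws)"
proof -
  let ?c = "discrete_cospan n xs ys" and ?d = "discrete_cospan k zs ws"
  let ?e = "discrete_cospan (n + k) (xs @ map ((+) n) zs) (ys @ map ((+) n) ws)"
  note c = cospan_discrete[OF assms(1,2), of \<Sigma>] and d = cospan_discrete[OF assms(3,4), of \<Sigma>]
  have e: "cospan \<Sigma> (length xs + length zs) (length ys + length ws) ?e"
    using cospan_discrete[of "xs @ map ((+) n) zs" "n + k" "ys @ map ((+) n) ws" \<Sigma>] assms by fastforce
  have "quots \<Sigma> (cospan_sum ?c ?d) (sum_rel {} {}) = quots \<Sigma> ?e {}"
  proof (rule quots_isoI[where hv = "case_sum id ((+) n)" and he = "case_sum id id" and ke = Inl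
        and kv = "\<lambda>x. if x < n then Inl x else Inr (x - n)"])
    show "cospan \<Sigma> (length xs + length zs) (length ys + length ws) (cospan_sum ?c ?d)"
      using c d by (rule cospan_cospan_sum)
  qed (use e in \<open>auto simp: hyp_morphism_def sum_rel_def comp_def\<close>)
  then show ?thesis
    using tensor_quots[OF c _ d, of "{}" "{}"] by (simp add: cospan_class_quots[OF c] cospan_class_quots[OF d] cospan_class_quots[OF e])
qed

lemma discrete_relabel:
  assumes "set xs \<subseteq> {..<n}" "set ys \<subseteq> {..<n}" "bij_betw f {..<n} {..<n}"
  shows "dcl \<Sigma> n xs ys = dcl \<Sigma> n (map f xs) (map f ys)"
proof (rule cospan_class_eqI[where hv = f and he = id])
  show "cospan \<Sigma> (length xs) (length ys) (discrete_cospan n xs ys)"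
    using assms by (intro cospan_discrete)
  have "set (map f xs) \<subseteq> {..<n}" "set (map f ys) \<subseteq> {..<n}"
    using assms by (auto simp: bij_betw_def)
  then show "cospan \<Sigma> (length xs) (length ys) (discrete_cospan n (map f xs) (map f ys))"
    using cospan_discrete[of "map f xs" n "map f ys" \<Sigma>] by simp
qed (use assms in \<open>auto simp: hyp_morphism_def bij_betw_def\<close>)

lemma sum_rel_iff [simp]:
  "(Inl a, Inl b) \<in> sum_rel R S \<longleftrightarrow> (a, b) \<in> R" "(Inr c, Inr d) \<in> sum_rel R S \<longleftrightarrow> (c, d) \<in> S"
  "(Inl a, Inr d) \<notin> sum_rel R S" "(Inr c, Inl b) \<notin> sum_rel R S"
  by (auto simp: sum_rel_def)

lemma glue_rel_iff [simp]:
  "(Inl a, Inr d) \<in> glue_rel e f \<longleftrightarrow> (a, d) \<in> set (zip (right_leg e) (left_leg f))"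
  "(Inl a, Inl b) \<notin> glue_rel e f" "(Inr c, x) \<notin> glue_rel e f"
  by (auto simp: glue_rel_image)

lemma zip_map_iff [simp]:
  "(Inl a, x) \<in> set (zip (map Inl xs) zs) \<longleftrightarrow> (a, x) \<in> set (zip xs zs)"
  "(Inr b, x) \<in> set (zip (map Inr ys) zs) \<longleftrightarrow> (b, x) \<in> set (zip ys zs)"
  "(x, Inl a) \<in> set (zip zs (map Inl xs)) \<longleftrightarrow> (x, a) \<in> set (zip zs xs)"
  "(x, Inr b) \<in> set (zip zs (map Inr ys)) \<longleftrightarrow> (x, b) \<in> set (zip zs ys)"
  "(Inr b, x) \<notin> set (zip (map Inl xs) zs)" "(Inl a, x) \<notin> set (zip (map Inr ys) zs)"
  "(x, Inr b) \<notin> set (zip zs (map Inl xs))" "(x, Inl a) \<notin> set (zip zs (map Inr ys))"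
  by (auto simp: zip_map1 zip_map2; force)+

lemma upt_append: "[0..<i] @ map ((+) i) [0..<j] = [0..<i + j]"
  by (auto intro!: nth_equalityI simp: nth_append)

lemma nth_swap:
  "length xs = n \<Longrightarrow> length ys = q \<Longrightarrow> map ((!) (xs @ ys)) ([n..<n + q] @ [0..<n]) = ys @ xs"
  by (auto intro!: nth_equalityI simp: nth_append)

text \<open>Two representatives of one class: an identity left leg suits composition after another
  cospan, an identity right leg composition before it.\<close>

lemma swap_Csp:
  "swap (Csp_prop \<Sigma>) m n = dcl \<Sigma> (m + n) [0..<m + n] ([m..<m + n] @ [0..<m])"
  "swap (Csp_prop \<Sigma>) m n = dcl \<Sigma> (n + m) ([n..<n + m] @ [0..<n]) [0..<n + m]"
proof -
  show 1: "swap (Csp_prop \<Sigma>) m n = dcl \<Sigma> (m + n) [0..<m + n] ([m..<m + n] @ [0..<m])"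
    by (simp add: Csp_prop_def)
  \<comment> \<open>The renumbering of vertices by exchanging the two blocks, which makes the right
    leg an identity.\<close>
  define f where "f = (\<lambda>i. if i < m then n + i else i - m)"
  have l: "map f [0..<m + n] = [n..<n + m] @ [0..<n]"
    by (auto intro!: nth_equalityI simp: f_def nth_append)
  have r: "map f ([m..<m + n] @ [0..<m]) = [0..<n + m]"
    by (auto intro!: nth_equalityI simp: f_def nth_append)
  have "bij_betw f {..<m + n} {..<m + n}"
    by (rule bij_betw_byWitness[where f' = "\<lambda>i. if i < n then m + i else i - n"]) (auto simp: f_def)
  moreover have "set [0..<m + n] \<subseteq> {..<m + n}" "set ([m..<m + n] @ [0..<m]) \<subseteq> {..<m + n}" by auto
  ultimately have "dcl \<Sigma> (m + n) [0..<m + n] ([m..<m + n] @ [0..<m]) = dcl \<Sigma> (m + n) (map f [0..<m + n]) (map f ([m..<m + n] @ [0..<m]))"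
    by (intro discrete_relabel)
  then show "swap (Csp_prop \<Sigma>) m n = dcl \<Sigma> (n + m) ([n..<n + m] @ [0..<n]) [0..<n + m]"
    unfolding 1 l r by (simp only: add.commute)
qed

lemma ident_Csp: "ident (Csp_prop \<Sigma>) n = dcl \<Sigma> n [0..<n] [0..<n]"
  by (simp add: Csp_prop_def)

lemma dcl_hom: "set xs \<subseteq> {..<k} \<Longrightarrow> set ys \<subseteq> {..<k} \<Longrightarrow> dcl \<Sigma> k xs ys \<in> hom (Csp_prop \<Sigma>) (length xs) (length ys)"
  using cospan_discrete[of xs k ys \<Sigma>] by (auto simp: Csp_simps)

lemma dcl_quots: "set xs \<subseteq> {..<k} \<Longrightarrow> set ys \<subseteq> {..<k} \<Longrightarrow> dcl \<Sigma> k xs ys = quots \<Sigma> (discrete_cospan k xs ys) {}"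
  by (rule cospan_class_quots[OF cospan_discrete])

lemma discrete_cospan_update:
  "(discrete_cospan k xs ys)\<lparr>right_leg := zs\<rparr> = discrete_cospan k xs zs"
  "(discrete_cospan k xs ys)\<lparr>left_leg := zs\<rparr> = discrete_cospan k zs ys"
  by (simp_all add: discrete_cospan_def)

lemma dcl_compose:
  assumes "set xs \<subseteq> {..<k}" "set ys \<subseteq> {..<k}" "set zs \<subseteq> {..<length ys}"
  shows "compose (Csp_prop \<Sigma>) (dcl \<Sigma> k xs ys) (dcl \<Sigma> (length ys) [0..<length ys] zs) = dcl \<Sigma> k xs (map ((!) ys) zs)"
proof -
  have s: "set (map ((!) ys) zs) \<subseteq> {..<k}" using nth_subset[OF assms(2,3)] .
  from compose_discrete[OF cospan_discrete[OF assms(1,2)] _ assms(3), of "{}" \<Sigma>] show ?thesis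
    unfolding dcl_quots[OF assms(1,2)] dcl_quots[OF assms(1) s] discrete_cospan_update by simp
qed

lemma compose_dcl:
  assumes "set xs \<subseteq> {..<k}" "set ys \<subseteq> {..<k}" "set zs \<subseteq> {..<length xs}"
  shows "compose (Csp_prop \<Sigma>) (dcl \<Sigma> (length xs) zs [0..<length xs]) (dcl \<Sigma> k xs ys) = dcl \<Sigma> k (map ((!) xs) zs) ys"
proof -
  have s: "set (map ((!) xs) zs) \<subseteq> {..<k}" using nth_subset[OF assms(1,3)] .
  from discrete_compose[OF cospan_discrete[OF assms(1,2)] _ assms(3), of "{}" \<Sigma>] show ?thesis
    unfolding dcl_quots[OF assms(1,2)] dcl_quots[OF s assms(2)] discrete_cospan_update by simp
qed

text \<open>The inner interfaces have equal lengths, so the zip of the appended legs splits at the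
  border of the two summands.\<close>

lemma glue_sum_iff:
  assumes "cospan \<Sigma> m n c" "cospan \<Sigma> n p d" "cospan \<Sigma> m' n' c'" "cospan \<Sigma> n' p' d'"
  shows "(u, v) \<in> glue_rel (cospan_sum c c') (cospan_sum d d') \<longleftrightarrow>
    (case u of Inl (Inl a) \<Rightarrow> (case v of Inr (Inl b) \<Rightarrow> (a, b) \<in> set (zip (right_leg c) (left_leg d)) | _ \<Rightarrow> False)
     | Inl (Inr a) \<Rightarrow> (case v of Inr (Inr b) \<Rightarrow> (a, b) \<in> set (zip (right_leg c') (left_leg d')) | _ \<Rightarrow> False)
     | _ \<Rightarrow> False)"
  using assms by (auto simp: cospan_def split: sum.splits)

text \<open>With pushouts replaced by delayed quotients, each axiom is an explicit bijection between
  sums of hypergraphs or an equation between reindexed lists.\<close>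

lemma prop_cat_Csp: "prop_cat (Csp_prop \<Sigma>)"
proof -
  let ?P = "Csp_prop \<Sigma>"
  have up: "set [0..<n] \<subseteq> {..<n}" for n by auto
  note E = Csp_homE
  have CQ: "compose ?P (quots \<Sigma> c {}) (quots \<Sigma> d {}) = quots \<Sigma> (csp_glue c d) (glue_rel c d)"
    if "cospan \<Sigma> m n c" "cospan \<Sigma> n p d" for m n p and c d :: "'a ncospan"
    using compose_quots[OF that(1) _ that(2), of "{}" "{}"] by (simp add: sum_rel_def)
  have TQ: "tensor ?P (quots \<Sigma> c {}) (quots \<Sigma> d {}) = quots \<Sigma> (cospan_sum c d) {}"
    if "cospan \<Sigma> m n c" "cospan \<Sigma> p q d" for m n p q and c d :: "'a ncospan"
    using tensor_quots[OF that(1) _ that(2), of "{}" "{}"] by (simp add: sum_rel_def)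
  show ?thesis
  proof
    fix f m n m' n' assume "f \<in> hom ?P m n" "f \<in> hom ?P m' n'"
    then obtain c d :: "'a ncospan" where c: "cospan \<Sigma> m n c" "f = quots \<Sigma> c {}"
      and d: "cospan \<Sigma> m' n' d" "f = quots \<Sigma> d {}" by (elim E)
    obtain z hv he where z: "quot c {} z hv he" "z \<in> f" using quots_nonempty[OF c(1)] c(2) by metis
    from z(2) obtain hv' he' where "quot d {} z hv' he'" unfolding d(2) quots_def by blast
    from quot_cospan[OF c(1) z(1)] quot_cospan[OF d(1) this] show "m = m' \<and> n = n'"
      by (simp add: cospan_def)
  next
    fix n show "ident ?P n \<in> hom ?P n n"
      using dcl_hom[OF up up, of \<Sigma> n] by (simp add: ident_Csp)
  next
    fix f m n g p assume "f \<in> hom ?P m n" "g \<in> hom ?P n p"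
    then show "compose ?P f g \<in> hom ?P m p"
      by (elim E) (simp add: CQ quots_hom cospan_glue)
  next
    fix f m n g p q assume "f \<in> hom ?P m n" "g \<in> hom ?P p q"
    then show "tensor ?P f g \<in> hom ?P (m + p) (n + q)"
      by (elim E) (simp add: TQ quots_hom cospan_cospan_sum)
  next
    fix m n
    have "set [0..<m + n] \<subseteq> {..<m + n}" "set ([m..<m + n] @ [0..<m]) \<subseteq> {..<m + n}" by auto
    from dcl_hom[OF this, of \<Sigma>] show "swap ?P m n \<in> hom ?P (m + n) (n + m)"
      by (simp add: swap_Csp(1))
  next
    fix f m n assume "f \<in> hom ?P m n"
    then obtain c :: "'a ncospan" where c: "cospan \<Sigma> m n c" and [simp]: "f = quots \<Sigma> c {}" by (rule E)
    have l: "length (left_leg c) = m" "length (right_leg c) = n" using c by (auto simp: cospan_def)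
    show "compose ?P (ident ?P m) f = f"
      using discrete_compose[OF c _ up, of "{}"] map_nth[of "left_leg c"] l by (simp add: ident_Csp)
    show "compose ?P f (ident ?P n) = f"
      using compose_discrete[OF c _ up, of "{}"] map_nth[of "right_leg c"] l by (simp add: ident_Csp)
    have i: "cospan \<Sigma> 0 0 (discrete_cospan 0 [] [])" "ident ?P 0 = quots \<Sigma> (discrete_cospan 0 [] []) {}"
      using cospan_discrete[of "[]" 0 "[]" \<Sigma>] by (simp_all add: ident_Csp dcl_quots)
    have "quots \<Sigma> (cospan_sum (discrete_cospan 0 [] []) c) {} = quots \<Sigma> c {}"
      by (rule quots_isoI[where hv = "case_sum id id" and he = "case_sum undefined id" and kv = Inr and ke = Inr])
         (use cospan_cospan_sum[OF i(1) c] c in \<open>auto simp: hyp_morphism_def comp_def\<close>)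
    then show "tensor ?P (ident ?P 0) f = f" by (simp add: i(2) TQ[OF i(1) c])
    have "quots \<Sigma> (cospan_sum c (discrete_cospan 0 [] [])) {} = quots \<Sigma> c {}"
      by (rule quots_isoI[where hv = "case_sum id id" and he = "case_sum id undefined" and kv = Inl and ke = Inl])
         (use cospan_cospan_sum[OF c i(1)] c in \<open>auto simp: hyp_morphism_def comp_def\<close>)
    then show "tensor ?P f (ident ?P 0) = f" by (simp add: i(2) TQ[OF c i(1)])
  next
    fix f m n g p h q assume "f \<in> hom ?P m n" "g \<in> hom ?P n p" "h \<in> hom ?P p q"
    then obtain c d e :: "'a ncospan" where c: "cospan \<Sigma> m n c" and d: "cospan \<Sigma> n p d" and e: "cospan \<Sigma> p q e"
      and [simp]: "f = quots \<Sigma> c {}" "g = quots \<Sigma> d {}" "h = quots \<Sigma> e {}" by (elim E)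
    note cd = cospan_glue[OF c d] and de = cospan_glue[OF d e]
    have l: "compose ?P (compose ?P f g) h = quots \<Sigma> (csp_glue (csp_glue c d) e)
        (sum_rel (glue_rel c d) {} \<union> glue_rel (csp_glue c d) e)"
      using compose_quots[OF cd glue_rel_subset[OF c d] e, of "{}"] by (simp add: CQ[OF c d])
    have r: "compose ?P f (compose ?P g h) = quots \<Sigma> (csp_glue c (csp_glue d e))
        (sum_rel {} (glue_rel d e) \<union> glue_rel c (csp_glue d e))"
      using compose_quots[OF c _ de glue_rel_subset[OF d e], of "{}"] by (simp add: CQ[OF d e])
    show "compose ?P (compose ?P f g) h = compose ?P f (compose ?P g h)"
      unfolding l r
    proof (rule quots_isoI[where hv = "case_sum (case_sum Inl (Inr \<circ> Inl)) (Inr \<circ> Inr)"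
          and he = "case_sum (case_sum Inl (Inr \<circ> Inl)) (Inr \<circ> Inr)"
          and kv = "case_sum (Inl \<circ> Inl) (case_sum (Inl \<circ> Inr) Inr)"
          and ke = "case_sum (Inl \<circ> Inl) (case_sum (Inl \<circ> Inr) Inr)"])
      show "cospan \<Sigma> m q (csp_glue (csp_glue c d) e)" "cospan \<Sigma> m q (csp_glue c (csp_glue d e))"
        using cospan_glue[OF cd e] cospan_glue[OF c de] by auto
    qed (auto simp: hyp_morphism_def ball_Plus image_subset_iff comp_def split: sum.splits)
  next
    fix m n show "tensor ?P (ident ?P m) (ident ?P n) = ident ?P (m + n)"
      by (simp only: ident_Csp tensor_discrete up upt_append)
  next
    fix f m n g p f' m' n' g' p'
    assume "f \<in> hom ?P m n" "g \<in> hom ?P n p" "f' \<in> hom ?P m' n'" "g' \<in> hom ?P n' p'"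
    then obtain c d c' d' :: "'a ncospan" where c: "cospan \<Sigma> m n c" and d: "cospan \<Sigma> n p d"
      and c': "cospan \<Sigma> m' n' c'" and d': "cospan \<Sigma> n' p' d'"
      and [simp]: "f = quots \<Sigma> c {}" "g = quots \<Sigma> d {}" "f' = quots \<Sigma> c' {}" "g' = quots \<Sigma> d' {}"
      by (elim E)
    note cd = cospan_glue[OF c d] and cd' = cospan_glue[OF c' d']
      and cc = cospan_cospan_sum[OF c c'] and dd = cospan_cospan_sum[OF d d']
    have l: "tensor ?P (compose ?P f g) (compose ?P f' g') =
      quots \<Sigma> (cospan_sum (csp_glue c d) (csp_glue c' d')) (sum_rel (glue_rel c d) (glue_rel c' d'))"
      using tensor_quots[OF cd glue_rel_subset[OF c d] cd' glue_rel_subset[OF c' d']] by (simp add: CQ[OF c d] CQ[OF c' d'])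
    have r: "compose ?P (tensor ?P f f') (tensor ?P g g') =
      quots \<Sigma> (csp_glue (cospan_sum c c') (cospan_sum d d')) (glue_rel (cospan_sum c c') (cospan_sum d d'))"
      using compose_quots[OF cc _ dd, of "{}" "{}"] by (simp add: TQ[OF c c'] TQ[OF d d'] sum_rel_def)
    show "tensor ?P (compose ?P f g) (compose ?P f' g') = compose ?P (tensor ?P f f') (tensor ?P g g')"
      unfolding l r
    proof (rule quots_isoI[where hv = "case_sum (case_sum (Inl \<circ> Inl) (Inr \<circ> Inl)) (case_sum (Inl \<circ> Inr) (Inr \<circ> Inr))"
          and he = "case_sum (case_sum (Inl \<circ> Inl) (Inr \<circ> Inl)) (case_sum (Inl \<circ> Inr) (Inr \<circ> Inr))"
          and kv = "case_sum (case_sum (Inl \<circ> Inl) (Inr \<circ> Inl)) (case_sum (Inl \<circ> Inr) (Inr \<circ> Inr))"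
          and ke = "case_sum (case_sum (Inl \<circ> Inl) (Inr \<circ> Inl)) (case_sum (Inl \<circ> Inr) (Inr \<circ> Inr))"])
      show "cospan \<Sigma> (m + m') (p + p') (cospan_sum (csp_glue c d) (csp_glue c' d'))"
        "cospan \<Sigma> (m + m') (p + p') (csp_glue (cospan_sum c c') (cospan_sum d d'))"
        using cospan_cospan_sum[OF cd cd'] cospan_glue[OF cc dd] by auto
    qed (auto simp: hyp_morphism_def ball_Plus image_subset_iff comp_def glue_sum_iff[OF c d c' d'] split: sum.splits)
  next
    fix f m n g m' n' h m'' n''
    assume "f \<in> hom ?P m n" "g \<in> hom ?P m' n'" "h \<in> hom ?P m'' n''"
    then obtain c d e :: "'a ncospan" where c: "cospan \<Sigma> m n c" and d: "cospan \<Sigma> m' n' d" and e: "cospan \<Sigma> m'' n'' e"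
      and [simp]: "f = quots \<Sigma> c {}" "g = quots \<Sigma> d {}" "h = quots \<Sigma> e {}" by (elim E)
    note cd = cospan_cospan_sum[OF c d] and de = cospan_cospan_sum[OF d e]
    have l: "tensor ?P (tensor ?P f g) h = quots \<Sigma> (cospan_sum (cospan_sum c d) e) {}"
      using tensor_quots[OF cd _ e, of "{}" "{}"] by (simp add: TQ[OF c d] sum_rel_def)
    have r: "tensor ?P f (tensor ?P g h) = quots \<Sigma> (cospan_sum c (cospan_sum d e)) {}"
      using tensor_quots[OF c _ de, of "{}" "{}"] by (simp add: TQ[OF d e] sum_rel_def)
    show "tensor ?P (tensor ?P f g) h = tensor ?P f (tensor ?P g h)"
      unfolding l r
    proof (rule quots_isoI[where hv = "case_sum (case_sum Inl (Inr \<circ> Inl)) (Inr \<circ> Inr)"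
          and he = "case_sum (case_sum Inl (Inr \<circ> Inl)) (Inr \<circ> Inr)"
          and kv = "case_sum (Inl \<circ> Inl) (case_sum (Inl \<circ> Inr) Inr)"
          and ke = "case_sum (Inl \<circ> Inl) (case_sum (Inl \<circ> Inr) Inr)"])
      show "cospan \<Sigma> (m + m' + m'') (n + n' + n'') (cospan_sum (cospan_sum c d) e)"
        "cospan \<Sigma> (m + m' + m'') (n + n' + n'') (cospan_sum c (cospan_sum d e))"
        using cospan_cospan_sum[OF cd e] cospan_cospan_sum[OF c de] by (auto simp: add.assoc)
    qed (auto simp: hyp_morphism_def ball_Plus image_subset_iff comp_def split: sum.splits)
  next
    fix f m n g p q assume "f \<in> hom ?P m n" "g \<in> hom ?P p q"
    then obtain c d :: "'a ncospan" where c: "cospan \<Sigma> m n c" and d: "cospan \<Sigma> p q d"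
      and [simp]: "f = quots \<Sigma> c {}" "g = quots \<Sigma> d {}" by (elim E)
    have lc: "length (left_leg c) = m" "length (right_leg c) = n" "length (left_leg d) = p" "length (right_leg d) = q"
      using c d by (auto simp: cospan_def)
    note cd = cospan_cospan_sum[OF c d] and dc = cospan_cospan_sum[OF d c]
    have "set ([n..<n + q] @ [0..<n]) \<subseteq> {..<n + q}" by auto
    from compose_discrete[OF cd _ this, of "{}"]
    have l: "compose ?P (tensor ?P f g) (swap ?P n q) =
      quots \<Sigma> ((cospan_sum c d)\<lparr>right_leg := map Inr (right_leg d) @ map Inl (right_leg c)\<rparr>) {}"
      by (simp add: swap_Csp(1) TQ[OF c d] nth_swap lc del: map_append)
    have "set ([p..<p + m] @ [0..<p]) \<subseteq> {..<p + m}" by auto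
    from discrete_compose[OF dc _ this, of "{}"]
    have r: "compose ?P (swap ?P m p) (tensor ?P g f) =
      quots \<Sigma> ((cospan_sum d c)\<lparr>left_leg := map Inr (left_leg c) @ map Inl (left_leg d)\<rparr>) {}"
      by (simp add: swap_Csp(2) TQ[OF d c] nth_swap lc del: map_append)
    show "compose ?P (tensor ?P f g) (swap ?P n q) = compose ?P (swap ?P m p) (tensor ?P g f)"
      unfolding l r
    proof (rule quots_isoI[where hv = "case_sum Inr Inl" and he = "case_sum Inr Inl" and kv = "case_sum Inr Inl" and ke = "case_sum Inr Inl"])
      show "cospan \<Sigma> (m + p) (q + n) ((cospan_sum c d)\<lparr>right_leg := map Inr (right_leg d) @ map Inl (right_leg c)\<rparr>)"
        "cospan \<Sigma> (m + p) (q + n) ((cospan_sum d c)\<lparr>left_leg := map Inr (left_leg c) @ map Inl (left_leg d)\<rparr>)"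
        using cd dc by (auto simp: cospan_def)
    qed (auto simp: hyp_morphism_def ball_Plus image_subset_iff comp_def split: sum.splits)
  next
    fix m n
    let ?a = "[m..<m + n] @ [0..<m]" and ?b = "[n..<n + m] @ [0..<n]"
    have "map ((!) ?a) ?b = [0..<m] @ [m..<m + n]"
      by (rule nth_swap) simp_all
    also have "\<dots> = [0..<m + n]"
      using upt_add_eq_append[of 0 m n] by simp
    finally have e: "map ((!) ?a) ?b = [0..<m + n]" .
    have "compose ?P (dcl \<Sigma> (m + n) [0..<m + n] ?a) (dcl \<Sigma> (length ?a) [0..<length ?a] ?b) =
       dcl \<Sigma> (m + n) [0..<m + n] (map ((!) ?a) ?b)"
      by (rule dcl_compose) auto
    moreover have "length ?a = n + m" by simp
    ultimately show "compose ?P (swap ?P m n) (swap ?P n m) = ident ?P (m + n)"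
      unfolding e by (simp add: swap_Csp(1) ident_Csp)
  next
    fix m n p
    let ?a = "([m..<m + n] @ [0..<m]) @ map ((+) (m + n)) [0..<p]"
    let ?b = "[0..<n] @ map ((+) n) ([m..<m + p] @ [0..<m])"
    have a: "tensor ?P (swap ?P m n) (ident ?P p) = dcl \<Sigma> (m + n + p) ([0..<m + n] @ map ((+) (m + n)) [0..<p]) ?a"
      unfolding swap_Csp(1) ident_Csp by (rule tensor_discrete) auto
    have b: "tensor ?P (ident ?P n) (swap ?P m p) = dcl \<Sigma> (n + (m + p)) ([0..<n] @ map ((+) n) [0..<m + p]) ?b"
      unfolding swap_Csp(1) ident_Csp by (rule tensor_discrete) auto
    have "compose ?P (dcl \<Sigma> (m + n + p) [0..<m + n + p] ?a) (dcl \<Sigma> (length ?a) [0..<length ?a] ?b) =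
       dcl \<Sigma> (m + n + p) [0..<m + n + p] (map ((!) ?a) ?b)"
      by (rule dcl_compose) auto
    moreover have "map ((!) ?a) ?b = [m..<m + (n + p)] @ [0..<m]"
      by (auto intro!: nth_equalityI simp: nth_append)
    moreover have "length ?a = n + (m + p)" by simp
    ultimately show "swap ?P m (n + p) = compose ?P (tensor ?P (swap ?P m n) (ident ?P p)) (tensor ?P (ident ?P n) (swap ?P m p))"
      unfolding a b upt_append by (simp add: swap_Csp(1) add.assoc)
  qed
qed

text \<open>These laws for the four generators make cup and cap symmetric and yield the zigzag,
  hence the canonical trace.\<close>

locale frob_prop = prop_cat P
  for P :: "('a, 'm) prop_data_scheme" (structure) +
  fixes \<phi> :: "frob_gen \<Rightarrow> 'a"
  assumes merge_hom: "\<phi> FMerge \<in> hom P 2 1" and unit_hom: "\<phi> FUnit \<in> hom P 0 1"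
    and copy_hom: "\<phi> FCopy \<in> hom P 1 2" and counit_hom: "\<phi> FCounit \<in> hom P 1 0"
    and copy_counit: "\<phi> FCopy \<Zcomp> (ident P 1 \<otimes> \<phi> FCounit) = ident P 1"
    and copy_swap: "\<phi> FCopy \<Zcomp> swap P 1 1 = \<phi> FCopy"
    and unit_merge: "(\<phi> FUnit \<otimes> ident P 1) \<Zcomp> \<phi> FMerge = ident P 1"
    and swap_merge: "swap P 1 1 \<Zcomp> \<phi> FMerge = \<phi> FMerge"
    and frobenius: "(\<phi> FCopy \<otimes> ident P 1) \<Zcomp> (ident P 1 \<otimes> \<phi> FMerge) = \<phi> FMerge \<Zcomp> \<phi> FCopy"
begin

lemma gen_ar [simp]:
  "ar (\<phi> FMerge)" "dm (\<phi> FMerge) = Suc (Suc 0)" "cd (\<phi> FMerge) = Suc 0"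
  "ar (\<phi> FUnit)" "dm (\<phi> FUnit) = 0" "cd (\<phi> FUnit) = Suc 0"
  "ar (\<phi> FCopy)" "dm (\<phi> FCopy) = Suc 0" "cd (\<phi> FCopy) = Suc (Suc 0)"
  "ar (\<phi> FCounit)" "dm (\<phi> FCounit) = Suc 0" "cd (\<phi> FCounit) = 0"
  using merge_hom unit_hom copy_hom counit_hom by (simp_all add: hom_iff)

lemma power_ar [simp]:
  "ar (merge_power P (\<phi> FMerge) n)" "dm (merge_power P (\<phi> FMerge) n) = n + n" "cd (merge_power P (\<phi> FMerge) n) = n"
  "ar (copy_power P (\<phi> FCopy) n)" "dm (copy_power P (\<phi> FCopy) n) = n" "cd (copy_power P (\<phi> FCopy) n) = n + n"
  "ar (tensor_power P (\<phi> FUnit) n)" "dm (tensor_power P (\<phi> FUnit) n) = 0" "cd (tensor_power P (\<phi> FUnit) n) = n"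
  "ar (tensor_power P (\<phi> FCounit) n)" "dm (tensor_power P (\<phi> FCounit) n) = n" "cd (tensor_power P (\<phi> FCounit) n) = 0"
  by (induction n) simp_all

abbreviation "\<F> \<equiv> frobenius_from P \<phi>"

lemma frobenius_from_simps [simp]:
  "fmerge \<F> = merge_power P (\<phi> FMerge)" "funit \<F> = tensor_power P (\<phi> FUnit)"
  "fcopy \<F> = copy_power P (\<phi> FCopy)" "fcounit \<F> = tensor_power P (\<phi> FCounit)"
  by (simp_all add: frobenius_from_def)

lemma cup_1: "cup P \<F> 1 = \<phi> FUnit \<Zcomp> \<phi> FCopy"
  by (simp add: cup_def)

lemma cap_1: "cap P \<F> 1 = \<phi> FMerge \<Zcomp> \<phi> FCounit"
  by (simp add: cap_def)

sublocale compact_prop P "cup P \<F>" "cap P \<F>"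
proof
  fix x n
  show "cup P \<F> x \<in> hom P 0 (x + x)" "cap P \<F> x \<in> hom P (x + x) 0"
    by (simp_all add: cup_def cap_def hom_iff)
  show "cup P \<F> 0 = ident P 0" "cap P \<F> 0 = ident P 0"
    by (simp_all add: cup_def cap_def)
  show "cup P \<F> (Suc n) = (cup P \<F> 1 \<otimes> cup P \<F> n) \<Zcomp> (ident P 1 \<otimes> swap P 1 n \<otimes> ident P n)"
    unfolding cup_1 by (simp add: cup_def ichange flip: comp_assoc)
  show "cap P \<F> (Suc n) = (ident P 1 \<otimes> swap P n 1 \<otimes> ident P n) \<Zcomp> (cap P \<F> 1 \<otimes> cap P \<F> n)"
    unfolding cap_1 by (simp add: cap_def ichange)
  show "cup P \<F> 1 \<Zcomp> swap P 1 1 = cup P \<F> 1"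
    unfolding cup_1 using copy_swap by simp
  show "swap P 1 1 \<Zcomp> cap P \<F> 1 = cap P \<F> 1"
    unfolding cap_1 by (simp add: assocL[OF swap_merge[simplified]])
  \<comment> \<open>The Frobenius law turns the middle of the zigzag into a merge followed by a
    copy; unit and counit then cancel separately.\<close>
  have "(cup P \<F> 1 \<otimes> ident P 1) \<Zcomp> (ident P 1 \<otimes> cap P \<F> 1) =
    (\<phi> FUnit \<otimes> ident P 1) \<Zcomp> (((\<phi> FCopy \<otimes> ident P 1) \<Zcomp> (ident P 1 \<otimes> \<phi> FMerge)) \<Zcomp> (ident P 1 \<otimes> \<phi> FCounit))"
    unfolding cup_1 cap_1 by (simp add: tens_ident_w ident_tens w_comp)
  also have "\<dots> = ((\<phi> FUnit \<otimes> ident P 1) \<Zcomp> \<phi> FMerge) \<Zcomp> (\<phi> FCopy \<Zcomp> (ident P 1 \<otimes> \<phi> FCounit))"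
    unfolding frobenius by simp
  finally show "(cup P \<F> 1 \<otimes> ident P 1) \<Zcomp> (ident P 1 \<otimes> cap P \<F> 1) = ident P 1"
    unfolding unit_merge copy_counit by simp
qed

end

lemma with_canonical_trace_simps [simp]:
  "hom (with_canonical_trace P F) = hom P" "ident (with_canonical_trace P F) = ident P"
  "compose (with_canonical_trace P F) = compose P" "tensor (with_canonical_trace P F) = tensor P"
  "swap (with_canonical_trace P F) = swap P" "trace (with_canonical_trace P F) = canonical_trace P F"
  by (simp_all add: with_canonical_trace_def prop_data.defs)

lemma traced_prop_cat_with_canonical_trace:
  assumes "frob_prop P \<phi>"
  shows "traced_prop_cat (with_canonical_trace P (frobenius_from P \<phi>))"
proof -
  interpret frob_prop P \<phi> by (rule assms)
  show ?thesis
  proof (rule traced_prop_cat_canonical)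
    fix x m n h assume "h \<in> hom P (x + m) (x + n)"
    then show "trace (with_canonical_trace P (frobenius_from P \<phi>)) x m n h = tr x m n h"
      by (simp add: hom_iff canonical_trace_def tr_def tens_ident_w ident_tens)
  qed simp_all
qed

lemma frob_prop_of_model:
  assumes P: "prop_cat P" and m: "is_model Sym_Mon frob_presentation (with_canonical_trace P F) \<phi>"
  shows "frob_prop P \<phi>"
proof -
  interpret prop_cat P by (rule P)
  have g: "\<phi> c \<in> hom P (arity frob_presentation c) (coarity frob_presentation c)" for c
    using m by (auto simp: is_model_def frob_presentation_def)
  have e: "eval frob_presentation (with_canonical_trace P F) \<phi> s = eval frob_presentation (with_canonical_trace P F) \<phi> t"
    if "(s, t) \<in> equations frob_presentation" "typed Sym_Mon frob_presentation s m n" "typed Sym_Mon frob_presentation t m n" for s t m n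
    using m that unfolding is_model_def by blast
  note ty = typed_def frob_presentation_def
  show ?thesis
  proof
    show "\<phi> FMerge \<in> hom P 2 1" "\<phi> FUnit \<in> hom P 0 1" "\<phi> FCopy \<in> hom P 1 2" "\<phi> FCounit \<in> hom P 1 0"
      using g[of FMerge] g[of FUnit] g[of FCopy] g[of FCounit] by (simp_all add: frob_presentation_def)
    show "compose P (\<phi> FCopy) (tensor P (ident P 1) (\<phi> FCounit)) = ident P 1"
      using e[of "Gen FCopy \<triangleright> (Ident 1 \<oplus> Gen FCounit)" "Ident 1" 1 1] by (simp add: ty)
    show "compose P (\<phi> FCopy) (swap P 1 1) = \<phi> FCopy"
      using e[of "Gen FCopy \<triangleright> Swap 1 1" "Gen FCopy" 1 2] by (simp add: ty)
    show "compose P (tensor P (\<phi> FUnit) (ident P 1)) (\<phi> FMerge) = ident P 1"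
      using e[of "(Gen FUnit \<oplus> Ident 1) \<triangleright> Gen FMerge" "Ident 1" 1 1] by (simp add: ty)
    show "compose P (swap P 1 1) (\<phi> FMerge) = \<phi> FMerge"
      using e[of "Swap 1 1 \<triangleright> Gen FMerge" "Gen FMerge" 2 1] by (simp add: ty)
    show "compose P (tensor P (\<phi> FCopy) (ident P 1)) (tensor P (ident P 1) (\<phi> FMerge)) = compose P (\<phi> FMerge) (\<phi> FCopy)"
      using e[of "(Gen FCopy \<oplus> Ident 1) \<triangleright> (Ident 1 \<oplus> Gen FMerge)" "Gen FMerge \<triangleright> Gen FCopy" 2 2] by (simp add: ty)
  qed
qed

subsection \<open>The Frobenius structure of discrete cospans\<close>

lemma Plus_empty [simp]: "{} <+> {} = {}"
  by auto

text \<open>Gluing that links everything to the vertex 0 of the first cospan makes the pushout a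
  point. This settles the Frobenius laws and the special law.\<close>

lemma compose_single:
  assumes s: "set xs \<subseteq> {..<k}" "set ys \<subseteq> {..<k}" "set zs \<subseteq> {..<l}" "set ws \<subseteq> {..<l}" "length ys = length zs" "0 < k"
    and conn: "\<And>u. u \<in> {..<k} <+> {..<l} \<Longrightarrow> (Inl 0, u) \<in> eqv ((\<lambda>(a, b). (Inl a, Inr b)) ` set (zip ys zs))"
  shows "compose (Csp_prop \<Sigma>) (dcl \<Sigma> k xs ys) (dcl \<Sigma> l zs ws) = dcl \<Sigma> 1 (map (\<lambda>_. 0) xs) (map (\<lambda>_. 0) ws)"
proof -
  let ?c = "discrete_cospan k xs ys" and ?d = "discrete_cospan l zs ws"
  let ?e = "discrete_cospan 1 (map (\<lambda>_. 0) xs) (map (\<lambda>_. 0) ws)"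
  note c = cospan_discrete[OF s(1,2), of \<Sigma>] and d = cospan_discrete[OF s(3,4), of \<Sigma>, folded s(5)]
  have e: "cospan \<Sigma> (length xs) (length ws) ?e"
    using cospan_discrete[of "map (\<lambda>_. 0) xs" 1 "map (\<lambda>_. 0) ws" \<Sigma>] by auto
  \<comment> \<open>\<open>Inl 0\<close> represents the only class; it is a vertex because
    \<open>0 < k\<close>.\<close>
  have "quots \<Sigma> (csp_glue ?c ?d) (glue_rel ?c ?d) = quots \<Sigma> ?e {}"
    by (rule quots_eqI[where hv = "\<lambda>_. 0" and he = "case_sum id id" and kv = "\<lambda>_. Inl 0"])
       (use cospan_glue[OF c d] e s conn in \<open>auto simp: hyp_morphism_def bij_betw_def glue_rel_image comp_def\<close>)
  then show ?thesis
    using compose_quots[OF c _ d, of "{}" "{}"] cospan_class_quots[OF c] cospan_class_quots[OF d] cospan_class_quots[OF e]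
    by (simp add: sum_rel_def)
qed

lemma upt_1: "[0..<Suc 0] = [0]" "[0..<Suc (Suc 0)] = [0, 1::nat]" "[0..<3] = [0, 1, 2::nat]"
  by (simp_all add: upt_rec)

definition csp_gen :: "'g signature \<Rightarrow> frob_gen \<Rightarrow> 'g ncospan set" where
  "csp_gen \<Sigma> = case_frob_gen (dcl \<Sigma> 1 [0, 0] [0]) (dcl \<Sigma> 1 [] [0]) (dcl \<Sigma> 1 [0] [0, 0]) (dcl \<Sigma> 1 [0] [])"

lemma csp_gen_hom: "csp_gen \<Sigma> c \<in> hom (Csp_prop \<Sigma>) (arity frob_presentation c) (coarity frob_presentation c)"
  using dcl_hom[of "[0, 0]" 1 "[0]" \<Sigma>] dcl_hom[of "[]" 1 "[0]" \<Sigma>] dcl_hom[of "[0]" 1 "[0, 0]" \<Sigma>] dcl_hom[of "[0]" 1 "[]" \<Sigma>]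
  by (cases c) (simp_all add: csp_gen_def frob_presentation_def numeral_2_eq_2)

lemma csp_frobenius_equations:
  assumes "(s, t) \<in> equations frob_presentation"
    and Q: "compose Q = compose (Csp_prop \<Sigma>)" "tensor Q = tensor (Csp_prop \<Sigma>)" "ident Q = ident (Csp_prop \<Sigma>)" "swap Q = swap (Csp_prop \<Sigma>)"
  shows "eval frob_presentation Q (csp_gen \<Sigma>) s = eval frob_presentation Q (csp_gen \<Sigma>) t"
proof -
  let ?P = "Csp_prop \<Sigma>"
  have T: "tensor ?P (dcl \<Sigma> 1 xs ys) (dcl \<Sigma> 1 zs ws) = dcl \<Sigma> 2 (xs @ map ((+) 1) zs) (ys @ map ((+) 1) ws)"
    if "set xs \<subseteq> {0}" "set ys \<subseteq> {0}" "set zs \<subseteq> {0}" "set ws \<subseteq> {0}" for xs ys zs ws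
    using tensor_discrete[of xs 1 ys zs 1 ws \<Sigma>] that by (auto simp: numeral_2_eq_2 lessThan_Suc)
  have C: "compose ?P (dcl \<Sigma> 1 xs [0, 0]) (dcl \<Sigma> 2 [0, 1] zs) = dcl \<Sigma> 1 xs (map ((!) [0, 0]) zs)"
    if "set xs \<subseteq> {0}" "set zs \<subseteq> {0, 1}" for xs zs
    using dcl_compose[of xs 1 "[0, 0]" zs \<Sigma>] that by (auto simp: numeral_2_eq_2 lessThan_Suc insert_commute)
  have C1: "compose ?P (dcl \<Sigma> 1 xs [0]) (dcl \<Sigma> 1 [0] zs) = dcl \<Sigma> 1 xs (map ((!) [0]) zs)"
    if "set xs \<subseteq> {0}" "set zs \<subseteq> {0}" for xs zs
    using dcl_compose[of xs 1 "[0]" zs \<Sigma>] that by (auto simp: lessThan_Suc)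
  have C': "compose ?P (dcl \<Sigma> 2 zs [0, 1]) (dcl \<Sigma> 1 [0, 0] ys) = dcl \<Sigma> 1 (map ((!) [0, 0]) zs) ys"
    if "set ys \<subseteq> {0}" "set zs \<subseteq> {0, 1}" for ys zs
    using compose_dcl[of "[0, 0]" 1 ys zs \<Sigma>] that by (auto simp: numeral_2_eq_2 lessThan_Suc insert_commute)
  have i: "ident ?P 1 = dcl \<Sigma> 1 [0] [0]" by (simp add: ident_Csp)
  have sw: "swap ?P 1 1 = dcl \<Sigma> 2 [0, 1] [1, 0]" "swap ?P 1 1 = dcl \<Sigma> 2 [1, 0] [0, 1]"
    using swap_Csp(1)[of \<Sigma> 1 1] swap_Csp(2)[of \<Sigma> 1 1] by (simp_all add: numeral_2_eq_2 upt_1)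
  have S: "compose ?P (dcl \<Sigma> 2 [0, 1] [1, 0]) (dcl \<Sigma> 1 [0, 0] [0]) = dcl \<Sigma> 1 [0, 0] [0]"
    unfolding sw(1)[symmetric] unfolding sw(2) using C'[of "[0]" "[1, 0]"] by simp
  \<comment> \<open>The three glued pairs link all four vertices into one chain.\<close>
  have F1: "compose ?P (dcl \<Sigma> 2 [0, 1] [0, 0, 1]) (dcl \<Sigma> 2 [0, 1, 1] [0, 1]) = dcl \<Sigma> 1 [0, 0] [0, 0]"
  proof -
    let ?R = "(\<lambda>(a, b). (Inl a, Inr b)) ` set (zip [0, 0, 1::nat] [0, 1, 1::nat])"
    have 1: "(Inl 0, Inr 0) \<in> eqv ?R" "(Inl 0, Inr 1) \<in> eqv ?R" "(Inl 1, Inr 1) \<in> eqv ?R"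
      by (rule eqv_base, simp)+
    have "(Inl 0, u) \<in> eqv ?R" if "u \<in> {..<2} <+> {..<2}" for u
      using that 1 eqv_trans[OF 1(2) eqv_sym[OF 1(3)]] by (auto simp: numeral_2_eq_2 lessThan_Suc)
    from compose_single[of "[0, 1]" 2 "[0, 0, 1]" "[0, 1, 1]" 2 "[0, 1]" \<Sigma>, OF _ _ _ _ _ _ this]
    show ?thesis by simp
  qed
  have F2: "compose ?P (dcl \<Sigma> 2 [0, 1] [0, 1, 1]) (dcl \<Sigma> 2 [0, 0, 1] [0, 1]) = dcl \<Sigma> 1 [0, 0] [0, 0]"
  proof -
    let ?R = "(\<lambda>(a, b). (Inl a, Inr b)) ` set (zip [0, 1, 1::nat] [0, 0, 1::nat])"
    have 1: "(Inl 0, Inr 0) \<in> eqv ?R" "(Inl 1, Inr 0) \<in> eqv ?R" "(Inl 1, Inr 1) \<in> eqv ?R"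
      by (rule eqv_base, simp)+
    have "(Inl 0, u) \<in> eqv ?R" if "u \<in> {..<2} <+> {..<2}" for u
      using that 1 eqv_trans[OF 1(1) eqv_sym[OF 1(2)]] eqv_trans[OF eqv_trans[OF 1(1) eqv_sym[OF 1(2)]] 1(3)]
      by (auto simp: numeral_2_eq_2 lessThan_Suc)
    from compose_single[of "[0, 1]" 2 "[0, 1, 1]" "[0, 0, 1]" 2 "[0, 1]" \<Sigma>, OF _ _ _ _ _ _ this]
    show ?thesis by simp
  qed
  have F3: "compose ?P (dcl \<Sigma> 1 [0] [0, 0]) (dcl \<Sigma> 1 [0, 0] [0]) = dcl \<Sigma> 1 [0] [0]"
  proof -
    let ?R = "(\<lambda>(a, b). (Inl a, Inr b)) ` set (zip [0, 0::nat] [0, 0::nat])"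
    have 1: "(Inl 0, Inr 0) \<in> eqv ?R" by (rule eqv_base, simp)
    have "(Inl 0, u) \<in> eqv ?R" if "u \<in> {..<1} <+> {..<1}" for u
      using that 1 by auto
    from compose_single[of "[0]" 1 "[0, 0]" "[0, 0]" 1 "[0]" \<Sigma>, OF _ _ _ _ _ _ this]
    show ?thesis by simp
  qed
  show ?thesis
    using assms(1) unfolding frob_presentation_def
    by (auto simp: Q csp_gen_def i[unfolded One_nat_def] i sw(1)[unfolded One_nat_def] S[unfolded One_nat_def]
      T[unfolded One_nat_def] C[unfolded One_nat_def] C1[unfolded One_nat_def] C'[unfolded One_nat_def]
      F1[unfolded One_nat_def] F2[unfolded One_nat_def] F3[unfolded One_nat_def])
qed

lemma upt_1_append: "[0] @ map ((+) 1) [0..<n] = [0..<1 + n]"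
  using upt_append[of 1 n] by (simp add: upt_1)

lemma merge_power_Csp: "merge_power (Csp_prop \<Sigma>) (dcl \<Sigma> 1 [0, 0] [0]) n = dcl \<Sigma> n ([0..<n] @ [0..<n]) [0..<n]"
proof (induction n)
  case 0
  show ?case by (simp add: ident_Csp)
next
  case (Suc n)
  let ?P = "Csp_prop \<Sigma>"
  let ?zs = "([0] @ map ((+) 1) ([1..<1 + n] @ [0])) @ map ((+) (1 + (1 + n))) [0..<n]"
  let ?xs = "[0, 0] @ map ((+) 1) ([0..<n] @ [0..<n])"
  have i: "ident ?P 1 = dcl \<Sigma> 1 [0] [0]" by (simp add: ident_Csp)
  have 1: "tensor ?P (ident ?P 1) (swap ?P n 1) = dcl \<Sigma> (1 + (1 + n)) ([0] @ map ((+) 1) ([1..<1 + n] @ [0])) ([0] @ map ((+) 1) [0..<1 + n])"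
    unfolding swap_Csp(2) i by (subst tensor_discrete) (auto simp: upt_1)
  have 2: "tensor ?P (tensor ?P (ident ?P 1) (swap ?P n 1)) (ident ?P n) = dcl \<Sigma> (1 + (1 + n) + n) ?zs [0..<1 + (1 + n) + n]"
    unfolding 1 unfolding ident_Csp upt_1_append by (subst tensor_discrete) (auto simp: upt_append simp del: upt_Suc)
  have 3: "tensor ?P (dcl \<Sigma> 1 [0, 0] [0]) (merge_power ?P (dcl \<Sigma> 1 [0, 0] [0]) n) = dcl \<Sigma> (1 + n) ?xs [0..<1 + n]"
    unfolding Suc upt_1_append[symmetric] by (subst tensor_discrete) auto
  have l: "length ?xs = 1 + (1 + n) + n" by simp
  have "merge_power ?P (dcl \<Sigma> 1 [0, 0] [0]) (Suc n) = dcl \<Sigma> (1 + n) (map ((!) ?xs) ?zs) [0..<1 + n]"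
    unfolding merge_power.simps 2 3 l[symmetric] by (rule compose_dcl) auto
  also have "map ((!) ?xs) ?zs = [0..<Suc n] @ [0..<Suc n]"
    by (rule nth_equalityI) (auto simp: nth_append nth_Cons' simp del: upt_Suc)
  finally show ?case by simp
qed

lemma copy_power_Csp: "copy_power (Csp_prop \<Sigma>) (dcl \<Sigma> 1 [0] [0, 0]) n = dcl \<Sigma> n [0..<n] ([0..<n] @ [0..<n])"
proof (induction n)
  case 0
  show ?case by (simp add: ident_Csp)
next
  case (Suc n)
  let ?P = "Csp_prop \<Sigma>"
  let ?zs = "([0] @ map ((+) 1) ([1..<1 + n] @ [0])) @ map ((+) (1 + (1 + n))) [0..<n]"
  let ?xs = "[0, 0] @ map ((+) 1) ([0..<n] @ [0..<n])"
  have i: "ident ?P 1 = dcl \<Sigma> 1 [0] [0]" by (simp add: ident_Csp)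
  have 1: "tensor ?P (ident ?P 1) (swap ?P 1 n) = dcl \<Sigma> (1 + (1 + n)) ([0] @ map ((+) 1) [0..<1 + n]) ([0] @ map ((+) 1) ([1..<1 + n] @ [0]))"
    unfolding swap_Csp(1) i by (subst tensor_discrete) (auto simp: upt_1)
  have 2: "tensor ?P (tensor ?P (ident ?P 1) (swap ?P 1 n)) (ident ?P n) = dcl \<Sigma> (1 + (1 + n) + n) [0..<1 + (1 + n) + n] ?zs"
    unfolding 1 unfolding ident_Csp upt_1_append by (subst tensor_discrete) (auto simp: upt_append simp del: upt_Suc)
  have 3: "tensor ?P (dcl \<Sigma> 1 [0] [0, 0]) (copy_power ?P (dcl \<Sigma> 1 [0] [0, 0]) n) = dcl \<Sigma> (1 + n) [0..<1 + n] ?xs"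
    unfolding Suc upt_1_append[symmetric] by (subst tensor_discrete) auto
  have l: "length ?xs = 1 + (1 + n) + n" by simp
  have "copy_power ?P (dcl \<Sigma> 1 [0] [0, 0]) (Suc n) = dcl \<Sigma> (1 + n) [0..<1 + n] (map ((!) ?xs) ?zs)"
    unfolding copy_power.simps 2 3 l[symmetric] by (rule dcl_compose) auto
  also have "map ((!) ?xs) ?zs = [0..<Suc n] @ [0..<Suc n]"
    by (rule nth_equalityI) (auto simp: nth_append nth_Cons' simp del: upt_Suc)
  finally show ?case by simp
qed

lemma tensor_power_Csp:
  "tensor_power (Csp_prop \<Sigma>) (dcl \<Sigma> 1 [] [0]) n = dcl \<Sigma> n [] [0..<n]"
  "tensor_power (Csp_prop \<Sigma>) (dcl \<Sigma> 1 [0] []) n = dcl \<Sigma> n [0..<n] []"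
proof (induction n)
  case (Suc n)
  show "tensor_power (Csp_prop \<Sigma>) (dcl \<Sigma> 1 [] [0]) (Suc n) = dcl \<Sigma> (Suc n) [] [0..<Suc n]"
    using upt_1_append[of n] unfolding tensor_power.simps Suc by (subst tensor_discrete) (auto simp del: upt_Suc)
  show "tensor_power (Csp_prop \<Sigma>) (dcl \<Sigma> 1 [0] []) (Suc n) = dcl \<Sigma> (Suc n) [0..<Suc n] []"
    using upt_1_append[of n] unfolding tensor_power.simps Suc by (subst tensor_discrete) (auto simp del: upt_Suc)
qed (simp_all add: ident_Csp)

text \<open>With this, a PROP morphism that preserves the Frobenius generators on the object 1
  preserves the canonical trace.\<close>

lemma Csp_frobenius_from: "Csp_frobenius \<Sigma> = frobenius_from (Csp_prop \<Sigma>) (csp_gen \<Sigma>)"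
  by (simp add: Csp_frobenius_def frobenius_from_def csp_gen_def fun_eq_iff
      merge_power_Csp[unfolded One_nat_def] copy_power_Csp[unfolded One_nat_def] tensor_power_Csp[unfolded One_nat_def])

lemma csp_gen_model: "is_model Sym_Mon frob_presentation (Csp \<Sigma>) (csp_gen \<Sigma>)"
  unfolding is_model_def Csp_def
proof (intro conjI ballI)
  fix c show "csp_gen \<Sigma> c \<in> hom (with_canonical_trace (Csp_prop \<Sigma>) (Csp_frobenius \<Sigma>)) (arity frob_presentation c) (coarity frob_presentation c)"
    by (simp add: csp_gen_hom)
next
  fix p assume p: "p \<in> equations frob_presentation"
  obtain s t where st: "p = (s, t)" by (cases p)
  show "case p of (s, t) \<Rightarrow> \<forall>m n. typed Sym_Mon frob_presentation s m n \<longrightarrow> typed Sym_Mon frob_presentation t m n \<longrightarrow>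
    eval frob_presentation (with_canonical_trace (Csp_prop \<Sigma>) (Csp_frobenius \<Sigma>)) (csp_gen \<Sigma>) s =
    eval frob_presentation (with_canonical_trace (Csp_prop \<Sigma>) (Csp_frobenius \<Sigma>)) (csp_gen \<Sigma>) t"
    using csp_frobenius_equations[of s t "with_canonical_trace (Csp_prop \<Sigma>) (Csp_frobenius \<Sigma>)" \<Sigma>] p st by simp
qed

lemma frob_prop_Csp: "frob_prop (Csp_prop \<Sigma>) (csp_gen \<Sigma>)"
  using frob_prop_of_model[OF prop_cat_Csp] csp_gen_model unfolding Csp_def by blast

lemma traced_prop_cat_Csp: "traced_prop_cat (Csp \<Sigma>)"
  unfolding Csp_def Csp_frobenius_from by (rule traced_prop_cat_with_canonical_trace[OF frob_prop_Csp])

lemma cup_Csp: "cup (Csp_prop \<Sigma>) (Csp_frobenius \<Sigma>) x = dcl \<Sigma> x [] ([0..<x] @ [0..<x])"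
proof -
  have "compose (Csp_prop \<Sigma>) (dcl \<Sigma> x [] [0..<x]) (dcl \<Sigma> (length [0..<x]) [0..<length [0..<x]] ([0..<x] @ [0..<x])) =
    dcl \<Sigma> x [] (map ((!) [0..<x]) ([0..<x] @ [0..<x]))"
    by (rule dcl_compose) auto
  moreover have "map ((!) [0..<x]) ([0..<x] @ [0..<x]) = [0..<x] @ [0..<x]"
    by (rule map_idI) auto
  ultimately show ?thesis by (simp add: cup_def Csp_frobenius_def)
qed

lemma cap_Csp: "cap (Csp_prop \<Sigma>) (Csp_frobenius \<Sigma>) x = dcl \<Sigma> x ([0..<x] @ [0..<x]) []"
proof -
  have "compose (Csp_prop \<Sigma>) (dcl \<Sigma> x ([0..<x] @ [0..<x]) [0..<x]) (dcl \<Sigma> (length [0..<x]) [0..<length [0..<x]] []) =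
    dcl \<Sigma> x ([0..<x] @ [0..<x]) (map ((!) [0..<x]) [])"
    by (rule dcl_compose) auto
  then show ?thesis by (simp add: cap_def Csp_frobenius_def)
qed

section \<open>The canonical trace of cospans\<close>

lemma in_zip_upt:
  "(i, y) \<in> set (zip [0..<k] ys) \<longleftrightarrow> i < k \<and> i < length ys \<and> y = ys ! i"
  "(y, i) \<in> set (zip ys [0..<k]) \<longleftrightarrow> i < k \<and> i < length ys \<and> y = ys ! i"
  by (auto simp: in_set_zip intro!: exI[of _ i])

lemma cospan_discreteI:
  "set xs \<subseteq> {..<k} \<Longrightarrow> set ys \<subseteq> {..<k} \<Longrightarrow> length xs = m \<Longrightarrow> length ys = n \<Longrightarrow> cospan \<Sigma> m n (discrete_cospan k xs ys)"
  using cospan_discrete by blast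

text \<open>Cup and cap only link the first \<open>x\<close> vertices of the left leg to those of
  the right leg, so the two pushouts amount to \<open>x\<close> further pairs on the apex of
  \<open>c\<close>.\<close>

lemma trace_Csp:
  assumes c: "cospan \<Sigma> (x + m) (x + n) c" "R \<subseteq> verts (apex c) \<times> verts (apex c)"
  shows "trace (Csp \<Sigma>) x m n (quots \<Sigma> c R) =
    quots \<Sigma> (c\<lparr>left_leg := drop x (left_leg c), right_leg := drop x (right_leg c)\<rparr>)
      (R \<union> set (zip (take x (left_leg c)) (take x (right_leg c))))"
proof -
  let ?P = "Csp_prop \<Sigma>"
  have lc: "length (left_leg c) = x + m" "length (right_leg c) = x + n"
    "set (left_leg c) \<subseteq> verts (apex c)" "set (right_leg c) \<subseteq> verts (apex c)"
    using c(1) by (auto simp: cospan_def)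
  let ?A = "discrete_cospan (x + m) (map ((+) x) [0..<m]) ([0..<x] @ [0..<x + m])"
  let ?I = "discrete_cospan x [0..<x] [0..<x]"
  let ?B = "cospan_sum ?I c"
  let ?C = "discrete_cospan (x + n) ([0..<x] @ [0..<x + n]) (map ((+) x) [0..<n])"
  have a1: "tensor ?P (cup ?P (Csp_frobenius \<Sigma>) x) (ident ?P m) = dcl \<Sigma> (x + m) ([] @ map ((+) x) [0..<m]) (([0..<x] @ [0..<x]) @ map ((+) x) [0..<m])"
    unfolding cup_Csp ident_Csp by (rule tensor_discrete) auto
  have A: "cospan \<Sigma> m (x + (x + m)) ?A"
    by (rule cospan_discreteI) auto
  have I: "cospan \<Sigma> x x ?I"
    by (rule cospan_discreteI) auto
  have C: "cospan \<Sigma> (x + (x + n)) n ?C"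
    by (rule cospan_discreteI) auto
  have B: "cospan \<Sigma> (x + (x + m)) (x + (x + n)) ?B" using I c(1) by (rule cospan_cospan_sum)
  have a: "tensor ?P (cup ?P (Csp_frobenius \<Sigma>) x) (ident ?P m) = quots \<Sigma> ?A {}"
    unfolding a1 using cospan_class_quots[OF A] upt_append[of x m] by simp
  have c1: "tensor ?P (cap ?P (Csp_frobenius \<Sigma>) x) (ident ?P n) = dcl \<Sigma> (x + n) (([0..<x] @ [0..<x]) @ map ((+) x) [0..<n]) ([] @ map ((+) x) [0..<n])"
    unfolding cap_Csp ident_Csp by (rule tensor_discrete) auto
  have cc: "tensor ?P (cap ?P (Csp_frobenius \<Sigma>) x) (ident ?P n) = quots \<Sigma> ?C {}"
    unfolding c1 using cospan_class_quots[OF C] upt_append[of x n] by simp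
  have b: "tensor ?P (ident ?P x) (quots \<Sigma> c R) = quots \<Sigma> ?B (sum_rel {} R)"
    unfolding ident_Csp cospan_class_quots[OF I] using tensor_quots[OF I _ c, of "{}"] by simp
  have sB: "sum_rel {} R \<subseteq> verts (apex ?B) \<times> verts (apex ?B)"
    using c(2) by (auto simp: sum_rel_def)
  let ?S1 = "sum_rel {} (sum_rel {} R) \<union> glue_rel ?A ?B"
  let ?S = "sum_rel ?S1 {} \<union> glue_rel (csp_glue ?A ?B) ?C"
  have ab: "compose ?P (quots \<Sigma> ?A {}) (quots \<Sigma> ?B (sum_rel {} R)) = quots \<Sigma> (csp_glue ?A ?B) ?S1"
    by (rule compose_quots[OF A _ B sB]) simp
  have sAB: "?S1 \<subseteq> verts (apex (csp_glue ?A ?B)) \<times> verts (apex (csp_glue ?A ?B))"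
    using glue_rel_subset[OF A B] sum_rel_subset[of "{}" "verts (apex ?A)" "sum_rel {} R" "verts (apex ?B)"] sB by simp
  have AB: "cospan \<Sigma> m (x + (x + n)) (csp_glue ?A ?B)" using A B by (rule cospan_glue)
  have abc: "compose ?P (quots \<Sigma> (csp_glue ?A ?B) ?S1) (quots \<Sigma> ?C {}) = quots \<Sigma> (csp_glue (csp_glue ?A ?B) ?C) ?S"
    by (rule compose_quots[OF AB sAB C]) simp
  have tr: "trace (Csp \<Sigma>) x m n (quots \<Sigma> c R) = quots \<Sigma> (csp_glue (csp_glue ?A ?B) ?C) ?S"
    unfolding Csp_def with_canonical_trace_simps canonical_trace_def a b cc ab abc ..
  let ?d = "c\<lparr>left_leg := drop x (left_leg c), right_leg := drop x (right_leg c)\<rparr>"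
  let ?Z = "set (zip (take x (left_leg c)) (take x (right_leg c)))"
  \<comment> \<open>Each auxiliary vertex goes to a vertex of \<open>c\<close> that it is glued to.
    On the loop there is a choice, harmless modulo \<open>?Z\<close>: the left leg for the cup and
    the identity strand, the right leg for the cap.\<close>
  let ?hv = "case_sum (case_sum ((!) (left_leg c)) (case_sum ((!) (left_leg c)) id)) ((!) (right_leg c))"
  let ?he = "case_sum (case_sum undefined (case_sum undefined id)) undefined"
  let ?kv = "\<lambda>v. Inl (Inr (Inr v))"
  \<comment> \<open>These four links make up the loop, from a vertex of the left leg through cup,
    identity strand and cap to the corresponding vertex of the right leg.\<close>
  have p1: "(Inl (Inl i), Inl (Inr (Inl i))) \<in> eqv ?S" if "i < x" for i
    using that by (intro eqv_base) (auto simp: in_zip_upt)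
  have p2: "(Inl (Inl i), ?kv (left_leg c ! i)) \<in> eqv ?S" if "i < x + m" for i
    using that lc by (intro eqv_base) (auto simp: in_zip_upt)
  have p3: "(Inl (Inr (Inl i)), Inr i) \<in> eqv ?S" if "i < x" for i
    using that by (intro eqv_base) (auto simp: in_zip_upt)
  have p4: "(?kv (right_leg c ! i), Inr i) \<in> eqv ?S" if "i < x + n" for i
    using that lc by (intro eqv_base) (auto simp: in_zip_upt)
  have z: "(left_leg c ! i, right_leg c ! i) \<in> eqv (R \<union> ?Z)" if "i < x" for i
    using that lc by (intro eqv_base) (auto simp: in_set_zip dest!: spec[of _ i])
  have "quots \<Sigma> (csp_glue (csp_glue ?A ?B) ?C) ?S = quots \<Sigma> ?d (R \<union> ?Z)"
  proof (rule quots_eqI[where hv = ?hv and he = ?he and kv = ?kv])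
    show "cospan \<Sigma> m n (csp_glue (csp_glue ?A ?B) ?C)" using AB C by (rule cospan_glue)
    show "cospan \<Sigma> m n ?d"
      using c(1) by (auto simp: cospan_def dest: in_set_dropD)
    show "hyp_morphism (apex (csp_glue (csp_glue ?A ?B) ?C)) (apex ?d) ?hv ?he"
      using lc by (auto simp: hyp_morphism_def ball_Plus image_subset_iff comp_def subset_iff)
    show "bij_betw ?he (edges (apex (csp_glue (csp_glue ?A ?B) ?C))) (edges (apex ?d))"
      by (rule bij_betw_byWitness[where f' = ?kv]) auto
    show "map ?hv (left_leg (csp_glue (csp_glue ?A ?B) ?C)) = left_leg ?d"
      using lc by (auto intro!: nth_equalityI)
    show "map ?hv (right_leg (csp_glue (csp_glue ?A ?B) ?C)) = right_leg ?d"
      using lc by (auto intro!: nth_equalityI)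
    show "(?hv u, ?hv v) \<in> eqv (R \<union> ?Z)" if "(u, v) \<in> ?S" for u v
      using that lc z by (auto simp: in_zip_upt intro: eqv_base split: sum.splits)
    show "?kv v \<in> verts (apex (csp_glue (csp_glue ?A ?B) ?C))" if "v \<in> verts (apex ?d)" for v
      using that by auto
    show "(?kv u, ?kv v) \<in> eqv ?S" if "(u, v) \<in> R \<union> ?Z" for u v
    proof (cases "(u, v) \<in> R")
      case True
      then show ?thesis by (intro eqv_base) auto
    next
      case False
      with that obtain i where i: "i < x" "u = left_leg c ! i" "v = right_leg c ! i"
        by (auto simp: in_set_zip)
      from i(1) have "i < x + m" "i < x + n" by auto
      from eqv_trans[OF eqv_trans[OF eqv_sym[OF p2[OF this(1)]] eqv_trans[OF p1[OF i(1)] p3[OF i(1)]]] eqv_sym[OF p4[OF this(2)]]]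
      show ?thesis unfolding i(2,3) .
    qed
    show "(?kv (?hv u), u) \<in> eqv ?S" if u: "u \<in> verts (apex (csp_glue (csp_glue ?A ?B) ?C))" for u
    proof -
      consider i where "u = Inl (Inl i)" "i < x + m" | i where "u = Inl (Inr (Inl i))" "i < x"
        | v where "u = Inl (Inr (Inr v))" | i where "u = Inr i" "i < x + n"
        using u by auto
      then show ?thesis
      proof cases
        case (1 i)
        then show ?thesis using eqv_sym[OF p2[of i]] by simp
      next
        case (2 i)
        then show ?thesis using eqv_trans[OF eqv_sym[OF p2[of i]] p1[of i]] by simp
      next
        case (4 i)
        then show ?thesis using p4[of i] by simp
      qed simp
    qed
    show "(?hv (?kv v), v) \<in> eqv (R \<union> ?Z)" for v
      by simp
  qed
  with tr show ?thesis by simp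
qed

subsection \<open>The interpretation of generators\<close>

text \<open>Being a morphism, the identity makes the classes of the generators a model of their own
  presentation.\<close>

lemma with_canonical_trace_identity:
  "is_morphism Sym_Mon P (with_canonical_trace (presented_prop P) F) (\<lambda>X. X)"
  by (simp add: is_morphism_def prop_morphism_def)

lemma is_model_free:
  "is_model D (free_presentation \<Sigma>) Q \<gamma> \<longleftrightarrow> (\<forall>g\<in>gens \<Sigma>. \<gamma> g \<in> hom Q (arity \<Sigma> g) (coarity \<Sigma> g))"
  by (simp add: is_model_def free_presentation_def signature.defs)

lemma is_model_comon_of_frob:
  assumes "is_model Sym_Mon frob_presentation Q \<phi>"
  shows "is_model D comon_presentation Q (case_comon_gen (\<phi> FCopy) (\<phi> FCounit))"
proof -
  have g: "\<phi> c \<in> hom Q (arity frob_presentation c) (coarity frob_presentation c)" for c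
    using assms by (auto simp: is_model_def frob_presentation_def)
  have e: "eval frob_presentation Q \<phi> s = eval frob_presentation Q \<phi> t"
    if "(s, t) \<in> equations frob_presentation" "typed Sym_Mon frob_presentation s m n" "typed Sym_Mon frob_presentation t m n" for s t m n
    using assms that unfolding is_model_def by blast
  note ty = typed_def frob_presentation_def
  note eqs = e[of "Gen FCopy \<triangleright> (Gen FCopy \<oplus> Ident 1)" "Gen FCopy \<triangleright> (Ident 1 \<oplus> Gen FCopy)" 1 3]
    e[of "Gen FCopy \<triangleright> (Gen FCounit \<oplus> Ident 1)" "Ident 1" 1 1]
    e[of "Gen FCopy \<triangleright> (Ident 1 \<oplus> Gen FCounit)" "Ident 1" 1 1]
    e[of "Gen FCopy \<triangleright> Swap 1 1" "Gen FCopy" 1 2]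
  have "eval comon_presentation Q (case_comon_gen (\<phi> FCopy) (\<phi> FCounit)) s =
      eval comon_presentation Q (case_comon_gen (\<phi> FCopy) (\<phi> FCounit)) t"
    if "(s, t) \<in> equations comon_presentation" for s t
    using that eqs by (auto simp: ty comon_presentation_def)
  moreover have "case_comon_gen (\<phi> FCopy) (\<phi> FCounit) c \<in> hom Q (arity comon_presentation c) (coarity comon_presentation c)" for c
    using g[of FCopy] g[of FCounit] by (cases c) (simp_all add: comon_presentation_def frob_presentation_def)
  ultimately show ?thesis by (auto simp: is_model_def)
qed

lemma SMC_Frob_model:
  "is_model Sym_Mon (SMC_Frob_presentation \<Sigma>) (SMC_Frob \<Sigma>) (\<lambda>g. term_class Sym_Mon (SMC_Frob_presentation \<Sigma>) (Gen g))"
  unfolding SMC_Frob_def by (rule is_model_of_morphism[OF with_canonical_trace_identity])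

lemma SMC_Frob_frob_model:
  "is_model Sym_Mon frob_presentation (SMC_Frob \<Sigma>) (\<lambda>c. term_class Sym_Mon (SMC_Frob_presentation \<Sigma>) (Gen (Inr c)))"
  using SMC_Frob_model[of \<Sigma>] unfolding is_model_sum by blast

lemma frob_prop_SMC_Frob:
  "frob_prop (presented_prop (SMC_Frob_presentation \<Sigma>)) (\<lambda>c. term_class Sym_Mon (SMC_Frob_presentation \<Sigma>) (Gen (Inr c)))"
  using frob_prop_of_model[OF prop_cat_presented] SMC_Frob_frob_model unfolding SMC_Frob_def by blast

lemma traced_prop_cat_SMC_Frob: "traced_prop_cat (SMC_Frob \<Sigma>)"
  unfolding SMC_Frob_def by (rule traced_prop_cat_with_canonical_trace[OF frob_prop_SMC_Frob])

lemma is_cat_traced: "traced_prop_cat Q \<Longrightarrow> is_cat D Q"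
  by (simp add: is_cat_def traced_prop_cat.axioms(1))

context frob_prop
begin

text \<open>The canonical trace is a formula in the PROP operations and the four generators, so
  nothing about traces has to be assumed of \<open>F\<close>.\<close>

lemma morphism_canonical_trace:
  assumes F: "prop_morphism P Q F" and h: "h \<in> hom P (x + m) (x + n)"
  shows "F (canonical_trace P (frobenius_from P \<phi>) x m n h) = canonical_trace Q (frobenius_from Q (\<lambda>c. F (\<phi> c))) x m n (F h)"
proof -
  have Fi: "F (ident P n) = ident Q n" and Fs: "F (swap P m n) = swap Q m n" for m n
    using F by (auto simp: prop_morphism_def)
  have Fc: "F (f \<Zcomp> g) = compose Q (F f) (F g)" if "ar f" "ar g" "cd f = dm g" for f g
  proof -
    have "f \<in> hom P (dm f) (cd f)" "g \<in> hom P (cd f) (cd g)" using that by (simp_all add: hom_iff)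
    then show ?thesis using F unfolding prop_morphism_def by blast
  qed
  have Ft: "F (f \<otimes> g) = tensor Q (F f) (F g)" if "ar f" "ar g" for f g
  proof -
    have "f \<in> hom P (dm f) (cd f)" "g \<in> hom P (dm g) (cd g)" using that by (simp_all add: hom_iff)
    then show ?thesis using F unfolding prop_morphism_def by blast
  qed
  have p: "F (merge_power P (\<phi> FMerge) k) = merge_power Q (F (\<phi> FMerge)) k"
    "F (copy_power P (\<phi> FCopy) k) = copy_power Q (F (\<phi> FCopy)) k"
    "F (tensor_power P (\<phi> FUnit) k) = tensor_power Q (F (\<phi> FUnit)) k"
    "F (tensor_power P (\<phi> FCounit) k) = tensor_power Q (F (\<phi> FCounit)) k" for k
    by (induction k) (simp_all add: Fi Fc Ft Fs del: tens_assoc tens_ident)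
  have c: "F (cup P \<F> x) = cup Q (frobenius_from Q (\<lambda>c. F (\<phi> c))) x" "F (cap P \<F> x) = cap Q (frobenius_from Q (\<lambda>c. F (\<phi> c))) x"
    by (simp_all add: cup_def cap_def Fc p) (simp_all add: frobenius_from_def)
  have "ar h" "dm h = x + m" "cd h = x + n" using h by (simp_all add: hom_iff)
  then show ?thesis
    unfolding canonical_trace_def by (simp add: Fc Ft Fi c del: comp_assoc)
qed

end

lemma gen_cospan_simps [simp]:
  "verts (apex (gen_cospan \<Sigma> g)) = {..<arity \<Sigma> g + coarity \<Sigma> g}" "edges (apex (gen_cospan \<Sigma> g)) = {0}"
  "label (apex (gen_cospan \<Sigma> g)) i = g" "sources (apex (gen_cospan \<Sigma> g)) i = [0..<arity \<Sigma> g]"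
  "targets (apex (gen_cospan \<Sigma> g)) i = [arity \<Sigma> g..<arity \<Sigma> g + coarity \<Sigma> g]"
  "left_leg (gen_cospan \<Sigma> g) = [0..<arity \<Sigma> g]"
  "right_leg (gen_cospan \<Sigma> g) = [arity \<Sigma> g..<arity \<Sigma> g + coarity \<Sigma> g]"
  by (simp_all add: gen_cospan_def Let_def)

lemma cospan_gen_cospan: "g \<in> gens \<Sigma> \<Longrightarrow> cospan \<Sigma> (arity \<Sigma> g) (coarity \<Sigma> g) (gen_cospan \<Sigma> g)"
  by (auto simp: cospan_def hyp_def)

lemma sem_gen_Inr: "sem_gen \<Sigma> (Inr c) = csp_gen \<Sigma> c"
  by (cases c) (simp_all add: sem_gen_def csp_gen_def Csp_frobenius_def)

lemma sem_gen_model: "is_model Sym_Mon (SMC_Frob_presentation \<Sigma>) (Csp \<Sigma>) (sem_gen \<Sigma>)"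
proof -
  have "sem_gen \<Sigma> (Inl g) \<in> hom (Csp \<Sigma>) (arity \<Sigma> g) (coarity \<Sigma> g)" if "g \<in> gens \<Sigma>" for g
    using cospan_gen_cospan[OF that] by (auto simp: sem_gen_def Csp_def Csp_simps)
  then show ?thesis
    using csp_gen_model[of \<Sigma>] by (simp add: is_model_sum is_model_free sem_gen_Inr)
qed

lemma sem_class:
  "typed Sym_Mon (SMC_Frob_presentation \<Sigma>) t m n \<Longrightarrow>
    sem \<Sigma> (term_class Sym_Mon (SMC_Frob_presentation \<Sigma>) t) = eval (SMC_Frob_presentation \<Sigma>) (Csp \<Sigma>) (sem_gen \<Sigma>) t"
  unfolding sem_def by (rule induced_class[OF is_cat_traced[OF traced_prop_cat_Csp] sem_gen_model])

lemma typed_Gen_sum: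
  "g \<in> gens \<Sigma> \<Longrightarrow> typed D (presentation_sum (free_presentation \<Sigma>) P) (Gen (Inl g)) (arity \<Sigma> g) (coarity \<Sigma> g)"
  "c \<in> gens P \<Longrightarrow> typed D (presentation_sum (free_presentation \<Sigma>) P) (Gen (Inr c)) (arity P c) (coarity P c)"
  by (auto simp: typed_def presentation_sum_def free_presentation_def signature.defs)

lemma gens_UNIV [simp]: "gens frob_presentation = UNIV" "gens comon_presentation = UNIV"
  by (simp_all add: frob_presentation_def comon_presentation_def)

lemma sem_Gen:
  "g \<in> gens \<Sigma> \<Longrightarrow> sem \<Sigma> (term_class Sym_Mon (SMC_Frob_presentation \<Sigma>) (Gen (Inl g))) = cospan_class \<Sigma> (gen_cospan \<Sigma> g)"
  "sem \<Sigma> (term_class Sym_Mon (SMC_Frob_presentation \<Sigma>) (Gen (Inr c))) = csp_gen \<Sigma> c"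
  using sem_class[OF typed_Gen_sum(1), of g \<Sigma>] sem_class[OF typed_Gen_sum(2), of c \<Sigma>]
  by (simp_all add: sem_gen_Inr) (simp add: sem_gen_def)

text \<open>The Frobenius generators go to those of cospans, so preservation of the trace is an
  instance of \<open>morphism_canonical_trace\<close>.\<close>

lemma sem_morphism: "traced_prop_morphism (SMC_Frob \<Sigma>) (Csp \<Sigma>) (sem \<Sigma>)"
proof -
  let ?P = "presented_prop (SMC_Frob_presentation \<Sigma>)"
  have p: "prop_morphism ?P (Csp \<Sigma>) (sem \<Sigma>)"
    using is_morphism_induced[OF is_cat_traced[OF traced_prop_cat_Csp] sem_gen_model, of \<Sigma>]
    by (simp add: sem_def is_morphism_def)
  interpret frob_prop ?P "\<lambda>c. term_class Sym_Mon (SMC_Frob_presentation \<Sigma>) (Gen (Inr c))"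
    by (rule frob_prop_SMC_Frob)
  have p': "prop_morphism ?P (Csp_prop \<Sigma>) (sem \<Sigma>)"
    using p by (simp add: prop_morphism_def Csp_def)
  have f: "(\<lambda>c. sem \<Sigma> (term_class Sym_Mon (SMC_Frob_presentation \<Sigma>) (Gen (Inr c)))) = csp_gen \<Sigma>"
    by (simp add: fun_eq_iff sem_Gen)
  show ?thesis
    using p morphism_canonical_trace[OF p']
    unfolding traced_prop_morphism_def SMC_Frob_def Csp_def f Csp_frobenius_from
    by (simp add: prop_morphism_def)
qed

lemma I_Gen: "g \<in> gens \<Sigma> \<Longrightarrow> \<I> \<Sigma> (term_class Traced (free_presentation \<Sigma>) (Gen g)) =
    term_class Sym_Mon (SMC_Frob_presentation \<Sigma>) (Gen (Inl g))"
proof -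
  assume g: "g \<in> gens \<Sigma>"
  let ?c = "\<lambda>g. term_class Sym_Mon (SMC_Frob_presentation \<Sigma>) (Gen (Inl g))"
  have i: "induced \<Sigma> (SMC_Frob \<Sigma>) ?c = induced (free_presentation \<Sigma>) (SMC_Frob \<Sigma>) ?c"
    by (simp add: fun_eq_iff induced_def)
  have m: "is_model Traced (free_presentation \<Sigma>) (SMC_Frob \<Sigma>) ?c"
    using SMC_Frob_model[of \<Sigma>] by (simp add: is_model_sum is_model_free)
  have t: "typed Traced (free_presentation \<Sigma>) (Gen g) (arity \<Sigma> g) (coarity \<Sigma> g)"
    using g by (simp add: typed_def free_presentation_def signature.defs)
  show ?thesis
    unfolding \<I>_def i using induced_class[OF is_cat_traced[OF traced_prop_cat_SMC_Frob] m t] by simp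
qed

lemma C_Gen:
  "Frob_inr \<Sigma> (\<C> (term_class Sym_Mon comon_presentation (Gen c))) =
    term_class Sym_Mon (SMC_Frob_presentation \<Sigma>) (Gen (Inr (case_comon_gen FCopy FCounit c)))"
proof -
  let ?c = "\<lambda>c. term_class Sym_Mon frob_presentation (Gen c)"
  let ?d = "\<lambda>c. term_class Sym_Mon (SMC_Frob_presentation \<Sigma>) (Gen (Inr c))"
  have Fc: "is_cat Sym_Mon Frob"
    using prop_cat_cong[OF prop_cat_presented[of Sym_Mon frob_presentation], of Frob] by (simp add: is_cat_def Frob_def)
  have "is_model Sym_Mon frob_presentation Frob ?c"
    unfolding Frob_def by (rule is_model_of_morphism[OF with_canonical_trace_identity])
  from is_model_comon_of_frob[OF this]
  have m: "is_model Sym_Mon comon_presentation Frob (case_comon_gen (?c FCopy) (?c FCounit))" .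
  have t: "typed Sym_Mon comon_presentation (Gen c) (arity comon_presentation c) (coarity comon_presentation c)"
    by (simp add: typed_def)
  have "\<C> (term_class Sym_Mon comon_presentation (Gen c)) = ?c (case_comon_gen FCopy FCounit c)"
    unfolding \<C>_def induced_class[OF Fc m t] by (cases c) simp_all
  moreover have "Frob_inr \<Sigma> (?c d) = ?d d" for d
  proof -
    have t: "typed Sym_Mon frob_presentation (Gen d) (arity frob_presentation d) (coarity frob_presentation d)"
      by (simp add: typed_def)
    show ?thesis
      unfolding Frob_inr_def induced_class[OF is_cat_traced[OF traced_prop_cat_SMC_Frob] SMC_Frob_frob_model t] by simp
  qed
  ultimately show ?thesis by simp
qed

lemma copairing_morphism:
  "traced_prop_morphism (STMC_CComon \<Sigma>) (SMC_Frob \<Sigma>) (copairing_\<I>_\<C> \<Sigma>)"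
  "g \<in> gens \<Sigma> \<Longrightarrow> copairing_\<I>_\<C> \<Sigma> (term_class Traced (STMC_CComon_presentation \<Sigma>) (Gen (Inl g))) =
    term_class Sym_Mon (SMC_Frob_presentation \<Sigma>) (Gen (Inl g))"
  "copairing_\<I>_\<C> \<Sigma> (term_class Traced (STMC_CComon_presentation \<Sigma>) (Gen (Inr c))) =
    term_class Sym_Mon (SMC_Frob_presentation \<Sigma>) (Gen (Inr (case_comon_gen FCopy FCounit c)))"
proof -
  let ?S = "STMC_CComon_presentation \<Sigma>"
  let ?\<gamma> = "case_sum (\<lambda>g. \<I> \<Sigma> (term_class Traced (free_presentation \<Sigma>) (Gen g)))
     (\<lambda>c. (Frob_inr \<Sigma> \<circ> \<C>) (term_class Sym_Mon comon_presentation (Gen c)))"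
  let ?d = "\<lambda>c. term_class Sym_Mon (SMC_Frob_presentation \<Sigma>) (Gen (Inr c))"
  have "(\<lambda>c. (Frob_inr \<Sigma> \<circ> \<C>) (term_class Sym_Mon comon_presentation (Gen c))) = case_comon_gen (?d FCopy) (?d FCounit)"
    by (simp add: fun_eq_iff C_Gen split: comon_gen.split)
  then have m: "is_model Traced ?S (SMC_Frob \<Sigma>) ?\<gamma>"
    using is_model_comon_of_frob[OF SMC_Frob_frob_model, of Traced \<Sigma>] SMC_Frob_model[of \<Sigma>]
    by (simp add: is_model_sum is_model_free I_Gen)
  note Q = is_cat_traced[OF traced_prop_cat_SMC_Frob]
  have e: "copairing_\<I>_\<C> \<Sigma> = induced ?S (SMC_Frob \<Sigma>) ?\<gamma>"
    by (simp add: copairing_\<I>_\<C>_def copairing_def)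
  show "traced_prop_morphism (STMC_CComon \<Sigma>) (SMC_Frob \<Sigma>) (copairing_\<I>_\<C> \<Sigma>)"
    using is_morphism_induced[OF Q m] by (simp add: e is_morphism_def STMC_CComon_def)
  show "g \<in> gens \<Sigma> \<Longrightarrow> copairing_\<I>_\<C> \<Sigma> (term_class Traced ?S (Gen (Inl g))) =
    term_class Sym_Mon (SMC_Frob_presentation \<Sigma>) (Gen (Inl g))"
    using induced_class[OF Q m typed_Gen_sum(1), of g] by (simp add: e I_Gen)
  show "copairing_\<I>_\<C> \<Sigma> (term_class Traced ?S (Gen (Inr c))) =
    term_class Sym_Mon (SMC_Frob_presentation \<Sigma>) (Gen (Inr (case_comon_gen FCopy FCounit c)))"
    using induced_class[OF Q m typed_Gen_sum(2), of c] by (simp add: e C_Gen)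
qed

text \<open>The isomorphism to be established, before corestriction, as a map into all
  cospans.\<close>

definition den :: "'g signature \<Rightarrow> ('g + comon_gen) trm set \<Rightarrow> 'g ncospan set" where
  "den \<Sigma> X = sem \<Sigma> (copairing_\<I>_\<C> \<Sigma> X)"

lemma den_morphism: "traced_prop_morphism (STMC_CComon \<Sigma>) (Csp \<Sigma>) (den \<Sigma>)"
proof -
  have a: "traced_prop_morphism (STMC_CComon \<Sigma>) (SMC_Frob \<Sigma>) (copairing_\<I>_\<C> \<Sigma>)" by (rule copairing_morphism)
  have b: "traced_prop_morphism (SMC_Frob \<Sigma>) (Csp \<Sigma>) (sem \<Sigma>)" by (rule sem_morphism)
  have h: "copairing_\<I>_\<C> \<Sigma> f \<in> hom (SMC_Frob \<Sigma>) m n" if "f \<in> hom (STMC_CComon \<Sigma>) m n" for f m n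
    using a that by (simp add: traced_prop_morphism_def prop_morphism_def)
  show ?thesis
    unfolding traced_prop_morphism_def prop_morphism_def den_def
  proof (intro conjI allI ballI, goal_cases)
    case (1 m n f) then show ?case using h[OF 1] b by (simp add: traced_prop_morphism_def prop_morphism_def)
  next
    case (2 n) then show ?case using a b by (simp add: traced_prop_morphism_def prop_morphism_def)
  next
    case (3 m n p f g)
    show ?case using a b h[OF 3(1)] h[OF 3(2)] 3 unfolding traced_prop_morphism_def prop_morphism_def by metis
  next
    case (4 m n p q f g)
    show ?case using a b h[OF 4(1)] h[OF 4(2)] 4 unfolding traced_prop_morphism_def prop_morphism_def by metis
  next
    case (5 m n) then show ?case using a b by (simp add: traced_prop_morphism_def prop_morphism_def)
  next
    case (6 x m n f)
    show ?case using a b h[OF 6] 6 unfolding traced_prop_morphism_def by metis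
  qed
qed

lemma den_Gen:
  "g \<in> gens \<Sigma> \<Longrightarrow> den \<Sigma> (term_class Traced (STMC_CComon_presentation \<Sigma>) (Gen (Inl g))) = cospan_class \<Sigma> (gen_cospan \<Sigma> g)"
  "den \<Sigma> (term_class Traced (STMC_CComon_presentation \<Sigma>) (Gen (Inr Copy))) = dcl \<Sigma> 1 [0] [0, 0]"
  "den \<Sigma> (term_class Traced (STMC_CComon_presentation \<Sigma>) (Gen (Inr Discard))) = dcl \<Sigma> 1 [0] []"
  by (simp_all add: den_def copairing_morphism sem_Gen csp_gen_def)

subsection \<open>The cospan of a net\<close>

context net_prop
begin

text \<open>A box without inputs has no need of its loop: sliding it round leaves a trace over no
  wires.\<close>

lemma net_snoc_unit:
  assumes v: "valid (Bs @ [(b, [], [a])]) L R" and u: "bx b = un"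
  shows "net (Bs @ [(b, [], [a])]) L R = (un \<otimes> ident P (length L)) \<Zcomp> net Bs (a # L) R"
proof -
  note v' = net_snoc(1)[OF v, simplified]
  have "net (Bs @ [(b, [], [a])]) L R = trace P 1 (length L) (length R) (net Bs (a # L) R \<Zcomp> w 0 un (length R))"
    using net_snoc(2)[OF v] u by simp
  also have "\<dots> = trace P 0 (length L) (length R) (w 0 un (length L) \<Zcomp> net Bs (a # L) R)"
    using v' by (intro tr_slide[symmetric]) simp_all
  also have "\<dots> = w 0 un (length L) \<Zcomp> net Bs (a # L) R"
    using v' by (intro tr_0) simp_all
  finally show ?thesis by (simp add: tens_ident_w)
qed

end

lemma comonoid_prop_of_model:
  assumes Q: "prop_cat Q" and m: "is_model D comon_presentation Q \<phi>"
  shows "comonoid_prop Q (\<phi> Copy) (\<phi> Discard)"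
proof -
  interpret prop_cat Q by (rule Q)
  have g: "\<phi> c \<in> hom Q (arity comon_presentation c) (coarity comon_presentation c)" for c
    using m by (auto simp: is_model_def)
  have e: "eval comon_presentation Q \<phi> s = eval comon_presentation Q \<phi> t"
    if "(s, t) \<in> equations comon_presentation" "typed D comon_presentation s m n" "typed D comon_presentation t m n" for s t m n
    using m that unfolding is_model_def by blast
  note ty = typed_def comon_presentation_def
  show ?thesis
  proof
    show "\<phi> Copy \<in> hom Q 1 2" "\<phi> Discard \<in> hom Q 1 0"
      using g[of Copy] g[of Discard] by (simp_all add: comon_presentation_def)
    show "compose Q (\<phi> Copy) (tensor Q (\<phi> Copy) (ident Q 1)) = compose Q (\<phi> Copy) (tensor Q (ident Q 1) (\<phi> Copy))"
      using e[of "Gen Copy \<triangleright> (Gen Copy \<oplus> Ident 1)" "Gen Copy \<triangleright> (Ident 1 \<oplus> Gen Copy)" 1 3] by (simp add: ty)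
    show "compose Q (\<phi> Copy) (tensor Q (\<phi> Discard) (ident Q 1)) = ident Q 1"
      using e[of "Gen Copy \<triangleright> (Gen Discard \<oplus> Ident 1)" "Ident 1" 1 1] by (simp add: ty)
    show "compose Q (\<phi> Copy) (tensor Q (ident Q 1) (\<phi> Discard)) = ident Q 1"
      using e[of "Gen Copy \<triangleright> (Ident 1 \<oplus> Gen Discard)" "Ident 1" 1 1] by (simp add: ty)
    show "compose Q (\<phi> Copy) (swap Q 1 1) = \<phi> Copy"
      using e[of "Gen Copy \<triangleright> Swap 1 1" "Gen Copy" 1 2] by (simp add: ty)
  qed
qed

lemma STMC_CComon_simps:
  "hom (STMC_CComon \<Sigma>) = hom (presented Traced (STMC_CComon_presentation \<Sigma>))"
  "ident (STMC_CComon \<Sigma>) = ident (presented Traced (STMC_CComon_presentation \<Sigma>))"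
  "compose (STMC_CComon \<Sigma>) = compose (presented Traced (STMC_CComon_presentation \<Sigma>))"
  "tensor (STMC_CComon \<Sigma>) = tensor (presented Traced (STMC_CComon_presentation \<Sigma>))"
  "swap (STMC_CComon \<Sigma>) = swap (presented Traced (STMC_CComon_presentation \<Sigma>))"
  by (simp_all add: STMC_CComon_def)

lemma traced_prop_cat_STMC_CComon: "traced_prop_cat (STMC_CComon \<Sigma>)"
  unfolding STMC_CComon_def by (rule traced_prop_cat_presented)

lemma STMC_CComon_comon_model:
  "is_model Traced comon_presentation (STMC_CComon \<Sigma>) (\<lambda>c. term_class Traced (STMC_CComon_presentation \<Sigma>) (Gen (Inr c)))"
proof -
  have "is_morphism Traced (STMC_CComon_presentation \<Sigma>) (STMC_CComon \<Sigma>) (\<lambda>X. X)"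
    by (simp add: is_morphism_def traced_prop_morphism_def prop_morphism_def STMC_CComon_def)
  from is_model_of_morphism[OF this] show ?thesis by (simp add: is_model_sum)
qed

text \<open>The box \<^const>\<open>None\<close> stands for the trace of the copy: a vertex that is neither an input nor a target.\<close>

definition free_box :: "'g signature \<Rightarrow> 'g option \<Rightarrow> ('g + comon_gen) trm set" where
  "free_box \<Sigma> = case_option
     (trace (STMC_CComon \<Sigma>) 1 0 1 (term_class Traced (STMC_CComon_presentation \<Sigma>) (Gen (Inr Copy))))
     (\<lambda>g. term_class Traced (STMC_CComon_presentation \<Sigma>) (Gen (Inl g)))"

text \<open>Hyperedges are positions and not boxes, since boxes without outputs may occur several
  times. A box \<open>None\<close> contributes its name as a vertex but no hyperedge, so
  \<open>the\<close> is taken on hyperedges only where a label exists.\<close>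

definition cosp :: "('g option \<times> 'v list \<times> 'v list) list \<Rightarrow> 'v list \<Rightarrow> 'v list \<Rightarrow> ('v, nat, 'g) cospan" where
  "cosp Bs L R = \<lparr>apex = \<lparr>verts = set (outs Bs @ L), edges = {i. i < length Bs \<and> fst (Bs ! i) \<noteq> None},
     label = \<lambda>i. the (fst (Bs ! i)), sources = \<lambda>i. fst (snd (Bs ! i)), targets = \<lambda>i. snd (snd (Bs ! i))\<rparr>,
     left_leg = L, right_leg = R\<rparr>"

lemma cosp_simps [simp]:
  "verts (apex (cosp Bs L R)) = set (outs Bs @ L)"
  "edges (apex (cosp Bs L R)) = {i. i < length Bs \<and> fst (Bs ! i) \<noteq> None}"
  "label (apex (cosp Bs L R)) i = the (fst (Bs ! i))" "sources (apex (cosp Bs L R)) i = fst (snd (Bs ! i))"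
  "targets (apex (cosp Bs L R)) i = snd (snd (Bs ! i))"
  "left_leg (cosp Bs L R) = L" "right_leg (cosp Bs L R) = R"
  by (simp_all add: cosp_def)

lemma outs_concat: "outs Bs = concat (map (snd \<circ> snd) Bs)"
  by (simp add: outs_def comp_def case_prod_unfold)

lemma ins_nth_subset: "i < length Bs \<Longrightarrow> set (fst (snd (Bs ! i))) \<subseteq> set (ins Bs)"
  by (auto simp: ins_def case_prod_unfold intro!: bexI[of _ "Bs ! i"])

lemma outs_nth_subset: "i < length Bs \<Longrightarrow> set (snd (snd (Bs ! i))) \<subseteq> set (outs Bs)"
  by (auto simp: outs_def case_prod_unfold intro!: bexI[of _ "Bs ! i"])

section \<open>Nets in the free traced PROP with a comonoid\<close>

locale stmc =
  fixes \<Sigma> :: "'g signature"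
begin

abbreviation "\<S> \<equiv> STMC_CComon_presentation \<Sigma>"
abbreviation "\<P> \<equiv> STMC_CComon \<Sigma>"
abbreviation "cl \<equiv> term_class Traced \<S>"

sublocale net_prop "STMC_CComon \<Sigma>" "term_class Traced (STMC_CComon_presentation \<Sigma>) (Gen (Inr Copy))"
  "term_class Traced (STMC_CComon_presentation \<Sigma>) (Gen (Inr Discard))" "free_box \<Sigma>"
proof -
  show "net_prop (STMC_CComon \<Sigma>) (cl (Gen (Inr Copy))) (cl (Gen (Inr Discard)))"
    unfolding net_prop_def
    using traced_prop_cat_STMC_CComon comonoid_prop_of_model[OF _ STMC_CComon_comon_model, of \<Sigma>]
      traced_prop_cat.axioms(1) by blast
qed

lemma free_box_None: "free_box \<Sigma> None = un"
  by (simp add: free_box_def un_def)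

lemma term_class_hom_iff: "cl t \<in> hom \<P> m n \<longleftrightarrow> typed Traced \<S> t m n"
proof
  assume "cl t \<in> hom \<P> m n"
  then obtain s where s: "typed Traced \<S> s m n" "cl t = cl s" by (auto simp: STMC_CComon_simps elim: presented_homE)
  have "s \<in> cl t" unfolding s(2) by (simp add: term_class_def eq_refl[OF s(1)])
  then have "term_eq Traced \<S> t s" by (simp add: term_class_def)
  from term_eq_typed[OF this] show "typed Traced \<S> t m n" using s(1) by (simp add: typed_def)
qed (simp add: STMC_CComon_simps presented_hom)

lemma okb_iff:
  "okb (Some g, S, T) \<longleftrightarrow> g \<in> gens \<Sigma> \<and> length S = arity \<Sigma> g \<and> length T = coarity \<Sigma> g"
  "okb (None, S, T) \<longleftrightarrow> S = [] \<and> length T = 1"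
proof -
  have "okb (Some g, S, T) \<longleftrightarrow> typed Traced \<S> (Gen (Inl g)) (length S) (length T)"
    unfolding okb_def by (simp add: free_box_def  add: term_class_hom_iff)
  then show "okb (Some g, S, T) \<longleftrightarrow> g \<in> gens \<Sigma> \<and> length S = arity \<Sigma> g \<and> length T = coarity \<Sigma> g"
    by (auto simp: typed_def presentation_sum_def free_presentation_def signature.defs)
  show "okb (None, S, T) \<longleftrightarrow> S = [] \<and> length T = 1"
    by (auto simp: free_box_None)
qed

text \<open>Induction on terms, with the closure properties of nets at the operations;
  \<open>free_box_None\<close> supplies the box that a loop leaves behind.\<close>

lemma rep_term: "typed Traced \<S> t m n \<Longrightarrow> rep m n (cl t)"
proof (induction t arbitrary: m n)
  case (Gen x)
  show ?case
  proof (cases x)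
    case (Inl g)
    have "free_box \<Sigma> (Some g) \<in> hom \<P> m n"
      using Gen Inl unfolding free_box_def by (simp add: term_class_hom_iff)
    from rep_box[OF this] show ?thesis by (simp add: free_box_def Inl)
  next
    case (Inr c)
    then show ?thesis
    proof (cases c)
      case Copy
      then have "m = 1" "n = 2" using Gen Inr by (auto simp: typed_def presentation_sum_def comon_presentation_def)
      moreover have "rep 1 (length [0, 0::nat]) (fn 1 [0, 0])" by (rule rep_fn) simp
      ultimately show ?thesis using Inr Copy fn_cp by (simp add: numeral_2_eq_2 del: fn.simps)
    next
      case Discard
      then have "m = 1" "n = 0" using Gen Inr by (auto simp: typed_def presentation_sum_def comon_presentation_def)
      moreover have "rep 1 (length ([]::nat list)) (fn 1 [])" by (rule rep_fn) simp
      ultimately show ?thesis using Inr Discard fn_dc by (simp del: fn.simps)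
    qed
  qed
next
  case (Ident k)
  have "rep k (length [0..<k]) (fn k [0..<k])" by (rule rep_fn) auto
  then show ?case using Ident by (simp add: fn_ident STMC_CComon_simps presented_ident)
next
  case (Swap p q)
  have "rep (p + q) (length ([p..<p + q] @ [0..<p])) (fn (p + q) ([p..<p + q] @ [0..<p]))" by (rule rep_fn) auto
  then show ?case using Swap by (simp add: STMC_CComon_simps presented_swap flip: fn_swap)
next
  case (Seq s t)
  then have st: "typed Traced \<S> s m (tdom \<S> t)" "typed Traced \<S> t (tdom \<S> t) n" by (auto simp: typed_def)
  from rep_comp[OF free_box_None Seq.IH(1)[OF st(1)] Seq.IH(2)[OF st(2)]] show ?case
    by (simp add: STMC_CComon_simps presented_compose[OF st])
next
  case (Tens s t)
  then have st: "typed Traced \<S> s (tdom \<S> s) (tcod \<S> s)" "typed Traced \<S> t (tdom \<S> t) (tcod \<S> t)"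
    and mn: "m = tdom \<S> s + tdom \<S> t" "n = tcod \<S> s + tcod \<S> t" by (auto simp: typed_def)
  from rep_tens[OF Tens.IH(1)[OF st(1)] Tens.IH(2)[OF st(2)]] show ?case
    unfolding mn by (simp add: STMC_CComon_simps presented_tensor[OF st])
next
  case (Tr x t)
  then have t: "typed Traced \<S> t (x + m) (x + n)" by (auto simp: typed_def)
  from rep_trace[OF free_box_None Tr.IH[OF t]] show ?case
    using presented_trace[OF t] by (simp add: STMC_CComon_def)
qed

lemma rep_hom: "f \<in> hom \<P> m n \<Longrightarrow> rep m n f"
  using rep_term by (auto simp: STMC_CComon_simps elim: presented_homE)

lemma den_simps:
  "den \<Sigma> (ident \<P> n) = ident (Csp_prop \<Sigma>) n"
  "ar f \<Longrightarrow> ar g \<Longrightarrow> cd f = dm g \<Longrightarrow> den \<Sigma> (compose \<P> f g) = compose (Csp_prop \<Sigma>) (den \<Sigma> f) (den \<Sigma> g)"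
  "ar f \<Longrightarrow> ar g \<Longrightarrow> den \<Sigma> (tensor \<P> f g) = tensor (Csp_prop \<Sigma>) (den \<Sigma> f) (den \<Sigma> g)"
  "den \<Sigma> (swap \<P> m n) = swap (Csp_prop \<Sigma>) m n"
  "ar f \<Longrightarrow> dm f = x + m \<Longrightarrow> cd f = x + n \<Longrightarrow> den \<Sigma> (trace \<P> x m n f) = trace (Csp \<Sigma>) x m n (den \<Sigma> f)"
proof -
  note F = den_morphism[of \<Sigma>, unfolded traced_prop_morphism_def prop_morphism_def]
  show "den \<Sigma> (ident \<P> n) = ident (Csp_prop \<Sigma>) n" "den \<Sigma> (swap \<P> m n) = swap (Csp_prop \<Sigma>) m n"
    using F by (auto simp: Csp_def)
  show "den \<Sigma> (compose \<P> f g) = compose (Csp_prop \<Sigma>) (den \<Sigma> f) (den \<Sigma> g)" if "ar f" "ar g" "cd f = dm g"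
  proof -
    have "f \<in> hom \<P> (dm f) (cd f)" "g \<in> hom \<P> (cd f) (cd g)" using that by (simp_all add: hom_iff)
    then show ?thesis using F unfolding Csp_def with_canonical_trace_simps by blast
  qed
  show "den \<Sigma> (tensor \<P> f g) = tensor (Csp_prop \<Sigma>) (den \<Sigma> f) (den \<Sigma> g)" if "ar f" "ar g"
  proof -
    have "f \<in> hom \<P> (dm f) (cd f)" "g \<in> hom \<P> (dm g) (cd g)" using that by (simp_all add: hom_iff)
    then show ?thesis using F unfolding Csp_def with_canonical_trace_simps by blast
  qed
  show "den \<Sigma> (trace \<P> x m n f) = trace (Csp \<Sigma>) x m n (den \<Sigma> f)" if "ar f" "dm f = x + m" "cd f = x + n"
  proof -
    have "f \<in> hom \<P> (x + m) (x + n)" using that by (simp add: hom_iff)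
    from F[THEN conjunct2, rule_format, OF this] show ?thesis .
  qed
qed

section \<open>The interpretation of wirings\<close>

lemma den_copy: "den \<Sigma> (cl (Gen (Inr Copy))) = dcl \<Sigma> 1 [0] [0, 0]"
  and den_discard: "den \<Sigma> (cl (Gen (Inr Discard))) = dcl \<Sigma> 1 [0] []"
  by (simp_all add: den_Gen)

lemma den_Dl: "den \<Sigma> (\<Delta> n) = dcl \<Sigma> n [0..<n] ([0..<n] @ [0..<n])"
proof -
  have "den \<Sigma> (\<Delta> n) = copy_power (Csp_prop \<Sigma>) (dcl \<Sigma> 1 [0] [0, 0]) n"
    by (induction n) (simp_all add: copy_power.simps den_simps den_copy del: tens_assoc tens_ident)
  then show ?thesis unfolding copy_power_Csp .
qed

lemma den_Ec: "den \<Sigma> (\<E> n) = dcl \<Sigma> n [0..<n] []"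
proof -
  have "den \<Sigma> (\<E> n) = tensor_power (Csp_prop \<Sigma>) (dcl \<Sigma> 1 [0] []) n"
    by (induction n) (simp_all add: tensor_power.simps den_simps den_discard)
  then show ?thesis unfolding tensor_power_Csp .
qed

lemma den_pr:
  assumes "x < p"
  shows "den \<Sigma> (pr p x) = dcl \<Sigma> p [0..<p] [x]"
proof -
  let ?q = "p - Suc x"
  have "den \<Sigma> (pr p x) = tensor (Csp_prop \<Sigma>) (dcl \<Sigma> x [0..<x] [])
      (tensor (Csp_prop \<Sigma>) (dcl \<Sigma> 1 [0] [0]) (dcl \<Sigma> ?q [0..<?q] []))"
    by (simp add: pr_def den_simps den_Ec ident_Csp)
  also have "tensor (Csp_prop \<Sigma>) (dcl \<Sigma> 1 [0] [0]) (dcl \<Sigma> ?q [0..<?q] []) = dcl \<Sigma> (1 + ?q) [0..<1 + ?q] [0]"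
    unfolding upt_1_append[symmetric] by (subst tensor_discrete) auto
  also have "tensor (Csp_prop \<Sigma>) (dcl \<Sigma> x [0..<x] []) \<dots> = dcl \<Sigma> (x + (1 + ?q)) [0..<x + (1 + ?q)] [x]"
    unfolding upt_append[symmetric] by (subst tensor_discrete) auto
  finally show ?thesis using assms by simp
qed

lemma den_fn: "set xs \<subseteq> {..<p} \<Longrightarrow> den \<Sigma> (fn p xs) = dcl \<Sigma> p [0..<p] xs"
proof (induction xs)
  case Nil
  then show ?case by (simp add: den_Ec)
next
  case (Cons x xs)
  let ?u = "[0..<p] @ [0..<p]"
  have x: "x < p" "set xs \<subseteq> {..<p}" using Cons.prems by auto
  have "den \<Sigma> (fn p (x # xs)) = compose (Csp_prop \<Sigma>) (dcl \<Sigma> p [0..<p] ?u) (tensor (Csp_prop \<Sigma>) (dcl \<Sigma> p [0..<p] [x]) (dcl \<Sigma> p [0..<p] xs))"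
    using x Cons.IH by (simp add: den_simps den_Dl den_pr)
  also have "tensor (Csp_prop \<Sigma>) (dcl \<Sigma> p [0..<p] [x]) (dcl \<Sigma> p [0..<p] xs) = dcl \<Sigma> (p + p) [0..<p + p] ([x] @ map ((+) p) xs)"
    unfolding upt_append[symmetric] using x by (subst tensor_discrete) auto
  also have "compose (Csp_prop \<Sigma>) (dcl \<Sigma> p [0..<p] ?u) (dcl \<Sigma> (p + p) [0..<p + p] ([x] @ map ((+) p) xs)) = dcl \<Sigma> p [0..<p] (map ((!) ?u) ([x] @ map ((+) p) xs))"
  proof -
    have l: "p + p = length ?u" by simp
    show ?thesis unfolding l by (rule dcl_compose) (use x in auto)
  qed
  also have "map ((!) ?u) ([x] @ map ((+) p) xs) = x # xs"
    using x by (auto simp: nth_append subset_iff intro!: map_idI)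
  finally show ?case .
qed

lemma cospan_cosp:
  assumes v: "valid Bs L R"
  shows "cospan \<Sigma> (length L) (length R) (cosp Bs L R)"
proof -
  have s: "set (ins Bs @ R) \<subseteq> set (outs Bs @ L)" using v by (simp add: valid_def)
  have "label (apex (cosp Bs L R)) i \<in> gens \<Sigma> \<and>
      length (sources (apex (cosp Bs L R)) i) = arity \<Sigma> (label (apex (cosp Bs L R)) i) \<and>
      set (sources (apex (cosp Bs L R)) i) \<subseteq> verts (apex (cosp Bs L R)) \<and>
      length (targets (apex (cosp Bs L R)) i) = coarity \<Sigma> (label (apex (cosp Bs L R)) i) \<and>
      set (targets (apex (cosp Bs L R)) i) \<subseteq> verts (apex (cosp Bs L R))"
    if i: "i < length Bs" "fst (Bs ! i) \<noteq> None" for i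
  proof -
    obtain g S T where B: "Bs ! i = (Some g, S, T)" using i(2) by (cases "Bs ! i") auto
    have "okb (Some g, S, T)" using v i(1) B nth_mem[of i Bs] by (auto simp: valid_def)
    from this[unfolded okb_iff] show ?thesis
      using B ins_nth_subset[OF i(1)] outs_nth_subset[OF i(1)] s by auto
  qed
  then show ?thesis
    using s by (simp add: cospan_def hyp_def)
qed

text \<open>\<open>den_fn\<close> yields positions as vertices, \<open>cosp\<close> has names;
  indexing into \<open>L\<close> and \<open>idx L\<close> translate between them.\<close>

lemma den_wire:
  assumes "distinct L" "set R \<subseteq> set L"
  shows "den \<Sigma> (wire L R) = quots \<Sigma> (cosp [] L R) {}"
proof -
  let ?ys = "map (idx L) R"
  have s: "set [0..<length L] \<subseteq> {..<length L}" "set ?ys \<subseteq> {..<length L}"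
    using assms(2) by (auto intro: idx_less)
  have v: "valid [] L R" using assms by (simp add: valid_def)
  have "den \<Sigma> (wire L R) = quots \<Sigma> (discrete_cospan (length L) [0..<length L] ?ys) {}"
    unfolding wire_def den_fn[OF s(2)] by (rule dcl_quots[OF s])
  also have "\<dots> = quots \<Sigma> (cosp [] L R) {}"
  proof (rule quots_isoI[where hv = "(!) L" and he = id and kv = "idx L" and ke = id])
    show "cospan \<Sigma> (length L) (length R) (discrete_cospan (length L) [0..<length L] ?ys)"
      using cospan_discrete[OF s] by simp
    show "cospan \<Sigma> (length L) (length R) (cosp [] L R)" by (rule cospan_cosp[OF v])
  qed (use assms in \<open>auto simp: hyp_morphism_def map_nth subset_iff idx_less intro!: map_idI\<close>)
  finally show ?thesis .
qed

text \<open>By \<open>net_snoc\<close> the box is composed after the smaller net and its outputs are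
  traced: composition glues its input vertices to \<open>S\<close>, the trace its output vertices to
  \<open>T\<close>.\<close>

lemma den_net_box:
  assumes v: "valid (Bs @ [(Some g, S, T)]) L R"
    and IH: "den \<Sigma> (net Bs (T @ L) (S @ R)) = quots \<Sigma> (cosp Bs (T @ L) (S @ R)) {}"
  shows "den \<Sigma> (net (Bs @ [(Some g, S, T)]) L R) = quots \<Sigma> (cosp (Bs @ [(Some g, S, T)]) L R) {}"
proof -
  let ?B = "(Some g, S, T)" and ?k = "arity \<Sigma> g" and ?l = "coarity \<Sigma> g" and ?m = "length L" and ?n = "length R"
  have v': "valid Bs (T @ L) (S @ R)" by (rule net_snoc(1)[OF v])
  have ok: "okb ?B" using v by (simp add: valid_def)
  from this[unfolded okb_iff] have g: "g \<in> gens \<Sigma>" and kl: "length S = ?k" "length T = ?l" by simp_all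
  note ok' = ok[unfolded okb_simp]
  let ?P = "Csp_prop \<Sigma>" and ?c = "cosp Bs (T @ L) (S @ R)"
  let ?d = "cospan_sum (gen_cospan \<Sigma> g) (discrete_cospan ?n [0..<?n] [0..<?n])"
  have d: "den \<Sigma> (w 0 (free_box \<Sigma> (Some g)) ?n) = quots \<Sigma> ?d {}"
  proof -
    have "den \<Sigma> (free_box \<Sigma> (Some g) ) = quots \<Sigma> (gen_cospan \<Sigma> g) {}"
      using den_Gen(1)[OF g] cospan_class_quots[OF cospan_gen_cospan[OF g]] by (simp add: free_box_def)
    moreover have "ident ?P ?n = quots \<Sigma> (discrete_cospan ?n [0..<?n] [0..<?n]) {}"
      unfolding ident_Csp by (rule dcl_quots) auto
    moreover have "den \<Sigma> (w 0 (free_box \<Sigma> (Some g)) ?n) = tensor ?P (den \<Sigma> (free_box \<Sigma> (Some g))) (ident ?P ?n)"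
      using ok' by (simp add: den_simps flip: tens_ident_w)
    ultimately show ?thesis
      using tensor_quots[OF cospan_gen_cospan[OF g] _ cospan_discreteI[of "[0..<?n]" ?n "[0..<?n]" ?n ?n \<Sigma>], of "{}" "{}"]
      by (simp add: sum_rel_def atLeast0LessThan)
  qed
  have cc: "cospan \<Sigma> (?l + ?m) (?k + ?n) ?c" using cospan_cosp[OF v'] kl by simp
  have cd: "cospan \<Sigma> (?k + ?n) (?l + ?n) ?d"
    by (rule cospan_cospan_sum[OF cospan_gen_cospan[OF g] cospan_discreteI]) auto
  have glue: "cospan \<Sigma> (?l + ?m) (?l + ?n) (csp_glue ?c ?d)" by (rule cospan_glue[OF cc cd])
  let ?e = "(csp_glue ?c ?d)\<lparr>left_leg := drop ?l (left_leg (csp_glue ?c ?d)), right_leg := drop ?l (right_leg (csp_glue ?c ?d))\<rparr>"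
  let ?Z = "set (zip (take ?l (left_leg (csp_glue ?c ?d))) (take ?l (right_leg (csp_glue ?c ?d))))"
  have "den \<Sigma> (net (Bs @ [?B]) L R) = trace (Csp \<Sigma>) ?l ?m ?n (compose ?P (quots \<Sigma> ?c {}) (quots \<Sigma> ?d {}))"
    unfolding net_snoc(2)[OF v] kl d[symmetric] IH[symmetric]
    using ok' kl v' by (simp add: den_simps)
  also have "compose ?P (quots \<Sigma> ?c {}) (quots \<Sigma> ?d {}) = quots \<Sigma> (csp_glue ?c ?d) (glue_rel ?c ?d)"
    using compose_quots[OF cc _ cd, of "{}" "{}"] by (simp add: sum_rel_def)
  also have "trace (Csp \<Sigma>) ?l ?m ?n \<dots> = quots \<Sigma> ?e (glue_rel ?c ?d \<union> ?Z)"
    by (rule trace_Csp[OF glue glue_rel_subset[OF cc cd]])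
  also have "\<dots> = quots \<Sigma> (cosp (Bs @ [?B]) L R) {}"
  \<comment> \<open>Vertices of the box go to the names at its ports: the \<open>?k\<close> inputs
    come first in \<open>gen_cospan\<close>, so output \<open>i\<close> has the number
    \<open>?k + i\<close>. Vertices of the straight wires go to the names in
    \<open>R\<close>.\<close>
  proof (rule quots_eqI[where hv = "case_sum id (case_sum (\<lambda>i. if i < ?k then S ! i else T ! (i - ?k)) ((!) R))"
        and he = "case_sum id (case_sum (\<lambda>_. length Bs) undefined)" and kv = Inl])
    let ?hv = "case_sum id (case_sum (\<lambda>i. if i < ?k then S ! i else T ! (i - ?k)) ((!) R))"
    let ?he = "case_sum id (case_sum (\<lambda>_. length Bs) undefined) :: nat + nat + nat \<Rightarrow> nat"
    have s: "set S \<subseteq> set (outs Bs @ T @ L)" "set R \<subseteq> set (outs Bs @ T @ L)"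
      using v' by (auto simp: valid_def)
    show "cospan \<Sigma> ?m ?n ?e"
      using glue cc cd kl by (auto simp: cospan_def dest: in_set_dropD)
    show "cospan \<Sigma> ?m ?n (cosp (Bs @ [?B]) L R)" by (rule cospan_cosp[OF v])
    have hs: "S ! i \<in> set (outs Bs @ T @ L)" if "i < ?k" for i by (rule subsetD[OF s(1)]) (use that kl in simp)
    have ht: "T ! i \<in> set (outs Bs @ T @ L)" if "i < ?l" for i using that kl by simp
    have hr: "R ! i \<in> set (outs Bs @ T @ L)" if "i < ?n" for i by (rule subsetD[OF s(2)]) (use that in simp)
    have V: "?hv u \<in> set (outs Bs @ T @ L)" if "u \<in> verts (apex ?e)" for u
      using that hs ht hr kl by (auto split: sum.splits)
    show "hyp_morphism (apex ?e) (apex (cosp (Bs @ [?B]) L R)) ?hv ?he"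
      unfolding hyp_morphism_def
    proof (intro conjI)
      show "?hv ` verts (apex ?e) \<subseteq> verts (apex (cosp (Bs @ [?B]) L R))" using V by auto
      show "?he ` edges (apex ?e) \<subseteq> edges (apex (cosp (Bs @ [?B]) L R))" by (auto simp: nth_append)
      have "map (\<lambda>i. if i < ?k then S ! i else T ! (i - ?k)) [0..<?k] = S"
        "map (\<lambda>i. if i < ?k then S ! i else T ! (i - ?k)) [?k..<?k + ?l] = T"
        using kl by (auto intro!: nth_equalityI)
      then show "\<forall>e\<in>edges (apex ?e). label (apex (cosp (Bs @ [?B]) L R)) (?he e) = label (apex ?e) e \<and>
        sources (apex (cosp (Bs @ [?B]) L R)) (?he e) = map ?hv (sources (apex ?e) e) \<and>
        targets (apex (cosp (Bs @ [?B]) L R)) (?he e) = map ?hv (targets (apex ?e) e)"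
        by (auto simp: ball_Plus nth_append comp_def)
    qed
    show "bij_betw ?he (edges (apex ?e)) (edges (apex (cosp (Bs @ [?B]) L R)))"
      \<comment> \<open>The last position belongs to the new box, and 0 is the only hyperedge of
        \<open>gen_cospan\<close>.\<close>
      by (rule bij_betw_byWitness[where f' = "\<lambda>i. if i < length Bs then Inl i else Inr (Inl 0)"])
         (auto simp: nth_append less_Suc_eq split: if_splits)
    show "map ?hv (left_leg ?e) = left_leg (cosp (Bs @ [?B]) L R)" using kl by (simp add: comp_def)
    show "map ?hv (right_leg ?e) = right_leg (cosp (Bs @ [?B]) L R)"
      using kl by (auto intro!: nth_equalityI)
    have g1: "(Inl (S ! i), Inr (Inl i)) \<in> glue_rel ?c ?d" if "i < ?k" for i
      using that kl by (auto simp: in_set_zip nth_append intro!: exI[of _ i])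
    have g2: "(Inl (R ! i), Inr (Inr i)) \<in> glue_rel ?c ?d" if "i < ?n" for i
      using that kl by (simp add: in_zip_upt)
    have g3: "(Inl (T ! i), Inr (Inl (?k + i))) \<in> ?Z" if "i < ?l" for i
      using that kl by (auto simp: in_set_zip nth_append intro!: exI[of _ i])
    show "(?hv u, ?hv v) \<in> eqv {}" if "(u, v) \<in> glue_rel ?c ?d \<union> ?Z" for u v
    proof -
      have "?hv u = ?hv v"
        using that
      proof
        assume "(u, v) \<in> glue_rel ?c ?d"
        then show ?thesis using kl by (auto simp: glue_rel_image in_set_zip)
      next
        assume "(u, v) \<in> ?Z"
        then obtain i where "i < ?l" "u = Inl (T ! i)" "v = Inr (Inl (?k + i))"
          using kl by (auto simp: in_set_zip nth_append)
        then show ?thesis by simp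
      qed
      then show ?thesis by simp
    qed
    show "Inl x \<in> verts (apex ?e)" if "x \<in> verts (apex (cosp (Bs @ [?B]) L R))" for x
      using that by auto
    show "(Inl x, Inl y) \<in> eqv (glue_rel ?c ?d \<union> ?Z)" if "(x, y) \<in> {}" for x y
      using that by simp
    show "(Inl (?hv u), u) \<in> eqv (glue_rel ?c ?d \<union> ?Z)" if u: "u \<in> verts (apex ?e)" for u
    proof -
      consider x where "u = Inl x" | i where "u = Inr (Inl i)" "i < ?k" | i where "u = Inr (Inl (?k + i))" "i < ?l"
        | i where "u = Inr (Inr i)" "i < ?n"
      proof (cases u)
        case (Inr y)
        show ?thesis
        proof (cases y)
          case (Inl i)
          show ?thesis
          proof (cases "i < ?k")
            case False
            then have "i = ?k + (i - ?k)" "i - ?k < ?l" using u Inr Inl by auto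
            then show ?thesis using that(3)[of "i - ?k"] Inr Inl by simp
          qed (use that(2) Inr Inl in blast)
        qed (use that(4) Inr u in auto)
      qed (use that(1) in blast)
      then show ?thesis
        by cases (use g1 g2 g3 in \<open>auto intro: eqv_base\<close>)
    qed
    show "(?hv (Inl x), x) \<in> eqv {}" for x by simp
  qed
  finally show ?thesis .
qed

end

text \<open>Distinctness of all output names means that a name determines the box and the port
  producing it; such pairs are what the in-degree counts.\<close>

lemma distinct_concat_nth:
  "distinct (concat xss) \<Longrightarrow> i < length xss \<Longrightarrow> i' < length xss \<Longrightarrow> j < length (xss ! i) \<Longrightarrow> j' < length (xss ! i') \<Longrightarrow>
    xss ! i ! j = xss ! i' ! j' \<Longrightarrow> i = i' \<and> j = j'"
proof (induction xss arbitrary: i i')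
  case (Cons xs xss)
  have d: "distinct xs" "distinct (concat xss)" and dj: "set xs \<inter> set (concat xss) = {}"
    using Cons.prems(1) by auto
  have mem: "xss ! k ! l \<in> set (concat xss)" if "k < length xss" "l < length (xss ! k)" for k l
    using nth_mem[OF that(1)] nth_mem[OF that(2)] by (auto intro!: bexI[of _ "xss ! k"])
  show ?case
  proof (cases i; cases i')
    fix k assume i: "i = 0" "i' = Suc k"
    then have "xss ! k ! j' \<in> set (concat xss)" "xss ! k ! j' \<in> set xs"
      using Cons.prems(3,4,5,6) mem[of k j'] nth_mem[of j xs] by auto
    then show ?thesis using dj by blast
  next
    fix k assume i: "i = Suc k" "i' = 0"
    then have "xss ! k ! j \<in> set (concat xss)" "xss ! k ! j \<in> set xs"
      using Cons.prems(2,4,5,6) mem[of k j] nth_mem[of j' xs] by auto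
    then show ?thesis using dj by blast
  next
    fix k k' assume "i = Suc k" "i' = Suc k'"
    then show ?thesis using Cons.IH[of k k'] Cons.prems d by simp
  qed (use Cons.prems d in \<open>simp add: nth_eq_iff_index_eq\<close>)
qed simp

text \<open>The opposite passage, from uniqueness of the producing ports to distinct output names,
  for reading a net off a cospan.\<close>

lemma distinct_concat_map:
  assumes "distinct es"
    and "\<And>e e' j j'. e \<in> set es \<Longrightarrow> e' \<in> set es \<Longrightarrow> j < length (f e) \<Longrightarrow> j' < length (f e') \<Longrightarrow> f e ! j = f e' ! j' \<Longrightarrow> e = e' \<and> j = j'"
  shows "distinct (concat (map f es))"
  using assms
proof (induction es)
  case (Cons e es)
  have "distinct (f e)"
    using Cons.prems(2)[of e e] by (auto simp: distinct_conv_nth)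
  moreover have "set (f e) \<inter> set (concat (map f es)) = {}"
  proof -
    have False if "v \<in> set (f e)" "e' \<in> set es" "v \<in> set (f e')" for v e'
    proof -
      obtain j j' where "j < length (f e)" "f e ! j = v" "j' < length (f e')" "f e' ! j' = v"
        using \<open>v \<in> set (f e)\<close> \<open>v \<in> set (f e')\<close> by (auto simp: in_set_conv_nth)
      then have "e = e'" using Cons.prems(2)[of e e' j j'] \<open>e' \<in> set es\<close> by simp
      then show False using Cons.prems(1) \<open>e' \<in> set es\<close> by simp
    qed
    then show ?thesis by auto
  qed
  moreover have "distinct (concat (map f es))"
    using Cons.prems by (intro Cons.IH) auto
  ultimately show ?case by simp
qed simp

context stmc
begin

lemma den_net_unit:
  assumes v: "valid (Bs @ [(None, [], [a])]) L R"
    and IH: "den \<Sigma> (net Bs (a # L) R) = quots \<Sigma> (cosp Bs (a # L) R) {}"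
  shows "den \<Sigma> (net (Bs @ [(None, [], [a])]) L R) = quots \<Sigma> (cosp (Bs @ [(None, [], [a])]) L R) {}"
proof -
  let ?P = "Csp_prop \<Sigma>" and ?m = "length L"
  have v': "valid Bs (a # L) R" using net_snoc(1)[OF v] by simp
  have cc: "cospan \<Sigma> (1 + ?m) (length R) (cosp Bs (a # L) R)" using cospan_cosp[OF v'] by simp
  have un: "den \<Sigma> un = dcl \<Sigma> 1 [] [0]"
  proof -
    have c: "cospan \<Sigma> (1 + 0) (1 + 1) (discrete_cospan 1 [0] [0, 0])" by (rule cospan_discreteI) auto
    have "den \<Sigma> un = trace (Csp \<Sigma>) 1 0 1 (quots \<Sigma> (discrete_cospan 1 [0] [0, 0]) {})"
      unfolding un_def cospan_class_quots[OF c, symmetric] den_copy[symmetric]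
      by (rule den_simps(5)) simp_all
    \<comment> \<open>The trace identifies the vertex 0 with itself: the pair is trivial, and a
      vertex remains that lies on the right leg only.\<close>
    also have "\<dots> = quots \<Sigma> (discrete_cospan 1 [] [0]) {(0, 0)}"
      by (subst trace_Csp[OF c]) (simp_all add: discrete_cospan_def)
    also have "\<dots> = quots \<Sigma> (discrete_cospan 1 [] [0]) {}"
    proof (rule quots_eqI[where hv = id and he = id and kv = id])
      show "cospan \<Sigma> 0 1 (discrete_cospan 1 [] [0])" "cospan \<Sigma> 0 1 (discrete_cospan 1 [] [0])"
        by (rule cospan_discreteI; simp)+
    qed (auto simp: hyp_morphism_def)
    also have "\<dots> = dcl \<Sigma> 1 [] [0]" by (rule dcl_quots[symmetric]) auto
    finally show ?thesis .
  qed
  have "den \<Sigma> (net (Bs @ [(None, [], [a])]) L R) =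
      compose ?P (tensor ?P (dcl \<Sigma> 1 [] [0]) (ident ?P ?m)) (quots \<Sigma> (cosp Bs (a # L) R) {})"
    unfolding net_snoc_unit[OF v free_box_None] IH[symmetric] un[symmetric] using v' by (simp add: den_simps)
  also have "tensor ?P (dcl \<Sigma> 1 [] [0]) (ident ?P ?m) = dcl \<Sigma> (1 + ?m) ([] @ map ((+) 1) [0..<?m]) ([0] @ map ((+) 1) [0..<?m])"
    unfolding ident_Csp by (rule tensor_discrete) auto
  also have "[0] @ map ((+) 1) [0..<?m] = [0..<1 + ?m]" by (rule upt_1_append)
  also have "compose ?P (dcl \<Sigma> (1 + ?m) ([] @ map ((+) 1) [0..<?m]) [0..<1 + ?m]) (quots \<Sigma> (cosp Bs (a # L) R) {}) =
      quots \<Sigma> ((cosp Bs (a # L) R)\<lparr>left_leg := map ((!) (left_leg (cosp Bs (a # L) R))) ([] @ map ((+) 1) [0..<?m])\<rparr>) {}"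
    by (rule discrete_compose[OF cc]) auto
  also have "map ((!) (left_leg (cosp Bs (a # L) R))) ([] @ map ((+) 1) [0..<?m]) = L"
    by (auto intro!: nth_equalityI)
  also have "quots \<Sigma> ((cosp Bs (a # L) R)\<lparr>left_leg := L\<rparr>) {} = quots \<Sigma> (cosp (Bs @ [(None, [], [a])]) L R) {}"
  proof (rule quots_isoI[where hv = id and he = id and kv = id and ke = id])
    show "cospan \<Sigma> ?m (length R) ((cosp Bs (a # L) R)\<lparr>left_leg := L\<rparr>)"
      using cospan_update(2)[OF cc, of L] by auto
    show "cospan \<Sigma> ?m (length R) (cosp (Bs @ [(None, [], [a])]) L R)" by (rule cospan_cosp[OF v])
  qed (auto simp: hyp_morphism_def nth_append less_Suc_eq)
  finally show ?thesis .
qed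

text \<open>Induction from the end of the list, since \<open>net_snoc\<close> splits off the last
  box.\<close>

lemma den_net: "valid Bs L R \<Longrightarrow> den \<Sigma> (net Bs L R) = quots \<Sigma> (cosp Bs L R) {}"
proof (induction Bs arbitrary: L R rule: rev_induct)
  case Nil
  then show ?case using den_wire[of L R] by (simp add: net_Nil valid_def)
next
  case (snoc B Bs)
  obtain b S T where B: "B = (b, S, T)" by (cases B) auto
  have v: "valid Bs (T @ L) (S @ R)" using net_snoc(1)[of Bs b S T L R] snoc.prems B by simp
  show ?case
  proof (cases b)
    case None
    have "okb (None, S, T)" using snoc.prems B None by (simp add: valid_def)
    from this[unfolded okb_iff] obtain a where "S = []" "T = [a]" by (auto simp: length_Suc_conv)
    then show ?thesis
      using den_net_unit[of Bs a L R] snoc.prems snoc.IH[OF v] B None by simp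
  next
    case (Some g)
    then show ?thesis
      using den_net_box[of Bs g S T L R] snoc.prems snoc.IH[OF v] B by simp
  qed
qed

section \<open>The image consists of the partial left-monogamous cospans\<close>

lemma in_degree_cosp:
  assumes v: "valid Bs L R"
  shows "in_degree (apex (cosp Bs L R)) x \<in> {0, 1}" "x \<in> set L \<Longrightarrow> in_degree (apex (cosp Bs L R)) x = 0"
proof -
  let ?D = "{(e, j). e \<in> edges (apex (cosp Bs L R)) \<and> j < length (targets (apex (cosp Bs L R)) e) \<and>
    targets (apex (cosp Bs L R)) e ! j = x}"
  have d: "distinct (concat (map (snd \<circ> snd) Bs))" "set (outs Bs) \<inter> set L = {}"
    using v by (auto simp: valid_def outs_concat)
  let ?Ts = "map (snd \<circ> snd) Bs"
  have D: "fst p < length ?Ts \<and> snd p < length (?Ts ! fst p) \<and> ?Ts ! fst p ! snd p = x" if "p \<in> ?D" for p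
    using that by (cases p) auto
  have eq: "p = q" if "p \<in> ?D" "q \<in> ?D" for p q
  proof -
    from distinct_concat_nth[OF d(1), of "fst p" "fst q" "snd p" "snd q"]
    have "fst p = fst q \<and> snd p = snd q" using D[OF that(1)] D[OF that(2)] by metis
    then show ?thesis by (simp add: prod_eq_iff)
  qed
  have "card ?D \<le> 1"
  proof (cases "?D = {}")
    case False
    then obtain p where "p \<in> ?D" by blast
    then have "?D \<subseteq> {p}" using eq by blast
    from card_mono[OF _ this] show ?thesis by simp
  next
    case True
    show ?thesis unfolding True by simp
  qed
  then show "in_degree (apex (cosp Bs L R)) x \<in> {0, 1}" unfolding in_degree_def by auto
  assume x: "x \<in> set L"
  have "?D = {}"
  proof (rule equals0I)
    fix p assume "p \<in> ?D"
    from D[OF this] have "fst p < length Bs" "x \<in> set (snd (snd (Bs ! fst p)))"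
      using nth_mem[of "snd p" "?Ts ! fst p"] by auto
    then have "x \<in> set (outs Bs)" using outs_nth_subset by blast
    then show False using x d(2) by auto
  qed
  then show "in_degree (apex (cosp Bs L R)) x = 0" unfolding in_degree_def by (simp only: card.empty)
qed

lemma plm_cosp:
  assumes v: "valid Bs L R"
  shows "partial_left_monogamous (cosp Bs L R)"
  using in_degree_cosp[OF v] v unfolding partial_left_monogamous_def by (auto simp: valid_def)

lemma den_in_PLM:
  assumes "f \<in> hom \<P> m n"
  shows "den \<Sigma> f \<in> hom (PLM_Csp \<Sigma>) m n"
proof -
  obtain Bs :: "('g option \<times> nat list \<times> nat list) list" and L R
    where r: "valid Bs L R" "length L = m" "length R = n" "net Bs L R = f"
    using rep_hom[OF assms] unfolding rep_def by metis
  have "den \<Sigma> f = cospan_class \<Sigma> (cosp Bs L R)" "cospan \<Sigma> m n (cosp Bs L R)"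
    using den_net[OF r(1)] cospan_class_quots[OF cospan_cosp[OF r(1)]] cospan_cosp[OF r(1)] r by auto
  then show ?thesis using plm_cosp[OF r(1)] unfolding PLM_Csp_def by auto
qed

text \<open>Vertices become names and hyperedges become boxes. A vertex that is neither on the left
  leg nor a target would have no source in a net; it becomes the output of a box
  \<open>None\<close>.\<close>

lemma PLM_in_den:
  assumes c: "cospan \<Sigma> m n c" and plm: "partial_left_monogamous c"
  obtains f where "f \<in> hom \<P> m n" "den \<Sigma> f = cospan_class \<Sigma> c"
proof -
  let ?F = "apex c" and ?L = "left_leg c" and ?R = "right_leg c"
  have hF: "hyp \<Sigma> ?F" and l: "length ?L = m" "length ?R = n" "set ?L \<subseteq> verts ?F" "set ?R \<subseteq> verts ?F"
    using c by (auto simp: cospan_def)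
  have fin: "finite (verts ?F)" "finite (edges ?F)" using hF by (auto simp: hyp_def)
  have E: "set (sources ?F e) \<subseteq> verts ?F" "set (targets ?F e) \<subseteq> verts ?F" "label ?F e \<in> gens \<Sigma>"
    "length (sources ?F e) = arity \<Sigma> (label ?F e)" "length (targets ?F e) = coarity \<Sigma> (label ?F e)"
    if "e \<in> edges ?F" for e
    using hF that by (auto simp: hyp_def)
  let ?D = "\<lambda>v. {(e, j). e \<in> edges ?F \<and> j < length (targets ?F e) \<and> targets ?F e ! j = v}"
  \<comment> \<open>On an infinite set \<open>card\<close> would be 0 by default, and the in-degree
    would not bound anything.\<close>
  have Dfin: "finite (?D v)" for v
  proof (rule finite_subset)
    show "?D v \<subseteq> (SIGMA e:edges ?F. {..<length (targets ?F e)})" by auto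
  qed (use fin in auto)
  obtain es where es: "set es = edges ?F" "distinct es" using finite_distinct_list[OF fin(2)] by auto
  define N where "N = verts ?F - set ?L - (\<Union>e\<in>edges ?F. set (targets ?F e))"
  have "finite N" using fin by (simp add: N_def)
  then obtain fs where fs: "set fs = N" "distinct fs" using finite_distinct_list by auto
  define Bs where "Bs = map (\<lambda>e. (Some (label ?F e), sources ?F e, targets ?F e)) es @ map (\<lambda>v. (None, [], [v])) fs"
  have o: "outs Bs = concat (map (targets ?F) es) @ fs"
    by (simp add: Bs_def outs_concat comp_def)
  have i: "ins Bs = concat (map (sources ?F) es)"
    by (simp add: Bs_def ins_def case_prod_unfold comp_def concat_map_singleton)
  have "distinct (concat (map (targets ?F) es))"
  proof (rule distinct_concat_map[OF es(2)])
    fix e e' j j' assume a: "e \<in> set es" "e' \<in> set es" "j < length (targets ?F e)" "j' < length (targets ?F e')"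
      "targets ?F e ! j = targets ?F e' ! j'"
    let ?v = "targets ?F e ! j"
    have "?v \<in> verts ?F" using E(2) a es nth_mem by blast
    then have "in_degree ?F ?v = 0 \<or> in_degree ?F ?v \<in> {0, 1}"
      using plm unfolding partial_left_monogamous_def by blast
    then have "in_degree ?F ?v \<le> 1" by auto
    then have "card (?D ?v) \<le> Suc 0" by (simp add: in_degree_def)
    moreover have "(e, j) \<in> ?D ?v" "(e', j') \<in> ?D ?v" using a es by auto
    ultimately have "(e, j) = (e', j')" unfolding card_le_Suc0_iff_eq[OF Dfin] by blast
    then show "e = e' \<and> j = j'" by simp
  qed
  moreover have "set (concat (map (targets ?F) es)) \<inter> set ?L = {}"
  proof (rule equals0I)
    fix v assume v: "v \<in> set (concat (map (targets ?F) es)) \<inter> set ?L"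
    then obtain e j where "e \<in> edges ?F" "j < length (targets ?F e)" "targets ?F e ! j = v"
      using es by (auto simp: in_set_conv_nth)
    then have "?D v \<noteq> {}" by blast
    then have "card (?D v) \<noteq> 0" using Dfin[of v] unfolding card_eq_0_iff by blast
    moreover have "in_degree ?F v = 0" using v plm by (simp add: partial_left_monogamous_def)
    ultimately show False by (simp add: in_degree_def)
  qed
  moreover have "distinct ?L" using plm by (simp add: partial_left_monogamous_def)
  ultimately have d: "distinct (outs Bs @ ?L)"
    using fs es unfolding o by (auto simp: N_def)
  have V: "set (outs Bs @ ?L) = verts ?F"
    unfolding o using fs es E(2) l by (auto simp: N_def)
  have "\<forall>B\<in>set Bs. okb B"
  proof
    fix B assume "B \<in> set Bs"
    then consider e where "e \<in> edges ?F" "B = (Some (label ?F e), sources ?F e, targets ?F e)" | v where "B = (None, [], [v])"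
      using es by (auto simp: Bs_def)
    then show "okb B"
    proof cases
      case 1
      show ?thesis unfolding 1(2) okb_iff using E[OF 1(1)] by simp
    next
      case 2
      show ?thesis unfolding 2 okb_iff by simp
    qed
  qed
  moreover have "set (ins Bs @ ?R) \<subseteq> verts ?F"
    unfolding i using E(1) es l by auto
  ultimately have v: "valid Bs ?L ?R" using d V by (simp add: valid_def)
  have "quots \<Sigma> (cosp Bs ?L ?R) {} = quots \<Sigma> c {}"
  proof (rule quots_isoI[where hv = id and he = "(!) es" and kv = id and ke = "idx es"])
    show "cospan \<Sigma> m n (cosp Bs ?L ?R)" using cospan_cosp[OF v] l by simp
    show "cospan \<Sigma> m n c" by (rule c)
    have edge: "i < length es" if "i \<in> edges (apex (cosp Bs ?L ?R))" for i
      using that by (auto simp: Bs_def nth_append split: if_splits)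
    have nth: "Bs ! i = (Some (label ?F (es ! i)), sources ?F (es ! i), targets ?F (es ! i))" if "i < length es" for i
      using that by (simp add: Bs_def nth_append)
    show "hyp_morphism (apex (cosp Bs ?L ?R)) ?F id ((!) es)"
      unfolding hyp_morphism_def
    proof (intro conjI ballI)
      show "id ` verts (apex (cosp Bs ?L ?R)) \<subseteq> verts ?F" using V by simp
      show "(!) es ` edges (apex (cosp Bs ?L ?R)) \<subseteq> edges ?F" using edge es by auto
      fix i assume "i \<in> edges (apex (cosp Bs ?L ?R))"
      from nth[OF edge[OF this]]
      show "label ?F (es ! i) = label (apex (cosp Bs ?L ?R)) i"
        "sources ?F (es ! i) = map id (sources (apex (cosp Bs ?L ?R)) i)"
        "targets ?F (es ! i) = map id (targets (apex (cosp Bs ?L ?R)) i)" by simp_all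
    qed
    show "idx es x \<in> edges (apex (cosp Bs ?L ?R)) \<and> es ! idx es x = x" if "x \<in> edges ?F" for x
    proof -
      have "x \<in> set es" using that es by simp
      moreover from this have "idx es x < length es" by (rule idx_less)
      ultimately show ?thesis using nth[of "idx es x"] by (simp add: Bs_def)
    qed
    show "id x \<in> verts (apex (cosp Bs ?L ?R)) \<and> id (id x) = x" if "x \<in> verts ?F" for x
      using that V by simp
    show "idx es (es ! u) = u" if "u \<in> edges (apex (cosp Bs ?L ?R))" for u
      using edge[OF that] es by simp
  qed simp_all
  then have "den \<Sigma> (net Bs ?L ?R) = cospan_class \<Sigma> c"
    using den_net[OF v] cospan_class_quots[OF c] by simp
  moreover have "net Bs ?L ?R \<in> hom \<P> m n"
    using net_ar[OF v] l by (simp add: hom_iff)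
  ultimately show thesis using that by blast
qed

end

subsection \<open>Nets with isomorphic cospans\<close>

text \<open>Hyperedges of \<open>cosp\<close> are positions; this turns a bijection between
  positions into an equality between multisets of boxes.\<close>

lemma mset_filter_nth: "mset (filter Q xs) = image_mset ((!) xs) (mset_set {i. i < length xs \<and> Q (xs ! i)})"
proof (induction xs rule: rev_induct)
  case (snoc x xs)
  let ?E = "{i. i < length xs \<and> Q (xs ! i)}"
  have s: "{i. i < length (xs @ [x]) \<and> Q ((xs @ [x]) ! i)} = ?E \<union> (if Q x then {length xs} else {})"
    by (auto simp: nth_append less_Suc_eq)
  have "image_mset ((!) (xs @ [x])) (mset_set ?E) = image_mset ((!) xs) (mset_set ?E)"
    by (rule image_mset_cong) (simp add: nth_append)
  then show ?case unfolding s using snoc by simp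
qed simp

lemma mset_outs_filter: "mset (outs Bs) = mset (outs (filter Q Bs)) + mset (outs (filter (\<lambda>B. \<not> Q B) Bs))"
  by (induction Bs) auto

lemma set_outs_mset: "mset Bs = mset Bs' \<Longrightarrow> set (outs Bs) = set (outs Bs')"
  unfolding outs_def using mset_eq_setD[of Bs Bs'] by simp

context stmc
begin

abbreviation "boxes \<equiv> filter (\<lambda>B. fst B \<noteq> None)"
abbreviation "units \<equiv> filter (\<lambda>B. \<not> fst B \<noteq> None)"
abbreviation vertex :: "'v \<Rightarrow> 'g option \<times> 'v list \<times> 'v list" where "vertex v \<equiv> (None, [], [v])"

lemma units_eq: "\<forall>B\<in>set Bs. okb B \<Longrightarrow> units Bs = map vertex (outs (units Bs))"
proof (induction Bs)
  case (Cons B Bs)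
  obtain b S T where B: "B = (b, S, T)" by (cases B) auto
  show ?case
  proof (cases b)
    case None
    have "okb (None, S, T)" using Cons.prems B None by simp
    from this[unfolded okb_iff] obtain a where "S = []" "T = [a]" by (auto simp: length_Suc_conv)
    then show ?thesis using Cons B None by simp
  qed (use Cons B in simp)
qed simp

text \<open>The names of the \<open>None\<close> boxes are those left over by the left interface and
  the labelled boxes, so the cospan determines them although they have no hyperedges.\<close>

lemma valid_outs:
  assumes "valid Bs L R"
  shows "distinct (outs (units Bs))" "set (outs (units Bs)) = set (outs Bs @ L) - set L - set (outs (boxes Bs))"
proof -
  have "mset (outs (boxes Bs) @ outs (units Bs) @ L) = mset (outs Bs @ L)"
    using mset_outs_filter[of Bs "\<lambda>B. fst B \<noteq> None"] by simp
  from mset_eq_setD[OF this] mset_eq_imp_distinct_iff[OF this] assms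
  show "distinct (outs (units Bs))" "set (outs (units Bs)) = set (outs Bs @ L) - set L - set (outs (boxes Bs))"
    by (auto simp: valid_def)
qed

text \<open>Labelled boxes are matched by the bijection of hyperedges. For the \<open>None\<close>
  boxes there is no such bijection, but their names form a complement, which the injective vertex
  map preserves.\<close>

lemma net_eq_of_cospan_iso:
  assumes v: "valid Bs L R" and v': "valid Bs' L' R'" and iso: "cospan_iso (cosp Bs L R) (cosp Bs' L' R')"
  shows "net Bs L R = net Bs' L' R'"
proof -
  obtain hv he where h: "hyp_morphism (apex (cosp Bs L R)) (apex (cosp Bs' L' R')) hv he"
    and hv: "bij_betw hv (set (outs Bs @ L)) (set (outs Bs' @ L'))"
    and he: "bij_betw he {i. i < length Bs \<and> fst (Bs ! i) \<noteq> None} {i. i < length Bs' \<and> fst (Bs' ! i) \<noteq> None}"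
    and L: "map hv L = L'" "map hv R = R'"
    using iso unfolding cospan_iso_def cosp_simps by auto
  let ?E = "{i. i < length Bs \<and> fst (Bs ! i) \<noteq> None}" and ?E' = "{i. i < length Bs' \<and> fst (Bs' ! i) \<noteq> None}"
  have inj: "inj_on hv (set (outs Bs @ L))" and im: "hv ` set (outs Bs @ L) = set (outs Bs' @ L')"
    using hv by (auto simp: bij_betw_def)
  have heE: "he ` ?E = ?E'" "inj_on he ?E" using he by (auto simp: bij_betw_def)
  have B: "rename hv (Bs ! i) = Bs' ! he i" if i: "i \<in> ?E" for i
  proof -
    have "he i \<in> ?E'" using heE(1) i by blast
    then show ?thesis
      using h i unfolding hyp_morphism_def cosp_simps by (cases "Bs ! i"; cases "Bs' ! he i") auto
  qed
  have "mset (map (rename hv) (boxes Bs)) = image_mset (rename hv \<circ> (!) Bs) (mset_set ?E)"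
    unfolding mset_map mset_filter_nth multiset.map_comp by (rule refl)
  also have "\<dots> = image_mset ((!) Bs' \<circ> he) (mset_set ?E)"
    by (rule image_mset_cong) (use B in simp)
  also have "\<dots> = image_mset ((!) Bs') (mset_set ?E')"
    unfolding heE(1)[symmetric] image_mset_mset_set[OF heE(2), symmetric] multiset.map_comp by (rule refl)
  finally have some: "mset (map (rename hv) (boxes Bs)) = mset (boxes Bs')"
    by (simp only: mset_filter_nth)
  have so: "hv ` set (outs (boxes Bs)) = set (outs (boxes Bs'))"
    using set_outs_mset[OF some] by simp
  have "set (outs (boxes Bs)) \<subseteq> set (outs Bs @ L)" by (auto simp: outs_def)
  then have "hv ` (set (outs Bs @ L) - set L - set (outs (boxes Bs))) =
      hv ` set (outs Bs @ L) - hv ` set L - hv ` set (outs (boxes Bs))"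
    using inj_on_image_set_diff[OF inj, of "set (outs Bs @ L)" "set L"]
      inj_on_image_set_diff[OF inj, of "set (outs Bs @ L) - set L" "set (outs (boxes Bs))"] by auto
  then have "hv ` set (outs (units Bs)) = set (outs (units Bs'))"
    unfolding valid_outs(2)[OF v] valid_outs(2)[OF v'] im so L(1)[symmetric] set_map .
  moreover have "inj_on hv (set (outs (units Bs)))"
    using inj unfolding valid_outs(2)[OF v] by (rule inj_on_subset) blast
  ultimately have "mset (map hv (outs (units Bs))) = mset (outs (units Bs'))"
    using valid_outs(1)[OF v] valid_outs(1)[OF v']
    by (intro set_eq_iff_mset_eq_distinct[THEN iffD1]) (simp_all add: distinct_map)
  then have units: "mset (map vertex (map hv (outs (units Bs)))) =
      mset (map vertex (outs (units Bs')))"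
    unfolding mset_map by (rule arg_cong)
  have u': "map vertex (outs (units Bs')) = units Bs'"
    using units_eq[of Bs'] v' by (simp add: valid_def)
  have u: "map vertex (map hv (outs (units Bs))) = map (rename hv) (units Bs)"
    by (subst (2) units_eq) (use v in \<open>simp_all add: valid_def\<close>)
  from units have none: "mset (map (rename hv) (units Bs)) = mset (units Bs')" by (simp only: u u')
  have "mset (map (rename hv) Bs) = image_mset (rename hv) (mset (boxes Bs) + mset (units Bs))"
    by (simp flip: multiset_partition)
  also have "\<dots> = mset (boxes Bs') + mset (units Bs')"
    unfolding image_mset_union mset_map[symmetric] some none by (rule refl)
  also have "\<dots> = mset Bs'"
    by (simp flip: multiset_partition)
  finally have "mset (map (rename hv) Bs) = mset Bs'" .
  from net_perm[OF this net_rename(2)[OF v inj]] net_rename(1)[OF v inj] show ?thesis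
    by (simp add: L)
qed

lemma den_inj:
  assumes "f \<in> hom \<P> m n" "f' \<in> hom \<P> m n" "den \<Sigma> f = den \<Sigma> f'"
  shows "f = f'"
proof -
  obtain Bs Bs' :: "('g option \<times> nat list \<times> nat list) list" and L R L' R'
    where v: "valid Bs L R" "net Bs L R = f" and v': "valid Bs' L' R'" "net Bs' L' R' = f'"
    using rep_hom[OF assms(1)] rep_hom[OF assms(2)] unfolding rep_def by metis
  have "cospan_class \<Sigma> (cosp Bs L R) = cospan_class \<Sigma> (cosp Bs' L' R')"
    using den_net[OF v(1)] den_net[OF v'(1)] cospan_class_quots[OF cospan_cosp[OF v(1)]]
      cospan_class_quots[OF cospan_cosp[OF v'(1)]] assms(3) v v' by simp
  moreover have "cosp Bs' L' R' \<in> cospan_class \<Sigma> (cosp Bs' L' R')"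
  proof -
    have "hyp_morphism (apex (cosp Bs' L' R')) (apex (cosp Bs' L' R')) id id" by (simp add: hyp_morphism_def)
    then have "cospan_iso (cosp Bs' L' R') (cosp Bs' L' R')"
      unfolding cospan_iso_def by (intro exI[of _ id]) (auto simp: hyp_morphism_def)
    then show ?thesis using cospan_cosp[OF v'(1)] by (simp add: cospan_class_def cospan_def)
  qed
  ultimately have "cosp Bs' L' R' \<in> cospan_class \<Sigma> (cosp Bs L R)" by simp
  then have "cospan_iso (cosp Bs L R) (cosp Bs' L' R')" by (simp add: cospan_class_def)
  from net_eq_of_cospan_iso[OF v(1) v'(1) this] show ?thesis using v v' by simp
qed

lemma hom_PLM_den: "hom (PLM_Csp \<Sigma>) m n = den \<Sigma> ` hom \<P> m n"
proof
  show "hom (PLM_Csp \<Sigma>) m n \<subseteq> den \<Sigma> ` hom \<P> m n"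
  proof
    fix X assume "X \<in> hom (PLM_Csp \<Sigma>) m n"
    then obtain c :: "'g ncospan" where c: "cospan \<Sigma> m n c" "partial_left_monogamous c" "X = cospan_class \<Sigma> c"
      by (auto simp: PLM_Csp_def)
    obtain f where "f \<in> hom \<P> m n" "den \<Sigma> f = cospan_class \<Sigma> c" by (rule PLM_in_den[OF c(1,2)])
    then show "X \<in> den \<Sigma> ` hom \<P> m n" unfolding c(3) by (metis imageI)
  qed
qed (use den_in_PLM in blast)

end

lemma PLM_Csp_simps:
  "ident (PLM_Csp \<Sigma>) = ident (Csp \<Sigma>)" "compose (PLM_Csp \<Sigma>) = compose (Csp \<Sigma>)"
  "tensor (PLM_Csp \<Sigma>) = tensor (Csp \<Sigma>)" "swap (PLM_Csp \<Sigma>) = swap (Csp \<Sigma>)" "trace (PLM_Csp \<Sigma>) = trace (Csp \<Sigma>)"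
  by (simp_all add: PLM_Csp_def)

text \<open>Closure under the operations is inherited from \<open>P\<close> through
  \<open>F\<close>, the equations from \<open>Q\<close>, whose hom-sets contain those of
  \<open>Q'\<close>.\<close>

lemma traced_prop_image:
  assumes P: "traced_prop_cat P" and Q: "traced_prop_cat Q" and F: "traced_prop_morphism P Q F"
    and hom: "\<And>m n. hom Q' m n = F ` hom P m n"
    and ops: "ident Q' = ident Q" "compose Q' = compose Q" "tensor Q' = tensor Q" "swap Q' = swap Q" "trace Q' = trace Q"
  shows "traced_prop_cat Q'" "traced_prop_morphism P Q' F"
proof -
  interpret P: traced_prop_cat P by (rule P)
  interpret Q: traced_prop_cat Q by (rule Q)
  have conj: "(\<forall>m n. \<forall>f\<in>hom P m n. F f \<in> hom Q m n)"
    "(\<forall>n. F (ident P n) = ident Q n)"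
    "(\<forall>m n p. \<forall>f\<in>hom P m n. \<forall>g\<in>hom P n p. F (compose P f g) = compose Q (F f) (F g))"
    "(\<forall>m n p q. \<forall>f\<in>hom P m n. \<forall>g\<in>hom P p q. F (tensor P f g) = tensor Q (F f) (F g))"
    "(\<forall>m n. F (swap P m n) = swap Q m n)"
    "\<forall>x m n. \<forall>h\<in>hom P (x + m) (x + n). F (trace P x m n h) = trace Q x m n (F h)"
    using F unfolding traced_prop_morphism_def prop_morphism_def by - (elim conjE, assumption)+
  note F' = conj(1)[rule_format] and Fo = conj(2)[rule_format] conj(5)[rule_format] conj(3)[rule_format]
    conj(4)[rule_format] conj(6)[rule_format]
  have sub: "X \<in> hom Q m n" if "X \<in> hom Q' m n" for X m n using that F' hom by auto
  have "\<forall>m n. \<forall>f\<in>hom P m n. F f \<in> hom Q' m n" using hom by simp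
  then show "traced_prop_morphism P Q' F"
    unfolding traced_prop_morphism_def prop_morphism_def ops using conj(2-6) by (intro conjI)
  show "traced_prop_cat Q'"
  proof (unfold_locales, unfold ops)
    show "X \<in> hom Q' m n \<Longrightarrow> X \<in> hom Q' m' n' \<Longrightarrow> m = m' \<and> n = n'" for X m n m' n'
      using sub Q.hom_disjoint by blast
    show "ident Q n \<in> hom Q' n n" for n
      unfolding hom Fo(1)[symmetric] by (rule imageI[OF P.ident_hom])
    show "swap Q m n \<in> hom Q' (m + n) (n + m)" for m n
      unfolding hom Fo(2)[symmetric] by (rule imageI[OF P.swap_hom])
    show "compose Q X Y \<in> hom Q' m p" if X: "X \<in> hom Q' m n" and Y: "Y \<in> hom Q' n p" for X Y m n p
    proof -
      obtain f g where "f \<in> hom P m n" "X = F f" "g \<in> hom P n p" "Y = F g" using X Y hom by auto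
      then show ?thesis unfolding hom using Fo(3)[of f m n g p] P.compose_hom[of f m n g p] by (metis imageI)
    qed
    show "tensor Q X Y \<in> hom Q' (m + p) (n + q)" if X: "X \<in> hom Q' m n" and Y: "Y \<in> hom Q' p q" for X Y m n p q
    proof -
      obtain f g where "f \<in> hom P m n" "X = F f" "g \<in> hom P p q" "Y = F g" using X Y hom by auto
      then show ?thesis unfolding hom using Fo(4)[of f m n g p q] P.tensor_hom[of f m n g p q] by (metis imageI)
    qed
    show "trace Q x m n X \<in> hom Q' m n" if X: "X \<in> hom Q' (x + m) (x + n)" for X x m n
    proof -
      obtain h where "h \<in> hom P (x + m) (x + n)" "X = F h" using X hom by auto
      then show ?thesis unfolding hom using Fo(5)[of h x m n] P.trace_hom[of h x m n] by (metis imageI)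
    qed
  qed (use sub in \<open>blast intro: Q.ident_compose Q.compose_ident Q.compose_assoc Q.tensor_ident Q.interchange
    Q.tensor_assoc Q.unit_tensor Q.tensor_unit Q.swap_natural Q.swap_swap Q.hexagon Q.tightening Q.sliding
    Q.vanishing_zero Q.vanishing_add Q.superposing Q.yanking\<close>)+
qed

theorem theorem4p14:
  fixes \<Sigma> :: "'g signature"
  shows "traced_prop_iso (STMC_CComon \<Sigma>) (PLM_Csp \<Sigma>) (\<lambda>X. sem \<Sigma> (copairing_\<I>_\<C> \<Sigma> X))"
proof -
  interpret stmc \<Sigma> .
  have den: "(\<lambda>X. sem \<Sigma> (copairing_\<I>_\<C> \<Sigma> X)) = den \<Sigma>"
    by (auto simp: den_def)
  show ?thesis
    unfolding den traced_prop_iso_def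
  proof (intro conjI allI)
    note im = traced_prop_image[OF traced_prop_cat_STMC_CComon traced_prop_cat_Csp den_morphism hom_PLM_den PLM_Csp_simps]
    show "traced_prop_cat (STMC_CComon \<Sigma>)" by (rule traced_prop_cat_STMC_CComon)
    show "traced_prop_cat (PLM_Csp \<Sigma>)" by (rule im(1))
    show "traced_prop_morphism (STMC_CComon \<Sigma>) (PLM_Csp \<Sigma>) (den \<Sigma>)" by (rule im(2))
    show "bij_betw (den \<Sigma>) (hom (STMC_CComon \<Sigma>) m n) (hom (PLM_Csp \<Sigma>) m n)" for m n
      unfolding bij_betw_def hom_PLM_den by (intro conjI inj_onI refl) (rule den_inj)
  qed
qed

end
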